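(* Let $F$ be a natural bundle on $\mathcal{M}f_n$, $M$ an $n$-dimensional manifold, $G$ a Lie group with Lie algebra $\mathfrak g$, $P$ a principal $G$-bundle over $M$, and $V$ a $G$-module. For every section $a\in\Gamma(M,P\times_G\mathfrak g)$ and every map $h\colon F(M)\to P\times_GV$ of fiber bundles over $M$, we have $$\pounds_{X^a}h=-a\cdot h .$$
   Context: All manifolds and maps are smooth. $\Phi^t_X$ denotes the (local) flow of a vector field $X$, defined at time $t$ on the open set $U^X_t$. Natural bundles. $\mathcal{M}f_n$ is the category of $n$-dimensional manifolds with local diffeomorphisms as morphisms. A natural bundle on $\mathcal{M}f_n$ is a functor $F$ from $\mathcal{M}f_n$ to smooth manifolds together with a natural transformation $p_M\colon F(M)\to M$ such that each $p_M$ is a fiber bundle and, for each morphism $f\colon M\to M'$, $F(f)$ covers $f$ and is a fiberwise diffeomorphism. For a vector field $X$ on $M$, its canonical lift $\mathcal F(X)$ is the unique vector field on $F(M)$ whose flow satisfies $U^{\mathcal F(X)}_t=\mathrm{Im}\,F(\iota_t)$ and $\Phi^t_{\mathcal F(X)}\circ F(\iota_t)=F(\iota_{-t})\circ F(\Phi^t_X)$, where $\iota_t\colon U^X_t\hookrightarrow M$ is the inclusion and $\Phi^t_X\colon U^X_t\to U^X_{-t}$. Associated bundles. For a manifold $N$ with left $G$-action, $P\times_G N=(P\times N)/G$ for the action $(p,y)g=(pg,g^{-1}y)$; classes are written $[p,y]$. For $p\in P_x$ and $z\in (P\times_G N)_x$, $p\backslash z\in N$ is the unique element with $z=[p,p\backslash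 z]$. $G$ acts on $\mathfrak g$ by the adjoint action. Darboux-Lie derivative. Let $\widetilde X$ be a $G$-invariant vector field on $P$ over the vector field $X$ on $M$, and let $\widetilde X_V$ be the vector field on $P\times_GV$ with flow $[p,v]\mapsto[\Phi^t_{\widetilde X}p,v]$. For a bundle map $h\colon F(M)\to P\times_GV$ over $\mathrm{id}_M$, the vector $T_yh(\mathcal F(X)_y)-(\widetilde X_V)_{h(y)}$ is vertical, hence of the form $\left.\frac{d}{dt}\right|_0[p,\gamma(t)]$ with $p\in P$ fixed and $\gamma$ a curve in $V$; then $\pounds_{\widetilde X}h(y)=[p,\mathrm{vpr}_V(\dot\gamma(0))]$, where $\mathrm{vpr}_V\colon TV\to V$, $\left.\frac{d}{dt}\right|_0(v+tw)\mapsto w$. Notation of the statement. For $a\in\Gamma(M,P\times_G\mathfrak g)$, $X^a$ is the $G$-invariant vertical vector field on $P$ with flow $\Phi^t_{X^a}p=p\exp((p\backslash a(x))t)$ for $x\in M$, $p\in P_x$. The map $a\cdot h\colon F(M)\to P\times_GV$ is $a\cdot h(y)=[p,(p\backslash a(x))(p\backslash h(y))]$ for $y\in F(M)_x$ and arbitrary $p\in P_x$, using the induced action of $\mathfrak g$ on $V$: $\dot\gamma(0)v=\mathrm{vpr}_V\big(\left.\frac{d}{dt}\right|_0\gamma(t)v\big)$ for a curve $\gamma$ in $G$ with $\gamma(0)=e$. *)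

theory Defs
  imports "HOL-Analysis.Analysis" "HOL-Algebra.Group"
begin

text \<open>
  Manifolds are modelled on types of class \<open>real_inner\<close> that are finite-dimensional as vector
  spaces, the finite-dimensionality being part of the predicate \<open>manifold\<close> below.  Unlike
  \<open>euclidean_space\<close>, this admits dimension 0 (discrete groups, zero-dimensional fibres, trivial
  modules), and model spaces can be paired.  Only the vector space structure of the model
  (with its unique Hausdorff vector space topology) is relevant.
\<close>

definition finite_dim :: "'e::real_vector itself \<Rightarrow> bool" where
  "finite_dim _ \<longleftrightarrow> (\<exists>B::'e set. finite B \<and> span B = UNIV)"

text \<open>Smoothness of functions on open subsets of finite-dimensional spaces: all iterated
  directional derivatives exist, are differentiable and continuous.\<close>

primrec Ck_on :: "nat \<Rightarrow> 'e::real_normed_vector set \<Rightarrow> ('e \<Rightarrow> 'f::real_normed_vector) \<Rightarrow> bool" where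
  "Ck_on 0 S f \<longleftrightarrow> continuous_on S f"
| "Ck_on (Suc k) S f \<longleftrightarrow>
     (\<forall>x\<in>S. f differentiable (at x)) \<and> (\<forall>v. Ck_on k S (\<lambda>x. frechet_derivative f (at x) v))"

definition smooth_on :: "'e::real_normed_vector set \<Rightarrow> ('e \<Rightarrow> 'f::real_normed_vector) \<Rightarrow> bool" where
  "smooth_on S f \<longleftrightarrow> (\<forall>k. Ck_on k S f)"


section \<open>Manifolds\<close>

text \<open>Charts are total functions together with their domain; only the values on the domain matter.\<close>

type_synonym ('a, 'e) chart = "'a set \<times> ('a \<Rightarrow> 'e)"

record ('a, 'e) mfd =
  points :: "'a set"
  atlas :: "('a, 'e) chart set"

abbreviation chart_inv :: "('a, 'e) chart \<Rightarrow> 'e \<Rightarrow> 'a" where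
  "chart_inv c \<equiv> inv_into (fst c) (snd c)"

definition is_chart :: "'a set \<Rightarrow> ('a, 'e::real_inner) chart \<Rightarrow> bool" where
  "is_chart A c \<longleftrightarrow> fst c \<subseteq> A \<and> inj_on (snd c) (fst c) \<and> open (snd c ` fst c)"

definition compatible :: "('a, 'e::real_inner) chart \<Rightarrow> ('a, 'e) chart \<Rightarrow> bool" where
  "compatible c d \<longleftrightarrow>
     open (snd c ` (fst c \<inter> fst d)) \<and> open (snd d ` (fst c \<inter> fst d)) \<and>
     smooth_on (snd c ` (fst c \<inter> fst d)) (snd d \<circ> chart_inv c) \<and>
     smooth_on (snd d ` (fst c \<inter> fst d)) (snd c \<circ> chart_inv d)"

definition mtop :: "('a, 'e::real_inner) mfd \<Rightarrow> 'a topology" where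
  "mtop M = topology (\<lambda>W. W \<subseteq> points M \<and> (\<forall>c\<in>atlas M. open (snd c ` (W \<inter> fst c))))"

text \<open>The atlas of a manifold is maximal; its topology, given by the atlas, is Hausdorff and
  second countable.\<close>

definition manifold :: "('a, 'e::real_inner) mfd \<Rightarrow> bool" where
  "manifold M \<longleftrightarrow>
     finite_dim TYPE('e) \<and>
     (\<forall>c\<in>atlas M. is_chart (points M) c) \<and>
     (\<Union>c\<in>atlas M. fst c) = points M \<and>
     (\<forall>c\<in>atlas M. \<forall>d\<in>atlas M. compatible c d) \<and>
     (\<forall>c. is_chart (points M) c \<and> (\<forall>d\<in>atlas M. compatible c d) \<longrightarrow> c \<in> atlas M) \<and>
     Hausdorff_space (mtop M) \<and>
     second_countable (mtop M)"

text \<open>The objects of the category of \<open>n\<close>-dimensional manifolds.  The type \<open>'a\<close> of points plays the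
  role of a universe; if it has at least the cardinality of the continuum, every \<open>n\<close>-dimensional
  manifold is diffeomorphic to one with points in \<open>'a\<close>.\<close>

definition Mf :: "nat \<Rightarrow> ('a, 'e::real_inner) mfd set" where
  "Mf n = {M. manifold M \<and> dim (UNIV :: 'e set) = n}"

definition generated_mfd :: "'a set \<Rightarrow> ('a, 'e::real_inner) chart set \<Rightarrow> ('a, 'e) mfd" where
  "generated_mfd A C = \<lparr>points = A, atlas = {c. is_chart A c \<and> (\<forall>d\<in>C. compatible c d)}\<rparr>"

definition open_sub :: "('a, 'e) mfd \<Rightarrow> 'a set \<Rightarrow> ('a, 'e) mfd" where
  "open_sub M U = \<lparr>points = U, atlas = {c \<in> atlas M. fst c \<subseteq> U}\<rparr>"

definition prod_mfd :: "('a, 'e::real_inner) mfd \<Rightarrow> ('b, 'f::real_inner) mfd \<Rightarrow> ('a \<times> 'b, 'e \<times> 'f) mfd" where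
  "prod_mfd M N = generated_mfd (points M \<times> points N)
     {(fst c \<times> fst d, map_prod (snd c) (snd d)) |c d. c \<in> atlas M \<and> d \<in> atlas N}"

definition vec_mfd :: "('v, 'v::real_inner) mfd" where
  "vec_mfd = generated_mfd UNIV {(UNIV, id)}"

definition smooth_map :: "('a, 'e::real_inner) mfd \<Rightarrow> ('b, 'f::real_inner) mfd \<Rightarrow> ('a \<Rightarrow> 'b) \<Rightarrow> bool" where
  "smooth_map M N f \<longleftrightarrow>
     f ` points M \<subseteq> points N \<and> continuous_map (mtop M) (mtop N) f \<and>
     (\<forall>c\<in>atlas M. \<forall>d\<in>atlas N.
        smooth_on (snd c ` {x \<in> fst c. f x \<in> fst d}) (snd d \<circ> f \<circ> chart_inv c))"

definition diffeo :: "('a, 'e::real_inner) mfd \<Rightarrow> ('b, 'f::real_inner) mfd \<Rightarrow> ('a \<Rightarrow> 'b) \<Rightarrow> bool" where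
  "diffeo M N f \<longleftrightarrow>
     bij_betw f (points M) (points N) \<and> smooth_map M N f \<and>
     smooth_map N M (inv_into (points M) f)"

definition local_diffeo :: "('a, 'e::real_inner) mfd \<Rightarrow> ('b, 'f::real_inner) mfd \<Rightarrow> ('a \<Rightarrow> 'b) \<Rightarrow> bool" where
  "local_diffeo M N f \<longleftrightarrow>
     (\<forall>x\<in>points M. \<exists>U. openin (mtop M) U \<and> x \<in> U \<and> openin (mtop N) (f ` U) \<and>
        diffeo (open_sub M U) (open_sub N (f ` U)) f)"


section \<open>Tangent vectors, vector fields and flows\<close>

text \<open>A tangent vector at \<open>x\<close> is the family of its coordinates in all charts around \<open>x\<close> (and 0 for
  all other charts).  Linear operations on tangent vectors at the same point are thus pointwise.
  The base point is not part of the vector.\<close>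

type_synonym ('a, 'e) tvec = "('a, 'e) chart \<Rightarrow> 'e"

definition charts_at :: "('a, 'e) mfd \<Rightarrow> 'a \<Rightarrow> ('a, 'e) chart set" where
  "charts_at M x = {c \<in> atlas M. x \<in> fst c}"

definition tangent_space :: "('a, 'e::real_inner) mfd \<Rightarrow> 'a \<Rightarrow> ('a, 'e) tvec set" where
  "tangent_space M x =
     {\<xi>. (\<forall>c. c \<notin> charts_at M x \<longrightarrow> \<xi> c = 0) \<and>
         (\<forall>c\<in>charts_at M x. \<forall>d\<in>charts_at M x.
            \<xi> d = frechet_derivative (snd d \<circ> chart_inv c) (at (snd c x)) (\<xi> c))}"

text \<open>\<open>velocity M \<gamma> t\<close> is the tangent vector of the curve \<open>\<gamma>\<close> at time \<open>t\<close>.\<close>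

definition velocity :: "('a, 'e::real_inner) mfd \<Rightarrow> (real \<Rightarrow> 'a) \<Rightarrow> real \<Rightarrow> ('a, 'e) tvec" where
  "velocity M \<gamma> t =
     (\<lambda>c. if c \<in> charts_at M (\<gamma> t) then vector_derivative (snd c \<circ> \<gamma>) (at t) else 0)"

definition smooth_curve_at_0 :: "('a, 'e::real_inner) mfd \<Rightarrow> (real \<Rightarrow> 'a) \<Rightarrow> bool" where
  "smooth_curve_at_0 M \<gamma> \<longleftrightarrow>
     (\<exists>\<epsilon>>0. smooth_map (open_sub vec_mfd {-\<epsilon><..<\<epsilon>}) M \<gamma>)"

text \<open>The tangent map \<open>T\<^sub>x f\<close>; the value does not depend on the chart \<open>c\<close> that is used.\<close>

definition tangent_map ::
  "('a, 'e::real_inner) mfd \<Rightarrow> ('b, 'f::real_inner) mfd \<Rightarrow> ('a \<Rightarrow> 'b) \<Rightarrow> 'a \<Rightarrow> ('a, 'e) tvec \<Rightarrow> ('b, 'f) tvec" where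
  "tangent_map M N f x \<xi> =
     (let c = (SOME c. c \<in> charts_at M x) in
      (\<lambda>d. if d \<in> charts_at N (f x)
           then frechet_derivative (snd d \<circ> f \<circ> chart_inv c) (at (snd c x)) (\<xi> c) else 0))"

text \<open>Vector fields take the value 0 outside of the manifold, so that they are determined by their
  values on the manifold.\<close>

definition vector_field :: "('a, 'e::real_inner) mfd \<Rightarrow> ('a \<Rightarrow> ('a, 'e) tvec) \<Rightarrow> bool" where
  "vector_field M X \<longleftrightarrow>
     (\<forall>x\<in>points M. X x \<in> tangent_space M x) \<and>
     (\<forall>x. x \<notin> points M \<longrightarrow> X x = (\<lambda>c. 0)) \<and>
     (\<forall>c\<in>atlas M. smooth_on (snd c ` fst c) (\<lambda>z. X (chart_inv c z) c))"

definition integral_curve ::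
  "('a, 'e::real_inner) mfd \<Rightarrow> ('a \<Rightarrow> ('a, 'e) tvec) \<Rightarrow> real set \<Rightarrow> (real \<Rightarrow> 'a) \<Rightarrow> bool" where
  "integral_curve M X I \<gamma> \<longleftrightarrow>
     open I \<and> is_interval I \<and> continuous_map (top_of_set I) (mtop M) \<gamma> \<and>
     (\<forall>t\<in>I. \<forall>c\<in>charts_at M (\<gamma> t). ((snd c \<circ> \<gamma>) has_vector_derivative X (\<gamma> t) c) (at t))"

text \<open>The (maximal) flow of \<open>X\<close>: \<open>flow_dom M X t\<close> is the open set of points at which the flow is
  defined at time \<open>t\<close>.\<close>

definition flow_dom :: "('a, 'e::real_inner) mfd \<Rightarrow> ('a \<Rightarrow> ('a, 'e) tvec) \<Rightarrow> real \<Rightarrow> 'a set" where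
  "flow_dom M X t =
     {x \<in> points M. \<exists>I \<gamma>. integral_curve M X I \<gamma> \<and> 0 \<in> I \<and> t \<in> I \<and> \<gamma> 0 = x}"

definition flow :: "('a, 'e::real_inner) mfd \<Rightarrow> ('a \<Rightarrow> ('a, 'e) tvec) \<Rightarrow> real \<Rightarrow> 'a \<Rightarrow> 'a" where
  "flow M X t x =
     (THE y. \<exists>I \<gamma>. integral_curve M X I \<gamma> \<and> 0 \<in> I \<and> t \<in> I \<and> \<gamma> 0 = x \<and> \<gamma> t = y)"

text \<open>\<open>vpr\<close> maps the class of \<open>t \<mapsto> v + tw\<close> to \<open>w\<close>.\<close>

definition vpr :: "('v::real_inner, 'v) tvec \<Rightarrow> 'v" where
  "vpr \<xi> = (THE w. \<exists>v. \<xi> = velocity vec_mfd (\<lambda>t. v + t *\<^sub>R w) 0)"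


section \<open>Natural bundles\<close>

definition local_triv ::
  "('b, 'e::real_inner \<times> 's::real_inner) mfd \<Rightarrow> ('a, 'e) mfd \<Rightarrow> ('b \<Rightarrow> 'a) \<Rightarrow> ('b, 's) mfd \<Rightarrow>
   'a set \<Rightarrow> ('b \<Rightarrow> 'a \<times> 'b) \<Rightarrow> bool" where
  "local_triv E M p S U \<psi> \<longleftrightarrow>
     manifold S \<and> openin (mtop M) U \<and>
     diffeo (open_sub E {y \<in> points E. p y \<in> U}) (prod_mfd (open_sub M U) S) \<psi> \<and>
     (\<forall>y\<in>points E. p y \<in> U \<longrightarrow> fst (\<psi> y) = p y)"

text \<open>The points of the standard fibre are taken in the type of points of the total space, which is
  no restriction since the standard fibre is diffeomorphic to a fibre.\<close>

definition fiber_bundle ::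
  "('b, 'e::real_inner \<times> 's::real_inner) mfd \<Rightarrow> ('a, 'e) mfd \<Rightarrow> ('b \<Rightarrow> 'a) \<Rightarrow> bool" where
  "fiber_bundle E M p \<longleftrightarrow>
     manifold E \<and> manifold M \<and> smooth_map E M p \<and>
     (\<exists>S. \<forall>x\<in>points M. \<exists>U \<psi>. x \<in> U \<and> local_triv E M p S U \<psi>)"

definition fiber_mfd ::
  "('b, 'e::real_inner \<times> 's::real_inner) mfd \<Rightarrow> ('a, 'e) mfd \<Rightarrow> ('b \<Rightarrow> 'a) \<Rightarrow> 'a \<Rightarrow> ('b, 's) mfd" where
  "fiber_mfd E M p x = generated_mfd {y \<in> points E. p y = x}
     {({y \<in> points E. p y = x \<and> snd (\<psi> y) \<in> fst d}, \<lambda>y. snd d (snd (\<psi> y))) |d S U \<psi>.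
        x \<in> U \<and> local_triv E M p S U \<psi> \<and> d \<in> atlas S}"

text \<open>The data of a natural bundle: the functor on objects and on morphisms, and the projections.
  A morphism is given by its source, its target and a function on points.  The model space of
  \<open>F(M)\<close> is the product of those of the base and of the standard fibre; the latter may be trivial.\<close>

record ('a, 'e, 'b, 's) natural_bundle_data =
  FObj :: "('a, 'e) mfd \<Rightarrow> ('b, 'e \<times> 's) mfd"
  FMor :: "('a, 'e) mfd \<Rightarrow> ('a, 'e) mfd \<Rightarrow> ('a \<Rightarrow> 'a) \<Rightarrow> 'b \<Rightarrow> 'b"
  FProj :: "('a, 'e) mfd \<Rightarrow> 'b \<Rightarrow> 'a"

definition mor :: "('a, 'e::real_inner) mfd \<Rightarrow> ('a, 'e) mfd \<Rightarrow> ('a \<Rightarrow> 'a) \<Rightarrow> bool" where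
  "mor M N f \<longleftrightarrow> manifold M \<and> manifold N \<and> f ` points M \<subseteq> points N \<and> local_diffeo M N f"

text \<open>The second conjunct on morphisms says that \<open>FMor\<close> only depends on the function \<open>f\<close> as a map
  with source \<open>M\<close>.\<close>

definition natural_bundle ::
  "nat \<Rightarrow> ('a, 'e::real_inner, 'b, 's::real_inner) natural_bundle_data \<Rightarrow> bool" where
  "natural_bundle n F \<longleftrightarrow>
     (\<forall>M\<in>Mf n. fiber_bundle (FObj F M) M (FProj F M)) \<and>
     (\<forall>M\<in>Mf n. \<forall>N\<in>Mf n. \<forall>f. mor M N f \<longrightarrow>
        smooth_map (FObj F M) (FObj F N) (FMor F M N f) \<and>
        (\<forall>g. (\<forall>x\<in>points M. g x = f x) \<longrightarrow>
           (\<forall>y\<in>points (FObj F M). FMor F M N g y = FMor F M N f y)) \<and>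
        (\<forall>y\<in>points (FObj F M). FProj F N (FMor F M N f y) = f (FProj F M y)) \<and>
        (\<forall>x\<in>points M. diffeo (fiber_mfd (FObj F M) M (FProj F M) x)
           (fiber_mfd (FObj F N) N (FProj F N) (f x)) (FMor F M N f))) \<and>
     (\<forall>M\<in>Mf n. \<forall>y\<in>points (FObj F M). FMor F M M id y = y) \<and>
     (\<forall>M\<in>Mf n. \<forall>N\<in>Mf n. \<forall>K\<in>Mf n. \<forall>f g. mor M N f \<and> mor N K g \<longrightarrow>
        (\<forall>y\<in>points (FObj F M). FMor F M K (g \<circ> f) y = FMor F N K g (FMor F M N f y)))"

definition canonical_lift ::
  "('a, 'e::real_inner, 'b, 's::real_inner) natural_bundle_data \<Rightarrow> ('a, 'e) mfd \<Rightarrow>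
   ('a \<Rightarrow> ('a, 'e) tvec) \<Rightarrow> 'b \<Rightarrow> ('b, 'e \<times> 's) tvec" where
  "canonical_lift F M X =
     (let U = (\<lambda>t. open_sub M (flow_dom M X t)); \<iota> = (\<lambda>t. FMor F (U t) M id) in
      THE Y. vector_field (FObj F M) Y \<and>
        (\<forall>t. flow_dom (FObj F M) Y t = \<iota> t ` points (FObj F (U t))) \<and>
        (\<forall>t. \<forall>y\<in>points (FObj F (U t)).
           flow (FObj F M) Y t (\<iota> t y) = \<iota> (- t) (FMor F (U t) (U (- t)) (flow M X t) y)))"


section \<open>Lie groups\<close>

record ('g, 'l) lie_group_data =
  lgrp :: "'g monoid"
  lmfd :: "('g, 'l) mfd"

definition lie_group :: "('g, 'l::real_inner) lie_group_data \<Rightarrow> bool" where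
  "lie_group G \<longleftrightarrow>
     group (lgrp G) \<and> manifold (lmfd G) \<and> points (lmfd G) = carrier (lgrp G) \<and>
     smooth_map (prod_mfd (lmfd G) (lmfd G)) (lmfd G) (\<lambda>(g, h). g \<otimes>\<^bsub>lgrp G\<^esub> h) \<and>
     smooth_map (lmfd G) (lmfd G) (\<lambda>g. inv\<^bsub>lgrp G\<^esub> g)"

text \<open>The Lie algebra as a set is the tangent space at the unit.  The following is its
  manifold structure as a finite-dimensional vector space.\<close>

definition lie_alg :: "('g, 'l::real_inner) lie_group_data \<Rightarrow> (('g, 'l) tvec, 'l) mfd" where
  "lie_alg G =
     (let e = \<one>\<^bsub>lgrp G\<^esub>; T = tangent_space (lmfd G) e in
      generated_mfd T {(T, \<lambda>\<xi>. \<xi> c) |c. c \<in> charts_at (lmfd G) e})"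

text \<open>\<open>exp \<xi> = \<gamma> 1\<close> for the one-parameter subgroup \<open>\<gamma>\<close> with initial velocity \<open>\<xi>\<close>.\<close>

definition lie_exp :: "('g, 'l::real_inner) lie_group_data \<Rightarrow> ('g, 'l) tvec \<Rightarrow> 'g" where
  "lie_exp G \<xi> =
     (THE g. \<exists>\<gamma>. smooth_map vec_mfd (lmfd G) \<gamma> \<and> (\<forall>s t. \<gamma> (s + t) = \<gamma> s \<otimes>\<^bsub>lgrp G\<^esub> \<gamma> t) \<and>
        velocity (lmfd G) \<gamma> 0 = \<xi> \<and> g = \<gamma> 1)"

definition Ad :: "('g, 'l::real_inner) lie_group_data \<Rightarrow> 'g \<Rightarrow> ('g, 'l) tvec \<Rightarrow> ('g, 'l) tvec" where
  "Ad G g =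
     tangent_map (lmfd G) (lmfd G) (\<lambda>h. g \<otimes>\<^bsub>lgrp G\<^esub> h \<otimes>\<^bsub>lgrp G\<^esub> inv\<^bsub>lgrp G\<^esub> g) \<one>\<^bsub>lgrp G\<^esub>"

text \<open>A \<open>G\<close>-module: a finite-dimensional real vector space with a smooth linear left action.\<close>

definition lie_module ::
  "('g, 'l::real_inner) lie_group_data \<Rightarrow> ('g \<Rightarrow> 'v \<Rightarrow> 'v::real_inner) \<Rightarrow> bool" where
  "lie_module G \<rho> \<longleftrightarrow>
     finite_dim TYPE('v) \<and>
     (\<forall>g\<in>carrier (lgrp G). linear (\<rho> g)) \<and>
     (\<forall>v. \<rho> \<one>\<^bsub>lgrp G\<^esub> v = v) \<and>
     (\<forall>g\<in>carrier (lgrp G). \<forall>h\<in>carrier (lgrp G). \<forall>v. \<rho> (g \<otimes>\<^bsub>lgrp G\<^esub> h) v = \<rho> g (\<rho> h v)) \<and>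
     smooth_map (prod_mfd (lmfd G) vec_mfd) vec_mfd (\<lambda>(g, v). \<rho> g v)"

definition lie_alg_act ::
  "('g, 'l::real_inner) lie_group_data \<Rightarrow> ('g \<Rightarrow> 'v \<Rightarrow> 'v::real_inner) \<Rightarrow> ('g, 'l) tvec \<Rightarrow> 'v \<Rightarrow> 'v" where
  "lie_alg_act G \<rho> \<xi> v =
     (THE w. \<exists>\<gamma>. smooth_curve_at_0 (lmfd G) \<gamma> \<and> \<gamma> 0 = \<one>\<^bsub>lgrp G\<^esub> \<and>
        velocity (lmfd G) \<gamma> 0 = \<xi> \<and> w = vpr (velocity vec_mfd (\<lambda>t. \<rho> (\<gamma> t) v) 0))"


section \<open>Principal bundles and associated bundles\<close>

record ('p, 'a, 'e, 'g, 'l) principal_bundle_data =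
  ptot :: "('p, 'e \<times> 'l) mfd"
  pproj :: "'p \<Rightarrow> 'a"
  pact :: "'p \<Rightarrow> 'g \<Rightarrow> 'p"

definition principal_bundle ::
  "('g, 'l::real_inner) lie_group_data \<Rightarrow> ('a, 'e::real_inner) mfd \<Rightarrow>
   ('p, 'a, 'e, 'g, 'l) principal_bundle_data \<Rightarrow> bool" where
  "principal_bundle G M P \<longleftrightarrow>
     lie_group G \<and> manifold M \<and> manifold (ptot P) \<and>
     smooth_map (ptot P) M (pproj P) \<and>
     smooth_map (prod_mfd (ptot P) (lmfd G)) (ptot P) (\<lambda>(p, g). pact P p g) \<and>
     (\<forall>p\<in>points (ptot P). pact P p \<one>\<^bsub>lgrp G\<^esub> = p) \<and>
     (\<forall>p\<in>points (ptot P). \<forall>g\<in>carrier (lgrp G). \<forall>h\<in>carrier (lgrp G).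
        pact P p (g \<otimes>\<^bsub>lgrp G\<^esub> h) = pact P (pact P p g) h) \<and>
     (\<forall>p\<in>points (ptot P). \<forall>g\<in>carrier (lgrp G). pproj P (pact P p g) = pproj P p) \<and>
     (\<forall>x\<in>points M. \<exists>U \<psi>. x \<in> U \<and> openin (mtop M) U \<and>
        diffeo (open_sub (ptot P) {p \<in> points (ptot P). pproj P p \<in> U})
          (prod_mfd (open_sub M U) (lmfd G)) \<psi> \<and>
        (\<forall>p\<in>points (ptot P). pproj P p \<in> U \<longrightarrow> fst (\<psi> p) = pproj P p \<and>
           (\<forall>g\<in>carrier (lgrp G). snd (\<psi> (pact P p g)) = snd (\<psi> p) \<otimes>\<^bsub>lgrp G\<^esub> g)))"

definition pfiber :: "('p, 'a, 'e, 'g, 'l) principal_bundle_data \<Rightarrow> 'a \<Rightarrow> 'p set" where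
  "pfiber P x = {p \<in> points (ptot P). pproj P p = x}"

text \<open>\<open>assoc_class G P \<alpha> p y\<close> is \<open>[p, y]\<close>, the orbit of \<open>(p, y)\<close>, for the left action \<open>\<alpha>\<close> of \<open>G\<close>.\<close>

definition assoc_class ::
  "('g, 'l) lie_group_data \<Rightarrow> ('p, 'a, 'e, 'g, 'l) principal_bundle_data \<Rightarrow> ('g \<Rightarrow> 'n \<Rightarrow> 'n) \<Rightarrow>
   'p \<Rightarrow> 'n \<Rightarrow> ('p \<times> 'n) set" where
  "assoc_class G P \<alpha> p y = {(pact P p g, \<alpha> (inv\<^bsub>lgrp G\<^esub> g) y) |g. g \<in> carrier (lgrp G)}"

definition assoc_proj ::
  "('p, 'a, 'e, 'g, 'l) principal_bundle_data \<Rightarrow> ('p \<times> 'n) set \<Rightarrow> 'a" where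
  "assoc_proj P z = the_elem ((pproj P \<circ> fst) ` z)"

text \<open>\<open>backslash G P N \<alpha> p z\<close> is \<open>p\z\<close>.\<close>

definition backslash ::
  "('g, 'l) lie_group_data \<Rightarrow> ('p, 'a, 'e, 'g, 'l) principal_bundle_data \<Rightarrow> ('n, 'v) mfd \<Rightarrow>
   ('g \<Rightarrow> 'n \<Rightarrow> 'n) \<Rightarrow> 'p \<Rightarrow> ('p \<times> 'n) set \<Rightarrow> 'n" where
  "backslash G P N \<alpha> p z = (THE y. y \<in> points N \<and> z = assoc_class G P \<alpha> p y)"

text \<open>The manifold \<open>P \<times>\<^sub>G N\<close>.  Its smooth structure is the one for which \<open>(x, y) \<mapsto> [s x, y]\<close> is a
  diffeomorphism from \<open>U \<times> N\<close> onto the restriction to \<open>U\<close>, for each local section \<open>s\<close> of \<open>P\<close> over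
  an open set \<open>U\<close>.\<close>

definition assoc_mfd ::
  "('g, 'l::real_inner) lie_group_data \<Rightarrow> ('a, 'e::real_inner) mfd \<Rightarrow>
   ('p, 'a, 'e, 'g, 'l) principal_bundle_data \<Rightarrow> ('n, 'v::real_inner) mfd \<Rightarrow> ('g \<Rightarrow> 'n \<Rightarrow> 'n) \<Rightarrow>
   (('p \<times> 'n) set, 'e \<times> 'v) mfd" where
  "assoc_mfd G M P N \<alpha> =
     generated_mfd {assoc_class G P \<alpha> p y |p y. p \<in> points (ptot P) \<and> y \<in> points N}
       {({assoc_class G P \<alpha> (s x) y |x y. x \<in> fst c \<and> y \<in> fst d},
         \<lambda>z. (snd c (assoc_proj P z), snd d (backslash G P N \<alpha> (s (assoc_proj P z)) z))) |s c d.
          c \<in> atlas M \<and> d \<in> atlas N \<and> smooth_map (open_sub M (fst c)) (ptot P) s \<and>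
          (\<forall>x\<in>fst c. pproj P (s x) = x)}"

abbreviation assoc_vec ::
  "('g, 'l::real_inner) lie_group_data \<Rightarrow> ('a, 'e::real_inner) mfd \<Rightarrow>
   ('p, 'a, 'e, 'g, 'l) principal_bundle_data \<Rightarrow> ('g \<Rightarrow> 'v \<Rightarrow> 'v::real_inner) \<Rightarrow>
   (('p \<times> 'v) set, 'e \<times> 'v) mfd" where
  "assoc_vec G M P \<rho> \<equiv> assoc_mfd G M P vec_mfd \<rho>"

text \<open>The fibrewise negation on \<open>P \<times>\<^sub>G V\<close>.\<close>

definition assoc_neg ::
  "('g, 'l) lie_group_data \<Rightarrow> ('p, 'a, 'e, 'g, 'l) principal_bundle_data \<Rightarrow> ('g \<Rightarrow> 'v \<Rightarrow> 'v::real_inner) \<Rightarrow>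
   ('p \<times> 'v) set \<Rightarrow> ('p \<times> 'v) set" where
  "assoc_neg G P \<rho> z =
     (THE w. \<exists>p\<in>points (ptot P). \<exists>v. z = assoc_class G P \<rho> p v \<and> w = assoc_class G P \<rho> p (- v))"

text \<open>\<open>\<Gamma>(M, P \<times>\<^sub>G \<g>)\<close>, for the adjoint action of \<open>G\<close> on \<open>\<g>\<close>.\<close>

definition adjoint_section ::
  "('g, 'l::real_inner) lie_group_data \<Rightarrow> ('a, 'e::real_inner) mfd \<Rightarrow>
   ('p, 'a, 'e, 'g, 'l) principal_bundle_data \<Rightarrow> ('a \<Rightarrow> ('p \<times> ('g, 'l) tvec) set) \<Rightarrow> bool" where
  "adjoint_section G M P a \<longleftrightarrow>
     smooth_map M (assoc_mfd G M P (lie_alg G) (Ad G)) a \<and>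
     (\<forall>x\<in>points M. assoc_proj P (a x) = x)"

definition bundle_map_to_assoc ::
  "('a, 'e::real_inner, 'b, 's::real_inner) natural_bundle_data \<Rightarrow>
   ('g, 'l::real_inner) lie_group_data \<Rightarrow> ('a, 'e) mfd \<Rightarrow>
   ('p, 'a, 'e, 'g, 'l) principal_bundle_data \<Rightarrow> ('g \<Rightarrow> 'v \<Rightarrow> 'v::real_inner) \<Rightarrow>
   ('b \<Rightarrow> ('p \<times> 'v) set) \<Rightarrow> bool" where
  "bundle_map_to_assoc F G M P \<rho> h \<longleftrightarrow>
     smooth_map (FObj F M) (assoc_vec G M P \<rho>) h \<and>
     (\<forall>y\<in>points (FObj F M). assoc_proj P (h y) = FProj F M y)"


section \<open>The Darboux-Lie derivative\<close>

definition G_invariant ::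
  "('g, 'l::real_inner) lie_group_data \<Rightarrow> ('p, 'a, 'e::real_inner, 'g, 'l) principal_bundle_data \<Rightarrow>
   ('p \<Rightarrow> ('p, 'e \<times> 'l) tvec) \<Rightarrow> bool" where
  "G_invariant G P X \<longleftrightarrow>
     (\<forall>g\<in>carrier (lgrp G). \<forall>p\<in>points (ptot P).
        tangent_map (ptot P) (ptot P) (\<lambda>q. pact P q g) p (X p) = X (pact P p g))"

definition vertical ::
  "('a, 'e::real_inner) mfd \<Rightarrow> ('p, 'a, 'e, 'g, 'l::real_inner) principal_bundle_data \<Rightarrow>
   ('p \<Rightarrow> ('p, 'e \<times> 'l) tvec) \<Rightarrow> bool" where
  "vertical M P X \<longleftrightarrow>
     (\<forall>p\<in>points (ptot P). tangent_map (ptot P) M (pproj P) p (X p) = (\<lambda>c. 0))"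

text \<open>The vector field on \<open>M\<close> that the \<open>G\<close>-invariant vector field \<open>X\<close> on \<open>P\<close> is over.\<close>

definition base_field ::
  "('a, 'e::real_inner) mfd \<Rightarrow> ('p, 'a, 'e, 'g, 'l::real_inner) principal_bundle_data \<Rightarrow>
   ('p \<Rightarrow> ('p, 'e \<times> 'l) tvec) \<Rightarrow> 'a \<Rightarrow> ('a, 'e) tvec" where
  "base_field M P X =
     (THE Y. vector_field M Y \<and>
        (\<forall>p\<in>points (ptot P). tangent_map (ptot P) M (pproj P) p (X p) = Y (pproj P p)))"

text \<open>The vector field \<open>X\<^sub>V\<close> on \<open>P \<times>\<^sub>G V\<close> with flow \<open>[p, v] \<mapsto> [\<Phi>\<^sup>t p, v]\<close>, \<open>\<Phi>\<close> being the flow of \<open>X\<close>.\<close>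

definition assoc_field ::
  "('g, 'l::real_inner) lie_group_data \<Rightarrow> ('a, 'e::real_inner) mfd \<Rightarrow>
   ('p, 'a, 'e, 'g, 'l) principal_bundle_data \<Rightarrow> ('g \<Rightarrow> 'v \<Rightarrow> 'v::real_inner) \<Rightarrow>
   ('p \<Rightarrow> ('p, 'e \<times> 'l) tvec) \<Rightarrow> ('p \<times> 'v) set \<Rightarrow> (('p \<times> 'v) set, 'e \<times> 'v) tvec" where
  "assoc_field G M P \<rho> X =
     (THE Y. vector_field (assoc_vec G M P \<rho>) Y \<and>
        (\<forall>t. flow_dom (assoc_vec G M P \<rho>) Y t =
           {assoc_class G P \<rho> p v |p v. p \<in> flow_dom (ptot P) X t}) \<and>
        (\<forall>t. \<forall>p\<in>flow_dom (ptot P) X t. \<forall>v.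
           flow (assoc_vec G M P \<rho>) Y t (assoc_class G P \<rho> p v) =
           assoc_class G P \<rho> (flow (ptot P) X t p) v))"

text \<open>The Darboux-Lie derivative of \<open>h\<close> along a \<open>G\<close>-invariant vector field \<open>X\<close> on \<open>P\<close>.\<close>

definition darboux_lie ::
  "('a, 'e::real_inner, 'b, 's::real_inner) natural_bundle_data \<Rightarrow>
   ('g, 'l::real_inner) lie_group_data \<Rightarrow> ('a, 'e) mfd \<Rightarrow>
   ('p, 'a, 'e, 'g, 'l) principal_bundle_data \<Rightarrow> ('g \<Rightarrow> 'v \<Rightarrow> 'v::real_inner) \<Rightarrow>
   ('p \<Rightarrow> ('p, 'e \<times> 'l) tvec) \<Rightarrow> ('b \<Rightarrow> ('p \<times> 'v) set) \<Rightarrow> 'b \<Rightarrow> ('p \<times> 'v) set" where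
  "darboux_lie F G M P \<rho> X h y =
     (let E = assoc_vec G M P \<rho>;
          lift = canonical_lift F M (base_field M P X) y;
          \<eta> = (\<lambda>c. tangent_map (FObj F M) E h y lift c - assoc_field G M P \<rho> X (h y) c) in
      THE z. \<exists>p\<in>points (ptot P). \<exists>\<gamma>. smooth_curve_at_0 vec_mfd \<gamma> \<and>
        assoc_class G P \<rho> p (\<gamma> 0) = h y \<and>
        \<eta> = velocity E (\<lambda>t. assoc_class G P \<rho> p (\<gamma> t)) 0 \<and>
        z = assoc_class G P \<rho> p (vpr (velocity vec_mfd \<gamma> 0)))"

text \<open>The vector field \<open>X\<^sup>a\<close>.\<close>

definition section_field ::
  "('g, 'l::real_inner) lie_group_data \<Rightarrow> ('a, 'e::real_inner) mfd \<Rightarrow>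
   ('p, 'a, 'e, 'g, 'l) principal_bundle_data \<Rightarrow> ('a \<Rightarrow> ('p \<times> ('g, 'l) tvec) set) \<Rightarrow>
   'p \<Rightarrow> ('p, 'e \<times> 'l) tvec" where
  "section_field G M P a =
     (THE X. vector_field (ptot P) X \<and> G_invariant G P X \<and> vertical M P X \<and>
        (\<forall>t. flow_dom (ptot P) X t = points (ptot P)) \<and>
        (\<forall>t. \<forall>p\<in>points (ptot P). flow (ptot P) X t p =
           pact P p (lie_exp G
             (\<lambda>c. t *\<^sub>R backslash G P (lie_alg G) (Ad G) p (a (pproj P p)) c))))"

definition section_dot ::
  "('a, 'e::real_inner, 'b, 's) natural_bundle_data \<Rightarrow>
   ('g, 'l::real_inner) lie_group_data \<Rightarrow> ('a, 'e) mfd \<Rightarrow>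
   ('p, 'a, 'e, 'g, 'l) principal_bundle_data \<Rightarrow> ('g \<Rightarrow> 'v \<Rightarrow> 'v::real_inner) \<Rightarrow>
   ('a \<Rightarrow> ('p \<times> ('g, 'l) tvec) set) \<Rightarrow> ('b \<Rightarrow> ('p \<times> 'v) set) \<Rightarrow> 'b \<Rightarrow> ('p \<times> 'v) set" where
  "section_dot F G M P \<rho> a h y =
     (let x = FProj F M y in
      THE z. \<exists>p\<in>pfiber P x. z = assoc_class G P \<rho> p
        (lie_alg_act G \<rho> (backslash G P (lie_alg G) (Ad G) p (a x))
           (backslash G P vec_mfd \<rho> p (h y))))"

end

theory Submission
  imports Defs
begin

text \<open>
  Since \<open>X\<^sup>a\<close> is vertical, it lies over the zero field of \<open>M\<close>, whose flow consists of identities;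
  hence its canonical lift to \<open>F(M)\<close> vanishes and the Darboux-Lie derivative of \<open>h\<close> only sees
  minus the field on \<open>P \<times>\<^sub>G V\<close> induced by \<open>X\<^sup>a\<close>.  At \<open>h(y) = [p, v]\<close> the flow of the latter is
  \<open>[p exp(t\<xi>), v] = [p, exp(t\<xi>) v]\<close> with \<open>\<xi> = p \<setminus> a\<close>, so its velocity is the vertical vector of
  \<open>\<xi> v\<close>, and the derivative is \<open>[p, -\<xi> v] = -(a \<sqdot> h)(y)\<close>.

  Every vector field in the statement is characterised by its flow.  Such a characterisation is
  met by at most one field, because integral curves in a Hausdorff manifold are unique, and it is met
  by the velocity field of the given one-parameter group of maps as soon as that field is smooth.
  The one-parameter subgroups of \<open>G\<close> come from the Picard theorem.
\<close>

text \<open>The statement consists of definite descriptions: fields given by their flows, the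
  exponential, and classes that may be computed at any point \<open>p\<close> of a fibre. Each must
  be shown to have a value, so smoothness of the fields and independence of \<open>p\<close> carry
  most of the work. Independence of \<open>p\<close> rests on one identity: the function
  \<open>xi p\<close>, which is \<open>p \<setminus> a\<close>, satisfies xi (p g) = Ad (inv g) (xi
  p). For smoothness of the fields, differentiable dependence of solutions on parameters is
  bypassed: a field such as \<open>X\<close> at \<open>p\<close> is the derivative of the action in
  the group direction, applied to \<open>xi p\<close>, and sees only the initial velocity of the
  one-parameter subgroup. The minus sign is realised by running the curve exp(t \<xi>) v backwards,
  since the derivative is defined through curves in \<open>V\<close>. A recurrent obstacle is that
  the model spaces are inner product spaces with a finite spanning set: continuity of linear maps
  and completeness are not part of their type, and coordinates in an orthonormal basis supply what
  analysis needs.\<close>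

section \<open>Smooth functions on finite-dimensional spaces\<close>

text \<open>Of an orthonormal basis only the expansion of vectors is recorded.\<close>

definition onb :: "'e::real_inner set \<Rightarrow> bool" where
  "onb B \<longleftrightarrow> finite B \<and> (\<forall>x. x = (\<Sum>b\<in>B. (x \<bullet> b) *\<^sub>R b))"

text \<open>Induction on the spanning set: the part of the new vector orthogonal to \<open>C\<close>
  is normalised and added, unless it vanishes. Only an inclusion of spans is claimed, which is
  enough when \<open>B\<close> spans everything.\<close>

lemma Gram_Schmidt_finite:
  fixes B :: "'e::real_inner set"
  assumes "finite B"
  shows "\<exists>C. finite C \<and> (\<forall>b\<in>C. \<forall>c\<in>C. b \<bullet> c = (if b = c then 1 else 0)) \<and> span B \<subseteq> span C"
  using assms
proof induction
  case empty
  show ?case by (rule exI[of _ "{}"]) auto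
next
  case (insert b B)
  then obtain C where C: "finite C" "\<And>b c. b \<in> C \<Longrightarrow> c \<in> C \<Longrightarrow> b \<bullet> c = (if b = c then 1 else 0)"
    "span B \<subseteq> span C" by blast
  define s where "s = (\<Sum>c\<in>C. (b \<bullet> c) *\<^sub>R c)"
  define r where "r = b - s"
  have s: "s \<in> span C" unfolding s_def by (intro span_sum span_scale span_base)
  have sc: "s \<bullet> c = b \<bullet> c" if "c \<in> C" for c
  proof -
    have "s \<bullet> c = (\<Sum>d\<in>C. if d = c then b \<bullet> d else 0)"
      unfolding s_def inner_sum_left using C(2) that by (intro sum.cong) auto
    then show ?thesis using that C(1) by simp
  qed
  have rc: "r \<bullet> c = 0" if "c \<in> C" for c
    using sc[OF that] by (simp add: r_def inner_diff_left)
  show ?case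
  proof (cases "r = 0")
    case True
    then have "b \<in> span C" using s by (simp add: r_def)
    then have "span (insert b B) \<subseteq> span C"
      using C(3) span_superset[of B] by (intro span_minimal) auto
    then show ?thesis using C(1,2) by blast
  next
    case False
    define c where "c = (1 / norm r) *\<^sub>R r"
    have cc: "c \<bullet> c = 1" using False by (simp add: c_def power2_norm_eq_inner[symmetric] power2_eq_square)
    have cd: "c \<bullet> d = 0" "d \<bullet> c = 0" if "d \<in> C" for d
      using rc[OF that] by (simp_all add: c_def inner_commute)
    have "c \<notin> C" using cc cd by fastforce
    have "b = s + norm r *\<^sub>R c" using False by (simp add: c_def r_def)
    moreover have "s \<in> span (insert c C)" "c \<in> span (insert c C)"
      using s span_mono[of C "insert c C"] span_base[of c "insert c C"] by auto
    ultimately have "b \<in> span (insert c C)" by (metis span_add span_scale)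
    moreover have "B \<subseteq> span (insert c C)"
      using C(3) span_superset[of B] span_mono[of C "insert c C"] by blast
    ultimately have "span (insert b B) \<subseteq> span (insert c C)" by (intro span_minimal) auto
    moreover have "x \<bullet> y = (if x = y then 1 else 0)" if "x \<in> insert c C" "y \<in> insert c C" for x y
      using that C(2) cc cd \<open>c \<notin> C\<close> by auto
    ultimately show ?thesis using C(1) by (intro exI[of _ "insert c C"]) blast
  qed
qed

text \<open>The vectors that have the required expansion form a subspace; it contains the
  orthonormal set \<open>C\<close>, hence everything.\<close>

lemma finite_dim_onb:
  assumes "finite_dim TYPE('e::real_inner)"
  obtains B :: "'e::real_inner set" where "onb B"
proof -
  obtain B :: "'e set" where B: "finite B" "span B = UNIV"
    using assms by (auto simp: finite_dim_def)
  obtain C :: "'e set" where C: "finite C" "\<And>b c. b \<in> C \<Longrightarrow> c \<in> C \<Longrightarrow> b \<bullet> c = (if b = c then 1 else 0)"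
    "span B \<subseteq> span C" using Gram_Schmidt_finite[OF B(1)] by blast
  have "x = (\<Sum>b\<in>C. (x \<bullet> b) *\<^sub>R b)" for x
  proof -
    have "span C \<subseteq> {x. x = (\<Sum>b\<in>C. (x \<bullet> b) *\<^sub>R b)}"
    proof (rule span_minimal)
      have "(\<Sum>b\<in>C. (c \<bullet> b) *\<^sub>R b) = (\<Sum>b\<in>C. if b = c then b else 0)" if "c \<in> C" for c
        using that C(2) by (intro sum.cong) auto
      then show "C \<subseteq> {x. x = (\<Sum>b\<in>C. (x \<bullet> b) *\<^sub>R b)}" using C(1) by auto
      show "subspace {x. x = (\<Sum>b\<in>C. (x \<bullet> b) *\<^sub>R b)}"
      proof (rule subspaceI; unfold mem_Collect_eq)
        fix x y assume "x = (\<Sum>b\<in>C. (x \<bullet> b) *\<^sub>R b)" "y = (\<Sum>b\<in>C. (y \<bullet> b) *\<^sub>R b)"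
        from arg_cong2[OF this, of "(+)"] show "x + y = (\<Sum>b\<in>C. ((x + y) \<bullet> b) *\<^sub>R b)"
          unfolding inner_add_left scaleR_add_left sum.distrib .
      next
        fix r x assume "x = (\<Sum>b\<in>C. (x \<bullet> b) *\<^sub>R b)"
        from arg_cong[OF this, of "scaleR r"] show "r *\<^sub>R x = (\<Sum>b\<in>C. ((r *\<^sub>R x) \<bullet> b) *\<^sub>R b)"
          unfolding inner_scaleR_left scaleR_scaleR[symmetric] scaleR_sum_right .
      qed simp
    qed
    then show ?thesis using B(2) C(3) by auto
  qed
  then show ?thesis using that C(1) unfolding onb_def by blast
qed

lemma finite_dim_real: "finite_dim TYPE(real)"
  unfolding finite_dim_def by (rule exI[of _ "{1}"]) (auto simp: span_singleton)

lemma finite_dim_prod: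
  assumes "finite_dim TYPE('e::real_inner)" "finite_dim TYPE('f::real_inner)"
  shows "finite_dim TYPE('e \<times> 'f)"
proof -
  obtain B :: "'e set" and C :: "'f set" where B: "finite B" "span B = UNIV" and C: "finite C" "span C = UNIV"
    using assms by (auto simp: finite_dim_def)
  let ?S = "(\<lambda>x. (x, 0)) ` B \<union> (\<lambda>y. (0, y)) ` C :: ('e \<times> 'f) set"
  have "z \<in> span ?S" for z
  proof -
    have "linear (\<lambda>x::'e. (x, 0::'f))" "linear (\<lambda>y::'f. (0::'e, y))"
      by (auto intro!: linearI)
    then have "span ((\<lambda>x. (x, 0::'f)) ` B) = (\<lambda>x. (x, 0)) ` UNIV" "span ((\<lambda>y. (0::'e, y)) ` C) = (\<lambda>y. (0, y)) ` UNIV"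
      by (simp_all only: linear_span_image B(2) C(2))
    then have "(fst z, 0) \<in> span ?S" "(0, snd z) \<in> span ?S"
      using span_mono[of "(\<lambda>x. (x, 0::'f)) ` B" ?S] span_mono[of "(\<lambda>y. (0::'e, y)) ` C" ?S] by auto
    from span_add[OF this] show ?thesis by simp
  qed
  then have "span ?S = UNIV" by blast
  moreover have "finite ?S" using B(1) C(1) by simp
  ultimately show ?thesis unfolding finite_dim_def by blast
qed

lemma onb_expand: "onb B \<Longrightarrow> x = (\<Sum>b\<in>B. (x \<bullet> b) *\<^sub>R b)"
  unfolding onb_def by blast

lemma linear_onb:
  assumes "linear f" "onb B"
  shows "f x = (\<Sum>b\<in>B. (x \<bullet> b) *\<^sub>R f b)"
proof -
  interpret linear f by fact
  from arg_cong[OF onb_expand[OF assms(2)], of f x] show ?thesis unfolding sum scale .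
qed

text \<open>Expand \<open>x\<close> in an orthonormal basis and bound each coordinate by
  Cauchy-Schwarz. It serves the group action on \<open>V\<close> and the coordinate changes of the
  Lie algebra.\<close>

lemma linear_bounded_finite_dim:
  fixes f :: "'e::real_inner \<Rightarrow> 'f::real_normed_vector"
  assumes "finite_dim TYPE('e)" "linear f"
  shows "bounded_linear f"
proof -
  obtain B :: "'e set" where B: "onb B" using finite_dim_onb[OF assms(1)] .
  interpret linear f by fact
  show ?thesis
  proof (rule bounded_linear_intro[of _ "\<Sum>b\<in>B. norm b * norm (f b)"])
    fix x :: 'e
    from linear_onb[OF assms(2) B, of x]
    have "norm (f x) = norm (\<Sum>b\<in>B. (x \<bullet> b) *\<^sub>R f b)" by (rule arg_cong)
    also have "\<dots> \<le> (\<Sum>b\<in>B. norm ((x \<bullet> b) *\<^sub>R f b))" by (rule norm_sum)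
    also have "\<dots> \<le> (\<Sum>b\<in>B. norm x * (norm b * norm (f b)))"
      by (intro sum_mono) (simp add: mult.assoc[symmetric] mult_right_mono Cauchy_Schwarz_ineq2)
    finally show "norm (f x) \<le> norm x * (\<Sum>b\<in>B. norm b * norm (f b))" by (simp add: sum_distrib_left)
  qed (auto simp: add scale)
qed

section \<open>Differentiability classes and their calculus\<close>

lemma Ck_on_subset: "Ck_on k S f \<Longrightarrow> T \<subseteq> S \<Longrightarrow> Ck_on k T f"
  by (induction k arbitrary: f) (auto intro: continuous_on_subset)

text \<open>\<open>Ck_on\<close> speaks of \<open>frechet_derivative\<close>, while calculus rules
  produce some derivative \<open>f'\<close>. Exchanging the two needs congruence at order
  \<open>k\<close>; it is a hypothesis here because \<open>Ck_on_cong\<close> is itself proved by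
  this rule, with the induction hypothesis in that place.\<close>

lemma Ck_on_SucI:
  fixes f :: "'e::real_normed_vector \<Rightarrow> 'f::real_normed_vector"
  assumes "\<And>x. x \<in> S \<Longrightarrow> (f has_derivative f' x) (at x)" "open S"
    and "\<And>v. Ck_on k S (\<lambda>x. f' x v)"
    and cong: "\<And>g h :: 'e \<Rightarrow> 'f. \<forall>x\<in>S. g x = h x \<Longrightarrow> Ck_on k S g \<Longrightarrow> Ck_on k S h"
  shows "Ck_on (Suc k) S f"
proof -
  have "f' x = frechet_derivative f (at x)" if "x \<in> S" for x
    using frechet_derivative_at assms(1) that by blast
  then have "\<forall>x\<in>S. f' x v = frechet_derivative f (at x) v" for v
    by simp
  from cong[OF this assms(3)] have "Ck_on k S (\<lambda>x. frechet_derivative f (at x) v)" for v .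
  then show ?thesis using assms(1) by (auto simp: differentiable_def)
qed

lemma Ck_on_cong: "open S \<Longrightarrow> \<forall>x\<in>S. f x = g x \<Longrightarrow> Ck_on k S f \<Longrightarrow> Ck_on k S g"
proof (induction k arbitrary: f g)
  case 0
  then show ?case by (auto cong: continuous_on_cong)
next
  case (Suc k)
  have *: "(g has_derivative frechet_derivative f (at x)) (at x)" if "x \<in> S" for x
    using Suc.prems that
    by (intro has_derivative_transform_within_open[where f=f and g=g and s=S])
      (auto simp: frechet_derivative_works[symmetric])
  show ?case
  proof (rule Ck_on_SucI[OF * Suc.prems(1)])
    show "Ck_on k S (\<lambda>x. frechet_derivative f (at x) v)" for v
      using Suc.prems(3) by simp
  qed (use Suc.IH[OF Suc.prems(1)] in blast)+
qed

text \<open>Frees the recursion from \<open>frechet_derivative\<close>: on an open set any family of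
  derivatives will do, and in this form the sum, product and chain rules enter the inductions
  below.\<close>

lemma Ck_on_Suc_iff:
  assumes "open S"
  shows "Ck_on (Suc k) S f \<longleftrightarrow> (\<exists>f'. (\<forall>x\<in>S. (f has_derivative f' x) (at x)) \<and> (\<forall>v. Ck_on k S (\<lambda>x. f' x v)))"
  (is "?L \<longleftrightarrow> ?R")
proof
  assume ?L
  then show ?R
    by (intro exI[of _ "\<lambda>x. frechet_derivative f (at x)"]) (auto simp: frechet_derivative_works[symmetric])
next
  assume ?R
  then obtain f' where f': "\<And>x. x \<in> S \<Longrightarrow> (f has_derivative f' x) (at x)" "\<And>v. Ck_on k S (\<lambda>x. f' x v)"
    by blast
  show ?L by (rule Ck_on_SucI[OF f'(1) assms f'(2) Ck_on_cong[OF assms]])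
qed

lemma Ck_on_local:
  assumes "\<And>x. x \<in> S \<Longrightarrow> \<exists>T. open T \<and> x \<in> T \<and> Ck_on k T f"
  shows "Ck_on k S f"
  using assms
proof (induction k arbitrary: f)
  case 0
  then have "isCont f x" if "x \<in> S" for x
    using that by (metis Ck_on.simps(1) continuous_on_eq_continuous_at)
  then show ?case by (simp add: continuous_at_imp_continuous_on)
next
  case (Suc k)
  show ?case unfolding Ck_on.simps
  proof (intro conjI ballI allI Suc.IH)
    fix x assume "x \<in> S"
    then show "f differentiable at x" using Suc.prems by fastforce
  next
    fix v x assume "x \<in> S"
    then show "\<exists>T. open T \<and> x \<in> T \<and> Ck_on k T (\<lambda>x. frechet_derivative f (at x) v)"
      using Suc.prems[of x] by auto
  qed
qed

lemma Ck_on_Suc_imp: "Ck_on (Suc k) S f \<Longrightarrow> Ck_on k S f"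
proof (induction k arbitrary: f)
  case 0
  then show ?case
    by (auto intro!: continuous_at_imp_continuous_on differentiable_imp_continuous_within)
next
  case (Suc k)
  have "Ck_on k S (\<lambda>x. frechet_derivative f (at x) v)" for v
    using Suc.prems by (intro Suc.IH) auto
  then show ?case using Suc.prems by auto
qed

lemma Ck_on_const: "Ck_on k S (\<lambda>x. c)"
  by (induction k arbitrary: c) auto

lemma Ck_on_id: "Ck_on k S (\<lambda>x. x)"
  by (cases k) (auto simp: Ck_on_const)

lemma Ck_on_bounded_linear:
  assumes "bounded_linear L" "open S"
  shows "Ck_on k S f \<Longrightarrow> Ck_on k S (\<lambda>x. L (f x))"
proof (induction k arbitrary: f)
  case 0
  then show ?case using bounded_linear.continuous_on[OF assms(1)] by auto
next
  case (Suc k)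
  then obtain f' where f': "\<And>x. x \<in> S \<Longrightarrow> (f has_derivative f' x) (at x)" "\<And>v. Ck_on k S (\<lambda>x. f' x v)"
    unfolding Ck_on_Suc_iff[OF assms(2)] by blast
  show ?case unfolding Ck_on_Suc_iff[OF assms(2)]
  proof (rule exI[of _ "\<lambda>x v. L (f' x v)"], intro conjI ballI allI)
    show "((\<lambda>x. L (f x)) has_derivative (\<lambda>v. L (f' x v))) (at x)" if "x \<in> S" for x
      by (rule bounded_linear.has_derivative[OF assms(1) f'(1)[OF that]])
    show "Ck_on k S (\<lambda>x. L (f' x v))" for v
      by (rule Suc.IH[OF f'(2)])
  qed
qed

lemma Ck_on_add: 
  assumes "open S"
  shows "Ck_on k S f \<Longrightarrow> Ck_on k S g \<Longrightarrow> Ck_on k S (\<lambda>x. f x + g x)"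
proof (induction k arbitrary: f g)
  case 0
  then show ?case by (simp add: continuous_on_add)
next
  case (Suc k)
  obtain f' where f': "\<And>x. x \<in> S \<Longrightarrow> (f has_derivative f' x) (at x)" "\<And>v. Ck_on k S (\<lambda>x. f' x v)"
    using Suc.prems(1) unfolding Ck_on_Suc_iff[OF assms] by blast
  obtain g' where g': "\<And>x. x \<in> S \<Longrightarrow> (g has_derivative g' x) (at x)" "\<And>v. Ck_on k S (\<lambda>x. g' x v)"
    using Suc.prems(2) unfolding Ck_on_Suc_iff[OF assms] by blast
  show ?case unfolding Ck_on_Suc_iff[OF assms]
  proof (rule exI[of _ "\<lambda>x v. f' x v + g' x v"], intro conjI ballI allI)
    show "((\<lambda>x. f x + g x) has_derivative (\<lambda>v. f' x v + g' x v)) (at x)" if "x \<in> S" for x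
      using that f' g' by (intro has_derivative_add) auto
    show "Ck_on k S (\<lambda>x. f' x v + g' x v)" for v
      by (rule Suc.IH[OF f'(2) g'(2)])
  qed
qed

lemma Ck_on_scaleR: 
  assumes "open S"
  shows "Ck_on k S f \<Longrightarrow> Ck_on k S g \<Longrightarrow> Ck_on k S (\<lambda>x. f x *\<^sub>R g x)"
proof (induction k arbitrary: f g)
  case 0
  then show ?case by (simp add: continuous_on_scaleR)
next
  case (Suc k)
  obtain f' where f': "\<And>x. x \<in> S \<Longrightarrow> (f has_derivative f' x) (at x)" "\<And>v. Ck_on k S (\<lambda>x. f' x v)"
    using Suc.prems(1) unfolding Ck_on_Suc_iff[OF assms] by blast
  obtain g' where g': "\<And>x. x \<in> S \<Longrightarrow> (g has_derivative g' x) (at x)" "\<And>v. Ck_on k S (\<lambda>x. g' x v)"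
    using Suc.prems(2) unfolding Ck_on_Suc_iff[OF assms] by blast
  have *: "Ck_on k S f" "Ck_on k S g" using Suc.prems Ck_on_Suc_imp by blast+
  show ?case unfolding Ck_on_Suc_iff[OF assms]
  proof (rule exI[of _ "\<lambda>x v. f x *\<^sub>R g' x v + f' x v *\<^sub>R g x"], intro conjI ballI allI)
    show "((\<lambda>x. f x *\<^sub>R g x) has_derivative (\<lambda>v. f x *\<^sub>R g' x v + f' x v *\<^sub>R g x)) (at x)" if "x \<in> S" for x
      using that f' g' by (intro has_derivative_scaleR) auto
    show "Ck_on k S (\<lambda>x. f x *\<^sub>R g' x v + f' x v *\<^sub>R g x)" for v
      using Ck_on_add[OF assms Suc.IH[OF *(1) g'(2)] Suc.IH[OF f'(2) *(2)]] .
  qed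
qed

lemma Ck_on_sum:
  assumes "open S" "\<And>i. i \<in> I \<Longrightarrow> Ck_on k S (f i)"
  shows "Ck_on k S (\<lambda>x. \<Sum>i\<in>I. f i x)"
  using assms(2)
  by (induction I rule: infinite_finite_induct) (auto intro: Ck_on_const Ck_on_add[OF assms(1)])

text \<open>\<open>Ck_on\<close> controls derivatives in fixed directions only, whereas the chain
  rule produces \<open>g' (f x) (f' x v)\<close> with a moving direction. Expanding
  \<open>f' x v\<close> in an orthonormal basis turns this into a finite sum of products to which
  the induction hypothesis applies.\<close>

lemma Ck_on_compose:
  fixes f :: "'e::real_normed_vector \<Rightarrow> 'f::real_inner" and g :: "'f \<Rightarrow> 'h::real_normed_vector"
  assumes "finite_dim TYPE('f)" "open S" "open T" "f ` S \<subseteq> T"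
  shows "Ck_on k S f \<Longrightarrow> Ck_on k T g \<Longrightarrow> Ck_on k S (\<lambda>x. g (f x))"
proof (induction k arbitrary: g)
  case 0
  then show ?case using assms(4) by (auto intro: continuous_on_compose2)
next
  case (Suc k)
  obtain B :: "'f set" where B: "onb B" using finite_dim_onb[OF assms(1)] .
  obtain f' where f': "\<And>x. x \<in> S \<Longrightarrow> (f has_derivative f' x) (at x)" "\<And>v. Ck_on k S (\<lambda>x. f' x v)"
    using Suc.prems(1) unfolding Ck_on_Suc_iff[OF assms(2)] by blast
  obtain g' where g': "\<And>x. x \<in> T \<Longrightarrow> (g has_derivative g' x) (at x)" "\<And>v. Ck_on k T (\<lambda>x. g' x v)"
    using Suc.prems(2) unfolding Ck_on_Suc_iff[OF assms(3)] by blast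
  have f: "Ck_on k S f" using Suc.prems Ck_on_Suc_imp by blast
  show ?case unfolding Ck_on_Suc_iff[OF assms(2)]
  proof (intro exI conjI ballI allI)
    fix x assume x: "x \<in> S"
    have "f x \<in> T" using x assms(4) by blast
    then have "((g \<circ> f) has_derivative g' (f x) \<circ> f' x) (at x)"
      by (intro diff_chain_at f' g' x)
    then show "((\<lambda>x. g (f x)) has_derivative (\<lambda>v. g' (f x) (f' x v))) (at x)" by (simp add: o_def)
  next
    fix v
    have *: "Ck_on k S (\<lambda>x. \<Sum>b\<in>B. (f' x v \<bullet> b) *\<^sub>R g' (f x) b)"
      by (rule Ck_on_sum[OF assms(2) Ck_on_scaleR[OF assms(2)
              Ck_on_bounded_linear[OF bounded_linear_inner_left assms(2) f'(2)] Suc.IH[OF f g'(2)]]])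
    have "(\<Sum>b\<in>B. (f' x v \<bullet> b) *\<^sub>R g' (f x) b) = g' (f x) (f' x v)" if "x \<in> S" for x
    proof -
      have "f x \<in> T" using that assms(4) by blast
      from linear_onb[OF has_derivative_linear[OF g'(1)[OF this]] B, symmetric] show ?thesis .
    qed
    then have "\<forall>x\<in>S. (\<Sum>b\<in>B. (f' x v \<bullet> b) *\<^sub>R g' (f x) b) = g' (f x) (f' x v)" by blast
    from Ck_on_cong[OF assms(2) this *] show "Ck_on k S (\<lambda>x. g' (f x) (f' x v))" .
  qed
qed

lemma smooth_on_subset: "smooth_on S f \<Longrightarrow> T \<subseteq> S \<Longrightarrow> smooth_on T f"
  unfolding smooth_on_def using Ck_on_subset by blast

lemma smooth_on_cong: "smooth_on S f \<Longrightarrow> open S \<Longrightarrow> (\<And>x. x \<in> S \<Longrightarrow> f x = g x) \<Longrightarrow> smooth_on S g"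
  unfolding smooth_on_def using Ck_on_cong[of S f g] by blast

lemma smooth_on_local:
  assumes "\<And>x. x \<in> S \<Longrightarrow> \<exists>T. open T \<and> x \<in> T \<and> smooth_on T f"
  shows "smooth_on S f"
  using assms unfolding smooth_on_def by (meson Ck_on_local)

lemma smooth_on_const: "smooth_on S (\<lambda>x. c)"
  by (simp add: smooth_on_def Ck_on_const)

lemma smooth_on_id: "smooth_on S (\<lambda>x. x)"
  by (simp add: smooth_on_def Ck_on_id)

lemma smooth_on_bounded_linear:
  "bounded_linear L \<Longrightarrow> open S \<Longrightarrow> smooth_on S f \<Longrightarrow> smooth_on S (\<lambda>x. L (f x))"
  by (simp add: smooth_on_def Ck_on_bounded_linear)

lemma smooth_on_add: "open S \<Longrightarrow> smooth_on S f \<Longrightarrow> smooth_on S g \<Longrightarrow> smooth_on S (\<lambda>x. f x + g x)"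
  by (simp add: smooth_on_def Ck_on_add)

lemma smooth_on_scaleR: "open S \<Longrightarrow> smooth_on S f \<Longrightarrow> smooth_on S g \<Longrightarrow> smooth_on S (\<lambda>x. f x *\<^sub>R g x)"
  by (simp add: smooth_on_def Ck_on_scaleR)

lemma smooth_on_sum: "open S \<Longrightarrow> (\<And>i. i \<in> I \<Longrightarrow> smooth_on S (f i)) \<Longrightarrow> smooth_on S (\<lambda>x. \<Sum>i\<in>I. f i x)"
  by (simp add: smooth_on_def Ck_on_sum)

lemma smooth_on_Pair:
  assumes "open S" "smooth_on S f" "smooth_on S g"
  shows "smooth_on S (\<lambda>x. (f x, g x))"
proof -
  have "smooth_on S (\<lambda>x. (f x, 0) + (0, g x))"
    by (intro smooth_on_add assms smooth_on_bounded_linear[where L="\<lambda>x. (x, 0)"]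
        smooth_on_bounded_linear[where L="\<lambda>x. (0, x)"] bounded_linear_Pair
        bounded_linear_ident bounded_linear_zero)
  then show ?thesis by simp
qed

lemma smooth_on_fst: "open S \<Longrightarrow> smooth_on S f \<Longrightarrow> smooth_on S (\<lambda>x. fst (f x))"
  and smooth_on_snd: "open S \<Longrightarrow> smooth_on S f \<Longrightarrow> smooth_on S (\<lambda>x. snd (f x))"
  by (simp_all add: smooth_on_bounded_linear bounded_linear_fst bounded_linear_snd)

lemma smooth_on_compose:
  fixes f :: "'e::real_normed_vector \<Rightarrow> 'f::real_inner" and g :: "'f \<Rightarrow> 'h::real_normed_vector"
  assumes "finite_dim TYPE('f)" "open S" "open T" "f ` S \<subseteq> T" "smooth_on S f" "smooth_on T g"
  shows "smooth_on S (\<lambda>x. g (f x))"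
  unfolding smooth_on_def
proof
  fix k
  show "Ck_on k S (\<lambda>x. g (f x))"
    by (rule Ck_on_compose[OF assms(1-4)]) (use assms(5,6) in \<open>simp_all only: smooth_on_def\<close>)
qed

lemma smooth_on_continuous: "smooth_on S f \<Longrightarrow> continuous_on S f"
  unfolding smooth_on_def by (metis Ck_on.simps(1))

lemma smooth_on_has_derivative:
  assumes "smooth_on S f" "x \<in> S"
  shows "(f has_derivative frechet_derivative f (at x)) (at x)"
proof -
  have "Ck_on (Suc 0) S f" using assms(1) by (simp only: smooth_on_def)
  then show ?thesis using assms(2) by (auto simp: frechet_derivative_works)
qed

lemma smooth_on_derivative: "smooth_on S f \<Longrightarrow> smooth_on S (\<lambda>x. frechet_derivative f (at x) v)"
  unfolding smooth_on_def by (metis Ck_on.simps(2))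

text \<open>Again the moving direction is expanded in an orthonormal basis. This is the form in
  which a vector field changes charts and in which partial derivatives depend on parameters.\<close>

lemma smooth_on_derivative_app:
  fixes u w :: "'e::real_normed_vector \<Rightarrow> 'f::real_inner" and f :: "'f \<Rightarrow> 'h::real_normed_vector"
  assumes "finite_dim TYPE('f)" "open S" "open T" "u ` S \<subseteq> T"
    and "smooth_on S u" "smooth_on S w" "smooth_on T f"
  shows "smooth_on S (\<lambda>x. frechet_derivative f (at (u x)) (w x))"
proof -
  obtain B :: "'f set" where B: "onb B" using finite_dim_onb[OF assms(1)] .
  have "smooth_on S (\<lambda>x. \<Sum>b\<in>B. (w x \<bullet> b) *\<^sub>R frechet_derivative f (at (u x)) b)"
    by (rule smooth_on_sum[OF assms(2) smooth_on_scaleR[OF assms(2)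
            smooth_on_bounded_linear[OF bounded_linear_inner_left assms(2,6)]
            smooth_on_compose[OF assms(1-5) smooth_on_derivative[OF assms(7)]]]])
  then show ?thesis
  proof (rule smooth_on_cong[OF _ assms(2)])
    fix x assume "x \<in> S"
    then have "linear (frechet_derivative f (at (u x)))"
      using assms(4) by (intro has_derivative_linear[OF smooth_on_has_derivative[OF assms(7)]]) blast
    from linear_onb[OF this B, of "w x"]
    show "(\<Sum>b\<in>B. (w x \<bullet> b) *\<^sub>R frechet_derivative f (at (u x)) b) = frechet_derivative f (at (u x)) (w x)" by (rule sym)
  qed
qed

text \<open>The finitely many directional derivatives along the basis are continuous, hence bounded
  near \<open>x0\<close>; this bounds the operator norm of the derivative, and the mean value
  inequality on a convex ball finishes.\<close>

lemma smooth_on_locally_lipschitz: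
  fixes f :: "'e::real_inner \<Rightarrow> 'f::real_normed_vector"
  assumes "finite_dim TYPE('e)" "open S" "smooth_on S f" "x0 \<in> S"
  obtains r L where "r > 0" "L \<ge> 0" "cball x0 r \<subseteq> S"
    "\<And>x y. x \<in> cball x0 r \<Longrightarrow> y \<in> cball x0 r \<Longrightarrow> norm (f x - f y) \<le> L * norm (x - y)"
proof -
  obtain B :: "'e set" where B: "onb B" using finite_dim_onb[OF assms(1)] .
  have fB: "finite B" using B by (simp add: onb_def)
  let ?D = "\<lambda>x. frechet_derivative f (at x)"
  have "eventually (\<lambda>x. norm (?D x b) < norm (?D x0 b) + 1) (nhds x0)" for b
  proof -
    have "isCont (\<lambda>x. ?D x b) x0"
      using smooth_on_continuous[OF smooth_on_derivative[OF assms(3)]] assms(2,4)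
      by (simp add: continuous_on_eq_continuous_at)
    then have "filterlim (\<lambda>x. ?D x b) (nhds (?D x0 b)) (nhds x0)"
      by (simp add: isCont_def tendsto_nhds_iff)
    from order_tendstoD(2)[OF tendsto_norm[OF this], of "norm (?D x0 b) + 1"] show ?thesis by simp
  qed
  then have "eventually (\<lambda>x. \<forall>b\<in>B. norm (?D x b) < norm (?D x0 b) + 1) (nhds x0)"
    using fB by (simp add: eventually_ball_finite)
  moreover have "eventually (\<lambda>x. x \<in> S) (nhds x0)"
    using assms(2,4) by (simp add: eventually_nhds_in_open)
  ultimately have "eventually (\<lambda>x. x \<in> S \<and> (\<forall>b\<in>B. norm (?D x b) < norm (?D x0 b) + 1)) (nhds x0)"
    by eventually_elim auto
  then obtain r where r: "r > 0" "\<And>x. x \<in> cball x0 r \<Longrightarrow> x \<in> S \<and> (\<forall>b\<in>B. norm (?D x b) < norm (?D x0 b) + 1)"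
    unfolding eventually_nhds_metric_le by (auto simp: dist_commute)
  \<comment> \<open>The operator norm bound obtained from |v \<bullet> b| \<le> |v| |b| when each
    directional derivative exceeds its norm at \<open>x0\<close> by less than 1.\<close>
  define L where "L = (\<Sum>b\<in>B. norm b * (norm (?D x0 b) + 1))"
  have L: "L \<ge> 0" unfolding L_def by (intro sum_nonneg) auto
  have "onorm (?D x) \<le> L" if x: "x \<in> cball x0 r" for x
  proof (rule onorm_bound[OF L])
    fix v
    have "linear (?D x)" using r(2)[OF x] has_derivative_linear smooth_on_has_derivative[OF assms(3)] by blast
    from linear_onb[OF this B, of v]
    have "norm (?D x v) = norm (\<Sum>b\<in>B. (v \<bullet> b) *\<^sub>R ?D x b)" by (rule arg_cong)
    also have "\<dots> \<le> (\<Sum>b\<in>B. norm ((v \<bullet> b) *\<^sub>R ?D x b))" by (rule norm_sum)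
    also have "\<dots> \<le> (\<Sum>b\<in>B. (norm v * norm b) * (norm (?D x0 b) + 1))"
      using r(2)[OF x] by (intro sum_mono) (auto intro!: mult_mono Cauchy_Schwarz_ineq2 simp: less_imp_le)
    finally show "norm (?D x v) \<le> L * norm v" by (simp add: L_def sum_distrib_left mult_ac)
  qed
  then have "norm (f x - f y) \<le> L * norm (x - y)" if "x \<in> cball x0 r" "y \<in> cball x0 r" for x y
    using that r(2) smooth_on_has_derivative[OF assms(3)]
    by (intro differentiable_bound[OF convex_cball[of x0 r], where f'="?D"]) (auto intro: has_derivative_at_withinI)
  then show ?thesis using that[OF r(1) L] r(2) by blast
qed

section \<open>Ordinary differential equations\<close>

lemma lipschitz_ode_unique_forward:
  fixes y z :: "real \<Rightarrow> 'e::real_inner"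
  assumes "t0 \<le> t1"
    and y: "\<And>t. t \<in> {t0..t1} \<Longrightarrow> (y has_vector_derivative f (y t)) (at t) \<and> y t \<in> C"
    and z: "\<And>t. t \<in> {t0..t1} \<Longrightarrow> (z has_vector_derivative f (z t)) (at t) \<and> z t \<in> C"
    and L: "\<And>u v. u \<in> C \<Longrightarrow> v \<in> C \<Longrightarrow> norm (f u - f v) \<le> L * norm (u - v)"
    and "y t0 = z t0"
  shows "y t1 = z t1"
proof -
  \<comment> \<open>\<open>|y - z|\<^sup>2 exp(-2 L t)\<close> is nonincreasing.\<close>
  let ?u = "\<lambda>t. y t - z t"
  let ?\<phi> = "\<lambda>t. (?u t \<bullet> ?u t) * exp (- 2 * L * t)"
  have "?\<phi> t1 \<le> ?\<phi> t0"
  proof (rule DERIV_nonpos_imp_nonincreasing[OF assms(1)])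
    fix t assume "t0 \<le> t" "t \<le> t1"
    then have t: "t \<in> {t0..t1}" by simp
    let ?d = "f (y t) - f (z t)"
    have "(?u has_vector_derivative ?d) (at t)"
      using y[OF t] z[OF t] by (auto intro: has_vector_derivative_diff)
    then have u: "(?u has_derivative (\<lambda>h. h *\<^sub>R ?d)) (at t)" by (simp add: has_vector_derivative_def)
    have "((\<lambda>t. ?u t \<bullet> ?u t) has_derivative (\<lambda>h. ?u t \<bullet> (h *\<^sub>R ?d) + (h *\<^sub>R ?d) \<bullet> ?u t)) (at t)"
      by (rule has_derivative_inner[OF u u])
    moreover have "(\<lambda>h. ?u t \<bullet> (h *\<^sub>R ?d) + (h *\<^sub>R ?d) \<bullet> ?u t) = (*) (2 * (?u t \<bullet> ?d))"
      by (auto simp: inner_commute)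
    ultimately have "((\<lambda>t. ?u t \<bullet> ?u t) has_real_derivative 2 * (?u t \<bullet> ?d)) (at t)"
      by (simp only: has_field_derivative_def)
    moreover have "((\<lambda>t. exp (- 2 * L * t)) has_real_derivative exp (- 2 * L * t) * (- 2 * L)) (at t)"
      by (auto intro!: derivative_eq_intros)
    ultimately have D: "(?\<phi> has_real_derivative
        2 * (?u t \<bullet> ?d) * exp (- 2 * L * t) + exp (- 2 * L * t) * (- 2 * L) * (?u t \<bullet> ?u t)) (at t)"
      by (rule DERIV_mult)
    have "?u t \<bullet> ?d \<le> norm (?u t) * norm ?d" by (rule norm_cauchy_schwarz)
    also have "\<dots> \<le> norm (?u t) * (L * norm (?u t))"
      using y[OF t] z[OF t] by (intro mult_left_mono L) auto
    finally have "?u t \<bullet> ?d \<le> L * (?u t \<bullet> ?u t)"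
      by (simp add: power2_norm_eq_inner[symmetric] power2_eq_square mult_ac)
    then have "2 * exp (- 2 * L * t) * (?u t \<bullet> ?d - L * (?u t \<bullet> ?u t)) \<le> 0"
      by (intro mult_nonneg_nonpos) auto
    then have "2 * (?u t \<bullet> ?d) * exp (- 2 * L * t) + exp (- 2 * L * t) * (- 2 * L) * (?u t \<bullet> ?u t) \<le> 0"
      by (simp only: right_diff_distrib mult_ac)
    with D show "\<exists>D. (?\<phi> has_real_derivative D) (at t) \<and> D \<le> 0" by blast
  qed
  then have "?u t1 \<bullet> ?u t1 \<le> 0" using assms(5) by (simp add: mult_le_0_iff)
  then show ?thesis by (metis antisym inner_eq_zero_iff inner_ge_zero right_minus_eq)
qed

text \<open>Reversing time replaces \<open>f\<close> by its negative, which has the same Lipschitz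
  constant, so backward times reduce to forward ones.\<close>

lemma lipschitz_ode_unique:
  fixes y z :: "real \<Rightarrow> 'e::real_inner"
  assumes y: "\<And>t. t \<in> I \<Longrightarrow> (y has_vector_derivative f (y t)) (at t) \<and> y t \<in> C"
    and z: "\<And>t. t \<in> I \<Longrightarrow> (z has_vector_derivative f (z t)) (at t) \<and> z t \<in> C"
    and L: "\<And>u v. u \<in> C \<Longrightarrow> v \<in> C \<Longrightarrow> norm (f u - f v) \<le> L * norm (u - v)"
    and "is_interval I" "t0 \<in> I" "t1 \<in> I" "y t0 = z t0"
  shows "y t1 = z t1"
proof (cases "t0 \<le> t1")
  case True
  have I: "t \<in> I" if "t \<in> {t0..t1}" for t
    using that by (intro mem_is_interval_1_I[OF assms(4,5,6)]) auto
  show ?thesis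
    by (rule lipschitz_ode_unique_forward[OF True y[OF I] z[OF I] L assms(7)])
next
  case False
  have I: "- t \<in> I" if "t \<in> {-t0..-t1}" for t
    using that by (intro mem_is_interval_1_I[OF assms(4,6,5)]) auto
  have *: "((\<lambda>t. x (- t)) has_vector_derivative - f (x (- t))) (at t)"
    if "(x has_vector_derivative f (x (- t))) (at (- t))" for t and x :: "real \<Rightarrow> 'e"
  proof -
    have "(uminus has_vector_derivative (-1::real)) (at t)"
      by (auto intro!: derivative_eq_intros)
    from vector_diff_chain_at[OF this that] show ?thesis by (simp add: o_def)
  qed
  have "(\<lambda>t. y (- t)) (- t1) = (\<lambda>t. z (- t)) (- t1)"
  proof (rule lipschitz_ode_unique_forward[of "- t0" "- t1" "\<lambda>t. y (- t)" "\<lambda>x. - f x" C "\<lambda>t. z (- t)" L])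
    show "((\<lambda>t. y (- t)) has_vector_derivative - f (y (- t))) (at t) \<and> y (- t) \<in> C" if "t \<in> {-t0..-t1}" for t
      using y[OF I[OF that]] * by blast
    show "((\<lambda>t. z (- t)) has_vector_derivative - f (z (- t))) (at t) \<and> z (- t) \<in> C" if "t \<in> {-t0..-t1}" for t
      using z[OF I[OF that]] * by blast
    show "norm (- f u - - f v) \<le> L * norm (u - v)" if "u \<in> C" "v \<in> C" for u v
      using L[OF that] by (simp add: norm_minus_commute)
  qed (use False assms(7) in auto)
  then show ?thesis by simp
qed

text \<open>The contraction acts on bounded continuous functions on the whole line. The Picard
  operator reads time through \<open>clip\<close>, so its values are constant outside
  [-\<epsilon>, \<epsilon>], and boundedness holds because they stay in the ball.\<close>

lemma picard_banach:
  fixes f :: "'b::banach \<Rightarrow> 'b"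
  assumes "r > 0" "L \<ge> 0"
    and L: "\<And>u v. u \<in> cball x0 r \<Longrightarrow> v \<in> cball x0 r \<Longrightarrow> norm (f u - f v) \<le> L * norm (u - v)"
  obtains \<epsilon> x where "\<epsilon> > 0" "x 0 = x0"
    "\<And>t. t \<in> {-\<epsilon><..<\<epsilon>} \<Longrightarrow> (x has_vector_derivative f (x t)) (at t) \<and> x t \<in> cball x0 r"
proof -
  define M where "M = norm (f x0) + L * r"
  have M0: "M \<ge> 0" using assms by (simp add: M_def)
  have M: "norm (f u) \<le> M" if "u \<in> cball x0 r" for u
  proof -
    have "norm (f u) \<le> norm (f x0) + norm (f u - f x0)" by (metis norm_triangle_sub)
    also have "norm (f u - f x0) \<le> L * norm (u - x0)" using that assms(1) by (intro L) auto
    also have "\<dots> \<le> L * r" using that assms(2) by (intro mult_left_mono) (auto simp: dist_norm norm_minus_commute)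
    finally show ?thesis by (simp add: M_def)
  qed
  \<comment> \<open>The factor 3 comes from \<open>bnd\<close>: two integrals over lengths at most 2
    \<epsilon> and \<epsilon>, joined by the triangle inequality. The first bound keeps the operator
    in the ball, the second makes its contraction constant 1/2; adding 1 keeps the denominators
    positive.\<close>
  define \<epsilon> where "\<epsilon> = min (r / (3 * (M + 1))) (1 / (6 * (L + 1)))"
  have \<epsilon>: "\<epsilon> > 0" using assms M0 by (simp add: \<epsilon>_def)
  have "\<epsilon> \<le> r / (3 * (M + 1))" "\<epsilon> \<le> 1 / (6 * (L + 1))" by (simp_all add: \<epsilon>_def)
  then have "\<epsilon> * (3 * (M + 1)) \<le> r" "\<epsilon> * (6 * (L + 1)) \<le> 1"
    using assms(2) M0 by (simp_all add: pos_le_divide_eq)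
  then have \<epsilon>M: "3 * \<epsilon> * M \<le> r" and \<epsilon>L: "3 * \<epsilon> * L \<le> 1/2"
    using \<epsilon> by (simp_all add: algebra_simps)
  have fc: "continuous_on (cball x0 r) f"
  proof (rule continuous_onI)
    fix u e :: real fix x assume x: "x \<in> cball x0 r" and "0 < (e::real)"
    show "\<exists>d>0. \<forall>x'\<in>cball x0 r. dist x' x < d \<longrightarrow> dist (f x') (f x) \<le> e"
    proof (intro exI conjI ballI impI)
      show "e / (L + 1) > 0" using \<open>e > 0\<close> assms(2) by simp
      fix x' assume x': "x' \<in> cball x0 r" "dist x' x < e / (L + 1)"
      have "dist (f x') (f x) \<le> L * dist x' x" using L[OF x'(1) x] by (simp add: dist_norm)
      also have "\<dots> \<le> (L + 1) * dist x' x" by (simp add: mult_right_mono)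
      also have "\<dots> \<le> e" using x'(2) assms(2) by (simp add: pos_less_divide_eq mult.commute)
      finally show "dist (f x') (f x) \<le> e" .
    qed
  qed
  define S where "S = {u::real \<Rightarrow>\<^sub>C 'b. \<forall>t. apply_bcontfun u t \<in> cball x0 r}"
  define clip where "clip t = max (-\<epsilon>) (min \<epsilon> t)" for t :: real
  have clip: "clip t \<in> {-\<epsilon>..\<epsilon>}" for t using \<epsilon> by (auto simp: clip_def)
  have cc: "continuous_on UNIV clip" unfolding clip_def by (intro continuous_intros)
  \<comment> \<open>All integrals start at the common left end -\<epsilon>, which avoids oriented
    integrals; subtracting the one up to 0 makes the value at time 0 equal to
    \<open>x0\<close>.\<close>
  define T where "T u t = x0 + integral {-\<epsilon>..clip t} (\<lambda>s. f (apply_bcontfun u s)) - integral {-\<epsilon>..0} (\<lambda>s. f (apply_bcontfun u s))" for u t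
  have fu: "continuous_on UNIV (\<lambda>s. f (apply_bcontfun u s))" if "u \<in> S" for u
    using that by (intro continuous_on_compose2[OF fc]) (auto simp: S_def)
  have int: "(\<lambda>s. f (apply_bcontfun u s)) integrable_on {a..b}" if "u \<in> S" for u a b
    by (intro integrable_continuous_real continuous_on_subset[OF fu[OF that]]) simp
  have bnd: "norm (integral {-\<epsilon>..clip t} g - integral {-\<epsilon>..0} g) \<le> 3 * \<epsilon> * K"
    if "continuous_on UNIV g" "\<And>s. norm (g s) \<le> K" for g :: "real \<Rightarrow> 'b" and K t
  proof -
    have K: "K \<ge> 0" using that(2) norm_ge_zero order_trans by blast
    have 1: "norm (integral {-\<epsilon>..clip t} g) \<le> K * (clip t - (-\<epsilon>))"
      using clip[of t] that by (intro integral_bound) (auto intro: continuous_on_subset)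
    have 2: "norm (integral {-\<epsilon>..0} g) \<le> K * (0 - (-\<epsilon>))"
      using \<epsilon> that by (intro integral_bound) (auto intro: continuous_on_subset)
    have "K * (clip t - (-\<epsilon>)) \<le> K * (2 * \<epsilon>)" using clip[of t] K by (intro mult_left_mono) auto
    then show ?thesis using 1 2 norm_triangle_ineq4[of "integral {-\<epsilon>..clip t} g" "integral {-\<epsilon>..0} g"]
      by (simp add: algebra_simps)
  qed
  have Tball: "T u t \<in> cball x0 r" if "u \<in> S" for u t
  proof -
    have "norm (integral {-\<epsilon>..clip t} (\<lambda>s. f (apply_bcontfun u s)) - integral {-\<epsilon>..0} (\<lambda>s. f (apply_bcontfun u s))) \<le> 3 * \<epsilon> * M"
      using that by (intro bnd fu M) (auto simp: S_def)
    then show ?thesis using \<epsilon>M unfolding T_def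
      by (simp add: dist_norm norm_minus_commute algebra_simps)
  qed
  have Tcont: "continuous_on UNIV (T u)" if "u \<in> S" for u
    unfolding T_def
    by (intro continuous_intros continuous_on_compose2[OF indefinite_integral_continuous_1[OF int[OF that, of "-\<epsilon>" \<epsilon>]] cc])
      (use clip in auto)
  have Tb: "T u \<in> bcontfun" if "u \<in> S" for u
    using Tcont[OF that] Tball[OF that] unfolding bcontfun_def
    by (auto intro: bounded_subset[OF bounded_cball[of x0 r]])
  define TT where "TT u = Bcontfun (T u)" for u
  have TT: "apply_bcontfun (TT u) = T u" if "u \<in> S" for u
    unfolding TT_def by (rule Bcontfun_inverse[OF Tb[OF that]])
  have "\<exists>!u\<in>S. TT u = u"
  proof (rule Banach_fix[of S "1/2"])
    have "closed S"
    proof -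
      have "S = (\<Inter>t. (\<lambda>u. apply_bcontfun u t) -` cball x0 r)" by (auto simp: S_def)
      moreover have "closed ((\<lambda>u::real \<Rightarrow>\<^sub>C 'b. apply_bcontfun u t) -` cball x0 r)" for t
      proof (rule closed_vimage[OF closed_cball])
        show "continuous_on UNIV (\<lambda>u::real \<Rightarrow>\<^sub>C 'b. apply_bcontfun u t)"
        proof (rule continuous_onI)
          fix x :: "real \<Rightarrow>\<^sub>C 'b" and e :: real assume "e > 0"
          then show "\<exists>d>0. \<forall>x'\<in>UNIV. dist x' x < d \<longrightarrow> dist (apply_bcontfun x' t) (apply_bcontfun x t) \<le> e"
            using dist_bounded[of _ t x] by (intro exI[of _ e]) (auto intro: order_trans less_imp_le)
        qed
      qed
      ultimately show ?thesis by (simp add: closed_INT)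
    qed
    then show "complete S" by (simp add: complete_eq_closed)
    have "apply_bcontfun (const_bcontfun x0) t = x0" for t :: real by (simp add: const_bcontfun.rep_eq)
    then have "const_bcontfun x0 \<in> S" using assms(1) by (simp add: S_def)
    then show "S \<noteq> {}" by blast
    have "TT u \<in> S" if "u \<in> S" for u
      unfolding S_def mem_Collect_eq TT[OF that] using Tball[OF that] by blast
    then show "TT ` S \<subseteq> S" by blast
    fix u v assume uv: "u \<in> S" "v \<in> S"
    show "dist (TT u) (TT v) \<le> 1/2 * dist u v"
    proof (rule dist_bound)
      fix t
      let ?g = "\<lambda>s. f (apply_bcontfun u s) - f (apply_bcontfun v s)"
      have "norm (?g s) \<le> L * dist u v" for s
      proof -
        have "norm (?g s) \<le> L * norm (apply_bcontfun u s - apply_bcontfun v s)"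
          using uv by (intro L) (auto simp: S_def)
        also have "\<dots> \<le> L * dist u v"
          using dist_bounded[of u s v] assms(2) by (intro mult_left_mono) (auto simp: dist_norm)
        finally show ?thesis .
      qed
      moreover have "continuous_on UNIV ?g" using uv fu by (intro continuous_intros) auto
      ultimately have "norm (integral {-\<epsilon>..clip t} ?g - integral {-\<epsilon>..0} ?g) \<le> 3 * \<epsilon> * (L * dist u v)"
        by (rule bnd[rotated])
      also have "integral {-\<epsilon>..clip t} ?g - integral {-\<epsilon>..0} ?g = T u t - T v t"
        using uv by (simp add: T_def integral_diff int)
      also have "3 * \<epsilon> * (L * dist u v) \<le> 1/2 * dist u v"
        using mult_right_mono[OF \<epsilon>L, of "dist u v"] by (simp add: mult_ac)
      finally show "dist (apply_bcontfun (TT u) t) (apply_bcontfun (TT v) t) \<le> 1/2 * dist u v"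
        using uv by (simp add: TT dist_norm)
    qed
  qed auto
  then obtain u where u: "u \<in> S" "TT u = u" by blast
  let ?x = "apply_bcontfun u"
  have x: "?x t = T u t" for t using TT[OF u(1)] u(2) by simp
  show ?thesis
  proof (rule that[OF \<epsilon>])
    have "clip 0 = 0" using \<epsilon> by (simp add: clip_def)
    then show "?x 0 = x0" using x[of 0] by (simp add: T_def)
    fix t assume t: "t \<in> {-\<epsilon><..<\<epsilon>}"
    have "((\<lambda>t. integral {-\<epsilon>..t} (\<lambda>s. f (?x s))) has_vector_derivative f (?x t)) (at t within {-\<epsilon>..\<epsilon>})"
      using t by (intro integral_has_vector_derivative continuous_on_subset[OF fu[OF u(1)]]) auto
    moreover have "at t within {-\<epsilon>..\<epsilon>} = at t"
      using t by (intro at_within_interior) auto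
    ultimately have "((\<lambda>t. x0 + integral {-\<epsilon>..t} (\<lambda>s. f (?x s)) - integral {-\<epsilon>..0} (\<lambda>s. f (?x s)))
        has_vector_derivative f (?x t)) (at t)"
      by (auto intro!: derivative_eq_intros)
    then have "(?x has_vector_derivative f (?x t)) (at t)"
    proof (rule has_vector_derivative_transform_within_open[OF _ open_greaterThanLessThan t])
      fix s assume "s \<in> {-\<epsilon><..<\<epsilon>}"
      then have "clip s = s" by (simp add: clip_def)
      then show "x0 + integral {-\<epsilon>..s} (\<lambda>s. f (?x s)) - integral {-\<epsilon>..0} (\<lambda>s. f (?x s)) = ?x s"
        using x[of s] by (simp add: T_def)
    qed
    then show "(?x has_vector_derivative f (?x t)) (at t) \<and> ?x t \<in> cball x0 r"
      using u(1) by (auto simp: S_def)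
  qed
qed

text \<open>A model space need not belong to the class \<open>banach\<close>; its dual is used instead.\<close>

lemma picard_finite_dim:
  fixes f :: "'e::real_inner \<Rightarrow> 'e"
  assumes "finite_dim TYPE('e)" "r > 0" "L \<ge> 0"
    and L: "\<And>u v. u \<in> cball x0 r \<Longrightarrow> v \<in> cball x0 r \<Longrightarrow> norm (f u - f v) \<le> L * norm (u - v)"
  obtains \<epsilon> x where "\<epsilon> > 0" "x 0 = x0"
    "\<And>t. t \<in> {-\<epsilon><..<\<epsilon>} \<Longrightarrow> (x has_vector_derivative f (x t)) (at t) \<and> x t \<in> cball x0 r"
proof -
  obtain B :: "'e set" where B: "onb B" using finite_dim_onb[OF assms(1)] .
  let ?J = "blinfun_inner_left :: 'e \<Rightarrow> ('e \<Rightarrow>\<^sub>L real)"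
  \<comment> \<open>\<open>K\<close> is a bounded linear left inverse of \<open>?J\<close>, so the
    equation can be transported to the complete dual space and its solution mapped back. The radius
    \<open>r / k\<close> used there makes \<open>K\<close> send the transported ball into the
    original one.\<close>
  define K where "K w = (\<Sum>b\<in>B. blinfun_apply w b *\<^sub>R b)" for w :: "'e \<Rightarrow>\<^sub>L real"
  have KJ: "K (?J v) = v" for v
    unfolding K_def using onb_expand[OF B, of v] by (simp add: inner_commute)
  have K: "bounded_linear K"
    unfolding K_def by (intro bounded_linear_sum bounded_linear_scaleR_const blinfun.bounded_linear_left)
  interpret K: bounded_linear K by fact
  interpret J: bounded_linear ?J by (rule bounded_linear_blinfun_inner_left)
  obtain k where k: "k > 0" "\<And>w. norm (K w) \<le> norm w * k" using K.pos_bounded by blast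
  obtain j where j: "j > 0" "\<And>v. norm (?J v) \<le> norm v * j" using J.pos_bounded by blast
  have Kc: "K w \<in> cball x0 r" if "w \<in> cball (?J x0) (r / k)" for w
  proof -
    have "norm (x0 - K w) = norm (K (?J x0 - w))" by (simp add: K.diff KJ)
    also have "\<dots> \<le> norm (?J x0 - w) * k" by (rule k)
    also have "\<dots> \<le> r" using that k(1) by (simp add: dist_norm pos_le_divide_eq)
    finally show ?thesis by (simp add: dist_norm)
  qed
  let ?f = "\<lambda>w. ?J (f (K w))"
  have "norm (?f u - ?f v) \<le> (L * k * j) * norm (u - v)"
    if "u \<in> cball (?J x0) (r / k)" "v \<in> cball (?J x0) (r / k)" for u v
  proof -
    have "norm (?f u - ?f v) = norm (?J (f (K u) - f (K v)))" by (simp add: J.diff)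
    also have "\<dots> \<le> norm (f (K u) - f (K v)) * j" by (rule j)
    also have "\<dots> \<le> (L * norm (K u - K v)) * j"
      using j(1) by (intro mult_right_mono L Kc that) auto
    also have "norm (K u - K v) \<le> norm (u - v) * k" using k(2)[of "u - v"] by (simp add: K.diff)
    then have "(L * norm (K u - K v)) * j \<le> (L * (norm (u - v) * k)) * j"
      using j(1) assms(3) by (intro mult_right_mono mult_left_mono) auto
    finally show ?thesis by (simp add: mult_ac)
  qed
  moreover have "r / k > 0" "L * k * j \<ge> 0" using assms(2,3) k(1) j(1) by simp_all
  ultimately obtain \<epsilon> w where w: "\<epsilon> > 0" "w 0 = ?J x0"
    "\<And>t. t \<in> {-\<epsilon><..<\<epsilon>} \<Longrightarrow> (w has_vector_derivative ?f (w t)) (at t) \<and> w t \<in> cball (?J x0) (r / k)"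
    using picard_banach[of "r / k" "L * k * j" "?J x0" ?f] by blast
  show ?thesis
  proof (rule that[OF w(1)])
    show "K (w 0) = x0" by (simp add: w(2) KJ)
    fix t assume "t \<in> {-\<epsilon><..<\<epsilon>}"
    from w(3)[OF this] have "(w has_vector_derivative ?f (w t)) (at t)" "w t \<in> cball (?J x0) (r / k)" by auto
    then show "((\<lambda>t. K (w t)) has_vector_derivative f (K (w t))) (at t) \<and> K (w t) \<in> cball x0 r"
      using Kc K.has_vector_derivative[of w "?f (w t)" "at t"] by (simp add: KJ)
  qed
qed

section \<open>Smooth structures\<close>

text \<open>Manifolds without the topological axioms: these would have to be checked again for products,
  for \<open>lie_alg\<close> and for associated bundles, although only the Hausdorff property is ever relevant.\<close>

definition smfd :: "('a, 'e::real_inner) mfd \<Rightarrow> bool" where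
  "smfd M \<longleftrightarrow>
     finite_dim TYPE('e) \<and>
     (\<forall>c\<in>atlas M. is_chart (points M) c) \<and>
     (\<Union>c\<in>atlas M. fst c) = points M \<and>
     (\<forall>c\<in>atlas M. \<forall>d\<in>atlas M. compatible c d) \<and>
     (\<forall>c. is_chart (points M) c \<and> (\<forall>d\<in>atlas M. compatible c d) \<longrightarrow> c \<in> atlas M)"

lemma manifold_smfd: "manifold M \<Longrightarrow> smfd M"
  and manifold_Hausdorff: "manifold M \<Longrightarrow> Hausdorff_space (mtop M)"
  unfolding manifold_def smfd_def by blast+

lemma chart_inv_left: "is_chart A c \<Longrightarrow> x \<in> fst c \<Longrightarrow> chart_inv c (snd c x) = x"
  by (simp add: is_chart_def)

lemma chart_inv_right: "z \<in> snd c ` fst c \<Longrightarrow> snd c (chart_inv c z) = z"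
  by (rule f_inv_into_f)

lemma chart_inv_into: "z \<in> snd c ` fst c \<Longrightarrow> chart_inv c z \<in> fst c"
  by (rule inv_into_into)

lemma chart_open: "is_chart A c \<Longrightarrow> open (snd c ` fst c)"
  by (simp add: is_chart_def)

lemma chart_subset: "is_chart A c \<Longrightarrow> x \<in> fst c \<Longrightarrow> x \<in> A"
  by (auto simp: is_chart_def)

lemma chart_image_iff: "is_chart A c \<Longrightarrow> x \<in> fst c \<Longrightarrow> W \<subseteq> fst c \<Longrightarrow> snd c x \<in> snd c ` W \<longleftrightarrow> x \<in> W"
  by (auto simp: is_chart_def inj_on_def)

lemma chart_image_iff': "is_chart A c \<Longrightarrow> z \<in> snd c ` fst c \<Longrightarrow> W \<subseteq> fst c \<Longrightarrow> z \<in> snd c ` W \<longleftrightarrow> chart_inv c z \<in> W"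
  by (metis chart_image_iff chart_inv_into chart_inv_right)

lemma chart_image_Int: "is_chart A c \<Longrightarrow> V \<subseteq> fst c \<Longrightarrow> W \<subseteq> fst c \<Longrightarrow> snd c ` (V \<inter> W) = snd c ` V \<inter> snd c ` W"
  unfolding is_chart_def by (intro inj_on_image_Int) auto

lemma compatible_sym: "compatible c d \<Longrightarrow> compatible d c"
  by (simp add: compatible_def Int_commute)

lemma compatible_smooth: "compatible c d \<Longrightarrow> smooth_on (snd c ` (fst c \<inter> fst d)) (\<lambda>z. snd d (chart_inv c z))"
  by (simp add: compatible_def o_def)

text \<open>The set is the preimage of an open set under the continuous transition map, taken inside
  the open overlap.\<close>

lemma transition_open:
  assumes "is_chart A c" "is_chart B d" "compatible c d" "W \<subseteq> fst d" "open (snd d ` W)"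
  shows "open (snd c ` (fst c \<inter> W))"
proof -
  have "snd c ` (fst c \<inter> W) = snd c ` (fst c \<inter> fst d) \<inter> (\<lambda>z. snd d (chart_inv c z)) -` (snd d ` W)"
  proof (intro equalityI subsetI)
    fix z assume "z \<in> snd c ` (fst c \<inter> W)"
    then show "z \<in> snd c ` (fst c \<inter> fst d) \<inter> (\<lambda>z. snd d (chart_inv c z)) -` (snd d ` W)"
      using assms(1,4) by (auto simp: chart_inv_left)
  next
    fix z assume "z \<in> snd c ` (fst c \<inter> fst d) \<inter> (\<lambda>z. snd d (chart_inv c z)) -` (snd d ` W)"
    then obtain x where x: "x \<in> fst c" "x \<in> fst d" "z = snd c x" "snd d (chart_inv c z) \<in> snd d ` W" by blast
    then have "x \<in> W" using assms(1,2,4) by (simp add: chart_inv_left chart_image_iff)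
    then show "z \<in> snd c ` (fst c \<inter> W)" using x by blast
  qed
  moreover have "open \<dots>"
    using assms(3,5) smooth_on_continuous[OF compatible_smooth[OF assms(3)]]
    by (intro continuous_open_preimage) (auto simp: compatible_def)
  ultimately show ?thesis by simp
qed

text \<open>Compatibility is not transitive as such. If charts of \<open>C\<close> cover the
  overlap, the transition from \<open>c\<close> to \<open>d\<close> factors locally through one of
  them.\<close>

lemma compatible_trans:
  fixes c :: "('a, 'e::real_inner) chart" and d :: "('a, 'e) chart"
  assumes fd: "finite_dim TYPE('e)" and c: "is_chart A c" and d: "is_chart B d"
    and C: "\<And>e. e \<in> C \<Longrightarrow> is_chart D e \<and> compatible c e \<and> compatible d e"
    and cov: "fst c \<inter> fst d \<subseteq> (\<Union>e\<in>C. fst e)"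
  shows "compatible c d"
proof -
  have op: "open (snd c ` (fst c \<inter> (fst e \<inter> fst d)))" if "is_chart A c" "compatible c e" "compatible d e"
    "e \<in> C" for c d :: "('a, 'e) chart" and e A
    using that C by (intro transition_open[of A c D e]) (auto simp: compatible_def Int_commute)
  have op2: "open (snd c ` (fst c \<inter> fst d))"
    if "is_chart A c" "is_chart B d" "\<And>e. e \<in> C \<Longrightarrow> compatible c e \<and> compatible d e" "fst c \<inter> fst d \<subseteq> (\<Union>e\<in>C. fst e)" 
    for c d :: "('a, 'e) chart" and A B
  proof -
    have "fst c \<inter> fst d = (\<Union>e\<in>C. fst c \<inter> (fst e \<inter> fst d))"
      using that(4) by blast
    then have "snd c ` (fst c \<inter> fst d) = snd c ` (\<Union>e\<in>C. fst c \<inter> (fst e \<inter> fst d))"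
      by (rule arg_cong)
    also have "\<dots> = (\<Union>e\<in>C. snd c ` (fst c \<inter> (fst e \<inter> fst d)))" by (rule image_UN)
    finally have *: "snd c ` (fst c \<inter> fst d) = (\<Union>e\<in>C. snd c ` (fst c \<inter> (fst e \<inter> fst d)))" .
    show ?thesis unfolding * by (intro open_UN ballI op[OF that(1)]) (use that(3) in blast)+
  qed
  have sm: "smooth_on (snd c ` (fst c \<inter> fst d)) (\<lambda>z. snd d (chart_inv c z))"
    if c: "is_chart A c" and d: "is_chart B d" and ce: "\<And>e. e \<in> C \<Longrightarrow> compatible c e \<and> compatible d e"
      and cov: "fst c \<inter> fst d \<subseteq> (\<Union>e\<in>C. fst e)" for c d :: "('a, 'e) chart" and A B
  proof (rule smooth_on_local)
    fix z assume "z \<in> snd c ` (fst c \<inter> fst d)"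
    then obtain x where x: "x \<in> fst c" "x \<in> fst d" "z = snd c x" by blast
    then obtain e where e: "e \<in> C" "x \<in> fst e" using cov by blast
    let ?T = "snd c ` (fst c \<inter> (fst e \<inter> fst d))"
    have T: "open ?T" "z \<in> ?T" using op[OF c] ce[OF e(1)] e x by auto
    have ed: "compatible e d" using ce[OF e(1)] compatible_sym by blast
    have oe: "open (snd e ` (fst e \<inter> fst d))" using ed by (simp add: compatible_def)
    have sub: "(\<lambda>z. snd e (chart_inv c z)) ` ?T \<subseteq> snd e ` (fst e \<inter> fst d)"
      using c by (auto simp: chart_inv_left)
    have "smooth_on ?T (\<lambda>z. snd e (chart_inv c z))"
      using ce[OF e(1)] by (intro smooth_on_subset[OF compatible_smooth[of c e]]) auto
    from smooth_on_compose[OF fd T(1) oe sub this compatible_smooth[OF ed]]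
    have "smooth_on ?T (\<lambda>z. snd d (chart_inv e (snd e (chart_inv c z))))" .
    then have "smooth_on ?T (\<lambda>z. snd d (chart_inv c z))"
    proof (rule smooth_on_cong[OF _ T(1)])
      fix w assume "w \<in> ?T"
      then obtain y where "y \<in> fst c" "y \<in> fst e" "w = snd c y" by blast
      then show "snd d (chart_inv e (snd e (chart_inv c w))) = snd d (chart_inv c w)"
        using c chart_inv_left[OF conjunct1[OF C[OF e(1)]]] by (simp add: chart_inv_left)
    qed
    then show "\<exists>T. open T \<and> z \<in> T \<and> smooth_on T (\<lambda>z. snd d (chart_inv c z))" using T by blast
  qed
  show ?thesis unfolding compatible_def o_def
    using op2[OF c d] op2[OF d c] sm[OF c d] sm[OF d c] C cov by (auto simp: Int_commute)
qed

text \<open>Two charts compatible with the covering family \<open>C\<close> are compatible with each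
  other by \<open>compatible_trans\<close>; maximality holds because \<open>C\<close> belongs to the
  generated atlas.\<close>

lemma generated_smfd:
  fixes C :: "('a, 'e::real_inner) chart set"
  assumes fd: "finite_dim TYPE('e)" and ch: "\<And>c. c \<in> C \<Longrightarrow> is_chart A c"
    and cov: "(\<Union>c\<in>C. fst c) = A" and co: "\<And>c d. c \<in> C \<Longrightarrow> d \<in> C \<Longrightarrow> compatible c d"
  shows "smfd (generated_mfd A C)" and "C \<subseteq> atlas (generated_mfd A C)"
proof -
  show C: "C \<subseteq> atlas (generated_mfd A C)" using ch co by (auto simp: generated_mfd_def)
  have at: "c \<in> atlas (generated_mfd A C) \<longleftrightarrow> is_chart A c \<and> (\<forall>d\<in>C. compatible c d)" for c
    by (simp add: generated_mfd_def)
  have pt: "points (generated_mfd A C) = A" by (simp add: generated_mfd_def)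
  show "smfd (generated_mfd A C)" unfolding smfd_def pt
  proof (intro conjI ballI allI impI)
    have "fst c \<subseteq> A" if "c \<in> atlas (generated_mfd A C)" for c
      using that by (simp add: at is_chart_def)
    moreover have "A \<subseteq> (\<Union>c\<in>atlas (generated_mfd A C). fst c)" using UN_mono[OF C, of fst fst] cov by simp
    ultimately show "(\<Union>c\<in>atlas (generated_mfd A C). fst c) = A" by (intro equalityI UN_least)
    fix c d assume c: "c \<in> atlas (generated_mfd A C)" and d: "d \<in> atlas (generated_mfd A C)"
    show "compatible c d"
    proof (rule compatible_trans[OF fd, of A c A d C A])
      show "is_chart A c" "is_chart A d" using c d by (simp_all add: at)
      then show "fst c \<inter> fst d \<subseteq> (\<Union>e\<in>C. fst e)" unfolding cov by (auto simp: is_chart_def)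
      fix e assume "e \<in> C"
      then show "is_chart A e \<and> compatible c e \<and> compatible d e" using c d ch by (simp add: at)
    qed
  next
    show "is_chart A c" if "c \<in> atlas (generated_mfd A C)" for c
      using that by (simp add: at)
    fix c assume c: "is_chart A c \<and> (\<forall>d\<in>atlas (generated_mfd A C). compatible c d)"
    then have "\<forall>d\<in>C. compatible c d" using subsetD[OF C] by metis
    then show "c \<in> atlas (generated_mfd A C)" unfolding at using c by simp
  qed (rule fd)
qed

context
  fixes M :: "('a, 'e::real_inner) mfd"
  assumes M: "smfd M"
begin

lemma smfd_chart: "c \<in> atlas M \<Longrightarrow> is_chart (points M) c"
  using M by (simp add: smfd_def)

lemma smfd_compatible: "c \<in> atlas M \<Longrightarrow> d \<in> atlas M \<Longrightarrow> compatible c d"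
  using M by (simp add: smfd_def)

lemma smfd_atlasI: "is_chart (points M) c \<Longrightarrow> (\<And>d. d \<in> atlas M \<Longrightarrow> compatible c d) \<Longrightarrow> c \<in> atlas M"
  using M unfolding smfd_def by blast

lemma smfd_ex_chart:
  assumes "x \<in> points M" obtains c where "c \<in> charts_at M x"
  using M assms unfolding smfd_def charts_at_def by blast

lemma charts_at_points: "c \<in> charts_at M x \<Longrightarrow> x \<in> points M"
  using M unfolding smfd_def charts_at_def by blast

lemma smfd_finite_dim: "finite_dim TYPE('e)"
  using M by (simp add: smfd_def)

text \<open>\<open>mtop\<close> is built by \<open>topology\<close>, so it can be unfolded only
  after the topology axioms are checked; the one for intersections rests on the injectivity of
  charts.\<close>

lemma openin_mtop: "openin (mtop M) W \<longleftrightarrow> W \<subseteq> points M \<and> (\<forall>c\<in>atlas M. open (snd c ` (W \<inter> fst c)))"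
proof -
  have "istopology (\<lambda>W. W \<subseteq> points M \<and> (\<forall>c\<in>atlas M. open (snd c ` (W \<inter> fst c))))"
    unfolding istopology_def
  proof (intro conjI allI impI ballI)
    fix S T c
    assume S: "S \<subseteq> points M \<and> (\<forall>c\<in>atlas M. open (snd c ` (S \<inter> fst c)))"
      and T: "T \<subseteq> points M \<and> (\<forall>c\<in>atlas M. open (snd c ` (T \<inter> fst c)))"
    show "S \<inter> T \<subseteq> points M" using S by blast
    assume c: "c \<in> atlas M"
    have "snd c ` (S \<inter> T \<inter> fst c) = snd c ` ((S \<inter> fst c) \<inter> (T \<inter> fst c))"
      by (rule arg_cong[where f="image (snd c)"]) blast
    also have "\<dots> = snd c ` (S \<inter> fst c) \<inter> snd c ` (T \<inter> fst c)"
      by (rule chart_image_Int[OF smfd_chart[OF c]]) auto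
    finally show "open (snd c ` (S \<inter> T \<inter> fst c))" using S T c by (simp add: open_Int)
  next
    fix K c
    assume K: "\<forall>S\<in>K. S \<subseteq> points M \<and> (\<forall>c\<in>atlas M. open (snd c ` (S \<inter> fst c)))"
    then show "\<Union>K \<subseteq> points M" by blast
    assume c: "c \<in> atlas M"
    have "snd c ` (\<Union>K \<inter> fst c) = (\<Union>S\<in>K. snd c ` (S \<inter> fst c))" by blast
    then show "open (snd c ` (\<Union>K \<inter> fst c))" using K c by auto
  qed
  then show ?thesis unfolding mtop_def by simp
qed

lemma openin_points: "openin (mtop M) (points M)"
  using smfd_chart unfolding openin_mtop by (auto simp: is_chart_def Int_absorb1)

lemma topspace_mtop: "topspace (mtop M) = points M"
  using openin_points openin_mtop by (metis openin_subset openin_topspace subset_antisym)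

lemma openin_chart_domain_subset:
  assumes "c \<in> atlas M" "W \<subseteq> fst c" "open (snd c ` W)"
  shows "openin (mtop M) W"
  unfolding openin_mtop
proof (intro conjI ballI)
  show "W \<subseteq> points M" using assms(2) chart_subset[OF smfd_chart[OF assms(1)]] by blast
  fix d assume d: "d \<in> atlas M"
  show "open (snd d ` (W \<inter> fst d))"
    using transition_open[OF smfd_chart[OF d] smfd_chart[OF assms(1)] smfd_compatible[OF d assms(1)] assms(2,3)]
    by (simp add: Int_commute)
qed

lemma openin_chart_domain: "c \<in> atlas M \<Longrightarrow> openin (mtop M) (fst c)"
  using chart_open[OF smfd_chart] by (intro openin_chart_domain_subset) blast+

lemma openin_chart_vimage:
  assumes "c \<in> atlas M" "open W"
  shows "openin (mtop M) {x \<in> fst c. snd c x \<in> W}"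
proof (rule openin_chart_domain_subset[OF assms(1)])
  have "snd c ` {x \<in> fst c. snd c x \<in> W} = snd c ` fst c \<inter> W" by auto
  then show "open (snd c ` {x \<in> fst c. snd c x \<in> W})"
    using assms(2) chart_open[OF smfd_chart[OF assms(1)]] by auto
qed auto

text \<open>By maximality of the atlas. The restricted chart has another total inverse, which agrees
  with the old one only on the image, so smoothness is transferred by congruence.\<close>

lemma restrict_chart:
  assumes c: "c \<in> atlas M" and U: "openin (mtop M) U"
  shows "(fst c \<inter> U, snd c) \<in> atlas M"
proof (rule smfd_atlasI)
  let ?c = "(fst c \<inter> U, snd c)"
  have cc: "is_chart (points M) c" using smfd_chart c .
  have "open (snd c ` (U \<inter> fst c))" using U c by (simp add: openin_mtop)
  then show cc': "is_chart (points M) ?c"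
    using cc by (auto simp: is_chart_def Int_commute intro: inj_on_subset)
  fix d assume d: "d \<in> atlas M"
  have "openin (mtop M) (U \<inter> fst d)" "openin (mtop M) (U \<inter> fst c)"
    using U openin_chart_domain[OF c] openin_chart_domain[OF d] by (simp_all add: openin_Int)
  then have "open (snd c ` (U \<inter> fst d \<inter> fst c))" "open (snd d ` (U \<inter> fst c \<inter> fst d))"
    using c d unfolding openin_mtop by blast+
  moreover have "U \<inter> fst d \<inter> fst c = fst c \<inter> U \<inter> fst d" "U \<inter> fst c \<inter> fst d = fst c \<inter> U \<inter> fst d" by blast+
  ultimately have 1: "open (snd c ` (fst c \<inter> U \<inter> fst d))" and 2: "open (snd d ` (fst c \<inter> U \<inter> fst d))" by simp_all
  have cd: "compatible c d" "compatible d c" using c d smfd_compatible by auto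
  have "smooth_on (snd c ` (fst c \<inter> U \<inter> fst d)) (\<lambda>z. snd d (chart_inv c z))"
    by (rule smooth_on_subset[OF compatible_smooth[OF cd(1)]]) auto
  then have 3: "smooth_on (snd c ` (fst c \<inter> U \<inter> fst d)) (\<lambda>z. snd d (chart_inv ?c z))"
  proof (rule smooth_on_cong[OF _ 1])
    fix z assume "z \<in> snd c ` (fst c \<inter> U \<inter> fst d)"
    then obtain x where "x \<in> fst c" "x \<in> U" "z = snd c x" by blast
    then show "snd d (chart_inv c z) = snd d (chart_inv ?c z)"
      using chart_inv_left[OF cc, of x] chart_inv_left[OF cc', of x] by simp
  qed
  have 4: "smooth_on (snd d ` (fst c \<inter> U \<inter> fst d)) (\<lambda>z. snd c (chart_inv d z))"
    by (rule smooth_on_subset[OF compatible_smooth[OF cd(2)]]) auto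
  show "compatible ?c d" unfolding compatible_def using 1 2 3 4 by (simp add: o_def)
qed

text \<open>For maximality, a chart inside \<open>U\<close> that is compatible with the charts
  inside \<open>U\<close> must be compatible with all charts of \<open>M\<close>; restricted charts
  cover \<open>U\<close>, so \<open>compatible_trans\<close> applies.\<close>

lemma smfd_open_sub:
  assumes U: "openin (mtop M) U"
  shows "smfd (open_sub M U)"
proof -
  have at: "c \<in> atlas (open_sub M U) \<longleftrightarrow> c \<in> atlas M \<and> fst c \<subseteq> U" for c
    by (simp add: open_sub_def)
  have pt: "points (open_sub M U) = U" by (simp add: open_sub_def)
  have UM: "U \<subseteq> points M" using U openin_mtop by blast
  have cov: "U \<subseteq> (\<Union>c\<in>atlas (open_sub M U). fst c)"
  proof
    fix x assume x: "x \<in> U"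
    then obtain c where "c \<in> charts_at M x" using UM smfd_ex_chart by blast
    then have "(fst c \<inter> U, snd c) \<in> atlas (open_sub M U)" "x \<in> fst (fst c \<inter> U, snd c)"
      using restrict_chart U x by (auto simp: at charts_at_def)
    then show "x \<in> (\<Union>c\<in>atlas (open_sub M U). fst c)" by blast
  qed
  show ?thesis unfolding smfd_def pt
  proof (intro conjI ballI allI impI)
    show "finite_dim TYPE('e)" by (rule smfd_finite_dim)
    show "(\<Union>c\<in>atlas (open_sub M U). fst c) = U" using cov at by blast
    show "is_chart U c" if "c \<in> atlas (open_sub M U)" for c
      using that smfd_chart[of c] by (auto simp: at is_chart_def)
    show "compatible c d" if "c \<in> atlas (open_sub M U)" "d \<in> atlas (open_sub M U)" for c d
      using that smfd_compatible by (auto simp: at)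
    fix c assume c: "is_chart U c \<and> (\<forall>d\<in>atlas (open_sub M U). compatible c d)"
    have cM: "is_chart (points M) c" using c UM by (auto simp: is_chart_def)
    have "c \<in> atlas M"
    proof (rule smfd_atlasI[OF cM])
      fix d assume d: "d \<in> atlas M"
      show "compatible c d"
      proof (rule compatible_trans[OF smfd_finite_dim cM smfd_chart[OF d], where C="atlas (open_sub M U)"])
        show "is_chart (points M) e \<and> compatible c e \<and> compatible d e" if "e \<in> atlas (open_sub M U)" for e
          using that c d at smfd_chart smfd_compatible by blast
        show "fst c \<inter> fst d \<subseteq> (\<Union>e\<in>atlas (open_sub M U). fst e)"
          using c cov by (auto simp: is_chart_def)
      qed
    qed
    then show "c \<in> atlas (open_sub M U)" using c by (simp add: at is_chart_def)
  qed
qed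

lemma openin_mtop_local:
  assumes "\<And>x. x \<in> W \<Longrightarrow> \<exists>c\<in>atlas M. \<exists>V. x \<in> V \<and> V \<subseteq> fst c \<inter> W \<and> open (snd c ` V)"
  shows "openin (mtop M) W"
proof (subst openin_subopen, rule ballI)
  fix x assume "x \<in> W"
  from assms[OF this] obtain c V where "c \<in> atlas M" "x \<in> V" "V \<subseteq> fst c \<inter> W" "open (snd c ` V)"
    by blast
  then show "\<exists>T. openin (mtop M) T \<and> x \<in> T \<and> T \<subseteq> W"
    using openin_chart_domain_subset[of c V] by blast
qed

end

section \<open>Smoothness at a point\<close>

text \<open>Smoothness on a whole coordinate neighbourhood, for a single pair of charts. That
  \<open>W\<close> is mapped into the target chart takes the place of continuity. The pointwise form
  suits maps that are smooth only near some points, such as local sections.\<close>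

definition smooth_at :: "('a, 'e::real_inner) mfd \<Rightarrow> ('b, 'f::real_inner) mfd \<Rightarrow> ('a \<Rightarrow> 'b) \<Rightarrow> 'a \<Rightarrow> bool" where
  "smooth_at M N f x \<longleftrightarrow>
     (\<exists>c\<in>charts_at M x. \<exists>d\<in>charts_at N (f x). \<exists>W. open W \<and> snd c x \<in> W \<and> W \<subseteq> snd c ` fst c \<and>
        (\<forall>z\<in>W. f (chart_inv c z) \<in> fst d) \<and> smooth_on W (\<lambda>z. snd d (f (chart_inv c z))))"

lemma smooth_atI:
  assumes "c \<in> charts_at M x" "d \<in> charts_at N (f x)" "open W" "snd c x \<in> W" "W \<subseteq> snd c ` fst c"
    and "\<And>z. z \<in> W \<Longrightarrow> f (chart_inv c z) \<in> fst d" "smooth_on W (\<lambda>z. snd d (f (chart_inv c z)))"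
  shows "smooth_at M N f x"
  unfolding smooth_at_def using assms
  by (intro bexI[OF _ assms(1)] bexI[OF _ assms(2)] exI[of _ W] conjI ballI) auto

lemma smooth_atE:
  assumes "smooth_at M N f x"
  obtains c d W where "c \<in> charts_at M x" "d \<in> charts_at N (f x)" "open W" "snd c x \<in> W" "W \<subseteq> snd c ` fst c"
    "\<And>z. z \<in> W \<Longrightarrow> f (chart_inv c z) \<in> fst d" "smooth_on W (\<lambda>z. snd d (f (chart_inv c z)))"
  using assms unfolding smooth_at_def by (elim bexE exE conjE) (metis (no_types, lifting))

text \<open>The local expression in new charts is the old one composed with transition maps on both
  sides, on a smaller open set.\<close>

lemma smooth_at_charts:
  fixes M :: "('a, 'e::real_inner) mfd" and N :: "('b, 'f::real_inner) mfd"
  assumes M: "smfd M" and N: "smfd N" and "smooth_at M N f x" "c \<in> charts_at M x" "d \<in> charts_at N (f x)"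
  obtains W where "open W" "snd c x \<in> W" "W \<subseteq> snd c ` fst c" "\<And>z. z \<in> W \<Longrightarrow> f (chart_inv c z) \<in> fst d"
    "smooth_on W (\<lambda>z. snd d (f (chart_inv c z)))"
proof -
  obtain c' d' W' where c': "c' \<in> charts_at M x" and d': "d' \<in> charts_at N (f x)" and W': "open W'" "snd c' x \<in> W'"
    "W' \<subseteq> snd c' ` fst c'" and fW: "\<And>z. z \<in> W' \<Longrightarrow> f (chart_inv c' z) \<in> fst d'"
    and sm: "smooth_on W' (\<lambda>z. snd d' (f (chart_inv c' z)))"
    using smooth_atE[OF assms(3)] by metis
  have x: "x \<in> fst c" "x \<in> fst c'" "f x \<in> fst d" "f x \<in> fst d'" and at: "c \<in> atlas M" "c' \<in> atlas M" "d \<in> atlas N" "d' \<in> atlas N"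
    using assms(4,5) c' d' by (auto simp: charts_at_def)
  note ch = smfd_chart[OF M at(1)] smfd_chart[OF M at(2)] smfd_chart[OF N at(3)] smfd_chart[OF N at(4)]
  have cc: "compatible c c'" using smfd_compatible[OF M at(1,2)] .
  have dd: "compatible d' d" using smfd_compatible[OF N at(4,3)] .
  define \<phi> where "\<phi> z = snd c' (chart_inv c z)" for z
  define \<psi> where "\<psi> z = snd d' (f (chart_inv c' z))" for z
  \<comment> \<open>Two successive restrictions: on \<open>W1\<close> the change of source charts is
    defined and lands in \<open>W'\<close>; on \<open>W\<close> the value also lies in the overlap
    of the target charts.\<close>
  define W1 where "W1 = snd c ` (fst c \<inter> fst c') \<inter> \<phi> -` W'"
  define W where "W = W1 \<inter> (\<lambda>z. \<psi> (\<phi> z)) -` (snd d' ` (fst d' \<inter> fst d))"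
  have s\<phi>: "smooth_on (snd c ` (fst c \<inter> fst c')) \<phi>"
    unfolding \<phi>_def by (rule compatible_smooth[OF cc])
  have W1: "open W1" unfolding W1_def
    using cc W'(1) s\<phi> by (intro continuous_open_preimage smooth_on_continuous) (auto simp: compatible_def)
  have s\<psi>: "smooth_on W1 (\<lambda>z. \<psi> (\<phi> z))"
  proof -
    have "\<phi> ` W1 \<subseteq> W'" by (auto simp: W1_def)
    moreover have "smooth_on W1 \<phi>" by (rule smooth_on_subset[OF s\<phi>]) (auto simp: W1_def)
    moreover have "smooth_on W' \<psi>" using sm by (simp add: \<psi>_def[abs_def])
    ultimately show ?thesis by (rule smooth_on_compose[OF smfd_finite_dim[OF M] W1 W'(1)])
  qed
  have oW: "open W" unfolding W_def
    using dd s\<psi> W1 by (intro continuous_open_preimage smooth_on_continuous) (auto simp: compatible_def)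
  have eq: "chart_inv c' (\<phi> z) = chart_inv c z" if "z \<in> W1" for z
    using that ch by (auto simp: W1_def \<phi>_def chart_inv_left)
  have d'W: "f (chart_inv c z) \<in> fst d'" if "z \<in> W1" for z
    using fW[of "\<phi> z"] that eq by (simp add: W1_def)
  have \<psi>\<phi>: "\<psi> (\<phi> z) = snd d' (f (chart_inv c z))" if "z \<in> W1" for z
    using eq[OF that] by (simp add: \<psi>_def)
  have dW: "f (chart_inv c z) \<in> fst d" if "z \<in> W" for z
  proof -
    have "z \<in> W1" using that by (simp add: W_def)
    then show ?thesis
      using that \<psi>\<phi> d'W chart_image_iff[OF ch(4) d'W, of z "fst d' \<inter> fst d"] by (auto simp: W_def)
  qed
  show ?thesis
  proof (rule that[OF oW])
    have "snd c x \<in> W1" using x W'(2) ch by (auto simp: W1_def \<phi>_def chart_inv_left)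
    then show "snd c x \<in> W" using x ch \<psi>\<phi> by (auto simp: W_def chart_inv_left)
    show "W \<subseteq> snd c ` fst c" by (auto simp: W_def W1_def)
    show "smooth_on W (\<lambda>z. snd d (f (chart_inv c z)))"
    proof (rule smooth_on_cong[OF _ oW])
      have "open (snd d' ` (fst d' \<inter> fst d))" using dd by (simp add: compatible_def)
      moreover have "(\<lambda>z. \<psi> (\<phi> z)) ` W \<subseteq> snd d' ` (fst d' \<inter> fst d)" by (auto simp: W_def)
      moreover have "smooth_on W (\<lambda>z. \<psi> (\<phi> z))" by (rule smooth_on_subset[OF s\<psi>]) (auto simp: W_def)
      ultimately show "smooth_on W (\<lambda>z. snd d (chart_inv d' (\<psi> (\<phi> z))))"
        by (rule smooth_on_compose[OF smfd_finite_dim[OF N] oW _ _ _ compatible_smooth[OF dd]])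
      fix z assume z: "z \<in> W"
      then have "z \<in> W1" by (simp add: W_def)
      then show "snd d (chart_inv d' (\<psi> (\<phi> z))) = snd d (f (chart_inv c z))"
        using \<psi>\<phi> d'W ch(4) by (simp add: chart_inv_left)
    qed
  qed (use dW in auto)
qed

lemma smooth_at_points:
  "smfd M \<Longrightarrow> smfd N \<Longrightarrow> smooth_at M N f x \<Longrightarrow> x \<in> points M \<and> f x \<in> points N"
  unfolding smooth_at_def by (blast dest: charts_at_points)

text \<open>In coordinates the set is a continuous preimage. Besides continuity of smooth maps, it
  produces the open domains on which local formulas are compared.\<close>

lemma openin_smooth_vimage:
  assumes M: "smfd M" and N: "smfd N" and f: "\<And>x. x \<in> U \<Longrightarrow> smooth_at M N f x"
    and U: "openin (mtop M) U" and W: "openin (mtop N) W"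
  shows "openin (mtop M) {x \<in> U. f x \<in> W}"
proof (rule openin_mtop_local[OF M])
  fix x assume "x \<in> {x \<in> U. f x \<in> W}"
  then have x: "x \<in> U" "f x \<in> W" by auto
  obtain c d W0 where c: "c \<in> atlas M" "x \<in> fst c" and d: "d \<in> atlas N" "f x \<in> fst d"
    and W0: "open W0" "snd c x \<in> W0" "W0 \<subseteq> snd c ` fst c" 
    "\<And>z. z \<in> W0 \<Longrightarrow> f (chart_inv c z) \<in> fst d" and sm: "smooth_on W0 (\<lambda>z. snd d (f (chart_inv c z)))"
    using smooth_atE[OF f[OF x(1)]] unfolding charts_at_def mem_Collect_eq by metis
  note ch = smfd_chart[OF M c(1)] smfd_chart[OF N d(1)]
  define Z where "Z = W0 \<inter> (\<lambda>z. snd d (f (chart_inv c z))) -` (snd d ` (W \<inter> fst d)) \<inter> snd c ` (U \<inter> fst c)"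
  have "open Z" unfolding Z_def
    using U W c d W0(1) smooth_on_continuous[OF sm]
    by (intro open_Int continuous_open_preimage) (auto simp: openin_mtop[OF M] openin_mtop[OF N])
  define V where "V = chart_inv c ` Z"
  have Zc: "Z \<subseteq> snd c ` fst c" using W0(3) by (auto simp: Z_def)
  have "snd c ` V = Z" unfolding V_def using Zc by (force simp: image_image chart_inv_right)
  moreover have "x \<in> V"
  proof -
    have "snd c x \<in> Z" using x c d W0 ch by (auto simp: Z_def chart_inv_left)
    then show ?thesis unfolding V_def using chart_inv_left[OF ch(1) c(2)] by (metis imageI)
  qed
  moreover have "V \<subseteq> fst c" unfolding V_def using Zc by (auto intro: chart_inv_into)
  moreover have "V \<subseteq> {x \<in> U. f x \<in> W}"
  proof
    fix y assume "y \<in> V"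
    then obtain z where z: "z \<in> Z" "y = chart_inv c z" unfolding V_def by blast
    have "z \<in> snd c ` (U \<inter> fst c)" "z \<in> snd c ` fst c" using z Zc by (auto simp: Z_def)
    then have "y \<in> U" using z(2) chart_image_iff'[OF ch(1), of z "U \<inter> fst c"] by auto
    moreover have "snd d (f y) \<in> snd d ` (W \<inter> fst d)" "f y \<in> fst d" using z W0 by (auto simp: Z_def)
    then have "f y \<in> W" using chart_image_iff[OF ch(2), of "f y" "W \<inter> fst d"] by auto
    ultimately show "y \<in> {x \<in> U. f x \<in> W}" by simp
  qed
  ultimately show "\<exists>c\<in>atlas M. \<exists>V. x \<in> V \<and> V \<subseteq> fst c \<inter> {x \<in> U. f x \<in> W} \<and> open (snd c ` V)"
    using c(1) \<open>open Z\<close> by blast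
qed

text \<open>The bridge between the definition that occurs in the statement and the pointwise notion
  that the proofs use. Continuity provides the open neighbourhood in one direction and is recovered
  from \<open>openin_smooth_vimage\<close> in the other.\<close>

lemma smooth_map_iff:
  assumes M: "smfd M" and N: "smfd N"
  shows "smooth_map M N f \<longleftrightarrow> (\<forall>x\<in>points M. smooth_at M N f x)"
proof
  assume f: "smooth_map M N f"
  show "\<forall>x\<in>points M. smooth_at M N f x"
  proof
    fix x assume x: "x \<in> points M"
    then have "f x \<in> points N" using f by (auto simp: smooth_map_def)
    then obtain d where d: "d \<in> charts_at N (f x)" using smfd_ex_chart[OF N] by blast
    obtain c where c: "c \<in> charts_at M x" using x smfd_ex_chart[OF M] by blast
    let ?W = "snd c ` {x \<in> fst c. f x \<in> fst d}"
    have cd: "c \<in> atlas M" "d \<in> atlas N" using c d by (auto simp: charts_at_def)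
    have "openin (mtop M) {x \<in> points M. f x \<in> fst d}"
      using f openin_chart_domain[OF N cd(2)]
      unfolding smooth_map_def continuous_map_def topspace_mtop[OF M] by blast
    then have "open (snd c ` ({x \<in> points M. f x \<in> fst d} \<inter> fst c))"
      using cd(1) unfolding openin_mtop[OF M] by blast
    moreover have "{x \<in> points M. f x \<in> fst d} \<inter> fst c = {x \<in> fst c. f x \<in> fst d}"
      using chart_subset[OF smfd_chart[OF M cd(1)]] by blast
    ultimately have W: "open ?W" by simp
    show "smooth_at M N f x"
    proof (rule smooth_atI[where f=f, OF c d W])
      show "snd c x \<in> ?W" using c d by (auto simp: charts_at_def)
      show "f (chart_inv c z) \<in> fst d" if "z \<in> ?W" for z
        using that smfd_chart[OF M cd(1)] by (auto simp: chart_inv_left)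
      show "smooth_on ?W (\<lambda>z. snd d (f (chart_inv c z)))"
        using f cd unfolding smooth_map_def o_def by blast
    qed blast
  qed
next
  assume f: "\<forall>x\<in>points M. smooth_at M N f x"
  show "smooth_map M N f" unfolding smooth_map_def
  proof (intro conjI ballI)
    show "f ` points M \<subseteq> points N" using f smooth_at_points[OF M N] by blast
    then show "continuous_map (mtop M) (mtop N) f"
      using f openin_smooth_vimage[OF M N _ openin_points[OF M]]
      unfolding continuous_map_def topspace_mtop[OF M] topspace_mtop[OF N] by blast
    fix c d assume c: "c \<in> atlas M" and d: "d \<in> atlas N"
    show "smooth_on (snd c ` {x \<in> fst c. f x \<in> fst d}) (snd d \<circ> f \<circ> chart_inv c)"
    proof (rule smooth_on_local)
      fix z assume "z \<in> snd c ` {x \<in> fst c. f x \<in> fst d}"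
      then obtain x where x: "x \<in> fst c" "f x \<in> fst d" "z = snd c x" by blast
      have "smooth_at M N f x" using f x chart_subset[OF smfd_chart[OF M c]] by blast
      moreover have "c \<in> charts_at M x" "d \<in> charts_at N (f x)" using x c d by (simp_all add: charts_at_def)
      ultimately obtain W where "open W" "snd c x \<in> W" "smooth_on W (\<lambda>z. snd d (f (chart_inv c z)))"
        using smooth_at_charts[OF M N] by metis
      then show "\<exists>T. open T \<and> z \<in> T \<and> smooth_on T (snd d \<circ> f \<circ> chart_inv c)"
        using x by (auto simp: o_def)
    qed
  qed
qed

lemma smooth_at_compose:
  assumes M: "smfd M" and N: "smfd N" and K: "smfd K"
    and f: "smooth_at M N f x" and g: "smooth_at N K g (f x)"
  shows "smooth_at M K (\<lambda>x. g (f x)) x"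
proof -
  obtain d e W' where d: "d \<in> charts_at N (f x)" and e: "e \<in> charts_at K (g (f x))"
    and W': "open W'" "snd d (f x) \<in> W'" "W' \<subseteq> snd d ` fst d" "\<And>z. z \<in> W' \<Longrightarrow> g (chart_inv d z) \<in> fst e"
    "smooth_on W' (\<lambda>z. snd e (g (chart_inv d z)))"
    using smooth_atE[OF g] by metis
  obtain c where c: "c \<in> charts_at M x" using f unfolding smooth_at_def by blast
  obtain W where W: "open W" "snd c x \<in> W" "W \<subseteq> snd c ` fst c" "\<And>z. z \<in> W \<Longrightarrow> f (chart_inv c z) \<in> fst d"
    "smooth_on W (\<lambda>z. snd d (f (chart_inv c z)))"
    using smooth_at_charts[OF M N f c d] by metis
  define V where "V = W \<inter> (\<lambda>z. snd d (f (chart_inv c z))) -` W'"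
  have V: "open V" unfolding V_def by (intro continuous_open_preimage smooth_on_continuous W W'(1))
  have dch: "is_chart (points N) d" "is_chart (points M) c" using d c smfd_chart[OF M] smfd_chart[OF N] unfolding charts_at_def by blast+
  have eq: "chart_inv d (snd d (f (chart_inv c z))) = f (chart_inv c z)" if "z \<in> V" for z
    using that W(4) chart_inv_left[OF dch(1)] by (simp add: V_def)
  have "(\<lambda>z. snd d (f (chart_inv c z))) ` V \<subseteq> W'" by (auto simp: V_def)
  moreover have "smooth_on V (\<lambda>z. snd d (f (chart_inv c z)))"
    by (rule smooth_on_subset[OF W(5)]) (auto simp: V_def)
  ultimately have "smooth_on V (\<lambda>z. snd e (g (chart_inv d (snd d (f (chart_inv c z))))))"
    by (rule smooth_on_compose[OF smfd_finite_dim[OF N] V W'(1) _ _ W'(5)])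
  then have "smooth_on V (\<lambda>z. snd e (g (f (chart_inv c z))))"
    by (rule smooth_on_cong[OF _ V]) (simp add: eq)
  moreover have "g (f (chart_inv c z)) \<in> fst e" if "z \<in> V" for z
    using eq[OF that] W'(4)[of "snd d (f (chart_inv c z))"] that by (simp add: V_def)
  moreover have "snd c x \<in> V" using W(2) W'(2) c chart_inv_left[OF dch(2), of x] by (auto simp: V_def charts_at_def)
  moreover have "V \<subseteq> snd c ` fst c" using W(3) by (auto simp: V_def)
  ultimately show ?thesis using smooth_atI[where f="\<lambda>x. g (f x)", OF c e V] by blast
qed

lemma smooth_at_cong:
  assumes M: "smfd M" and f: "smooth_at M N f x" and U: "openin (mtop M) U" "x \<in> U"
    and eq: "\<And>y. y \<in> U \<Longrightarrow> f y = g y"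
  shows "smooth_at M N g x"
proof -
  obtain c d W where c: "c \<in> charts_at M x" and d: "d \<in> charts_at N (f x)" and W: "open W" "snd c x \<in> W" "W \<subseteq> snd c ` fst c"
    "\<And>z. z \<in> W \<Longrightarrow> f (chart_inv c z) \<in> fst d" "smooth_on W (\<lambda>z. snd d (f (chart_inv c z)))"
    using smooth_atE[OF f] by metis
  have c': "c \<in> atlas M" "x \<in> fst c" using c by (auto simp: charts_at_def)
  define V where "V = W \<inter> snd c ` (U \<inter> fst c)"
  have V: "open V" using W(1) U(1) c' unfolding V_def openin_mtop[OF M] by blast
  have "chart_inv c z \<in> U" if "z \<in> V" for z
    using that chart_inv_left[OF smfd_chart[OF M c'(1)]] by (auto simp: V_def)
  then have eq': "f (chart_inv c z) = g (chart_inv c z)" if "z \<in> V" for z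
    using that eq by blast
  have "smooth_on V (\<lambda>z. snd d (f (chart_inv c z)))"
    by (rule smooth_on_subset[OF W(5)]) (simp add: V_def)
  then have "smooth_on V (\<lambda>z. snd d (g (chart_inv c z)))"
    by (rule smooth_on_cong[OF _ V]) (simp add: eq')
  moreover have "g (chart_inv c z) \<in> fst d" if "z \<in> V" for z
    using W(4)[of z] eq'[OF that] that by (simp add: V_def)
  moreover have "snd c x \<in> V" "V \<subseteq> snd c ` fst c" using W U c' by (auto simp: V_def)
  moreover have "d \<in> charts_at N (g x)" using d eq[OF U(2)] by simp
  ultimately show ?thesis using smooth_atI[where f=g, OF c _ V] by blast
qed

lemma smooth_at_const:
  assumes "smfd M" "smfd N" "x \<in> points M" "y \<in> points N"
  shows "smooth_at M N (\<lambda>_. y) x"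
proof -
  obtain c where c: "c \<in> charts_at M x" by (rule smfd_ex_chart[OF assms(1,3)])
  obtain d where d: "d \<in> charts_at N y" by (rule smfd_ex_chart[OF assms(2,4)])
  have ca: "c \<in> atlas M" "x \<in> fst c" using c by (simp_all add: charts_at_def)
  show ?thesis
  proof (rule smooth_atI[where f="\<lambda>_. y", OF c d chart_open[OF smfd_chart[OF assms(1) ca(1)]]])
    show "snd c x \<in> snd c ` fst c" using ca by blast
    show "y \<in> fst d" using d by (simp add: charts_at_def)
  qed (auto intro: smooth_on_const)
qed

lemma smooth_at_id:
  assumes "smfd M" "x \<in> points M"
  shows "smooth_at M M (\<lambda>x. x) x"
proof -
  obtain c where c: "c \<in> charts_at M x" by (rule smfd_ex_chart[OF assms])
  then have c': "is_chart (points M) c" "x \<in> fst c" using smfd_chart[OF assms(1)] unfolding charts_at_def by blast+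
  have "smooth_on (snd c ` fst c) (\<lambda>z. snd c (chart_inv c z))"
    by (rule smooth_on_cong[OF smooth_on_id chart_open[OF c'(1)]]) (simp add: chart_inv_right)
  from smooth_atI[where f="\<lambda>x. x", OF c c chart_open[OF c'(1)] imageI[OF c'(2)] subset_refl chart_inv_into this]
  show ?thesis .
qed

lemma smooth_at_open_sub:
  assumes M: "smfd M" and N: "smfd N" and U: "openin (mtop M) U" "x \<in> U"
  shows "smooth_at (open_sub M U) N f x \<longleftrightarrow> smooth_at M N f x"
proof
  assume "smooth_at (open_sub M U) N f x"
  then show "smooth_at M N f x"
  proof (rule smooth_atE)
    fix c d W
    assume c: "c \<in> charts_at (open_sub M U) x"
    have "c \<in> charts_at M x" using c by (simp add: charts_at_def open_sub_def)
    then show "d \<in> charts_at N (f x) \<Longrightarrow> open W \<Longrightarrow> snd c x \<in> W \<Longrightarrow> W \<subseteq> snd c ` fst c \<Longrightarrow>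
      (\<And>z. z \<in> W \<Longrightarrow> f (chart_inv c z) \<in> fst d) \<Longrightarrow> smooth_on W (\<lambda>z. snd d (f (chart_inv c z))) \<Longrightarrow>
      smooth_at M N f x" by (rule smooth_atI)
  qed
next
  assume f: "smooth_at M N f x"
  obtain c d where c: "c \<in> charts_at M x" and d: "d \<in> charts_at N (f x)" using smooth_atE[OF f] by metis
  let ?c = "(fst c \<inter> U, snd c)"
  have c': "?c \<in> charts_at M x" using c U restrict_chart[OF M _ U(1)] by (simp add: charts_at_def)
  have c'': "?c \<in> charts_at (open_sub M U) x" using c' by (simp add: charts_at_def open_sub_def)
  show "smooth_at (open_sub M U) N f x"
    by (rule smooth_at_charts[OF M N f c' d]) (rule smooth_atI[where f=f, OF c'' d])
qed

lemma smooth_at_open_sub_target: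
  assumes M: "smfd M" and N: "smfd N" and U: "openin (mtop N) U"
  shows "smooth_at M (open_sub N U) f x \<longleftrightarrow> smooth_at M N f x \<and> f x \<in> U"
proof
  assume f: "smooth_at M (open_sub N U) f x"
  then have "smooth_at M N f x"
  proof (rule smooth_atE)
    fix c d W
    assume c: "c \<in> charts_at M x" and d: "d \<in> charts_at (open_sub N U) (f x)"
    have "d \<in> charts_at N (f x)" using d by (simp add: charts_at_def open_sub_def)
    with c show "open W \<Longrightarrow> snd c x \<in> W \<Longrightarrow> W \<subseteq> snd c ` fst c \<Longrightarrow>
      (\<And>z. z \<in> W \<Longrightarrow> f (chart_inv c z) \<in> fst d) \<Longrightarrow> smooth_on W (\<lambda>z. snd d (f (chart_inv c z))) \<Longrightarrow>
      smooth_at M N f x" by (rule smooth_atI)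
  qed
  moreover have "f x \<in> U"
    using smooth_at_points[OF M smfd_open_sub[OF N U] f] by (simp add: open_sub_def)
  ultimately show "smooth_at M N f x \<and> f x \<in> U" by blast
next
  assume "smooth_at M N f x \<and> f x \<in> U"
  then have f: "smooth_at M N f x" and xU: "f x \<in> U" by auto
  obtain c d where c: "c \<in> charts_at M x" and d: "d \<in> charts_at N (f x)" using smooth_atE[OF f] by metis
  let ?d = "(fst d \<inter> U, snd d)"
  have d': "?d \<in> charts_at N (f x)" using d xU restrict_chart[OF N _ U] by (simp add: charts_at_def)
  have d'': "?d \<in> charts_at (open_sub N U) (f x)" using d' by (simp add: charts_at_def open_sub_def)
  show "smooth_at M (open_sub N U) f x"
    by (rule smooth_at_charts[OF M N f c d']) (rule smooth_atI[where f=f, OF c d''])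
qed

section \<open>Products and vector spaces\<close>

text \<open>Holds on the image of the product chart only, since \<open>inv_into\<close> is arbitrary
  elsewhere; hence the side conditions.\<close>

lemma prod_chart_inv:
  assumes "u \<in> snd c ` fst c" "v \<in> snd d ` fst d" "inj_on (snd c) (fst c)" "inj_on (snd d) (fst d)"
  shows "chart_inv (fst c \<times> fst d, map_prod (snd c) (snd d)) (u, v) = (chart_inv c u, chart_inv d v)"
proof -
  have "inj_on (map_prod (snd c) (snd d)) (fst c \<times> fst d)" by (rule map_prod_inj_on[OF assms(3,4)])
  moreover have "(chart_inv c u, chart_inv d v) \<in> fst c \<times> fst d"
    using chart_inv_into[OF assms(1)] chart_inv_into[OF assms(2)] by simp
  ultimately have "chart_inv (fst c \<times> fst d, map_prod (snd c) (snd d))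
      (map_prod (snd c) (snd d) (chart_inv c u, chart_inv d v)) = (chart_inv c u, chart_inv d v)"
    unfolding fst_conv snd_conv by (rule inv_into_f_f)
  then show ?thesis using chart_inv_right[OF assms(1)] chart_inv_right[OF assms(2)] by simp
qed

lemma prod_chart:
  assumes "is_chart A c" "is_chart B d"
  shows "is_chart (A \<times> B) (fst c \<times> fst d, map_prod (snd c) (snd d))"
  using assms unfolding is_chart_def
  by (auto simp: map_prod_surj_on open_Times map_prod_inj_on)

lemma prod_compatible:
  fixes c :: "('a, 'e::real_inner) chart" and d :: "('b, 'f::real_inner) chart"
  assumes fd: "finite_dim TYPE('e)" "finite_dim TYPE('f)"
    and "is_chart A c" "is_chart B d" "is_chart A c'" "is_chart B d'" "compatible c c'" "compatible d d'"
  shows "compatible (fst c \<times> fst d, map_prod (snd c) (snd d)) (fst c' \<times> fst d', map_prod (snd c') (snd d'))"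
proof -
  have im: "map_prod f g ` (fst c \<times> fst d \<inter> fst c' \<times> fst d') = f ` (fst c \<inter> fst c') \<times> g ` (fst d \<inter> fst d')" for f :: "'a \<Rightarrow> 'e" and g :: "'b \<Rightarrow> 'f"
    by (auto simp: image_iff)
  have sm: "smooth_on (snd c ` (fst c \<inter> fst c') \<times> snd d ` (fst d \<inter> fst d'))
     (\<lambda>z. map_prod (snd c') (snd d') (chart_inv (fst c \<times> fst d, map_prod (snd c) (snd d)) z))"
    (is "smooth_on ?S _")
    if "is_chart A c" "is_chart B d" "compatible c c'" "compatible d d'"
    for c c' :: "('a, 'e) chart" and d d' :: "('b, 'f) chart"
  proof -
    have S: "open ?S" using that by (auto simp: compatible_def intro: open_Times)
    have o: "open (snd c ` (fst c \<inter> fst c'))" "open (snd d ` (fst d \<inter> fst d'))"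
      using that by (auto simp: compatible_def)
    have i: "fst ` ?S \<subseteq> snd c ` (fst c \<inter> fst c')" "snd ` ?S \<subseteq> snd d ` (fst d \<inter> fst d')" by auto
    have "smooth_on ?S (\<lambda>z. (snd c' (chart_inv c (fst z)), snd d' (chart_inv d (snd z))))"
      by (rule smooth_on_Pair[OF S
            smooth_on_compose[OF fd(1) S o(1) i(1) smooth_on_fst[OF S smooth_on_id] compatible_smooth[OF that(3)]]
            smooth_on_compose[OF fd(2) S o(2) i(2) smooth_on_snd[OF S smooth_on_id] compatible_smooth[OF that(4)]]])
    then show ?thesis
    proof (rule smooth_on_cong[OF _ S])
      fix z assume "z \<in> ?S"
      then have "chart_inv (fst c \<times> fst d, map_prod (snd c) (snd d)) z = (chart_inv c (fst z), chart_inv d (snd z))"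
        using that prod_chart_inv[of "fst z" c "snd z" d] by (auto simp: is_chart_def)
      then show "(snd c' (chart_inv c (fst z)), snd d' (chart_inv d (snd z))) =
        map_prod (snd c') (snd d') (chart_inv (fst c \<times> fst d, map_prod (snd c) (snd d)) z)" by simp
    qed
  qed
  show ?thesis unfolding compatible_def fst_conv snd_conv im o_def
    using assms sm[OF assms(3,4,7,8)] sm[OF assms(5,6) compatible_sym[OF assms(7)] compatible_sym[OF assms(8)]]
    by (auto simp: compatible_def Int_commute intro: open_Times)
qed

lemma points_prod_mfd: "points (prod_mfd M N) = points M \<times> points N"
  by (simp add: prod_mfd_def generated_mfd_def)

lemma smfd_prod:
  assumes M: "smfd M" and N: "smfd N"
  shows "smfd (prod_mfd M N)"
    and prod_chart_atlas: "c \<in> atlas M \<Longrightarrow> d \<in> atlas N \<Longrightarrow> (fst c \<times> fst d, map_prod (snd c) (snd d)) \<in> atlas (prod_mfd M N)"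
proof -
  let ?C = "{(fst c \<times> fst d, map_prod (snd c) (snd d)) |c d. c \<in> atlas M \<and> d \<in> atlas N}"
  note fd = smfd_finite_dim[OF M] smfd_finite_dim[OF N]
  have 1: "is_chart (points M \<times> points N) c" if "c \<in> ?C" for c
    using that prod_chart smfd_chart[OF M] smfd_chart[OF N] by blast
  have 2: "(\<Union>c\<in>?C. fst c) = points M \<times> points N"
  proof (intro equalityI subsetI)
    fix z assume "z \<in> (\<Union>c\<in>?C. fst c)"
    then show "z \<in> points M \<times> points N" using chart_subset[OF 1] by blast
  next
    fix z assume "z \<in> points M \<times> points N"
    then have z: "fst z \<in> points M" "snd z \<in> points N" by auto
    obtain c where c: "c \<in> charts_at M (fst z)" by (rule smfd_ex_chart[OF M z(1)])
    obtain d where d: "d \<in> charts_at N (snd z)" by (rule smfd_ex_chart[OF N z(2)])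
    have "(fst c \<times> fst d, map_prod (snd c) (snd d)) \<in> ?C" using c d unfolding charts_at_def by blast
    moreover have "z \<in> fst (fst c \<times> fst d, map_prod (snd c) (snd d))"
      using c d by (simp add: charts_at_def mem_Times_iff)
    ultimately show "z \<in> (\<Union>c\<in>?C. fst c)" by (rule UN_I)
  qed
  have 3: "compatible c d" if "c \<in> ?C" "d \<in> ?C" for c d
    using that prod_compatible[OF fd smfd_chart[OF M] smfd_chart[OF N] smfd_chart[OF M] smfd_chart[OF N] 
      smfd_compatible[OF M] smfd_compatible[OF N]] by blast
  note * = generated_smfd[OF finite_dim_prod[OF fd], of ?C, OF 1 2 3]
  show "smfd (prod_mfd M N)" unfolding prod_mfd_def by (rule *(1))
  show "c \<in> atlas M \<Longrightarrow> d \<in> atlas N \<Longrightarrow> (fst c \<times> fst d, map_prod (snd c) (snd d)) \<in> atlas (prod_mfd M N)"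
    using *(2) unfolding prod_mfd_def by blast
qed

lemma prod_charts_at:
  assumes "smfd M" "smfd N" "c \<in> charts_at M x" "d \<in> charts_at N y"
  shows "(fst c \<times> fst d, map_prod (snd c) (snd d)) \<in> charts_at (prod_mfd M N) (x, y)"
  using prod_chart_atlas[OF assms(1,2), of c d] assms(3,4) by (simp add: charts_at_def)

lemma smooth_at_Pair:
  assumes K: "smfd K" and M: "smfd M" and N: "smfd N"
    and f: "smooth_at K M f x" and g: "smooth_at K N g x"
  shows "smooth_at K (prod_mfd M N) (\<lambda>x. (f x, g x)) x"
proof -
  obtain k c W1 where k: "k \<in> charts_at K x" and c: "c \<in> charts_at M (f x)"
    and W1: "open W1" "snd k x \<in> W1" "W1 \<subseteq> snd k ` fst k" "\<And>z. z \<in> W1 \<Longrightarrow> f (chart_inv k z) \<in> fst c"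
     "smooth_on W1 (\<lambda>z. snd c (f (chart_inv k z)))"
    using smooth_atE[OF f] by metis
  obtain d where d: "d \<in> charts_at N (g x)" using smooth_atE[OF g] by metis
  obtain W2 where W2: "open W2" "snd k x \<in> W2" "W2 \<subseteq> snd k ` fst k" "\<And>z. z \<in> W2 \<Longrightarrow> g (chart_inv k z) \<in> fst d"
     "smooth_on W2 (\<lambda>z. snd d (g (chart_inv k z)))"
    using smooth_at_charts[OF K N g k d] by metis
  let ?cd = "(fst c \<times> fst d, map_prod (snd c) (snd d))" and ?W = "W1 \<inter> W2"
  have W: "open ?W" using W1(1) W2(1) by blast
  have "smooth_on ?W (\<lambda>z. (snd c (f (chart_inv k z)), snd d (g (chart_inv k z))))"
    using smooth_on_subset[OF W1(5), of ?W] smooth_on_subset[OF W2(5), of ?W]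
    by (intro smooth_on_Pair[OF W]) auto
  then have "smooth_on ?W (\<lambda>z. snd ?cd (f (chart_inv k z), g (chart_inv k z)))" by simp
  moreover have "\<forall>z\<in>?W. (f (chart_inv k z), g (chart_inv k z)) \<in> fst ?cd" using W1(4) W2(4) by simp
  moreover have "?cd \<in> charts_at (prod_mfd M N) (f x, g x)" by (rule prod_charts_at[OF M N c d])
  ultimately show ?thesis using smooth_atI[OF k, of ?cd "prod_mfd M N" "\<lambda>x. (f x, g x)" ?W] W W1(2,3) W2(2) by blast
qed

lemma
  assumes M: "smfd M" and N: "smfd N" and z: "z \<in> points M \<times> points N"
  shows smooth_at_fst: "smooth_at (prod_mfd M N) M fst z" and smooth_at_snd: "smooth_at (prod_mfd M N) N snd z"
proof -
  have z': "fst z \<in> points M" "snd z \<in> points N" using z by (auto simp: mem_Times_iff)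
  obtain c where c: "c \<in> charts_at M (fst z)" by (rule smfd_ex_chart[OF M z'(1)])
  obtain d where d: "d \<in> charts_at N (snd z)" by (rule smfd_ex_chart[OF N z'(2)])
  note cd = smfd_chart[OF M, of c] smfd_chart[OF N, of d]
  have cd: "is_chart (points M) c" "is_chart (points N) d" "fst z \<in> fst c" "snd z \<in> fst d"
    using c d cd by (auto simp: charts_at_def)
  let ?cd = "(fst c \<times> fst d, map_prod (snd c) (snd d))" and ?W = "snd c ` fst c \<times> snd d ` fst d"
  have W: "open ?W" using cd by (auto simp: is_chart_def intro: open_Times)
  have ch: "?cd \<in> charts_at (prod_mfd M N) z" using prod_charts_at[OF M N c d] by simp
  have Wim: "?W \<subseteq> snd ?cd ` fst ?cd" "snd ?cd z \<in> ?W" using cd by (force simp: map_prod_def split_beta)+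
  have inv: "chart_inv ?cd w = (chart_inv c (fst w), chart_inv d (snd w))" if "w \<in> ?W" for w
    using prod_chart_inv[of "fst w" c "snd w" d] cd that by (auto simp: is_chart_def)
  have "smooth_on ?W (\<lambda>w. snd c (fst (chart_inv ?cd w)))"
    by (rule smooth_on_cong[OF smooth_on_fst[OF W smooth_on_id] W]) (simp add: inv chart_inv_right mem_Times_iff del: fst_conv snd_conv, simp add: chart_inv_right mem_Times_iff)
  moreover have "smooth_on ?W (\<lambda>w. snd d (snd (chart_inv ?cd w)))"
    by (rule smooth_on_cong[OF smooth_on_snd[OF W smooth_on_id] W]) (simp add: inv chart_inv_right mem_Times_iff del: fst_conv snd_conv, simp add: chart_inv_right mem_Times_iff)
  moreover have "fst (chart_inv ?cd w) \<in> fst c" "snd (chart_inv ?cd w) \<in> fst d" if "w \<in> ?W" for w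
    unfolding inv[OF that] using that chart_inv_into[of "fst w" c] chart_inv_into[of "snd w" d] by auto
  ultimately show "smooth_at (prod_mfd M N) M fst z" "smooth_at (prod_mfd M N) N snd z"
    using smooth_atI[where f=fst, OF ch c W Wim(2,1)] smooth_atI[where f=snd, OF ch d W Wim(2,1)] by blast+
qed

lemma vec_chart_inv [simp]: "chart_inv (UNIV, id) = id"
  by (simp add: inv_id)

lemma points_vec_mfd [simp]: "points vec_mfd = UNIV"
  by (simp add: vec_mfd_def generated_mfd_def)

lemma smfd_vec:
  assumes "finite_dim TYPE('v::real_inner)"
  shows "smfd (vec_mfd :: ('v, 'v) mfd)"
    and vec_chart_atlas: "(UNIV, id) \<in> atlas (vec_mfd :: ('v, 'v) mfd)"
proof -
  have "is_chart UNIV (UNIV, id :: 'v \<Rightarrow> 'v)" by (simp add: is_chart_def)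
  moreover have "compatible (UNIV, id :: 'v \<Rightarrow> 'v) (UNIV, id)"
    by (simp add: compatible_def smooth_on_id[unfolded id_def[symmetric]])
  ultimately have "smfd (generated_mfd UNIV {(UNIV, id :: 'v \<Rightarrow> 'v)})" 
    "{(UNIV, id :: 'v \<Rightarrow> 'v)} \<subseteq> atlas (generated_mfd UNIV {(UNIV, id :: 'v \<Rightarrow> 'v)})"
    using generated_smfd[OF assms, of "{(UNIV, id)}" UNIV] by auto
  then show "smfd (vec_mfd :: ('v, 'v) mfd)" "(UNIV, id) \<in> atlas (vec_mfd :: ('v, 'v) mfd)"
    by (auto simp: vec_mfd_def)
qed

lemma vec_charts_at: "finite_dim TYPE('v::real_inner) \<Longrightarrow> (UNIV, id) \<in> charts_at (vec_mfd :: ('v, 'v) mfd) x"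
  by (simp add: charts_at_def vec_chart_atlas)

lemma smooth_at_to_vec:
  fixes f :: "'a \<Rightarrow> 'v::real_inner"
  assumes M: "smfd M" and fd: "finite_dim TYPE('v)" and c: "c \<in> charts_at M x"
  shows "smooth_at M vec_mfd f x \<longleftrightarrow>
    (\<exists>W. open W \<and> snd c x \<in> W \<and> W \<subseteq> snd c ` fst c \<and> smooth_on W (\<lambda>z. f (chart_inv c z)))"
proof
  assume "smooth_at M vec_mfd f x"
  then show "\<exists>W. open W \<and> snd c x \<in> W \<and> W \<subseteq> snd c ` fst c \<and> smooth_on W (\<lambda>z. f (chart_inv c z))"
  proof (rule smooth_at_charts[OF M smfd_vec(1)[OF fd] _ c vec_charts_at[OF fd]])
    fix W assume W: "open W" "snd c x \<in> W" "W \<subseteq> snd c ` fst c"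
    assume "smooth_on W (\<lambda>z. snd (UNIV, id) (f (chart_inv c z)))"
    then have "smooth_on W (\<lambda>z. f (chart_inv c z))" by simp
    then show ?thesis using W by blast
  qed
next
  assume "\<exists>W. open W \<and> snd c x \<in> W \<and> W \<subseteq> snd c ` fst c \<and> smooth_on W (\<lambda>z. f (chart_inv c z))"
  then obtain W where W: "open W" "snd c x \<in> W" "W \<subseteq> snd c ` fst c" "smooth_on W (\<lambda>z. f (chart_inv c z))"
    by blast
  show "smooth_at M vec_mfd f x"
    by (rule smooth_atI[where f=f, OF c vec_charts_at[OF fd] W(1-3)]) (use W(4) in simp_all)
qed

lemma smooth_at_vec_vec:
  fixes f :: "'u::real_inner \<Rightarrow> 'v::real_inner"
  assumes "finite_dim TYPE('u)" "finite_dim TYPE('v)"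
  shows "smooth_at vec_mfd vec_mfd f x \<longleftrightarrow> (\<exists>W. open W \<and> x \<in> W \<and> smooth_on W f)"
  using smooth_at_to_vec[OF smfd_vec(1)[OF assms(1)] assms(2) vec_charts_at[OF assms(1)], of f x] by simp

lemma smooth_at_chart:
  fixes M :: "('a, 'e::real_inner) mfd"
  assumes M: "smfd M" and c: "c \<in> charts_at M x"
  shows "smooth_at M vec_mfd (snd c) x"
proof -
  have c': "is_chart (points M) c" "x \<in> fst c" using c smfd_chart[OF M] unfolding charts_at_def by blast+
  have "smooth_on (snd c ` fst c) (\<lambda>z. snd c (chart_inv c z))"
    by (rule smooth_on_cong[OF smooth_on_id chart_open[OF c'(1)]]) (simp add: chart_inv_right)
  then show ?thesis unfolding smooth_at_to_vec[OF M smfd_finite_dim[OF M] c]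
    using chart_open[OF c'(1)] imageI[OF c'(2), of "snd c"] by blast
qed

lemma smooth_at_chart_inv:
  fixes M :: "('a, 'e::real_inner) mfd"
  assumes M: "smfd M" and c: "c \<in> atlas M" "z \<in> snd c ` fst c"
  shows "smooth_at vec_mfd M (chart_inv c) z"
proof -
  have c': "is_chart (points M) c" using c smfd_chart[OF M] by blast
  have "smooth_on (snd c ` fst c) (\<lambda>z. snd c (chart_inv c z))"
    by (rule smooth_on_cong[OF smooth_on_id chart_open[OF c']]) (simp add: chart_inv_right)
  moreover have "c \<in> charts_at M (chart_inv c z)" using c chart_inv_into[of z c] by (simp add: charts_at_def)
  ultimately show ?thesis
    by (intro smooth_atI[where f="chart_inv c", OF vec_charts_at[OF smfd_finite_dim[OF M]] _ chart_open[OF c']])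
      (simp_all add: c(2) chart_inv_into[of _ c])
qed

text \<open>Near \<open>x\<close> the map is the inverse chart applied to its coordinates. This
  gives smoothness into \<open>lie_alg\<close> and associated bundles, where distinguished charts
  are known.\<close>

lemma smooth_at_into_chart:
  assumes M: "smfd M" and N: "smfd N" and d: "d \<in> atlas N" and U: "openin (mtop M) U" "x \<in> U"
    and fU: "\<And>y. y \<in> U \<Longrightarrow> f y \<in> fst d" and sm: "smooth_at M vec_mfd (\<lambda>x. snd d (f x)) x"
  shows "smooth_at M N f x"
proof -
  have "smooth_at M N (\<lambda>x. chart_inv d (snd d (f x))) x"
    by (rule smooth_at_compose[OF M smfd_vec(1)[OF smfd_finite_dim[OF N]] N sm])
      (use smooth_at_chart_inv[OF N d] fU U in auto)
  then show ?thesis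
    by (rule smooth_at_cong[OF M _ U]) (use fU chart_inv_left[OF smfd_chart[OF N d]] in auto)
qed

section \<open>Velocities and tangent maps\<close>

lemma smooth_curve_chart:
  fixes \<gamma> :: "real \<Rightarrow> 'a" and M :: "('a, 'e::real_inner) mfd"
  assumes M: "smfd M" and \<gamma>: "smooth_at vec_mfd M \<gamma> t" and c: "c \<in> charts_at M (\<gamma> t)"
  obtains W where "open W" "t \<in> W" "\<And>s. s \<in> W \<Longrightarrow> \<gamma> s \<in> fst c" "smooth_on W (\<lambda>s. snd c (\<gamma> s))"
proof (rule smooth_at_charts[OF smfd_vec(1)[OF finite_dim_real] M \<gamma> vec_charts_at[OF finite_dim_real] c])
  fix W :: "real set"
  assume "open W" "snd (UNIV, id) t \<in> W" "\<And>z. z \<in> W \<Longrightarrow> \<gamma> (chart_inv (UNIV, id) z) \<in> fst c"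
    "smooth_on W (\<lambda>z. snd c (\<gamma> (chart_inv (UNIV, id) z)))"
  then show thesis by (intro that[of W]) simp_all
qed

lemma velocity_eqI:
  assumes "c \<in> charts_at M (\<gamma> t)" "((\<lambda>s. snd c (\<gamma> s)) has_vector_derivative v) (at t)"
  shows "velocity M \<gamma> t c = v"
  using assms vector_derivative_at[OF assms(2)] by (simp add: velocity_def o_def)

lemma velocity_chart:
  fixes \<gamma> :: "real \<Rightarrow> 'a" and M :: "('a, 'e::real_inner) mfd"
  assumes M: "smfd M" and \<gamma>: "smooth_at vec_mfd M \<gamma> t" and c: "c \<in> charts_at M (\<gamma> t)"
  shows "((\<lambda>s. snd c (\<gamma> s)) has_vector_derivative velocity M \<gamma> t c) (at t)"
proof (rule smooth_curve_chart[OF M \<gamma> c])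
  fix W assume W: "t \<in> W" "smooth_on W (\<lambda>s. snd c (\<gamma> s))"
  have "(\<lambda>s. snd c (\<gamma> s)) differentiable at t"
    using smooth_on_has_derivative[OF W(2,1)] by (rule differentiableI)
  then show ?thesis using c by (simp add: vector_derivative_works[symmetric] velocity_def o_def)
qed

lemma velocity_outside: "c \<notin> charts_at M (\<gamma> t) \<Longrightarrow> velocity M \<gamma> t c = 0"
  by (simp add: velocity_def)

text \<open>\<open>vector_derivative\<close> is a choice operator, so equality is obtained by
  showing that both curves have the same derivatives; this also covers curves that have
  none.\<close>

lemma velocity_cong:
  fixes M :: "('a, 'e::real_inner) mfd"
  assumes "open T" "t \<in> T" and eq: "\<And>s. s \<in> T \<Longrightarrow> \<gamma> s = \<delta> s"
  shows "velocity M \<gamma> t = velocity M \<delta> t"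
proof
  fix c :: "('a, 'e) chart"
  have "((\<lambda>s. snd c (\<gamma> s)) has_vector_derivative D) (at t) \<longleftrightarrow> ((\<lambda>s. snd c (\<delta> s)) has_vector_derivative D) (at t)" for D
    using has_vector_derivative_transform_within_open[OF _ assms(1,2), of "\<lambda>s. snd c (\<gamma> s)" D "\<lambda>s. snd c (\<delta> s)"]
      has_vector_derivative_transform_within_open[OF _ assms(1,2), of "\<lambda>s. snd c (\<delta> s)" D "\<lambda>s. snd c (\<gamma> s)"] eq
    by auto
  then show "velocity M \<gamma> t c = velocity M \<delta> t c"
    using eq[OF assms(2)] by (simp add: velocity_def vector_derivative_def o_def)
qed

lemma smooth_on_chain:
  assumes f: "smooth_on W f" "y t \<in> W" and y: "(y has_vector_derivative v) (at t)"
  shows "((\<lambda>s. f (y s)) has_vector_derivative frechet_derivative f (at (y t)) v) (at t)"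
proof -
  let ?D = "frechet_derivative f (at (y t))"
  have D: "(f has_derivative ?D) (at (y t))" by (rule smooth_on_has_derivative[OF f])
  have "((\<lambda>s. f (y s)) has_derivative (\<lambda>h. ?D (h *\<^sub>R v))) (at t)"
    by (rule has_derivative_compose[where f=y and g=f, OF y[unfolded has_vector_derivative_def] D])
  then show ?thesis
    unfolding has_vector_derivative_def using linear_scale[OF has_derivative_linear[OF D]] by simp
qed

text \<open>The chain rule for the local expression of \<open>f\<close>. For the identity map it
  becomes the transformation law that defines \<open>tangent_space\<close>.\<close>

lemma velocity_compose:
  assumes M: "smfd M" and N: "smfd N" and \<gamma>: "smooth_at vec_mfd M \<gamma> t" and f: "smooth_at M N f (\<gamma> t)"
    and c: "c \<in> charts_at M (\<gamma> t)" and d: "d \<in> charts_at N (f (\<gamma> t))"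
  shows "velocity N (\<lambda>s. f (\<gamma> s)) t d =
    frechet_derivative (snd d \<circ> f \<circ> chart_inv c) (at (snd c (\<gamma> t))) (velocity M \<gamma> t c)"
proof (rule smooth_at_charts[OF M N f c d])
  fix W assume W: "snd c (\<gamma> t) \<in> W" "smooth_on W (\<lambda>z. snd d (f (chart_inv c z)))"
  show ?thesis
  proof (rule smooth_curve_chart[OF M \<gamma> c])
    fix V assume V: "open V" "t \<in> V" "\<And>s. s \<in> V \<Longrightarrow> \<gamma> s \<in> fst c"
    have cM: "is_chart (points M) c" using c smfd_chart[OF M] unfolding charts_at_def by blast
    have "((\<lambda>s. snd d (f (chart_inv c (snd c (\<gamma> s))))) has_vector_derivative
       frechet_derivative (\<lambda>z. snd d (f (chart_inv c z))) (at (snd c (\<gamma> t))) (velocity M \<gamma> t c)) (at t)"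
      by (rule smooth_on_chain[where y="\<lambda>s. snd c (\<gamma> s)", OF W(2,1) velocity_chart[OF M \<gamma> c]])
    then have "((\<lambda>s. snd d (f (\<gamma> s))) has_vector_derivative
       frechet_derivative (\<lambda>z. snd d (f (chart_inv c z))) (at (snd c (\<gamma> t))) (velocity M \<gamma> t c)) (at t)"
      by (rule has_vector_derivative_transform_within_open[OF _ V(1,2)]) (simp add: chart_inv_left[OF cM V(3)])
    from velocity_eqI[where \<gamma>="\<lambda>s. f (\<gamma> s)", OF d this] show ?thesis by (simp add: o_def)
  qed
qed

lemma smooth_at_affine: "smooth_at vec_mfd vec_mfd (\<lambda>s::real. a + k * s :: real) t"
proof -
  have "smooth_on UNIV (\<lambda>s::real. a + k * s)"
    by (intro smooth_on_add smooth_on_const smooth_on_bounded_linear[OF bounded_linear_mult_right] smooth_on_id open_UNIV)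
  then show ?thesis unfolding smooth_at_vec_vec[OF finite_dim_real finite_dim_real] by blast
qed

lemma smooth_at_affine_curve:
  fixes a k t :: real
  assumes M: "smfd M" and \<gamma>: "smooth_at vec_mfd M \<gamma> (a + k * t)"
  shows "smooth_at vec_mfd M (\<lambda>s. \<gamma> (a + k * s)) t"
  by (rule smooth_at_compose[OF smfd_vec(1)[OF finite_dim_real] smfd_vec(1)[OF finite_dim_real] M, where f="\<lambda>s::real. a + k * s" and g=\<gamma>, OF smooth_at_affine \<gamma>])

text \<open>Used with \<open>k = 1\<close> for shifts along flows, with an arbitrary factor for the
  exponential, and with \<open>k = -1\<close> for the reversal that produces the minus sign.\<close>

lemma velocity_affine:
  assumes M: "smfd M" and \<gamma>: "smooth_at vec_mfd M \<gamma> (a + k * t)"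
  shows "velocity M (\<lambda>s. \<gamma> (a + k * s)) t = (\<lambda>c. k *\<^sub>R velocity M \<gamma> (a + k * t) c)"
proof
  fix c
  show "velocity M (\<lambda>s. \<gamma> (a + k * s)) t c = k *\<^sub>R velocity M \<gamma> (a + k * t) c"
  proof (cases "c \<in> charts_at M (\<gamma> (a + k * t))")
    case True
    have "((\<lambda>s. a + k * s) has_vector_derivative k) (at t)"
      unfolding has_real_derivative_iff_has_vector_derivative[symmetric] by (auto intro!: derivative_eq_intros)
    from vector_diff_chain_at[OF this velocity_chart[OF M \<gamma> True]]
    show ?thesis by (intro velocity_eqI) (use True in \<open>simp_all add: o_def\<close>)
  qed (simp add: velocity_outside)
qed

lemma velocity_tangent:
  assumes M: "smfd M" and \<gamma>: "smooth_at vec_mfd M \<gamma> t"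
  shows "velocity M \<gamma> t \<in> tangent_space M (\<gamma> t)"
proof -
  have "\<gamma> t \<in> points M" using smooth_at_points[OF smfd_vec(1)[OF finite_dim_real] M \<gamma>] by blast
  note vc = velocity_compose[where f="\<lambda>x. x", OF M M \<gamma> smooth_at_id[OF M this]]
  show ?thesis unfolding tangent_space_def
  proof (intro CollectI conjI allI impI ballI)
    show "velocity M \<gamma> t c = 0" if "c \<notin> charts_at M (\<gamma> t)" for c
      using that by (rule velocity_outside)
    show "velocity M \<gamma> t d = frechet_derivative (snd d \<circ> chart_inv c) (at (snd c (\<gamma> t))) (velocity M \<gamma> t c)"
      if "c \<in> charts_at M (\<gamma> t)" "d \<in> charts_at M (\<gamma> t)" for c d
      using vc[OF that] unfolding o_def .
  qed
qed

text \<open>The transformation law recovers all coordinates from those in one chart, so equality of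
  tangent vectors can be checked in a single chart.\<close>

lemma tangent_space_eqI:
  assumes "\<xi> \<in> tangent_space M x" "\<eta> \<in> tangent_space M x" "c \<in> charts_at M x" "\<xi> c = \<eta> c"
  shows "\<xi> = \<eta>"
proof
  fix d
  show "\<xi> d = \<eta> d"
  proof (cases "d \<in> charts_at M x")
    case True
    then have "\<xi> d = frechet_derivative (snd d \<circ> chart_inv c) (at (snd c x)) (\<xi> c)"
      "\<eta> d = frechet_derivative (snd d \<circ> chart_inv c) (at (snd c x)) (\<eta> c)"
      using assms(1-3) unfolding tangent_space_def by blast+
    then show ?thesis using assms(4) by simp
  next
    case False
    then have "\<xi> d = 0" "\<eta> d = 0" using assms(1,2) unfolding tangent_space_def by blast+
    then show ?thesis by simp
  qed
qed

text \<open>A straight line in the chart. The inverse chart is arbitrary outside its image, so the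
  claims concern time 0 only.\<close>

lemma coordinate_curve:
  fixes M :: "('a, 'e::real_inner) mfd"
    and v :: 'e
  assumes M: "smfd M" and c: "c \<in> charts_at M x"
  defines "\<gamma> \<equiv> \<lambda>s::real. chart_inv c (snd c x + s *\<^sub>R v)"
  shows "smooth_at vec_mfd M \<gamma> 0" "\<gamma> 0 = x" "velocity M \<gamma> 0 c = v"
proof -
  have c': "c \<in> atlas M" "x \<in> fst c" using c by (simp_all add: charts_at_def)
  note ch = smfd_chart[OF M c'(1)]
  let ?a = "\<lambda>s::real. snd c x + s *\<^sub>R v"
  have a: "smooth_on UNIV ?a"
    by (intro smooth_on_add smooth_on_const smooth_on_bounded_linear[OF bounded_linear_scaleR_left] smooth_on_id open_UNIV)
  then have "smooth_at vec_mfd vec_mfd ?a 0"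
    unfolding smooth_at_vec_vec[OF finite_dim_real smfd_finite_dim[OF M]] by blast
  moreover have x0: "?a 0 \<in> snd c ` fst c" using c' by simp
  ultimately show s: "smooth_at vec_mfd M \<gamma> 0" unfolding \<gamma>_def
    by (rule smooth_at_compose[OF smfd_vec(1)[OF finite_dim_real] smfd_vec(1)[OF smfd_finite_dim[OF M]] M,
          where f="?a" and g="chart_inv c", OF _ smooth_at_chart_inv[OF M c'(1)]])
  show g0: "\<gamma> 0 = x" using c' ch by (simp add: \<gamma>_def chart_inv_left)
  let ?T = "?a -` (snd c ` fst c)"
  have "open ?T" using smooth_on_continuous[OF a] chart_open[OF ch] by (intro open_vimage) auto
  moreover have "0 \<in> ?T" using x0 by simp
  moreover have "(?a has_vector_derivative v) (at 0)" by (auto intro!: derivative_eq_intros)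
  ultimately have "((\<lambda>s. snd c (\<gamma> s)) has_vector_derivative v) (at 0)"
  proof -
    assume T: "open ?T" "0 \<in> ?T" and d: "(?a has_vector_derivative v) (at 0)"
    show ?thesis
      by (rule has_vector_derivative_transform_within_open[OF d T]) (simp add: \<gamma>_def chart_inv_right)
  qed
  then show "velocity M \<gamma> 0 c = v" using c g0 by (intro velocity_eqI) auto
qed

lemma tangent_vector_velocity:
  assumes M: "smfd M" and x: "x \<in> points M" and \<xi>: "\<xi> \<in> tangent_space M x"
  obtains \<gamma> :: "real \<Rightarrow> 'a" where "smooth_at vec_mfd M \<gamma> 0" "\<gamma> 0 = x" "velocity M \<gamma> 0 = \<xi>"
proof -
  obtain c where c: "c \<in> charts_at M x" by (rule smfd_ex_chart[OF M x])
  let ?\<gamma> = "\<lambda>s::real. chart_inv c (snd c x + s *\<^sub>R \<xi> c)"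
  note cc = coordinate_curve[OF M c, of "\<xi> c"]
  have "velocity M ?\<gamma> 0 = \<xi>"
    using velocity_tangent[OF M cc(1)] cc(2,3) by (intro tangent_space_eqI[OF _ \<xi> c]) simp_all
  then show ?thesis using that cc(1,2) by blast
qed

text \<open>\<open>tangent_map\<close> picks a chart by \<open>SOME\<close>;
  \<open>velocity_compose\<close> holds for every chart, so the choice does not matter and tangent
  maps can be computed on curves.\<close>

lemma tangent_map_velocity:
  assumes M: "smfd M" and N: "smfd N" and \<gamma>: "smooth_at vec_mfd M \<gamma> t" and f: "smooth_at M N f (\<gamma> t)"
  shows "tangent_map M N f (\<gamma> t) (velocity M \<gamma> t) = velocity N (\<lambda>s. f (\<gamma> s)) t"
proof
  fix d
  have "\<gamma> t \<in> points M" using smooth_at_points[OF M N f] by blast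
  then have c: "(SOME c. c \<in> charts_at M (\<gamma> t)) \<in> charts_at M (\<gamma> t)"
    using smfd_ex_chart[OF M] someI_ex by metis
  show "tangent_map M N f (\<gamma> t) (velocity M \<gamma> t) d = velocity N (\<lambda>s. f (\<gamma> s)) t d"
    unfolding tangent_map_def Let_def
    using velocity_compose[OF M N \<gamma> f c, of d] velocity_outside[of d N "\<lambda>s. f (\<gamma> s)" t] by simp
qed

lemma velocity_const:
  fixes M :: "('a, 'e::real_inner) mfd"
  assumes M: "smfd M" and x: "x \<in> points M"
  shows "velocity M (\<lambda>_. x) t = (\<lambda>_. 0)"
proof
  fix c :: "('a, 'e) chart"
  have "((\<lambda>_. snd c x) has_vector_derivative 0) (at t)" by (rule has_vector_derivative_const)
  then show "velocity M (\<lambda>_. x) t c = 0"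
    by (cases "c \<in> charts_at M x") (auto intro: velocity_eqI velocity_outside)
qed

text \<open>In coordinates the velocity is the partial derivative of \<open>f\<close> in the second variable, applied to
  the initial velocity of \<open>\<Gamma> x\<close>.  Thus no joint smoothness of \<open>\<Gamma>\<close> (such as that of the exponential
  map) is needed.\<close>

lemma smooth_at_velocity_param:
  fixes N :: "('a, 'e::real_inner) mfd" and K :: "('k, 'l::real_inner) mfd" and Q :: "('q, 'm::real_inner) mfd"
  assumes N: "smfd N" and K: "smfd K" and Q: "smfd Q"
    and f: "smooth_at (prod_mfd N K) Q f (x0, k0)"
    and U: "openin (mtop N) U" "x0 \<in> U"
    and \<Gamma>: "\<And>x. x \<in> U \<Longrightarrow> smooth_at vec_mfd K (\<Gamma> x) 0 \<and> \<Gamma> x 0 = k0"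
    and d: "d \<in> charts_at K k0" and e: "e \<in> charts_at Q (f (x0, k0))"
    and w: "smooth_at N vec_mfd (\<lambda>x. velocity K (\<Gamma> x) 0 d) x0"
  shows "smooth_at N vec_mfd (\<lambda>x. velocity Q (\<lambda>s. f (x, \<Gamma> x s)) 0 e) x0"
proof -
  note fdl = smfd_finite_dim[OF K] and fde = smfd_finite_dim[OF N] and fdm = smfd_finite_dim[OF Q]
  have "x0 \<in> points N" using U openin_mtop[OF N] by blast
  then obtain c where c: "c \<in> charts_at N x0" by (rule smfd_ex_chart[OF N])
  have ca: "c \<in> atlas N" "x0 \<in> fst c" "d \<in> atlas K" "k0 \<in> fst d" using c d by (simp_all add: charts_at_def)
  have cch: "is_chart (points N) c" and dch: "is_chart (points K) d"
    using smfd_chart[OF N ca(1)] smfd_chart[OF K ca(3)] .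
  let ?cd = "(fst c \<times> fst d, map_prod (snd c) (snd d))" and ?q = "snd d k0"
  have cd: "?cd \<in> charts_at (prod_mfd N K) (x0, k0)" by (rule prod_charts_at[OF N K c d])
  have inv: "chart_inv ?cd (snd c x, snd d k) = (x, k)" if "x \<in> fst c" "k \<in> fst d" for x k
    using prod_chart_inv[of "snd c x" c "snd d k" d] that cch dch by (simp add: is_chart_def)
  define \<Phi> where "\<Phi> z = snd e (f (chart_inv ?cd z))" for z
  obtain W where W: "open W" "snd ?cd (x0, k0) \<in> W" "W \<subseteq> snd ?cd ` fst ?cd" "\<And>z. z \<in> W \<Longrightarrow> f (chart_inv ?cd z) \<in> fst e"
    "smooth_on W \<Phi>" unfolding \<Phi>_def using smooth_at_charts[OF smfd_prod(1)[OF N K] Q f cd e] by metis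
  define w' where "w' u = velocity K (\<Gamma> (chart_inv c u)) 0 d" for u
  obtain W2 where W2: "open W2" "snd c x0 \<in> W2" "W2 \<subseteq> snd c ` fst c" "smooth_on W2 w'"
    using w unfolding smooth_at_to_vec[OF N fdl c] w'_def by blast
  \<comment> \<open>On \<open>S\<close> the point \<open>(u, ?q)\<close> stays in the domain of the
    local expression, with the group coordinate frozen; base point and direction
    \<open>(0, w' u)\<close> are then smooth functions of \<open>u\<close>.\<close>
  define S where "S = W2 \<inter> (\<lambda>u. (u, ?q)) -` W \<inter> snd c ` (U \<inter> fst c)"
  have "open ((\<lambda>u. (u, ?q)) -` W)" by (intro open_vimage W(1) continuous_intros)
  then have S: "open S" using W2(1) U(1) ca(1) unfolding S_def openin_mtop[OF N] by (intro open_Int) auto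
  have x0S: "snd c x0 \<in> S" using W2(2) W(2) U(2) ca by (simp add: S_def)
  have sm: "smooth_on S (\<lambda>u. frechet_derivative \<Phi> (at (u, ?q)) (0, w' u))"
  proof (rule smooth_on_derivative_app[where u="\<lambda>u. (u, ?q)" and w="\<lambda>u. (0, w' u)", OF finite_dim_prod[OF fde fdl] S W(1) _ _ _ W(5)])
    show "(\<lambda>u. (u, ?q)) ` S \<subseteq> W" by (auto simp: S_def)
    show "smooth_on S (\<lambda>u. (u, ?q))" by (rule smooth_on_Pair[OF S smooth_on_id smooth_on_const])
    have "smooth_on S w'" by (rule smooth_on_subset[OF W2(4)]) (auto simp: S_def)
    then show "smooth_on S (\<lambda>u. (0, w' u))" by (rule smooth_on_Pair[OF S smooth_on_const])
  qed
  have eq: "frechet_derivative \<Phi> (at (u, ?q)) (0, w' u) = velocity Q (\<lambda>s. f (chart_inv c u, \<Gamma> (chart_inv c u) s)) 0 e"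
    if u: "u \<in> S" for u
  proof -
    let ?x = "chart_inv c u"
    have uc: "u \<in> snd c ` fst c" using u W2(3) by (auto simp: S_def)
    have xU: "?x \<in> U" and xc: "?x \<in> fst c" 
      using u chart_image_iff'[OF cch uc, of "U \<inter> fst c"] by (auto simp: S_def)
    have cx: "snd c ?x = u" using uc by (rule chart_inv_right)
    have G: "smooth_at vec_mfd K (\<Gamma> ?x) 0" "\<Gamma> ?x 0 = k0" using \<Gamma>[OF xU] by auto
    have uq: "(u, ?q) \<in> W" using u by (simp add: S_def)
    have d': "d \<in> charts_at K (\<Gamma> ?x 0)" using d G by simp
    show ?thesis
    proof (rule smooth_curve_chart[OF K G(1) d'])
      fix V assume V: "open V" "(0::real) \<in> V" "\<And>s. s \<in> V \<Longrightarrow> \<Gamma> ?x s \<in> fst d"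
      have "((\<lambda>s. (u, snd d (\<Gamma> ?x s))) has_vector_derivative (0, w' u)) (at 0)"
        using velocity_chart[OF K G(1) d'] unfolding w'_def has_vector_derivative_def
        by (auto intro!: derivative_eq_intros)
      from smooth_on_chain[where y="\<lambda>s. (u, snd d (\<Gamma> ?x s))", OF W(5) _ this] uq G(2)
      have "((\<lambda>s. \<Phi> (u, snd d (\<Gamma> ?x s))) has_vector_derivative frechet_derivative \<Phi> (at (u, ?q)) (0, w' u)) (at 0)"
        by simp
      then have "((\<lambda>s. snd e (f (?x, \<Gamma> ?x s))) has_vector_derivative frechet_derivative \<Phi> (at (u, ?q)) (0, w' u)) (at 0)"
      proof (rule has_vector_derivative_transform_within_open[OF _ V(1,2)])
        fix s assume "s \<in> V"
        from inv[OF xc V(3)[OF this]] show "\<Phi> (u, snd d (\<Gamma> ?x s)) = snd e (f (?x, \<Gamma> ?x s))"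
          unfolding cx by (simp add: \<Phi>_def)
      qed
      moreover have "e \<in> charts_at Q (f (?x, \<Gamma> ?x 0))"
        using W(4)[OF uq] inv[OF xc ca(4)] e unfolding cx G(2) by (simp add: charts_at_def)
      ultimately show ?thesis by (intro velocity_eqI[symmetric])
    qed
  qed
  have "smooth_on S (\<lambda>u. velocity Q (\<lambda>s. f (chart_inv c u, \<Gamma> (chart_inv c u) s)) 0 e)"
    by (rule smooth_on_cong[OF sm S eq])
  moreover have "S \<subseteq> snd c ` fst c" using W2(3) by (auto simp: S_def)
  ultimately show ?thesis unfolding smooth_at_to_vec[OF N fdm c] using S x0S by blast
qed

section \<open>Vector fields, integral curves and flows\<close>

text \<open>One smooth coordinate function near each point is enough: the others arise from it by
  applying the derivative of a transition map.\<close>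

lemma vector_fieldI:
  fixes N :: "('a, 'e::real_inner) mfd"
  assumes N: "smfd N" and tan: "\<And>x. x \<in> points N \<Longrightarrow> X x \<in> tangent_space N x"
    and out: "\<And>x. x \<notin> points N \<Longrightarrow> X x = (\<lambda>_. 0)"
    and sm: "\<And>x. x \<in> points N \<Longrightarrow> \<exists>c\<in>charts_at N x. smooth_at N vec_mfd (\<lambda>y. X y c) x"
  shows "vector_field N X"
  unfolding vector_field_def
proof (intro conjI ballI allI impI tan out)
  fix c assume c: "c \<in> atlas N"
  note cch = smfd_chart[OF N c] and fd = smfd_finite_dim[OF N]
  show "smooth_on (snd c ` fst c) (\<lambda>z. X (chart_inv c z) c)"
  proof (rule smooth_on_local)
    fix z assume "z \<in> snd c ` fst c"
    then obtain x where x: "x \<in> fst c" "z = snd c x" by blast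
    have "x \<in> points N" using chart_subset[OF cch x(1)] .
    then obtain d where d: "d \<in> charts_at N x" "smooth_at N vec_mfd (\<lambda>y. X y d) x" using sm by metis
    have da: "d \<in> atlas N" "x \<in> fst d" using d(1) by (simp_all add: charts_at_def)
    have co: "compatible c d" "compatible d c" using smfd_compatible[OF N] c da by auto
    have "c \<in> charts_at N x" using c x by (simp add: charts_at_def)
    from d(2)[unfolded smooth_at_to_vec[OF N fd this]] obtain W where W: "open W" "snd c x \<in> W" "W \<subseteq> snd c ` fst c"
      "smooth_on W (\<lambda>z. X (chart_inv c z) d)" by blast
    let ?T = "W \<inter> snd c ` (fst c \<inter> fst d)"
    have T: "open ?T" using W(1) co by (auto simp: compatible_def)
    have zT: "z \<in> ?T" using x da W(2) by blast
    have o: "open (snd d ` (fst d \<inter> fst c))" using co by (simp add: compatible_def)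
    have "smooth_on ?T (\<lambda>z. frechet_derivative (\<lambda>w. snd c (chart_inv d w)) (at (snd d (chart_inv c z))) (X (chart_inv c z) d))"
    proof (rule smooth_on_derivative_app[OF fd T o _ _ _ compatible_smooth[OF co(2)]])
      show "(\<lambda>z. snd d (chart_inv c z)) ` ?T \<subseteq> snd d ` (fst d \<inter> fst c)"
        using chart_inv_left[OF cch] by auto
      show "smooth_on ?T (\<lambda>z. snd d (chart_inv c z))"
        by (rule smooth_on_subset[OF compatible_smooth[OF co(1)]]) blast
      show "smooth_on ?T (\<lambda>z. X (chart_inv c z) d)" by (rule smooth_on_subset[OF W(4)]) blast
    qed
    then have "smooth_on ?T (\<lambda>z. X (chart_inv c z) c)"
    proof (rule smooth_on_cong[OF _ T])
      fix w assume "w \<in> ?T"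
      then obtain y where y: "y \<in> fst c" "y \<in> fst d" "w = snd c y" by blast
      have yc: "chart_inv c w = y" using y chart_inv_left[OF cch] by simp
      have "c \<in> charts_at N y" "d \<in> charts_at N y" using y c da by (simp_all add: charts_at_def)
      moreover have "X y \<in> tangent_space N y" using tan chart_subset[OF cch y(1)] .
      ultimately have "X y c = frechet_derivative (snd c \<circ> chart_inv d) (at (snd d y)) (X y d)"
        unfolding tangent_space_def by blast
      then show "frechet_derivative (\<lambda>w. snd c (chart_inv d w)) (at (snd d (chart_inv c w))) (X (chart_inv c w) d) = X (chart_inv c w) c"
        unfolding yc by (simp add: o_def)
    qed
    then show "\<exists>T. open T \<and> z \<in> T \<and> smooth_on T (\<lambda>z. X (chart_inv c z) c)" using T zT by blast
  qed
qed

lemma vector_field_tangent: "vector_field N X \<Longrightarrow> x \<in> points N \<Longrightarrow> X x \<in> tangent_space N x"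
  by (simp add: vector_field_def)

lemma openin_mtop_vec:
  assumes "finite_dim TYPE('v::real_inner)"
  shows "openin (mtop (vec_mfd :: ('v, 'v) mfd)) W \<longleftrightarrow> open W"
proof
  assume "openin (mtop (vec_mfd :: ('v, 'v) mfd)) W"
  then have "\<forall>c\<in>atlas (vec_mfd :: ('v, 'v) mfd). open (snd c ` (W \<inter> fst c))"
    unfolding openin_mtop[OF smfd_vec(1)[OF assms]] by (rule conjunct2)
  from bspec[OF this vec_chart_atlas[OF assms]] have "open (id ` W)" by simp
  then show "open W" by simp
next
  assume "open W"
  then show "openin (mtop (vec_mfd :: ('v, 'v) mfd)) W"
    using openin_chart_domain_subset[OF smfd_vec(1)[OF assms] vec_chart_atlas[OF assms], of W] by simp
qed

lemma integral_curve_points: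
  assumes N: "smfd N" and "integral_curve N X I \<gamma>" "t \<in> I"
  shows "\<gamma> t \<in> points N"
  using assms(2,3) topspace_mtop[OF N] unfolding integral_curve_def continuous_map_def by auto

lemma integral_curve_deriv:
  assumes "integral_curve N X I \<gamma>" "t \<in> I" "c \<in> charts_at N (\<gamma> t)"
  shows "((\<lambda>s. snd c (\<gamma> s)) has_vector_derivative X (\<gamma> t) c) (at t)"
  using assms unfolding integral_curve_def o_def by blast

lemma integral_curve_vimage:
  assumes N: "smfd N" and \<gamma>: "integral_curve N X I \<gamma>" and V: "openin (mtop N) V"
  shows "open {t \<in> I. \<gamma> t \<in> V}"
proof -
  have "openin (top_of_set I) {t \<in> I. \<gamma> t \<in> V}"
    using \<gamma> V unfolding integral_curve_def continuous_map_def by auto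
  then show ?thesis using \<gamma> openin_open_trans unfolding integral_curve_def by blast
qed

text \<open>In a chart around the common value both curves solve the same equation, whose right side
  is Lipschitz on a small ball.\<close>

lemma integral_curve_unique_local:
  assumes N: "smfd N" and X: "vector_field N X"
    and \<gamma>: "integral_curve N X I \<gamma>" and \<delta>: "integral_curve N X J \<delta>"
    and t0: "t0 \<in> I \<inter> J" "\<gamma> t0 = \<delta> t0"
  shows "\<exists>\<epsilon>>0. \<forall>t\<in>ball t0 \<epsilon>. t \<in> I \<inter> J \<and> \<gamma> t = \<delta> t"
proof -
  have "\<gamma> t0 \<in> points N" using integral_curve_points[OF N \<gamma>] t0 by blast
  then obtain c where c: "c \<in> charts_at N (\<gamma> t0)" by (rule smfd_ex_chart[OF N])
  have ca: "c \<in> atlas N" "\<gamma> t0 \<in> fst c" using c by (simp_all add: charts_at_def)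
  note cch = smfd_chart[OF N ca(1)]
  let ?f = "\<lambda>z. X (chart_inv c z) c"
  have sf: "smooth_on (snd c ` fst c) ?f" using X ca(1) by (simp add: vector_field_def)
  have "snd c (\<gamma> t0) \<in> snd c ` fst c" using ca by blast
  from smooth_on_locally_lipschitz[OF smfd_finite_dim[OF N] chart_open[OF cch] sf this]
  obtain r L where r: "r > 0" and L: "\<And>x y. x \<in> cball (snd c (\<gamma> t0)) r \<Longrightarrow> y \<in> cball (snd c (\<gamma> t0)) r \<Longrightarrow> norm (?f x - ?f y) \<le> L * norm (x - y)"
    by metis
  \<comment> \<open>Pulling this open set back along both curves gives an open set of times at which
    both stay inside the Lipschitz ball.\<close>
  define V where "V = {x \<in> fst c. snd c x \<in> ball (snd c (\<gamma> t0)) r}"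
  have V: "openin (mtop N) V" unfolding V_def by (rule openin_chart_vimage[OF N ca(1) open_ball])
  have "open ({t \<in> I. \<gamma> t \<in> V} \<inter> {t \<in> J. \<delta> t \<in> V})"
    by (intro open_Int integral_curve_vimage[OF N \<gamma> V] integral_curve_vimage[OF N \<delta> V])
  moreover have "t0 \<in> {t \<in> I. \<gamma> t \<in> V} \<inter> {t \<in> J. \<delta> t \<in> V}" using t0 r ca by (auto simp: V_def)
  ultimately obtain \<epsilon> where \<epsilon>: "\<epsilon> > 0" "ball t0 \<epsilon> \<subseteq> {t \<in> I. \<gamma> t \<in> V} \<inter> {t \<in> J. \<delta> t \<in> V}"
    unfolding open_contains_ball by blast
  have "\<gamma> t = \<delta> t" if t: "t \<in> ball t0 \<epsilon>" for t
  proof -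
    have *: "((\<lambda>s. snd c (\<zeta> s)) has_vector_derivative ?f (snd c (\<zeta> s))) (at s) \<and> snd c (\<zeta> s) \<in> cball (snd c (\<gamma> t0)) r"
      if "integral_curve N X K \<zeta>" "s \<in> K" "\<zeta> s \<in> V" for \<zeta> K s
    proof -
      have "\<zeta> s \<in> fst c" using that(3) by (simp add: V_def)
      then have "c \<in> charts_at N (\<zeta> s)" "chart_inv c (snd c (\<zeta> s)) = \<zeta> s"
        using ca(1) chart_inv_left[OF cch] by (simp_all add: charts_at_def)
      then show ?thesis using integral_curve_deriv[OF that(1,2), of c] that(3) by (simp add: V_def)
    qed
    have "snd c (\<gamma> t) = snd c (\<delta> t)"
    proof (rule lipschitz_ode_unique[where y="\<lambda>s. snd c (\<gamma> s)" and z="\<lambda>s. snd c (\<delta> s)", OF _ _ L])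
      show "is_interval (ball t0 \<epsilon>)" by (rule is_interval_ball_real)
      show "t0 \<in> ball t0 \<epsilon>" using \<epsilon>(1) by simp
      show "t \<in> ball t0 \<epsilon>" by (rule t)
      show "snd c (\<gamma> t0) = snd c (\<delta> t0)" using t0 by simp
      show "((\<lambda>s. snd c (\<gamma> s)) has_vector_derivative ?f (snd c (\<gamma> s))) (at s) \<and> snd c (\<gamma> s) \<in> cball (snd c (\<gamma> t0)) r"
        if "s \<in> ball t0 \<epsilon>" for s using *[OF \<gamma>] \<epsilon>(2) that by blast
      show "((\<lambda>s. snd c (\<delta> s)) has_vector_derivative ?f (snd c (\<delta> s))) (at s) \<and> snd c (\<delta> s) \<in> cball (snd c (\<gamma> t0)) r"
        if "s \<in> ball t0 \<epsilon>" for s using *[OF \<delta>] \<epsilon>(2) that by blast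
    qed
    moreover have "\<gamma> t \<in> fst c" "\<delta> t \<in> fst c" using \<epsilon>(2) t by (auto simp: V_def)
    ultimately show ?thesis using chart_inv_left[OF cch] by metis
  qed
  then show ?thesis using \<epsilon> by blast
qed

text \<open>The set of times where the curves agree is open by local uniqueness, the set where they
  differ is open by the Hausdorff property, and the common interval is connected.\<close>

lemma integral_curve_unique:
  assumes N: "smfd N" and H: "Hausdorff_space (mtop N)" and X: "vector_field N X"
    and \<gamma>: "integral_curve N X I \<gamma>" and \<delta>: "integral_curve N X J \<delta>"
    and t0: "t0 \<in> I \<inter> J" "\<gamma> t0 = \<delta> t0" and t: "t \<in> I \<inter> J"
  shows "\<gamma> t = \<delta> t"
proof (rule ccontr)
  assume neq: "\<gamma> t \<noteq> \<delta> t"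
  let ?A = "{s \<in> I \<inter> J. \<gamma> s = \<delta> s}" and ?B = "{s \<in> I \<inter> J. \<gamma> s \<noteq> \<delta> s}"
  have "is_interval (I \<inter> J)" using \<gamma> \<delta> unfolding integral_curve_def by (intro is_interval_Int) auto
  then have con: "connected (I \<inter> J)" by (simp add: is_interval_connected)
  have A: "open ?A"
  proof (rule openI)
    fix s assume s: "s \<in> ?A"
    then have "s \<in> I \<inter> J" "\<gamma> s = \<delta> s" by auto
    from integral_curve_unique_local[OF N X \<gamma> \<delta> this]
    show "\<exists>\<epsilon>>0. ball s \<epsilon> \<subseteq> ?A" by blast
  qed
  have B: "open ?B"
  proof (rule openI)
    fix s assume s: "s \<in> ?B"
    have "\<gamma> s \<in> topspace (mtop N)" "\<delta> s \<in> topspace (mtop N)"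
      using s integral_curve_points[OF N \<gamma>] integral_curve_points[OF N \<delta>] unfolding topspace_mtop[OF N] by auto
    then obtain U V where UV: "openin (mtop N) U" "openin (mtop N) V" "\<gamma> s \<in> U" "\<delta> s \<in> V" "disjnt U V"
      using H s unfolding Hausdorff_space_def by blast
    let ?T = "{s \<in> I. \<gamma> s \<in> U} \<inter> {s \<in> J. \<delta> s \<in> V}"
    have "open ?T" by (intro open_Int integral_curve_vimage[OF N \<gamma>] integral_curve_vimage[OF N \<delta>] UV)
    moreover have "s \<in> ?T" using s UV by auto
    moreover have "?T \<subseteq> ?B" using UV(5) by (auto simp: disjnt_iff)
    ultimately show "\<exists>\<epsilon>>0. ball s \<epsilon> \<subseteq> ?B" unfolding open_contains_ball by blast
  qed
  have "?A \<inter> ?B \<inter> (I \<inter> J) = {}" "I \<inter> J \<subseteq> ?A \<union> ?B" by auto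
  from connectedD[OF con A B this] have "?A \<inter> (I \<inter> J) = {} \<or> ?B \<inter> (I \<inter> J) = {}" .
  then show False using t0 t neq by blast
qed

lemma integral_curve_shift:
  assumes \<gamma>: "integral_curve N X I \<gamma>" and J: "open J" "is_interval J" "\<And>t. t \<in> J \<Longrightarrow> s + t \<in> I"
  shows "integral_curve N X J (\<lambda>t. \<gamma> (s + t))"
  unfolding integral_curve_def
proof (intro conjI ballI J)
  have "continuous_map (top_of_set I) (mtop N) \<gamma>" using \<gamma> by (simp add: integral_curve_def)
  moreover have "continuous_map (top_of_set J) (top_of_set I) (\<lambda>t. s + t)"
    using J(3) by (auto simp: continuous_map_in_subtopology intro!: continuous_intros)
  ultimately have "continuous_map (top_of_set J) (mtop N) (\<gamma> \<circ> (\<lambda>t. s + t))" by (rule continuous_map_compose[rotated])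
  then show "continuous_map (top_of_set J) (mtop N) (\<lambda>t. \<gamma> (s + t))" by (simp add: o_def)
  fix t c assume t: "t \<in> J" "c \<in> charts_at N (\<gamma> (s + t))"
  have "((\<lambda>t. s + t) has_vector_derivative 1) (at t)"
    by (auto intro!: derivative_eq_intros)
  from vector_diff_chain_at[OF this integral_curve_deriv[OF \<gamma> J(3)[OF t(1)] t(2)]]
  show "((snd c \<circ> (\<lambda>t. \<gamma> (s + t))) has_vector_derivative X (\<gamma> (s + t)) c) (at t)" by (simp add: o_def)
qed

lemma integral_curveI:
  assumes N: "smfd N" and I: "open I" "is_interval I"
    and \<gamma>: "\<And>t. t \<in> I \<Longrightarrow> smooth_at vec_mfd N \<gamma> t \<and> velocity N \<gamma> t = X (\<gamma> t)"
  shows "integral_curve N X I \<gamma>"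
  unfolding integral_curve_def
proof (intro conjI ballI I)
  note V = smfd_vec(1)[OF finite_dim_real]
  have p: "\<gamma> t \<in> points N" if "t \<in> I" for t using smooth_at_points[OF V N] \<gamma>[OF that] by blast
  have "openin (top_of_set I) {t \<in> I. \<gamma> t \<in> U}" if "openin (mtop N) U" for U
  proof -
    have "openin (mtop vec_mfd) {t \<in> I. \<gamma> t \<in> U}"
      by (rule openin_smooth_vimage[OF V N _ _ that]) (use \<gamma> I(1) in \<open>simp_all add: openin_mtop_vec[OF finite_dim_real]\<close>)
    then have "open {t \<in> I. \<gamma> t \<in> U}" by (simp add: openin_mtop_vec[OF finite_dim_real])
    then show ?thesis by (intro open_openin_trans) (use I in auto)
  qed
  then show "continuous_map (top_of_set I) (mtop N) \<gamma>"
    using p topspace_mtop[OF N] unfolding continuous_map_def by auto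
  fix t c assume t: "t \<in> I" "c \<in> charts_at N (\<gamma> t)"
  show "((snd c \<circ> \<gamma>) has_vector_derivative X (\<gamma> t) c) (at t)"
    using velocity_chart[OF N, of \<gamma> t c] \<gamma>[OF t(1)] t(2) by (simp add: o_def)
qed

text \<open>Bootstrapping: the derivative is \<open>f\<close> composed with \<open>y\<close>, so
  each order of differentiability of \<open>y\<close> yields the next. Picard's theorem itself gives
  only differentiability.\<close>

lemma ode_solution_smooth:
  fixes y :: "real \<Rightarrow> 'e::real_inner"
  assumes fd: "finite_dim TYPE('e)" and T: "open T" and S: "open S" and f: "smooth_on S f"
    and y: "\<And>t. t \<in> T \<Longrightarrow> (y has_vector_derivative f (y t)) (at t) \<and> y t \<in> S"
  shows "smooth_on T y"
proof -
  have yS: "y ` T \<subseteq> S" using y by blast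
  have "Ck_on k T y" for k
  proof (induction k)
    case 0
    have "isCont y t" if "t \<in> T" for t
      using y[OF that] has_vector_derivative_continuous by blast
    then show ?case by (simp add: continuous_at_imp_continuous_on)
  next
    case (Suc k)
    have fk: "Ck_on k S f" using f by (simp add: smooth_on_def)
    show ?case unfolding Ck_on_Suc_iff[OF T]
    proof (intro exI[of _ "\<lambda>t h. h *\<^sub>R f (y t)"] conjI ballI allI)
      show "(y has_derivative (\<lambda>h. h *\<^sub>R f (y t))) (at t)" if "t \<in> T" for t
        using y[OF that] by (simp add: has_vector_derivative_def)
      show "Ck_on k T (\<lambda>t. v *\<^sub>R f (y t))" for v
        by (rule Ck_on_bounded_linear[OF bounded_linear_scaleR_right T Ck_on_compose[OF fd T S yS Suc fk]])
    qed
  qed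
  then show ?thesis by (simp add: smooth_on_def)
qed

lemma integral_curve_exists:
  fixes N :: "('a, 'e::real_inner) mfd"
  assumes N: "smfd N" and X: "vector_field N X" and x: "x \<in> points N"
  obtains \<epsilon> \<gamma> where "\<epsilon> > 0" "integral_curve N X {-\<epsilon><..<\<epsilon>} \<gamma>" "\<gamma> 0 = x"
    "\<And>t. t \<in> {-\<epsilon><..<\<epsilon>} \<Longrightarrow> smooth_at vec_mfd N \<gamma> t \<and> velocity N \<gamma> t = X (\<gamma> t)"
proof -
  obtain c where c: "c \<in> charts_at N x" by (rule smfd_ex_chart[OF N x])
  have ca: "c \<in> atlas N" "x \<in> fst c" using c by (simp_all add: charts_at_def)
  note cch = smfd_chart[OF N ca(1)] and fd = smfd_finite_dim[OF N] 
  note V = smfd_vec(1)[OF finite_dim_real] and V' = smfd_vec(1)[OF fd]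
  let ?f = "\<lambda>z. X (chart_inv c z) c" and ?S = "snd c ` fst c"
  have sf: "smooth_on ?S ?f" using X ca(1) by (simp add: vector_field_def)
  have S: "open ?S" by (rule chart_open[OF cch])
  have "snd c x \<in> ?S" using ca by blast
  from smooth_on_locally_lipschitz[OF fd S sf this] obtain r L where r: "r > 0" "L \<ge> 0" "cball (snd c x) r \<subseteq> ?S"
    and L: "\<And>u v. u \<in> cball (snd c x) r \<Longrightarrow> v \<in> cball (snd c x) r \<Longrightarrow> norm (?f u - ?f v) \<le> L * norm (u - v)"
    by metis
  obtain \<epsilon> y where \<epsilon>: "\<epsilon> > 0" and y0: "y 0 = snd c x"
    and y: "\<And>t. t \<in> {-\<epsilon><..<\<epsilon>} \<Longrightarrow> (y has_vector_derivative ?f (y t)) (at t) \<and> y t \<in> cball (snd c x) r"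
    using picard_finite_dim[OF fd r(1,2) L] by metis
  let ?I = "{-\<epsilon><..<\<epsilon>}"
  have yS: "(y has_vector_derivative ?f (y t)) (at t) \<and> y t \<in> ?S" if "t \<in> ?I" for t
    using y[OF that] r(3) by blast
  have sy: "smooth_on ?I y" by (rule ode_solution_smooth[OF fd open_greaterThanLessThan S sf yS])
  define \<gamma> where "\<gamma> t = chart_inv c (y t)" for t
  have \<gamma>: "smooth_at vec_mfd N \<gamma> t \<and> velocity N \<gamma> t = X (\<gamma> t)" if t: "t \<in> ?I" for t
  proof
    have "smooth_at vec_mfd vec_mfd y t"
      unfolding smooth_at_vec_vec[OF finite_dim_real fd] using sy t by (intro exI[of _ ?I]) auto
    then show s: "smooth_at vec_mfd N \<gamma> t" unfolding \<gamma>_def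
      by (rule smooth_at_compose[OF V V' N, where f=y and g="chart_inv c"])
        (rule smooth_at_chart_inv[OF N ca(1) conjunct2[OF yS[OF t]]])
    have gt: "\<gamma> t \<in> fst c" unfolding \<gamma>_def using yS[OF t] by (intro chart_inv_into) blast
    have cg: "c \<in> charts_at N (\<gamma> t)" using gt ca by (simp add: charts_at_def)
    have "((\<lambda>s. snd c (\<gamma> s)) has_vector_derivative ?f (y t)) (at t)"
    proof (rule has_vector_derivative_transform_within_open[OF conjunct1[OF yS[OF t]] open_greaterThanLessThan t])
      fix s assume "s \<in> ?I"
      from chart_inv_right[OF conjunct2[OF yS[OF this]]] show "y s = snd c (\<gamma> s)" by (simp add: \<gamma>_def)
    qed
    from velocity_eqI[where \<gamma>=\<gamma>, OF cg this] have "velocity N \<gamma> t c = X (\<gamma> t) c" by (simp add: \<gamma>_def[of t])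
    then show "velocity N \<gamma> t = X (\<gamma> t)"
      using chart_subset[OF cch gt]
      by (intro tangent_space_eqI[OF velocity_tangent[OF N s] vector_field_tangent[OF X] cg]) auto
  qed
  have "integral_curve N X ?I \<gamma>" by (rule integral_curveI[OF N open_greaterThanLessThan is_interval_oo \<gamma>])
  moreover have "\<gamma> 0 = x" using ca by (simp add: \<gamma>_def y0 chart_inv_left[OF cch])
  ultimately show ?thesis using that \<epsilon> \<gamma> by blast
qed

section \<open>Complete flows and the fields that they generate\<close>

text \<open>Smoothness is only required along the orbits; the smoothness of the generated field is
  a separate hypothesis where it matters.\<close>

definition smooth_flow :: "('a, 'e::real_inner) mfd \<Rightarrow> ('a \<Rightarrow> real \<Rightarrow> 'a) \<Rightarrow> bool" where
  "smooth_flow N \<Phi> \<longleftrightarrow> (\<forall>x\<in>points N. \<Phi> x 0 = x \<and> (\<forall>s t. \<Phi> x (s + t) = \<Phi> (\<Phi> x s) t) \<and>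
     (\<forall>t. smooth_at vec_mfd N (\<Phi> x) t))"

text \<open>The value 0 off the manifold follows the convention in \<open>vector_field\<close>, so
  that fields with the same flow are equal as functions.\<close>

definition flow_field :: "('a, 'e::real_inner) mfd \<Rightarrow> ('a \<Rightarrow> real \<Rightarrow> 'a) \<Rightarrow> 'a \<Rightarrow> ('a, 'e) tvec" where
  "flow_field N \<Phi> x = (if x \<in> points N then velocity N (\<Phi> x) 0 else (\<lambda>_. 0))"

text \<open>By the group law, the orbit of \<open>x\<close> shifted by \<open>t\<close> is the orbit
  of \<open>\<Phi> x t\<close>, whose velocity at 0 is the field there.\<close>

lemma velocity_smooth_flow:
  assumes N: "smfd N" and \<Phi>: "smooth_flow N \<Phi>" and x: "x \<in> points N"
  shows "smooth_at vec_mfd N (\<Phi> x) t" "velocity N (\<Phi> x) t = flow_field N \<Phi> (\<Phi> x t)" "\<Phi> x t \<in> points N"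
proof -
  show s: "smooth_at vec_mfd N (\<Phi> x) t" for t using \<Phi> x by (simp add: smooth_flow_def)
  show p: "\<Phi> x t \<in> points N"
    using smooth_at_points[OF smfd_vec(1)[OF finite_dim_real] N s] by blast
  have "(\<lambda>s. \<Phi> x (t + 1 * s)) = \<Phi> (\<Phi> x t)" using \<Phi> x by (auto simp: smooth_flow_def)
  moreover have "velocity N (\<lambda>s. \<Phi> x (t + 1 * s)) 0 = (\<lambda>c. 1 *\<^sub>R velocity N (\<Phi> x) (t + 1 * 0) c)"
    by (rule velocity_affine[OF N s])
  ultimately show "velocity N (\<Phi> x) t = flow_field N \<Phi> (\<Phi> x t)" using p by (simp add: flow_field_def)
qed

lemma flow_field_vector_field:
  assumes N: "smfd N" and \<Phi>: "smooth_flow N \<Phi>"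
    and sm: "\<And>x. x \<in> points N \<Longrightarrow> \<exists>c\<in>charts_at N x. smooth_at N vec_mfd (\<lambda>y. velocity N (\<Phi> y) 0 c) x"
  shows "vector_field N (flow_field N \<Phi>)"
proof (rule vector_fieldI[OF N])
  fix x assume x: "x \<in> points N"
  have "\<Phi> x 0 = x" using \<Phi> x by (simp add: smooth_flow_def)
  then show "flow_field N \<Phi> x \<in> tangent_space N x"
    using velocity_tangent[OF N velocity_smooth_flow(1)[OF N \<Phi> x, of 0]] x by (simp add: flow_field_def)
  obtain c where c: "c \<in> charts_at N x" "smooth_at N vec_mfd (\<lambda>y. velocity N (\<Phi> y) 0 c) x" using sm[OF x] by metis
  have "smooth_at N vec_mfd (\<lambda>y. flow_field N \<Phi> y c) x"
    by (rule smooth_at_cong[OF N c(2) openin_points[OF N] x]) (simp add: flow_field_def)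
  then show "\<exists>c\<in>charts_at N x. smooth_at N vec_mfd (\<lambda>y. flow_field N \<Phi> y c) x" using c(1) by blast
qed (simp add: flow_field_def)

lemma integral_curve_smooth_flow:
  assumes N: "smfd N" and \<Phi>: "smooth_flow N \<Phi>" and x: "x \<in> points N"
  shows "integral_curve N (flow_field N \<Phi>) UNIV (\<Phi> x)"
  by (rule integral_curveI[OF N open_UNIV is_interval_univ]) (use velocity_smooth_flow[OF N \<Phi> x] in blast)

lemma flow_eqI:
  assumes N: "smfd N" and H: "Hausdorff_space (mtop N)" and X: "vector_field N X"
    and \<gamma>: "integral_curve N X I \<gamma>" "0 \<in> I" "t \<in> I"
  shows "flow N X t (\<gamma> 0) = \<gamma> t"
  unfolding flow_def
proof (rule the_equality)
  show "\<exists>I \<delta>. integral_curve N X I \<delta> \<and> 0 \<in> I \<and> t \<in> I \<and> \<delta> 0 = \<gamma> 0 \<and> \<delta> t = \<gamma> t" using \<gamma> by blast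
  fix y assume "\<exists>J \<delta>. integral_curve N X J \<delta> \<and> 0 \<in> J \<and> t \<in> J \<and> \<delta> 0 = \<gamma> 0 \<and> \<delta> t = y"
  then obtain J \<delta> where \<delta>: "integral_curve N X J \<delta>" "0 \<in> J" "t \<in> J" "\<delta> 0 = \<gamma> 0" "\<delta> t = y" by blast
  have "\<delta> t = \<gamma> t" by (rule integral_curve_unique[OF N H X \<delta>(1) \<gamma>(1), of 0]) (use \<delta> \<gamma> in auto)
  then show "y = \<gamma> t" using \<delta> by simp
qed

lemma flow_flow_field:
  assumes N: "smfd N" and H: "Hausdorff_space (mtop N)" and \<Phi>: "smooth_flow N \<Phi>"
    and X: "vector_field N (flow_field N \<Phi>)"
  shows "flow_dom N (flow_field N \<Phi>) t = points N"
    and "x \<in> points N \<Longrightarrow> flow N (flow_field N \<Phi>) t x = \<Phi> x t"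
proof -
  have i: "integral_curve N (flow_field N \<Phi>) UNIV (\<Phi> x)" "\<Phi> x 0 = x" if "x \<in> points N" for x
    using integral_curve_smooth_flow[OF N \<Phi> that] \<Phi> that by (simp_all add: smooth_flow_def)
  show "flow_dom N (flow_field N \<Phi>) t = points N" unfolding flow_dom_def using i by blast
  show "flow N (flow_field N \<Phi>) t x = \<Phi> x t" if "x \<in> points N"
    using flow_eqI[OF N H X i(1)[OF that]] i(2)[OF that] by simp
qed

text \<open>That the flow domain at time 0 is everything yields an integral curve of
  \<open>Y\<close> through each point; near time 0 it coincides with the orbit of
  \<open>\<Phi>\<close>, so the velocities agree.\<close>

lemma flow_field_unique:
  assumes N: "smfd N" and H: "Hausdorff_space (mtop N)" and \<Phi>: "smooth_flow N \<Phi>"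
    and Y: "vector_field N Y" "\<And>t. flow_dom N Y t = points N" "\<And>t x. x \<in> points N \<Longrightarrow> flow N Y t x = \<Phi> x t"
  shows "Y = flow_field N \<Phi>"
proof
  fix x
  show "Y x = flow_field N \<Phi> x"
  proof (cases "x \<in> points N")
    case True
    then have "x \<in> flow_dom N Y 0" using Y(2) by blast
    then obtain I \<gamma> where \<gamma>: "integral_curve N Y I \<gamma>" "0 \<in> I" "\<gamma> 0 = x" unfolding flow_dom_def by blast
    have I: "open I" using \<gamma>(1) by (simp add: integral_curve_def)
    have eq: "\<gamma> t = \<Phi> x t" if "t \<in> I" for t
      using flow_eqI[OF N H Y(1) \<gamma>(1,2) that] Y(3)[OF True] \<gamma>(3) by simp
    obtain c where c: "c \<in> charts_at N x" by (rule smfd_ex_chart[OF N True])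
    have x0: "\<Phi> x 0 = x" using \<Phi> True by (simp add: smooth_flow_def)
    have "velocity N \<gamma> 0 c = Y x c"
      using integral_curve_deriv[OF \<gamma>(1,2), of c] \<gamma>(3) c by (intro velocity_eqI) auto
    moreover have "velocity N \<gamma> 0 = velocity N (\<Phi> x) 0" by (rule velocity_cong[OF I \<gamma>(2) eq])
    ultimately have "velocity N (\<Phi> x) 0 c = Y x c" by simp
    moreover have "velocity N (\<Phi> x) 0 \<in> tangent_space N x"
      using velocity_tangent[OF N velocity_smooth_flow(1)[OF N \<Phi> True, of 0]] x0 by simp
    ultimately have "velocity N (\<Phi> x) 0 = Y x"
      by (intro tangent_space_eqI[OF _ vector_field_tangent[OF Y(1) True] c])
    then show ?thesis using True by (simp add: flow_field_def)
  next
    case False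
    then show ?thesis using Y(1) by (simp add: flow_field_def vector_field_def)
  qed
qed

text \<open>The common evaluation of the descriptions of \<open>canonical_lift\<close>,
  \<open>section_field\<close> and \<open>assoc_field\<close>. The predicate may impose further
  conditions, which are verified for the flow field and ignored for uniqueness.\<close>

lemma the_flow_field:
  assumes N: "smfd N" and H: "Hausdorff_space (mtop N)" and \<Phi>: "smooth_flow N \<Phi>"
    and X: "vector_field N (flow_field N \<Phi>)" "P (flow_field N \<Phi>)"
    and P: "\<And>Y. P Y \<Longrightarrow> vector_field N Y \<and> (\<forall>t. flow_dom N Y t = points N) \<and> (\<forall>t. \<forall>x\<in>points N. flow N Y t x = \<Phi> x t)"
  shows "(THE Y. P Y) = flow_field N \<Phi>"
proof (rule the_equality[where P=P, OF X(2)])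
  fix Y assume "P Y"
  from P[OF this] show "Y = flow_field N \<Phi>" by (intro flow_field_unique[OF N H \<Phi>]) auto
qed

text \<open>Only the value and the velocity of a curve matter after a smooth map, since
  \<open>tangent_map\<close> depends on nothing else. It allows one curve to be exchanged for
  another.\<close>

lemma velocity_map_cong:
  assumes M: "smfd M" and N: "smfd N" and \<gamma>: "smooth_at vec_mfd M \<gamma> t" and \<delta>: "smooth_at vec_mfd M \<delta> u"
    and eq: "\<gamma> t = \<delta> u" "velocity M \<gamma> t = velocity M \<delta> u" and f: "smooth_at M N f (\<gamma> t)"
  shows "velocity N (\<lambda>s. f (\<gamma> s)) t = velocity N (\<lambda>s. f (\<delta> s)) u"
  using tangent_map_velocity[OF M N \<gamma> f] tangent_map_velocity[OF M N \<delta>, of f] f eq by simp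

section \<open>Curves near time 0 and velocities in vector spaces\<close>

lemma smooth_curve_points:
  fixes \<gamma> :: "real \<Rightarrow> 'a" and M :: "('a, 'e::real_inner) mfd"
  assumes M: "smfd M" and \<gamma>: "smooth_at vec_mfd M \<gamma> t"
  obtains W where "open W" "t \<in> W" "\<And>s. s \<in> W \<Longrightarrow> \<gamma> s \<in> points M"
proof -
  have "\<gamma> t \<in> points M" using smooth_at_points[OF smfd_vec(1)[OF finite_dim_real] M \<gamma>] by blast
  then obtain c where c: "c \<in> charts_at M (\<gamma> t)" by (rule smfd_ex_chart[OF M])
  then have cM: "is_chart (points M) c" using smfd_chart[OF M] unfolding charts_at_def by blast
  show thesis
  proof (rule smooth_curve_chart[OF M \<gamma> c])
    fix W assume "open W" "t \<in> W" "\<And>s. s \<in> W \<Longrightarrow> \<gamma> s \<in> fst c"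
    then show thesis using chart_subset[OF cM] by (intro that[of W]) auto
  qed
qed

lemma smooth_curve_at_0D:
  fixes M :: "('a, 'e::real_inner) mfd"
  assumes M: "smfd M" and \<gamma>: "smooth_curve_at_0 M \<gamma>"
  shows "smooth_at vec_mfd M \<gamma> 0"
proof -
  obtain \<epsilon> :: real where \<epsilon>: "\<epsilon> > 0" "smooth_map (open_sub vec_mfd {-\<epsilon><..<\<epsilon>}) M \<gamma>"
    using \<gamma> unfolding smooth_curve_at_0_def by blast
  note V = smfd_vec(1)[OF finite_dim_real]
  have o: "openin (mtop vec_mfd) {-\<epsilon><..<\<epsilon>}" by (simp add: openin_mtop_vec[OF finite_dim_real])
  have "smooth_at (open_sub vec_mfd {-\<epsilon><..<\<epsilon>}) M \<gamma> 0"
    using \<epsilon> unfolding smooth_map_iff[OF smfd_open_sub[OF V o] M] by (simp add: open_sub_def)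
  then show ?thesis using smooth_at_open_sub[OF V M o] \<epsilon>(1) by simp
qed

lemma smooth_curve_at_0I:
  fixes M :: "('a, 'e::real_inner) mfd"
  assumes M: "smfd M" and \<gamma>: "\<And>t. smooth_at vec_mfd M \<gamma> t"
  shows "smooth_curve_at_0 M \<gamma>"
proof -
  note V = smfd_vec(1)[OF finite_dim_real]
  have o: "openin (mtop vec_mfd) {-1<..<1::real}" by (simp add: openin_mtop_vec[OF finite_dim_real])
  have "smooth_map (open_sub vec_mfd {-1<..<1}) M \<gamma>"
    unfolding smooth_map_iff[OF smfd_open_sub[OF V o] M]
    using smooth_at_open_sub[OF V M o] \<gamma> by (simp add: open_sub_def)
  then show ?thesis unfolding smooth_curve_at_0_def by (intro exI[of _ 1]) simp
qed

lemma vec_velocity: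
  fixes \<gamma> :: "real \<Rightarrow> 'v::real_inner"
  assumes "finite_dim TYPE('v)" "(\<gamma> has_vector_derivative w) (at t)"
  shows "velocity vec_mfd \<gamma> t (UNIV, id) = w"
  using assms(2) by (intro velocity_eqI vec_charts_at assms(1)) simp

text \<open>\<open>vpr\<close> is described through straight lines. The curve has the velocity of
  its tangent line, and the identity chart shows that the direction is unique.\<close>

lemma vpr_eq:
  fixes \<gamma> :: "real \<Rightarrow> 'v::real_inner"
  assumes fd: "finite_dim TYPE('v)" and \<gamma>: "smooth_at vec_mfd vec_mfd \<gamma> 0" "(\<gamma> has_vector_derivative w) (at 0)"
  shows "vpr (velocity vec_mfd \<gamma> 0) = w"
  unfolding vpr_def
proof (rule the_equality)
  note V = smfd_vec(1)[OF fd]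
  have line: "velocity vec_mfd (\<lambda>t. v + t *\<^sub>R u) 0 (UNIV, id) = u" for v u :: 'v
    by (rule vec_velocity[OF fd]) (auto intro!: derivative_eq_intros)
  show "\<exists>v. velocity vec_mfd \<gamma> 0 = velocity vec_mfd (\<lambda>t. v + t *\<^sub>R w) 0"
  proof
    have "smooth_on UNIV (\<lambda>t::real. \<gamma> 0 + t *\<^sub>R w)"
      by (intro smooth_on_add smooth_on_const smooth_on_bounded_linear[OF bounded_linear_scaleR_left] smooth_on_id open_UNIV)
    then have s: "smooth_at vec_mfd vec_mfd (\<lambda>t::real. \<gamma> 0 + t *\<^sub>R w) 0"
      unfolding smooth_at_vec_vec[OF finite_dim_real fd] by blast
    show "velocity vec_mfd \<gamma> 0 = velocity vec_mfd (\<lambda>t. \<gamma> 0 + t *\<^sub>R w) 0"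
    proof (rule tangent_space_eqI[OF velocity_tangent[OF V \<gamma>(1)] _ vec_charts_at[OF fd]])
      show "velocity vec_mfd (\<lambda>t. \<gamma> 0 + t *\<^sub>R w) 0 \<in> tangent_space vec_mfd (\<gamma> 0)"
        using velocity_tangent[OF V s] by simp
      show "velocity vec_mfd \<gamma> 0 (UNIV, id) = velocity vec_mfd (\<lambda>t. \<gamma> 0 + t *\<^sub>R w) 0 (UNIV, id)"
        unfolding line by (rule vec_velocity[OF fd \<gamma>(2)])
    qed
  qed
  fix u assume "\<exists>v. velocity vec_mfd \<gamma> 0 = velocity vec_mfd (\<lambda>t. v + t *\<^sub>R u) 0"
  then obtain v where "velocity vec_mfd \<gamma> 0 = velocity vec_mfd (\<lambda>t. v + t *\<^sub>R u) 0" by blast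
  then show "u = w" using line[of v u] vec_velocity[OF fd \<gamma>(2)] by simp
qed

section \<open>Lie groups\<close>

text \<open>One-parameter subgroups, with smoothness in the pointwise form.\<close>

definition oneps :: "('g, 'l::real_inner) lie_group_data \<Rightarrow> (real \<Rightarrow> 'g) \<Rightarrow> bool" where
  "oneps G \<gamma> \<longleftrightarrow> (\<forall>t. smooth_at vec_mfd (lmfd G) \<gamma> t) \<and> (\<forall>s t. \<gamma> (s + t) = \<gamma> s \<otimes>\<^bsub>lgrp G\<^esub> \<gamma> t)"

text \<open>This is t \<mapsto> exp(t \<xi>), meaningful for \<xi> in the tangent space at the unit;
  existence and uniqueness are shown below.\<close>

definition oneps_of :: "('g, 'l::real_inner) lie_group_data \<Rightarrow> ('g, 'l) tvec \<Rightarrow> real \<Rightarrow> 'g" where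
  "oneps_of G \<xi> = (SOME \<gamma>. oneps G \<gamma> \<and> velocity (lmfd G) \<gamma> 0 = \<xi>)"

locale lie_grp =
  fixes G :: "('g, 'l::real_inner) lie_group_data"
  assumes lie: "lie_group G"
begin

abbreviation lmult (infixl "\<cdot>" 70) where "lmult \<equiv> mult (lgrp G)"
abbreviation lone ("\<e>") where "lone \<equiv> one (lgrp G)"
abbreviation linv where "linv \<equiv> m_inv (lgrp G)"
abbreviation "TG \<equiv> tangent_space (lmfd G) \<e>"

sublocale group "lgrp G"
  using lie by (simp add: lie_group_def)

lemma smfd_G: "smfd (lmfd G)"
  and Hausdorff_G: "Hausdorff_space (mtop (lmfd G))"
  and points_G: "points (lmfd G) = carrier (lgrp G)"
  using lie manifold_smfd manifold_Hausdorff by (auto simp: lie_group_def)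

lemma fd_G: "finite_dim TYPE('l)"
  by (rule smfd_finite_dim[OF smfd_G])

lemma smooth_mult:
  assumes K: "smfd K" and f: "smooth_at K (lmfd G) f x" and g: "smooth_at K (lmfd G) g x"
  shows "smooth_at K (lmfd G) (\<lambda>x. f x \<cdot> g x) x"
proof -
  note P = smfd_prod(1)[OF smfd_G smfd_G]
  have p: "smooth_at K (prod_mfd (lmfd G) (lmfd G)) (\<lambda>x. (f x, g x)) x"
    by (rule smooth_at_Pair[OF K smfd_G smfd_G f g])
  have "smooth_at (prod_mfd (lmfd G) (lmfd G)) (lmfd G) (\<lambda>(g, h). g \<cdot> h) (f x, g x)"
    using lie smooth_at_points[OF K P p] unfolding lie_group_def smooth_map_iff[OF P smfd_G] by blast
  from smooth_at_compose[OF K P smfd_G p this] show ?thesis by simp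
qed

lemma smooth_inv:
  assumes K: "smfd K" and f: "smooth_at K (lmfd G) f x"
  shows "smooth_at K (lmfd G) (\<lambda>x. linv (f x)) x"
proof -
  have "smooth_at (lmfd G) (lmfd G) (\<lambda>g. linv g) (f x)"
    using lie smooth_at_points[OF K smfd_G f] unfolding lie_group_def smooth_map_iff[OF smfd_G smfd_G] by blast
  from smooth_at_compose[OF K smfd_G smfd_G f this] show ?thesis .
qed

lemma smooth_const_G: "smfd K \<Longrightarrow> x \<in> points K \<Longrightarrow> g \<in> carrier (lgrp G) \<Longrightarrow> smooth_at K (lmfd G) (\<lambda>_. g) x"
  by (intro smooth_at_const smfd_G) (simp_all add: points_G)

lemma smooth_id_G: "g \<in> carrier (lgrp G) \<Longrightarrow> smooth_at (lmfd G) (lmfd G) (\<lambda>x. x) g"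
  by (intro smooth_at_id smfd_G) (simp add: points_G)

lemma smooth_curve_mult:
  "smooth_at vec_mfd (lmfd G) \<gamma> (t::real) \<Longrightarrow> g \<in> carrier (lgrp G) \<Longrightarrow> smooth_at vec_mfd (lmfd G) (\<lambda>s. g \<cdot> \<gamma> s) t"
  by (intro smooth_mult smooth_const_G smfd_vec(1) finite_dim_real) simp_all

lemma smooth_left_mult: "g \<in> carrier (lgrp G) \<Longrightarrow> h \<in> carrier (lgrp G) \<Longrightarrow> smooth_at (lmfd G) (lmfd G) (\<lambda>x. g \<cdot> x) h"
  by (intro smooth_mult smooth_const_G smooth_id_G smfd_G) (simp_all add: points_G)

text \<open>The left-invariant field generated by \<beta>: its value is a partial derivative of the
  multiplication in the fixed direction of \<beta>, hence \<open>smooth_at_velocity_param\<close>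
  with a constant family of curves.\<close>

lemma smooth_left_field:
  assumes \<beta>: "smooth_at vec_mfd (lmfd G) \<beta> 0" "\<beta> 0 = \<e>" and g: "g \<in> carrier (lgrp G)"
    and e: "e \<in> charts_at (lmfd G) g"
  shows "smooth_at (lmfd G) vec_mfd (\<lambda>x. velocity (lmfd G) (\<lambda>s. x \<cdot> \<beta> s) 0 e) g"
proof -
  note P = smfd_prod(1)[OF smfd_G smfd_G]
  have e1: "\<e> \<in> points (lmfd G)" by (simp add: points_G)
  obtain d where d: "d \<in> charts_at (lmfd G) \<e>" by (rule smfd_ex_chart[OF smfd_G e1])
  have z: "(g, \<e>) \<in> points (lmfd G) \<times> points (lmfd G)" using g by (simp add: points_G)
  have "smooth_at (lmfd G) vec_mfd (\<lambda>x. velocity (lmfd G) (\<lambda>s. (\<lambda>z. fst z \<cdot> snd z) (x, \<beta> s)) 0 e) g"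
  proof (rule smooth_at_velocity_param[where K="lmfd G" and \<Gamma>="\<lambda>_. \<beta>" and ?k0.0="\<e>", OF smfd_G smfd_G smfd_G _ openin_points[OF smfd_G] _ _ d])
    show "smooth_at (prod_mfd (lmfd G) (lmfd G)) (lmfd G) (\<lambda>z. fst z \<cdot> snd z) (g, \<e>)"
      by (intro smooth_mult P smooth_at_fst smooth_at_snd smfd_G z)
    show "e \<in> charts_at (lmfd G) ((\<lambda>z. fst z \<cdot> snd z) (g, \<e>))" using e g by simp
    show "smooth_at (lmfd G) vec_mfd (\<lambda>x. velocity (lmfd G) \<beta> 0 d) g"
      by (rule smooth_at_const[OF smfd_G smfd_vec(1)[OF fd_G]]) (simp_all add: points_G g)
  qed (use g \<beta> in \<open>simp_all add: points_G\<close>)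
  then show ?thesis by simp
qed

text \<open>Left translates of integral curves of a left-invariant field are again integral
  curves.\<close>

lemma velocity_left_mult:
  assumes \<gamma>: "smooth_at vec_mfd (lmfd G) \<gamma> t" and \<beta>: "smooth_at vec_mfd (lmfd G) \<beta> 0" "\<beta> 0 = \<e>"
    and g: "g \<in> carrier (lgrp G)" and h: "velocity (lmfd G) \<gamma> t = velocity (lmfd G) (\<lambda>s. \<gamma> t \<cdot> \<beta> s) 0"
  shows "velocity (lmfd G) (\<lambda>s. g \<cdot> \<gamma> s) t = velocity (lmfd G) (\<lambda>s. (g \<cdot> \<gamma> t) \<cdot> \<beta> s) 0"
proof -
  have gt: "\<gamma> t \<in> carrier (lgrp G)" using smooth_at_points[OF smfd_vec(1)[OF finite_dim_real] smfd_G \<gamma>] by (simp add: points_G)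
  have "velocity (lmfd G) (\<lambda>s. g \<cdot> \<gamma> s) t = velocity (lmfd G) (\<lambda>s. g \<cdot> (\<gamma> t \<cdot> \<beta> s)) 0"
    by (rule velocity_map_cong[OF smfd_G smfd_G \<gamma> smooth_curve_mult[OF \<beta>(1) gt] _ h smooth_left_mult[OF g gt]])
      (simp add: \<beta> gt)
  \<comment> \<open>Associativity holds on the carrier, where \<beta> is known to lie near time 0
    only; the curves are therefore compared on a neighbourhood of 0.\<close>
  also have "\<dots> = velocity (lmfd G) (\<lambda>s. (g \<cdot> \<gamma> t) \<cdot> \<beta> s) 0"
  proof (rule smooth_curve_points[OF smfd_G \<beta>(1)])
    fix W assume W: "open W" "(0::real) \<in> W" "\<And>s. s \<in> W \<Longrightarrow> \<beta> s \<in> points (lmfd G)"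
    show ?thesis by (rule velocity_cong[OF W(1,2)]) (use W(3) g gt in \<open>simp add: points_G m_assoc\<close>)
  qed
  finally show ?thesis .
qed

subsection \<open>One-parameter subgroups\<close>

lemma oneps_carrier: "oneps G \<gamma> \<Longrightarrow> \<gamma> t \<in> carrier (lgrp G)"
  using smooth_at_points[OF smfd_vec(1)[OF finite_dim_real] smfd_G, of \<gamma> t] by (simp add: oneps_def points_G)

lemma oneps_add: "oneps G \<gamma> \<Longrightarrow> \<gamma> (s + t) = \<gamma> s \<cdot> \<gamma> t"
  by (simp add: oneps_def)

lemma oneps_smooth: "oneps G \<gamma> \<Longrightarrow> smooth_at vec_mfd (lmfd G) \<gamma> t"
  by (simp add: oneps_def)

lemma oneps_0: "oneps G \<gamma> \<Longrightarrow> \<gamma> 0 = \<e>"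
  using oneps_add[of \<gamma> 0 0] oneps_carrier[of \<gamma> 0] l_cancel_one[of "\<gamma> 0" "\<gamma> 0"] by simp

lemma oneps_velocity:
  assumes "oneps G \<gamma>"
  shows "velocity (lmfd G) \<gamma> t = velocity (lmfd G) (\<lambda>s. \<gamma> t \<cdot> \<gamma> s) 0"
  using velocity_affine[OF smfd_G, of \<gamma> t 1 0] oneps_smooth[OF assms, of t]
  by (simp add: oneps_add[OF assms])

text \<open>Right translations by a one-parameter subgroup; the field they generate is
  left-invariant.\<close>

lemma smooth_flow_oneps: "oneps G \<gamma> \<Longrightarrow> smooth_flow (lmfd G) (\<lambda>g t. g \<cdot> \<gamma> t)"
  unfolding smooth_flow_def points_G
  by (auto simp: oneps_0 oneps_add oneps_carrier m_assoc intro: smooth_curve_mult oneps_smooth)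

text \<open>Both are integral curves through the unit of the left-invariant field of \<gamma>,
  because the velocity of a one-parameter subgroup at \<open>t\<close> is the left translate of its
  initial velocity.\<close>

lemma oneps_unique:
  assumes \<gamma>: "oneps G \<gamma>" and \<delta>: "oneps G \<delta>" and eq: "velocity (lmfd G) \<gamma> 0 = velocity (lmfd G) \<delta> 0"
  shows "\<gamma> = \<delta>"
proof
  fix t
  let ?X = "flow_field (lmfd G) (\<lambda>g t. g \<cdot> \<gamma> t)"
  note F = smooth_flow_oneps[OF \<gamma>]
  have X: "vector_field (lmfd G) ?X"
  proof (rule flow_field_vector_field[OF smfd_G F])
    fix g assume g: "g \<in> points (lmfd G)"
    obtain c where c: "c \<in> charts_at (lmfd G) g" by (rule smfd_ex_chart[OF smfd_G g])
    show "\<exists>c\<in>charts_at (lmfd G) g. smooth_at (lmfd G) vec_mfd (\<lambda>y. velocity (lmfd G) (\<lambda>t. y \<cdot> \<gamma> t) 0 c) g"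
      using smooth_left_field[OF oneps_smooth[OF \<gamma>] oneps_0[OF \<gamma>] _ c] c g by (auto simp: points_G)
  qed
  have 1: "integral_curve (lmfd G) ?X UNIV \<gamma>"
    using integral_curve_smooth_flow[OF smfd_G F, of "\<e>"] oneps_carrier[OF \<gamma>] by (simp add: points_G)
  have 2: "integral_curve (lmfd G) ?X UNIV \<delta>"
  proof (rule integral_curveI[OF smfd_G open_UNIV is_interval_univ], intro conjI oneps_smooth[OF \<delta>])
    fix t
    have "velocity (lmfd G) \<delta> t = velocity (lmfd G) (\<lambda>s. \<delta> t \<cdot> \<delta> s) 0" by (rule oneps_velocity[OF \<delta>])
    also have "\<dots> = velocity (lmfd G) (\<lambda>s. \<delta> t \<cdot> \<gamma> s) 0"
      by (rule velocity_map_cong[OF smfd_G smfd_G oneps_smooth[OF \<delta>] oneps_smooth[OF \<gamma>]])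
        (use eq \<gamma> \<delta> in \<open>simp_all add: oneps_0 oneps_carrier smooth_left_mult\<close>)
    finally show "velocity (lmfd G) \<delta> t = ?X (\<delta> t)" by (simp add: flow_field_def points_G oneps_carrier[OF \<delta>])
  qed
  show "\<gamma> t = \<delta> t"
    by (rule integral_curve_unique[OF smfd_G Hausdorff_G X 1 2, of 0]) (simp_all add: oneps_0 \<gamma> \<delta>)
qed

text \<open>A local homomorphism from the line extends by divisibility: any real becomes small after
  division by an integer, and the group power undoes the division.\<close>

lemma local_oneps_extends:
  assumes \<delta>: "\<delta> > 0" and J: "J = {-\<delta><..<\<delta>}"
    and sm: "\<And>t. t \<in> J \<Longrightarrow> smooth_at vec_mfd (lmfd G) \<gamma> t"
    and hom: "\<And>s t. s \<in> J \<Longrightarrow> t \<in> J \<Longrightarrow> s + t \<in> J \<Longrightarrow> \<gamma> (s + t) = \<gamma> s \<cdot> \<gamma> t"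
  obtains \<Gamma> where "oneps G \<Gamma>" "\<And>t. t \<in> J \<Longrightarrow> \<Gamma> t = \<gamma> t"
proof -
  note V = smfd_vec(1)[OF finite_dim_real]
  have ca: "\<gamma> t \<in> carrier (lgrp G)" if "t \<in> J" for t
    using smooth_at_points[OF V smfd_G sm[OF that]] by (simp add: points_G)
  have J0: "0 \<in> J" using \<delta> by (simp add: J)
  have g0: "\<gamma> 0 = \<e>" using hom[OF J0 J0] J0 ca[OF J0] l_cancel_one[of "\<gamma> 0" "\<gamma> 0"] by simp
  have sc: "k * u \<in> J" if "u \<in> J" "0 \<le> k" "k \<le> 1" for k u
  proof -
    have "\<bar>k * u\<bar> \<le> 1 * \<bar>u\<bar>" unfolding abs_mult using that by (intro mult_right_mono) auto
    then show ?thesis using that(1) unfolding J by (simp add: abs_le_iff) linarith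
  qed
  have pw: "\<gamma> u = \<gamma> (u / real M) [^]\<^bsub>lgrp G\<^esub> M" if u: "u \<in> J" and M: "M \<ge> 1" for u and M :: nat
  proof -
    have uM: "u / real M \<in> J" using sc[OF u, of "1 / real M"] M by simp
    have "k \<le> M \<Longrightarrow> \<gamma> (real k / real M * u) = \<gamma> (u / real M) [^]\<^bsub>lgrp G\<^esub> k" for k
    proof (induction k)
      case 0
      show ?case by (simp add: g0)
    next
      case (Suc k)
      have e: "real (Suc k) / real M * u = real k / real M * u + u / real M"
        by (simp add: add_divide_distrib distrib_right)
      have "real k / real M * u \<in> J" "real (Suc k) / real M * u \<in> J" using Suc.prems M by (intro sc[OF u]; simp)+
      then have "\<gamma> (real (Suc k) / real M * u) = \<gamma> (real k / real M * u) \<cdot> \<gamma> (u / real M)"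
        unfolding e using uM by (intro hom) auto
      then show ?case using Suc by simp
    qed
    from this[of M] show ?thesis using M by simp
  qed
  \<comment> \<open>Adding 1 after rounding up makes |t| / \<delta> strictly smaller than
    \<open>N t\<close>, as the open interval demands, and makes \<open>N t\<close> positive.\<close>
  define N where "N t = nat \<lceil>\<bar>t\<bar> / \<delta>\<rceil> + 1" for t :: real
  have NJ: "s / real (N t) \<in> J" if "\<bar>s\<bar> \<le> \<bar>t\<bar>" for s t
  proof -
    have "\<bar>t\<bar> / \<delta> < real (N t)" unfolding N_def by linarith
    then have "\<bar>t\<bar> < real (N t) * \<delta>" using \<delta> by (simp add: pos_divide_less_eq)
    then have "\<bar>s\<bar> < real (N t) * \<delta>" using that by simp
    moreover have "real (N t) > 0" by (simp add: N_def)
    ultimately have "\<bar>s / real (N t)\<bar> < \<delta>" by (simp add: pos_divide_less_eq mult.commute)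
    then show ?thesis unfolding J greaterThanLessThan_iff abs_less_iff by linarith
  qed
  have N1: "N t \<ge> 1" for t by (simp add: N_def)
  \<comment> \<open>\<open>\<gamma> (t/N)\<^sup>N\<close> does not depend on \<open>N\<close>, as long as \<open>t/N\<close> lies in \<open>J\<close>.\<close>
  define \<Gamma> where "\<Gamma> t = \<gamma> (t / real (N t)) [^]\<^bsub>lgrp G\<^esub> N t" for t
  have indep: "\<Gamma> t = \<gamma> (t / real M) [^]\<^bsub>lgrp G\<^esub> M" if M: "M \<ge> 1" "t / real M \<in> J" for t and M :: nat
  proof -
    have tN: "t / real (N t) \<in> J" by (rule NJ) simp
    \<comment> \<open>Both powers are compared with a common refinement: the value at t / (N M),
      raised to the power N M.\<close>
    have tNM: "t / real (N t) / real M \<in> J" using sc[OF tN, of "1 / real M"] M(1) by (simp add: mult.commute)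
    have "\<gamma> (t / real (N t)) = \<gamma> (t / real (N t) / real M) [^]\<^bsub>lgrp G\<^esub> M" by (rule pw[OF tN M(1)])
    moreover have "\<gamma> (t / real M) = \<gamma> (t / real M / real (N t)) [^]\<^bsub>lgrp G\<^esub> N t" by (rule pw[OF M(2) N1])
    moreover have "t / real M / real (N t) = t / real (N t) / real M" by (simp add: mult.commute)
    ultimately show ?thesis unfolding \<Gamma>_def using ca[OF tNM] by (simp add: nat_pow_pow mult.commute)
  qed
  have \<Gamma>J: "\<Gamma> t = \<gamma> t" if "t \<in> J" for t using indep[of 1 t] that ca[OF that] by simp
  have \<Gamma>c: "\<Gamma> t \<in> carrier (lgrp G)" for t unfolding \<Gamma>_def by (intro nat_pow_closed ca NJ) simp
  have \<Gamma>h: "\<Gamma> (s + t) = \<Gamma> s \<cdot> \<Gamma> t" for s t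
  proof -
    \<comment> \<open>One exponent for \<open>s\<close>, \<open>t\<close> and \<open>s + t\<close>.
      The values at s / M and t / M commute, both products being the value at (s + t) / M, so the
      power of the product splits.\<close>
    define M where "M = N (\<bar>s\<bar> + \<bar>t\<bar>)"
    have m: "s / real M \<in> J" "t / real M \<in> J" "(s + t) / real M \<in> J" unfolding M_def by (rule NJ; simp)+
    have M1: "M \<ge> 1" unfolding M_def by (rule N1)
    have st: "(s + t) / real M = s / real M + t / real M" "(s + t) / real M = t / real M + s / real M"
      by (simp_all add: add_divide_distrib)
    have h1: "\<gamma> ((s + t) / real M) = \<gamma> (s / real M) \<cdot> \<gamma> (t / real M)"
      using hom[OF m(1,2)] m(3) unfolding st(1) by simp
    moreover have "\<gamma> ((s + t) / real M) = \<gamma> (t / real M) \<cdot> \<gamma> (s / real M)"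
      using hom[OF m(2,1)] m(3) unfolding st(2) by simp
    ultimately have "\<gamma> (s / real M) \<cdot> \<gamma> (t / real M) = \<gamma> (t / real M) \<cdot> \<gamma> (s / real M)" by simp
    from pow_mult_distrib[OF this ca[OF m(1)] ca[OF m(2)]]
    show ?thesis unfolding indep[OF M1 m(1)] indep[OF M1 m(2)] indep[OF M1 m(3)] h1 .
  qed
  have "smooth_at vec_mfd (lmfd G) \<Gamma> t" for t
  proof -
    \<comment> \<open>Smoothness is carried from 0 to \<open>t\<close> by left translation: near
      \<open>t\<close>, the extension is its value at \<open>t\<close> times \<gamma> (s -
      t).\<close>
    have "smooth_at vec_mfd (lmfd G) (\<lambda>s. \<gamma> (- t + 1 * s)) t"
      by (rule smooth_at_affine_curve[OF smfd_G]) (use sm[OF J0] in simp)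
    from smooth_curve_mult[OF this \<Gamma>c[of t]]
    have 1: "smooth_at vec_mfd (lmfd G) (\<lambda>s. \<Gamma> t \<cdot> \<gamma> (- t + 1 * s)) t" .
    let ?U = "{t - \<delta><..<t + \<delta>}"
    have "openin (mtop vec_mfd) ?U" "t \<in> ?U" using \<delta> by (simp_all add: openin_mtop_vec[OF finite_dim_real])
    then show ?thesis
    proof (rule smooth_at_cong[OF V 1])
      fix s assume "s \<in> ?U"
      then have "- t + s \<in> J" by (auto simp: J)
      then show "\<Gamma> t \<cdot> \<gamma> (- t + 1 * s) = \<Gamma> s" using \<Gamma>h[of t "- t + s"] \<Gamma>J[of "- t + s"] by simp
    qed
  qed
  then show ?thesis using that[of \<Gamma>] \<Gamma>h \<Gamma>J by (simp add: oneps_def)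
qed

text \<open>Take the integral curve through the unit of the left-invariant field with value \<xi>.
  Shifting it in time and translating it from the left give integral curves with the same start, so
  it is a local homomorphism, which then extends.\<close>

lemma oneps_exists:
  assumes \<xi>: "\<xi> \<in> TG"
  obtains \<gamma> where "oneps G \<gamma>" "velocity (lmfd G) \<gamma> 0 = \<xi>"
proof -
  note V = smfd_vec(1)[OF finite_dim_real]
  have e1: "\<e> \<in> points (lmfd G)" by (simp add: points_G)
  obtain \<beta> :: "real \<Rightarrow> 'g" where \<beta>: "smooth_at vec_mfd (lmfd G) \<beta> 0" "\<beta> 0 = \<e>" "velocity (lmfd G) \<beta> 0 = \<xi>"
    by (rule tangent_vector_velocity[OF smfd_G e1 \<xi>])
  define X where "X g = (if g \<in> points (lmfd G) then velocity (lmfd G) (\<lambda>s. g \<cdot> \<beta> s) 0 else (\<lambda>_. 0))" for g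
  have X: "vector_field (lmfd G) X"
  proof (rule vector_fieldI[OF smfd_G])
    fix g assume g: "g \<in> points (lmfd G)"
    then have g': "g \<in> carrier (lgrp G)" by (simp add: points_G)
    show "X g \<in> tangent_space (lmfd G) g"
      using velocity_tangent[OF smfd_G smooth_curve_mult[OF \<beta>(1) g']] g g' \<beta>(2) by (simp add: X_def)
    obtain c where c: "c \<in> charts_at (lmfd G) g" by (rule smfd_ex_chart[OF smfd_G g])
    have "smooth_at (lmfd G) vec_mfd (\<lambda>y. X y c) g"
      by (rule smooth_at_cong[OF smfd_G smooth_left_field[OF \<beta>(1,2) g' c] openin_points[OF smfd_G] g]) (simp add: X_def)
    then show "\<exists>c\<in>charts_at (lmfd G) g. smooth_at (lmfd G) vec_mfd (\<lambda>y. X y c) g" using c by blast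
  qed (simp add: X_def)
  obtain \<epsilon> \<gamma> where \<epsilon>: "\<epsilon> > 0" and \<gamma>: "integral_curve (lmfd G) X {-\<epsilon><..<\<epsilon>} \<gamma>" "\<gamma> 0 = \<e>"
    "\<And>t. t \<in> {-\<epsilon><..<\<epsilon>} \<Longrightarrow> smooth_at vec_mfd (lmfd G) \<gamma> t \<and> velocity (lmfd G) \<gamma> t = X (\<gamma> t)"
    using integral_curve_exists[OF smfd_G X e1] by metis
  \<comment> \<open>Half the interval, so that sums of two times in \<open>J\<close> stay in the
    domain of \<gamma>.\<close>
  define J where "J = {-(\<epsilon>/2)<..<\<epsilon>/2}"
  have JI: "t \<in> {-\<epsilon><..<\<epsilon>}" if "t \<in> J" for t using that \<epsilon> by (auto simp: J_def)
  have JJ: "s + t \<in> {-\<epsilon><..<\<epsilon>}" if "s \<in> J" "t \<in> J" for s t using that by (auto simp: J_def)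
  have J: "open J" "is_interval J" "0 \<in> J" using \<epsilon> by (simp_all add: J_def is_interval_oo)
  have ca: "\<gamma> t \<in> carrier (lgrp G)" if "t \<in> J" for t
    using integral_curve_points[OF smfd_G \<gamma>(1) JI[OF that]] by (simp add: points_G)
  have hom: "\<gamma> (s + t) = \<gamma> s \<cdot> \<gamma> t" if s: "s \<in> J" and t: "t \<in> J" for s t
  proof -
    have 1: "integral_curve (lmfd G) X J (\<lambda>t. \<gamma> (s + t))"
      by (rule integral_curve_shift[OF \<gamma>(1) J(1,2) JJ[OF s]])
    have 2: "integral_curve (lmfd G) X J (\<lambda>t. \<gamma> s \<cdot> \<gamma> t)"
    proof (rule integral_curveI[OF smfd_G J(1,2)])
      fix u assume u: "u \<in> J"
      note g = \<gamma>(3)[OF JI[OF u]]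
      have "velocity (lmfd G) \<gamma> u = velocity (lmfd G) (\<lambda>s. \<gamma> u \<cdot> \<beta> s) 0"
        using g ca[OF u] by (simp add: X_def points_G)
      from velocity_left_mult[OF conjunct1[OF g] \<beta>(1,2) ca[OF s] this]
      show "smooth_at vec_mfd (lmfd G) (\<lambda>t. \<gamma> s \<cdot> \<gamma> t) u \<and> velocity (lmfd G) (\<lambda>t. \<gamma> s \<cdot> \<gamma> t) u = X (\<gamma> s \<cdot> \<gamma> u)"
        using smooth_curve_mult[OF conjunct1[OF g] ca[OF s]] ca[OF s] ca[OF u] by (simp add: X_def points_G)
    qed
    show ?thesis
      by (rule integral_curve_unique[OF smfd_G Hausdorff_G X 1 2, of 0]) (use J t \<gamma>(2) ca[OF s] in simp_all)
  qed
  have "\<epsilon> / 2 > 0" using \<epsilon> by simp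
  then obtain \<Gamma> where \<Gamma>: "oneps G \<Gamma>" "\<And>t. t \<in> J \<Longrightarrow> \<Gamma> t = \<gamma> t"
    using local_oneps_extends[OF _ J_def, of \<gamma>] hom \<gamma>(3) JI by metis
  have "velocity (lmfd G) \<Gamma> 0 = velocity (lmfd G) \<gamma> 0" by (rule velocity_cong[OF J(1,3) \<Gamma>(2)])
  also have "\<dots> = velocity (lmfd G) (\<lambda>s. \<e> \<cdot> \<beta> s) 0"
    using \<gamma>(2) \<gamma>(3)[OF JI[OF J(3)]] by (simp add: X_def points_G)
  also have "\<dots> = velocity (lmfd G) \<beta> 0"
  proof (rule smooth_curve_points[OF smfd_G \<beta>(1)])
    fix W assume W: "open W" "(0::real) \<in> W" "\<And>s. s \<in> W \<Longrightarrow> \<beta> s \<in> points (lmfd G)"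
    show ?thesis by (rule velocity_cong[OF W(1,2)]) (use W(3) in \<open>simp add: points_G\<close>)
  qed
  finally show ?thesis using that \<Gamma>(1) \<beta>(3) by simp
qed

lemma oneps_of:
  assumes "\<xi> \<in> TG"
  shows "oneps G (oneps_of G \<xi>)" "velocity (lmfd G) (oneps_of G \<xi>) 0 = \<xi>"
proof -
  have "\<exists>\<gamma>. oneps G \<gamma> \<and> velocity (lmfd G) \<gamma> 0 = \<xi>" using oneps_exists[OF assms] by blast
  from someI_ex[OF this] show "oneps G (oneps_of G \<xi>)" "velocity (lmfd G) (oneps_of G \<xi>) 0 = \<xi>"
    by (simp_all add: oneps_of_def)
qed

lemma oneps_of_eqI: "\<xi> \<in> TG \<Longrightarrow> oneps G \<gamma> \<Longrightarrow> velocity (lmfd G) \<gamma> 0 = \<xi> \<Longrightarrow> oneps_of G \<xi> = \<gamma>"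
  by (intro oneps_unique oneps_of) (simp_all add: oneps_of)

text \<open>The subgroup of \<xi>, run at speed \<open>t\<close>, has initial velocity t \<xi>, and
  its value at time 1 is exp(t \<xi>); uniqueness of one-parameter subgroups evaluates the
  description.\<close>

lemma lie_exp_scale:
  assumes \<xi>: "\<xi> \<in> TG"
  shows "lie_exp G (\<lambda>c. t *\<^sub>R \<xi> c) = oneps_of G \<xi> t"
proof -
  note o = oneps_of[OF \<xi>]
  let ?\<gamma> = "\<lambda>s. oneps_of G \<xi> (t * s)"
  have sm: "smooth_map vec_mfd (lmfd G) \<gamma> \<longleftrightarrow> (\<forall>t::real. smooth_at vec_mfd (lmfd G) \<gamma> t)" for \<gamma>
    by (simp add: smooth_map_iff[OF smfd_vec(1)[OF finite_dim_real] smfd_G])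
  have g: "oneps G ?\<gamma>" unfolding oneps_def
  proof (intro conjI allI)
    show "smooth_at vec_mfd (lmfd G) ?\<gamma> s" for s
      using smooth_at_affine_curve[OF smfd_G, of "oneps_of G \<xi>" 0 t s] oneps_smooth[OF o(1)] by simp
    show "oneps_of G \<xi> (t * (s + r)) = oneps_of G \<xi> (t * s) \<cdot> oneps_of G \<xi> (t * r)" for s r
      by (simp add: distrib_left oneps_add[OF o(1)])
  qed
  have v: "velocity (lmfd G) ?\<gamma> 0 = (\<lambda>c. t *\<^sub>R \<xi> c)"
    using velocity_affine[OF smfd_G, of "oneps_of G \<xi>" 0 t 0] oneps_smooth[OF o(1)] o(2) by simp
  show ?thesis unfolding lie_exp_def
  proof (rule the_equality)
    show "\<exists>\<gamma>. smooth_map vec_mfd (lmfd G) \<gamma> \<and> (\<forall>s t. \<gamma> (s + t) = \<gamma> s \<cdot> \<gamma> t) \<and>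
      velocity (lmfd G) \<gamma> 0 = (\<lambda>c. t *\<^sub>R \<xi> c) \<and> oneps_of G \<xi> t = \<gamma> 1"
    proof (intro exI[of _ ?\<gamma>] conjI)
      show "smooth_map vec_mfd (lmfd G) ?\<gamma>" unfolding sm using oneps_smooth[OF g] by blast
      show "\<forall>s r. ?\<gamma> (s + r) = ?\<gamma> s \<cdot> ?\<gamma> r" using oneps_add[OF g] by blast
    qed (simp_all add: v)
    fix x assume "\<exists>\<gamma>. smooth_map vec_mfd (lmfd G) \<gamma> \<and> (\<forall>s t. \<gamma> (s + t) = \<gamma> s \<cdot> \<gamma> t) \<and>
      velocity (lmfd G) \<gamma> 0 = (\<lambda>c. t *\<^sub>R \<xi> c) \<and> x = \<gamma> 1"
    then obtain \<gamma> where "oneps G \<gamma>" "velocity (lmfd G) \<gamma> 0 = (\<lambda>c. t *\<^sub>R \<xi> c)" "x = \<gamma> 1"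
      unfolding sm oneps_def by blast
    then show "x = oneps_of G \<xi> t" using oneps_unique[OF _ g, of \<gamma>] v by simp
  qed
qed

subsection \<open>The adjoint representation\<close>

lemma smooth_conj:
  assumes K: "smfd K" and "smooth_at K (lmfd G) f x" "smooth_at K (lmfd G) h x"
  shows "smooth_at K (lmfd G) (\<lambda>x. f x \<cdot> h x \<cdot> linv (f x)) x"
  by (intro smooth_mult smooth_inv assms)

lemma Ad_velocity:
  assumes g: "g \<in> carrier (lgrp G)" and \<beta>: "smooth_at vec_mfd (lmfd G) \<beta> 0" "\<beta> 0 = \<e>"
  shows "Ad G g (velocity (lmfd G) \<beta> 0) = velocity (lmfd G) (\<lambda>s. g \<cdot> \<beta> s \<cdot> linv g) 0"
proof -
  have "smooth_at (lmfd G) (lmfd G) (\<lambda>h. g \<cdot> h \<cdot> linv g) (\<beta> 0)"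
    using g by (intro smooth_conj smfd_G smooth_const_G smooth_id_G) (simp_all add: \<beta> points_G)
  from tangent_map_velocity[OF smfd_G smfd_G \<beta>(1) this] show ?thesis by (simp add: Ad_def \<beta>(2))
qed

lemma oneps_conj:
  assumes g: "g \<in> carrier (lgrp G)" and \<gamma>: "oneps G \<gamma>"
  shows "oneps G (\<lambda>s. g \<cdot> \<gamma> s \<cdot> linv g)"
  unfolding oneps_def
proof (intro conjI allI)
  show "smooth_at vec_mfd (lmfd G) (\<lambda>s. g \<cdot> \<gamma> s \<cdot> linv g) t" for t
    using g \<gamma> by (intro smooth_conj smooth_const_G oneps_smooth smfd_vec(1) finite_dim_real) simp_all
  fix s t
  have "linv g \<cdot> (g \<cdot> (\<gamma> t \<cdot> linv g)) = \<gamma> t \<cdot> linv g"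
    using g oneps_carrier[OF \<gamma>] by (simp add: m_assoc[symmetric])
  then show "g \<cdot> \<gamma> (s + t) \<cdot> linv g = (g \<cdot> \<gamma> s \<cdot> linv g) \<cdot> (g \<cdot> \<gamma> t \<cdot> linv g)"
    using g oneps_carrier[OF \<gamma>] by (simp add: oneps_add[OF \<gamma>] m_assoc)
qed

lemma Ad_oneps: "g \<in> carrier (lgrp G) \<Longrightarrow> \<xi> \<in> TG \<Longrightarrow> Ad G g \<xi> = velocity (lmfd G) (\<lambda>s. g \<cdot> oneps_of G \<xi> s \<cdot> linv g) 0"
  using Ad_velocity[of g "oneps_of G \<xi>"] oneps_of[of \<xi>] by (simp add: oneps_smooth oneps_0)

lemma Ad_closed:
  assumes "g \<in> carrier (lgrp G)" "\<xi> \<in> TG"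
  shows "Ad G g \<xi> \<in> TG"
  using velocity_tangent[OF smfd_G oneps_smooth[OF oneps_conj[OF assms(1) oneps_of(1)[OF assms(2)]]], of 0] assms
  by (simp add: Ad_oneps oneps_0 oneps_of)

text \<open>exp(s Ad g \<xi>) = g exp(s \<xi>) inv g, since the right side is a one-parameter
  subgroup with the initial velocity of the left.\<close>

lemma oneps_of_Ad:
  assumes "g \<in> carrier (lgrp G)" "\<xi> \<in> TG"
  shows "oneps_of G (Ad G g \<xi>) = (\<lambda>s. g \<cdot> oneps_of G \<xi> s \<cdot> linv g)"
  by (rule oneps_of_eqI[OF Ad_closed[OF assms] oneps_conj[OF assms(1) oneps_of(1)[OF assms(2)]]])
    (simp add: Ad_oneps assms)

lemma Ad_one: "\<xi> \<in> TG \<Longrightarrow> Ad G \<e> \<xi> = \<xi>"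
  using oneps_carrier[OF oneps_of(1)] by (simp add: Ad_oneps oneps_of)

text \<open>Iterated conjugation of the curve exp(s \<xi>); with \<open>oneps_of_Ad\<close> this
  becomes an identity in the group.\<close>

lemma Ad_mult:
  assumes "g \<in> carrier (lgrp G)" "h \<in> carrier (lgrp G)" "\<xi> \<in> TG"
  shows "Ad G (g \<cdot> h) \<xi> = Ad G g (Ad G h \<xi>)"
proof -
  have "Ad G g (Ad G h \<xi>) = velocity (lmfd G) (\<lambda>s. g \<cdot> (h \<cdot> oneps_of G \<xi> s \<cdot> linv h) \<cdot> linv g) 0"
    using assms by (simp add: Ad_oneps[OF assms(1) Ad_closed] oneps_of_Ad)
  also have "(\<lambda>s. g \<cdot> (h \<cdot> oneps_of G \<xi> s \<cdot> linv h) \<cdot> linv g) = (\<lambda>s. (g \<cdot> h) \<cdot> oneps_of G \<xi> s \<cdot> linv (g \<cdot> h))"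
    using assms oneps_carrier[OF oneps_of(1)[OF assms(3)]] by (simp add: m_assoc inv_mult_group)
  finally show ?thesis using assms by (simp add: Ad_oneps)
qed

text \<open>exp(t \<xi>) commutes with every exp(s \<xi>). This keeps \<open>xi\<close> constant
  along the orbits of the flow on \<open>P\<close>.\<close>

lemma Ad_oneps_self:
  assumes "\<xi> \<in> TG"
  shows "Ad G (linv (oneps_of G \<xi> t)) \<xi> = \<xi>"
proof -
  note o = oneps_of[OF assms] and c = oneps_carrier[OF oneps_of(1)[OF assms]]
  have "linv (oneps_of G \<xi> t) \<cdot> oneps_of G \<xi> s \<cdot> linv (linv (oneps_of G \<xi> t)) = oneps_of G \<xi> s" for s
  proof -
    have "oneps_of G \<xi> s \<cdot> oneps_of G \<xi> t = oneps_of G \<xi> t \<cdot> oneps_of G \<xi> s"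
      using oneps_add[OF o(1), of s t] oneps_add[OF o(1), of t s] by (simp add: add.commute)
    then show ?thesis using c by (simp add: m_assoc) (simp add: m_assoc[symmetric])
  qed
  then show ?thesis using o c by (simp add: Ad_oneps assms)
qed

lemma points_lie_alg: "points (lie_alg G) = TG"
  by (simp add: lie_alg_def Let_def generated_mfd_def)

text \<open>A coordinate at the unit is a bijection of the tangent space onto the model space,
  straight lines in the chart giving surjectivity. The transition between two such charts is the
  derivative at the unit of the transition in \<open>G\<close>: a linear map, hence smooth.\<close>

lemma smfd_lie_alg: "smfd (lie_alg G)"
  and lie_alg_chart_atlas: "c \<in> charts_at (lmfd G) \<e> \<Longrightarrow> (TG, \<lambda>\<xi>. \<xi> c) \<in> atlas (lie_alg G)"
proof -
  let ?C = "{(TG, \<lambda>\<xi>::('g, 'l) tvec. \<xi> c) |c. c \<in> charts_at (lmfd G) \<e>}"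
  have e1: "\<e> \<in> points (lmfd G)" by (simp add: points_G)
  have inj: "inj_on (\<lambda>\<xi>. \<xi> c) TG" if "c \<in> charts_at (lmfd G) \<e>" for c
    by (rule inj_onI) (rule tangent_space_eqI[OF _ _ that])
  have surj: "(\<lambda>\<xi>. \<xi> c) ` TG = UNIV" if c: "c \<in> charts_at (lmfd G) \<e>" for c
  proof (intro equalityI subsetI UNIV_I)
    fix v
    note cc = coordinate_curve[OF smfd_G c, of v]
    show "v \<in> (\<lambda>\<xi>. \<xi> c) ` TG"
      using velocity_tangent[OF smfd_G cc(1)] unfolding cc(2)
      by (intro rev_image_eqI[where x="velocity (lmfd G) (\<lambda>s. chart_inv c (snd c \<e> + s *\<^sub>R v)) 0"]) (simp_all add: cc(3))
  qed
  have ch: "is_chart TG k" if "k \<in> ?C" for k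
  proof -
    obtain c where "k = (TG, \<lambda>\<xi>. \<xi> c)" "c \<in> charts_at (lmfd G) \<e>" using \<open>k \<in> ?C\<close> by blast
    then show ?thesis using inj[of c] surj[of c] by (simp add: is_chart_def)
  qed
  have sm: "smooth_on UNIV (\<lambda>z. inv_into TG (\<lambda>\<xi>. \<xi> c) z d)"
    if c: "c \<in> charts_at (lmfd G) \<e>" and d: "d \<in> charts_at (lmfd G) \<e>" for c d
  proof -
    have cd: "c \<in> atlas (lmfd G)" "d \<in> atlas (lmfd G)" "\<e> \<in> fst c" "\<e> \<in> fst d" using c d by (simp_all add: charts_at_def)
    have "smooth_on (snd c ` (fst c \<inter> fst d)) (\<lambda>z. snd d (chart_inv c z))"
      by (rule compatible_smooth[OF smfd_compatible[OF smfd_G cd(1,2)]])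
    from smooth_on_has_derivative[OF this, of "snd c \<e>"] cd
    have "linear (frechet_derivative (\<lambda>z. snd d (chart_inv c z)) (at (snd c \<e>)))"
      by (intro has_derivative_linear) blast
    then have "smooth_on UNIV (frechet_derivative (\<lambda>z. snd d (chart_inv c z)) (at (snd c \<e>)))"
      by (rule smooth_on_bounded_linear[OF linear_bounded_finite_dim[OF fd_G] open_UNIV smooth_on_id])
    then show ?thesis
    proof (rule smooth_on_cong[OF _ open_UNIV])
      fix z
      have z: "z \<in> (\<lambda>\<xi>. \<xi> c) ` TG" using surj[OF c] by simp
      have i: "inv_into TG (\<lambda>\<xi>. \<xi> c) z \<in> TG" "inv_into TG (\<lambda>\<xi>. \<xi> c) z c = z"
        using inv_into_into[OF z] f_inv_into_f[OF z] .
      have *: "\<xi> d = frechet_derivative (snd d \<circ> chart_inv c) (at (snd c \<e>)) (\<xi> c)" if "\<xi> \<in> TG" for \<xi>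
        using that c d unfolding tangent_space_def by blast
      show "frechet_derivative (\<lambda>z. snd d (chart_inv c z)) (at (snd c \<e>)) z = inv_into TG (\<lambda>\<xi>. \<xi> c) z d"
        unfolding *[OF i(1)] i(2) o_def ..
    qed
  qed
  have co: "compatible k l" if "k \<in> ?C" "l \<in> ?C" for k l
  proof -
    obtain c where "k = (TG, \<lambda>\<xi>. \<xi> c)" "c \<in> charts_at (lmfd G) \<e>" using \<open>k \<in> ?C\<close> by blast
    moreover obtain d where "l = (TG, \<lambda>\<xi>. \<xi> d)" "d \<in> charts_at (lmfd G) \<e>" using \<open>l \<in> ?C\<close> by blast
    ultimately show ?thesis using surj[of c] surj[of d] sm[of c d] sm[of d c] by (simp add: compatible_def o_def)
  qed
  obtain c where "c \<in> charts_at (lmfd G) \<e>" by (rule smfd_ex_chart[OF smfd_G e1])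
  then have "(TG, \<lambda>\<xi>. \<xi> c) \<in> ?C" by blast
  from UN_upper[OF this, of fst] have "TG \<subseteq> (\<Union>k\<in>?C. fst k)" by (simp only: fst_conv)
  moreover have "fst k = TG" if "k \<in> ?C" for k using that by auto
  ultimately have "(\<Union>k\<in>?C. fst k) = TG" by blast
  note * = generated_smfd[OF fd_G ch this co]
  show "smfd (lie_alg G)" unfolding lie_alg_def Let_def by (rule *(1))
  show "c \<in> charts_at (lmfd G) \<e> \<Longrightarrow> (TG, \<lambda>\<xi>. \<xi> c) \<in> atlas (lie_alg G)" for c
    unfolding lie_alg_def Let_def using *(2) by blast
qed

lemma lie_alg_charts_at: "c \<in> charts_at (lmfd G) \<e> \<Longrightarrow> \<xi> \<in> TG \<Longrightarrow> (TG, \<lambda>\<xi>. \<xi> c) \<in> charts_at (lie_alg G) \<xi>"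
  using lie_alg_chart_atlas unfolding charts_at_def by simp

lemma smooth_at_to_lie_alg:
  assumes K: "smfd K" and c: "c \<in> charts_at (lmfd G) \<e>" and U: "openin (mtop K) U" "x \<in> U"
    and f: "\<And>y. y \<in> U \<Longrightarrow> f y \<in> TG" and sm: "smooth_at K vec_mfd (\<lambda>y. f y c) x"
  shows "smooth_at K (lie_alg G) f x"
  by (rule smooth_at_into_chart[OF K smfd_lie_alg lie_alg_chart_atlas[OF c] U]) (use f sm in simp_all)

lemma smooth_lie_alg_coord:
  assumes K: "smfd K" and c: "c \<in> charts_at (lmfd G) \<e>" and f: "smooth_at K (lie_alg G) f x"
  shows "smooth_at K vec_mfd (\<lambda>y. f y c) x"
proof -
  have fx: "f x \<in> TG" using smooth_at_points[OF K smfd_lie_alg f] by (simp add: points_lie_alg)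
  have "smooth_at (lie_alg G) vec_mfd (\<lambda>\<xi>. \<xi> c) (f x)"
    using smooth_at_chart[OF smfd_lie_alg lie_alg_charts_at[OF c fx]] by simp
  from smooth_at_compose[OF K smfd_lie_alg smfd_vec(1)[OF fd_G] f this] show ?thesis .
qed

text \<open>\<open>smooth_at_velocity_param\<close> for the curves exp(s \<xi>(x)), whose initial
  velocity is \<xi>(x). It is applied to conjugation, to the action on \<open>P\<close> and to the
  associated bundle.\<close>

lemma smooth_velocity_oneps:
  fixes N :: "('a, 'e::real_inner) mfd" and Q :: "('q, 'm::real_inner) mfd"
  assumes N: "smfd N" and Q: "smfd Q" and f: "smooth_at (prod_mfd N (lmfd G)) Q f (x0, \<e>)"
    and U: "openin (mtop N) U" "x0 \<in> U"
    and \<xi>: "\<And>x. x \<in> U \<Longrightarrow> smooth_at N (lie_alg G) \<xi> x" and e: "e \<in> charts_at Q (f (x0, \<e>))"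
  shows "smooth_at N vec_mfd (\<lambda>x. velocity Q (\<lambda>s. f (x, oneps_of G (\<xi> x) s)) 0 e) x0"
proof -
  have e1: "\<e> \<in> points (lmfd G)" by (simp add: points_G)
  obtain d where d: "d \<in> charts_at (lmfd G) \<e>" by (rule smfd_ex_chart[OF smfd_G e1])
  have T: "\<xi> x \<in> TG" if "x \<in> U" for x
    using smooth_at_points[OF N smfd_lie_alg \<xi>[OF that]] by (simp add: points_lie_alg)
  show ?thesis
  proof (rule smooth_at_velocity_param[OF N smfd_G Q f U _ d e])
    show "smooth_at vec_mfd (lmfd G) (oneps_of G (\<xi> x)) 0 \<and> oneps_of G (\<xi> x) 0 = \<e>" if "x \<in> U" for x
      using oneps_of(1)[OF T[OF that]] by (simp add: oneps_smooth oneps_0)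
    have "smooth_at N vec_mfd (\<lambda>x. \<xi> x d) x0" by (rule smooth_lie_alg_coord[OF N d \<xi>[OF U(2)]])
    then show "smooth_at N vec_mfd (\<lambda>x. velocity (lmfd G) (oneps_of G (\<xi> x)) 0 d) x0"
      by (rule smooth_at_cong[OF N _ U]) (simp add: oneps_of T)
  qed
qed

text \<open>Ad g \<xi> is the initial velocity of g exp(s \<xi>) inv g, so
  \<open>smooth_velocity_oneps\<close> applies with base the product of the group and its Lie
  algebra.\<close>

lemma smooth_Ad: "smooth_map (prod_mfd (lmfd G) (lie_alg G)) (lie_alg G) (\<lambda>(g, \<xi>). Ad G g \<xi>)"
proof -
  let ?N = "prod_mfd (lmfd G) (lie_alg G)"
  note N = smfd_prod(1)[OF smfd_G smfd_lie_alg]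
  have e1: "\<e> \<in> points (lmfd G)" by (simp add: points_G)
  obtain c where c: "c \<in> charts_at (lmfd G) \<e>" by (rule smfd_ex_chart[OF smfd_G e1])
  have pN: "points ?N = carrier (lgrp G) \<times> TG" by (simp add: points_prod_mfd points_G points_lie_alg)
  show ?thesis unfolding smooth_map_iff[OF N smfd_lie_alg]
  proof
    fix z assume z: "z \<in> points ?N"
    then have z': "z \<in> points (lmfd G) \<times> points (lie_alg G)" "(z, \<e>) \<in> points ?N \<times> points (lmfd G)"
      by (simp_all add: points_prod_mfd e1)
    let ?f = "\<lambda>w. fst (fst w) \<cdot> snd w \<cdot> linv (fst (fst w))"
    note P = smfd_prod(1)[OF N smfd_G]
    have sf: "smooth_at (prod_mfd ?N (lmfd G)) (lmfd G) (\<lambda>w. fst (fst w)) (z, \<e>)"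
      by (rule smooth_at_compose[where f=fst and g=fst, OF P N smfd_G smooth_at_fst[OF N smfd_G z'(2)]])
        (use smooth_at_fst[OF smfd_G smfd_lie_alg z'(1)] in simp)
    have f: "smooth_at (prod_mfd ?N (lmfd G)) (lmfd G) ?f (z, \<e>)"
      by (rule smooth_conj[OF P sf smooth_at_snd[OF N smfd_G z'(2)]])
    have "smooth_at ?N vec_mfd (\<lambda>x. velocity (lmfd G) (\<lambda>s. ?f (x, oneps_of G (snd x) s)) 0 c) z"
    proof (rule smooth_velocity_oneps[OF N smfd_G f openin_points[OF N] z])
      show "smooth_at ?N (lie_alg G) snd x" if "x \<in> points ?N" for x
        using that by (intro smooth_at_snd smfd_G smfd_lie_alg) (simp add: points_prod_mfd)
      show "c \<in> charts_at (lmfd G) (?f (z, \<e>))" using c z by (auto simp: pN)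
    qed
    then have "smooth_at ?N vec_mfd (\<lambda>x. (\<lambda>(g, \<xi>). Ad G g \<xi>) x c) z"
      by (rule smooth_at_cong[OF N _ openin_points[OF N] z]) (auto simp: pN Ad_oneps)
    then show "smooth_at ?N (lie_alg G) (\<lambda>(g, \<xi>). Ad G g \<xi>) z"
      by (intro smooth_at_to_lie_alg[OF N c openin_points[OF N] z]) (auto simp: pN Ad_closed)
  qed
qed

end

section \<open>Openness of smoothness, and vector-valued components\<close>

lemma smooth_at_nbhd:
  assumes M: "smfd M" and f: "smooth_at M N f x"
  obtains U where "openin (mtop M) U" "x \<in> U" "\<And>y. y \<in> U \<Longrightarrow> smooth_at M N f y"
proof -
  obtain c d W where c: "c \<in> charts_at M x" and d: "d \<in> charts_at N (f x)" and W: "open W" "snd c x \<in> W" "W \<subseteq> snd c ` fst c"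
    "\<And>z. z \<in> W \<Longrightarrow> f (chart_inv c z) \<in> fst d" "smooth_on W (\<lambda>z. snd d (f (chart_inv c z)))"
    using smooth_atE[OF f] by metis
  have ca: "c \<in> atlas M" "x \<in> fst c" "d \<in> atlas N" using c d by (simp_all add: charts_at_def)
  let ?U = "{y \<in> fst c. snd c y \<in> W}"
  have "smooth_at M N f y" if y: "y \<in> ?U" for y
  proof (rule smooth_atI[where f=f, OF _ _ W(1) _ W(3,4,5)])
    show "c \<in> charts_at M y" using y ca by (simp add: charts_at_def)
    show "snd c y \<in> W" using y by simp
    show "d \<in> charts_at N (f y)"
      using W(4)[of "snd c y"] y ca chart_inv_left[OF smfd_chart[OF M ca(1)], of y] by (simp add: charts_at_def)
  qed
  then show ?thesis using that[of ?U] openin_chart_vimage[OF M ca(1) W(1)] ca(2) W(2) by blast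
qed

lemma smooth_at_vec_Pair:
  fixes f :: "'k \<Rightarrow> 'u::real_inner" and g :: "'k \<Rightarrow> 'v::real_inner" and K :: "('k, 'w::real_inner) mfd"
  assumes K: "smfd K" and fd: "finite_dim TYPE('u)" "finite_dim TYPE('v)"
    and f: "smooth_at K vec_mfd f x" and g: "smooth_at K vec_mfd g x"
  shows "smooth_at K vec_mfd (\<lambda>x. (f x, g x)) x"
proof -
  have "x \<in> points K" using smooth_at_points[OF K smfd_vec(1)[OF fd(1)] f] by blast
  then obtain c where c: "c \<in> charts_at K x" by (rule smfd_ex_chart[OF K])
  obtain W1 where W1: "open W1" "snd c x \<in> W1" "W1 \<subseteq> snd c ` fst c" "smooth_on W1 (\<lambda>z. f (chart_inv c z))"
    using f unfolding smooth_at_to_vec[OF K fd(1) c] by blast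
  obtain W2 where W2: "open W2" "snd c x \<in> W2" "W2 \<subseteq> snd c ` fst c" "smooth_on W2 (\<lambda>z. g (chart_inv c z))"
    using g unfolding smooth_at_to_vec[OF K fd(2) c] by blast
  have W: "open (W1 \<inter> W2)" using W1 W2 by blast
  have "smooth_on (W1 \<inter> W2) (\<lambda>z. (f (chart_inv c z), g (chart_inv c z)))"
    by (intro smooth_on_Pair[OF W] smooth_on_subset[OF W1(4)] smooth_on_subset[OF W2(4)]) auto
  then show ?thesis unfolding smooth_at_to_vec[OF K finite_dim_prod[OF fd] c] using W W1 W2 by blast
qed

lemma
  fixes f :: "'k \<Rightarrow> 'u::real_inner \<times> 'v::real_inner" and K :: "('k, 'w::real_inner) mfd"
  assumes K: "smfd K" and fd: "finite_dim TYPE('u)" "finite_dim TYPE('v)" and f: "smooth_at K vec_mfd f x"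
  shows smooth_at_vec_fst: "smooth_at K vec_mfd (\<lambda>x. fst (f x)) x" and smooth_at_vec_snd: "smooth_at K vec_mfd (\<lambda>x. snd (f x)) x"
proof -
  have "x \<in> points K" using smooth_at_points[OF K smfd_vec(1)[OF finite_dim_prod[OF fd]] f] by blast
  then obtain c where c: "c \<in> charts_at K x" by (rule smfd_ex_chart[OF K])
  obtain W where W: "open W" "snd c x \<in> W" "W \<subseteq> snd c ` fst c" "smooth_on W (\<lambda>z. f (chart_inv c z))"
    using f unfolding smooth_at_to_vec[OF K finite_dim_prod[OF fd] c] by blast
  show "smooth_at K vec_mfd (\<lambda>x. fst (f x)) x"
    unfolding smooth_at_to_vec[OF K fd(1) c] using W smooth_on_fst[OF W(1,4)] by blast
  show "smooth_at K vec_mfd (\<lambda>x. snd (f x)) x"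
    unfolding smooth_at_to_vec[OF K fd(2) c] using W smooth_on_snd[OF W(1,4)] by blast
qed

section \<open>Principal bundles\<close>

locale princ = lie_grp G for G :: "('g, 'l::real_inner) lie_group_data" +
  fixes M :: "('a, 'e::real_inner) mfd" and P :: "('p, 'a, 'e, 'g, 'l) principal_bundle_data"
  assumes pb: "principal_bundle G M P"
begin

abbreviation TP where "TP \<equiv> points (ptot P)"
abbreviation act (infixl "\<star>" 70) where "act \<equiv> pact P"
abbreviation pr where "pr \<equiv> pproj P"

lemma smfd_M: "smfd M" and smfd_P: "smfd (ptot P)"
  and Hausdorff_M: "Hausdorff_space (mtop M)" and Hausdorff_P: "Hausdorff_space (mtop (ptot P))"
  using pb manifold_smfd manifold_Hausdorff unfolding principal_bundle_def by blast+

lemma smooth_act: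
  assumes K: "smfd K" and f: "smooth_at K (ptot P) f x" and g: "smooth_at K (lmfd G) g x"
  shows "smooth_at K (ptot P) (\<lambda>x. f x \<star> g x) x"
proof -
  note Q = smfd_prod(1)[OF smfd_P smfd_G]
  have p: "smooth_at K (prod_mfd (ptot P) (lmfd G)) (\<lambda>x. (f x, g x)) x"
    by (rule smooth_at_Pair[OF K smfd_P smfd_G f g])
  have "smooth_map (prod_mfd (ptot P) (lmfd G)) (ptot P) (\<lambda>(p, g). p \<star> g)"
    using pb by (simp add: principal_bundle_def)
  then have "smooth_at (prod_mfd (ptot P) (lmfd G)) (ptot P) (\<lambda>(p, g). p \<star> g) (f x, g x)"
    using smooth_at_points[OF K Q p] unfolding smooth_map_iff[OF Q smfd_P] by blast
  from smooth_at_compose[OF K Q smfd_P p this] show ?thesis by simp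
qed

lemma smooth_pr:
  assumes K: "smfd K" and f: "smooth_at K (ptot P) f x"
  shows "smooth_at K M (\<lambda>x. pr (f x)) x"
proof -
  have "smooth_map (ptot P) M pr" using pb by (simp add: principal_bundle_def)
  then have "smooth_at (ptot P) M pr (f x)"
    using smooth_at_points[OF K smfd_P f] unfolding smooth_map_iff[OF smfd_P smfd_M] by blast
  from smooth_at_compose[OF K smfd_P smfd_M f this] show ?thesis .
qed

lemma pr_points: "p \<in> TP \<Longrightarrow> pr p \<in> points M"
  using smooth_at_points[OF smfd_P smfd_M smooth_pr[OF smfd_P smooth_at_id[OF smfd_P]]] by blast

lemma act_closed:
  assumes "p \<in> TP" "g \<in> carrier (lgrp G)" shows "p \<star> g \<in> TP"
  using smooth_at_points[OF smfd_P smfd_P smooth_act[OF smfd_P smooth_at_id[OF smfd_P assms(1)] smooth_const_G[OF smfd_P assms]]]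
  by blast

lemma act_one: "p \<in> TP \<Longrightarrow> p \<star> \<e> = p"
  and act_mult: "p \<in> TP \<Longrightarrow> g \<in> carrier (lgrp G) \<Longrightarrow> h \<in> carrier (lgrp G) \<Longrightarrow> p \<star> (g \<cdot> h) = p \<star> g \<star> h"
  and pr_act: "p \<in> TP \<Longrightarrow> g \<in> carrier (lgrp G) \<Longrightarrow> pr (p \<star> g) = pr p"
  using pb unfolding principal_bundle_def by blast+

text \<open>Repackages a trivialisation \<psi>: the section is \<open>s y\<close>, the inverse image
  of (y, 1), and \<theta> is the group component of \<psi>. Equivariance and injectivity of \<psi>
  give p = s(pr p) \<theta>(p).\<close>

lemma trivialization:
  assumes x: "x \<in> points M"
  obtains U s \<theta> where "openin (mtop M) U" "x \<in> U"
    "\<And>y. y \<in> U \<Longrightarrow> smooth_at M (ptot P) s y \<and> pr (s y) = y"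
    "\<And>p. p \<in> TP \<Longrightarrow> pr p \<in> U \<Longrightarrow> smooth_at (ptot P) (lmfd G) \<theta> p \<and> p = s (pr p) \<star> \<theta> p"
    "\<And>p g. p \<in> TP \<Longrightarrow> pr p \<in> U \<Longrightarrow> g \<in> carrier (lgrp G) \<Longrightarrow> \<theta> (p \<star> g) = \<theta> p \<cdot> g"
proof -
  obtain U \<psi> where U: "x \<in> U" "openin (mtop M) U"
    and df: "diffeo (open_sub (ptot P) {p \<in> TP. pr p \<in> U}) (prod_mfd (open_sub M U) (lmfd G)) \<psi>"
    and \<psi>: "\<And>p. p \<in> TP \<Longrightarrow> pr p \<in> U \<Longrightarrow> fst (\<psi> p) = pr p"
      "\<And>p g. p \<in> TP \<Longrightarrow> pr p \<in> U \<Longrightarrow> g \<in> carrier (lgrp G) \<Longrightarrow> snd (\<psi> (p \<star> g)) = snd (\<psi> p) \<cdot> g"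
  proof -
    have "\<forall>x\<in>points M. \<exists>U \<psi>. x \<in> U \<and> openin (mtop M) U \<and>
        diffeo (open_sub (ptot P) {p \<in> TP. pr p \<in> U}) (prod_mfd (open_sub M U) (lmfd G)) \<psi> \<and>
        (\<forall>p\<in>TP. pr p \<in> U \<longrightarrow> fst (\<psi> p) = pr p \<and>
           (\<forall>g\<in>carrier (lgrp G). snd (\<psi> (p \<star> g)) = snd (\<psi> p) \<cdot> g))"
      using pb unfolding principal_bundle_def by (elim conjE)
    from bspec[OF this x] obtain U \<psi> where *: "x \<in> U" "openin (mtop M) U"
        "diffeo (open_sub (ptot P) {p \<in> TP. pr p \<in> U}) (prod_mfd (open_sub M U) (lmfd G)) \<psi>"
        "\<forall>p\<in>TP. pr p \<in> U \<longrightarrow> fst (\<psi> p) = pr p \<and>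
           (\<forall>g\<in>carrier (lgrp G). snd (\<psi> (p \<star> g)) = snd (\<psi> p) \<cdot> g)"
      by (elim exE conjE)
    show thesis by (rule that[OF *(1-3)]) (use *(4) in simp_all)
  qed
  let ?PU = "{p \<in> TP. pr p \<in> U}" and ?MU = "open_sub M U"
  let ?i = "inv_into ?PU \<psi>"
  have oPU: "openin (mtop (ptot P)) ?PU"
    by (rule openin_smooth_vimage[OF smfd_P smfd_M _ openin_points[OF smfd_P] U(2)])
      (rule smooth_pr[OF smfd_P smooth_at_id[OF smfd_P]])
  note SPU = smfd_open_sub[OF smfd_P oPU] and SMU = smfd_open_sub[OF smfd_M U(2)]
  note SQ = smfd_prod(1)[OF SMU smfd_G]
  have pPU: "points (open_sub (ptot P) ?PU) = ?PU" and pMU: "points ?MU = U" by (simp_all add: open_sub_def)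
  have pQ: "points (prod_mfd ?MU (lmfd G)) = U \<times> carrier (lgrp G)" by (simp add: points_prod_mfd pMU points_G)
  have bij: "bij_betw \<psi> ?PU (U \<times> carrier (lgrp G))" using df by (simp add: diffeo_def pPU pQ)
  have s\<psi>: "smooth_at (open_sub (ptot P) ?PU) (prod_mfd ?MU (lmfd G)) \<psi> p" if "p \<in> ?PU" for p
    using df that unfolding diffeo_def smooth_map_iff[OF SPU SQ] pPU by blast
  have si: "smooth_at (prod_mfd ?MU (lmfd G)) (open_sub (ptot P) ?PU) ?i z" if "z \<in> U \<times> carrier (lgrp G)" for z
    using df that unfolding diffeo_def smooth_map_iff[OF SQ SPU] pPU pQ by blast
  define s where "s y = ?i (y, \<e>)" for y
  define \<theta> where "\<theta> p = snd (\<psi> p)" for p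
  have s: "s y \<in> ?PU" "\<psi> (s y) = (y, \<e>)" if "y \<in> U" for y
  proof -
    have im: "(y, \<e>) \<in> \<psi> ` ?PU" using bij that unfolding bij_betw_def by simp
    show "s y \<in> ?PU" unfolding s_def by (rule inv_into_into[OF im])
    show "\<psi> (s y) = (y, \<e>)" unfolding s_def by (rule f_inv_into_f[OF im])
  qed
  have prs: "pr (s y) = y" if "y \<in> U" for y using s[OF that] \<psi>(1)[of "s y"] by simp
  have ss: "smooth_at M (ptot P) s y" if y: "y \<in> U" for y
  proof -
    have yM: "y \<in> points ?MU" using y by (simp add: pMU)
    have "smooth_at ?MU (prod_mfd ?MU (lmfd G)) (\<lambda>y. (y, \<e>)) y"
      by (rule smooth_at_Pair[OF SMU SMU smfd_G smooth_at_id[OF SMU yM] smooth_const_G[OF SMU yM one_closed]])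
    from smooth_at_compose[OF SMU SQ SPU this si] y
    have "smooth_at ?MU (open_sub (ptot P) ?PU) s y" by (simp add: s_def[abs_def])
    then show ?thesis
      unfolding smooth_at_open_sub_target[OF SMU smfd_P oPU] smooth_at_open_sub[OF smfd_M smfd_P U(2) y] by blast
  qed
  have \<theta>c: "\<theta> p \<in> carrier (lgrp G)" "\<psi> p = (pr p, \<theta> p)" if "p \<in> ?PU" for p
  proof -
    have "\<psi> p \<in> U \<times> carrier (lgrp G)" using bij that unfolding bij_betw_def by blast
    then show "\<theta> p \<in> carrier (lgrp G)" by (auto simp: \<theta>_def)
    show "\<psi> p = (pr p, \<theta> p)" using \<psi>(1) that by (simp add: \<theta>_def prod_eq_iff)
  qed
  have s\<theta>: "smooth_at (ptot P) (lmfd G) \<theta> p" if p: "p \<in> ?PU" for p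
  proof -
    have "\<psi> p \<in> points ?MU \<times> points (lmfd G)" using \<theta>c[OF p] p by (simp add: pMU points_G)
    from smooth_at_compose[OF SPU SQ smfd_G s\<psi>[OF p] smooth_at_snd[OF SMU smfd_G this]]
    have "smooth_at (open_sub (ptot P) ?PU) (lmfd G) \<theta> p" by (simp add: \<theta>_def[abs_def])
    then show ?thesis unfolding smooth_at_open_sub[OF smfd_P smfd_G oPU p] .
  qed
  have eq: "p = s (pr p) \<star> \<theta> p" if p: "p \<in> ?PU" for p
  proof -
    have U': "pr p \<in> U" using p by simp
    note sp = s[OF U']
    have q: "s (pr p) \<star> \<theta> p \<in> ?PU" using sp(1) \<theta>c(1)[OF p] act_closed pr_act prs[OF U'] U' by simp
    have "\<psi> (s (pr p) \<star> \<theta> p) = (pr p, \<theta> p)"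
      using \<psi>(2)[of "s (pr p)" "\<theta> p"] \<psi>(1)[of "s (pr p) \<star> \<theta> p"] sp \<theta>c(1)[OF p] q prs[OF U'] pr_act[of "s (pr p)" "\<theta> p"]
      by (simp add: prod_eq_iff)
    then have "\<psi> (s (pr p) \<star> \<theta> p) = \<psi> p" using \<theta>c(2)[OF p] by simp
    from inj_onD[OF bij_betw_imp_inj_on[OF bij] this q p] show ?thesis by simp
  qed
  show ?thesis
    by (rule that[OF U(2,1), of s \<theta>]) (use ss prs s\<theta> eq \<psi>(2) in \<open>simp_all add: \<theta>_def\<close>)
qed

text \<open>Freeness is not among the conditions in \<open>principal_bundle\<close>; it follows from
  the equivariance of \<theta> and cancellation in the group.\<close>

lemma act_free:
  assumes p: "p \<in> TP" and g: "g \<in> carrier (lgrp G)" "h \<in> carrier (lgrp G)" and eq: "p \<star> g = p \<star> h"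
  shows "g = h"
proof -
  obtain U s \<theta> where U: "pr p \<in> U"
    and \<theta>: "\<And>p. p \<in> TP \<Longrightarrow> pr p \<in> U \<Longrightarrow> smooth_at (ptot P) (lmfd G) \<theta> p \<and> p = s (pr p) \<star> \<theta> p"
      "\<And>p g. p \<in> TP \<Longrightarrow> pr p \<in> U \<Longrightarrow> g \<in> carrier (lgrp G) \<Longrightarrow> \<theta> (p \<star> g) = \<theta> p \<cdot> g"
    using trivialization[OF pr_points[OF p]] by metis
  have "\<theta> p \<in> carrier (lgrp G)"
    using smooth_at_points[OF smfd_P smfd_G conjunct1[OF \<theta>(1)[OF p U]]] by (simp add: points_G)
  moreover have "\<theta> p \<cdot> g = \<theta> p \<cdot> h" using \<theta>(2)[OF p U g(1)] \<theta>(2)[OF p U g(2)] eq by simp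
  ultimately show ?thesis using g by simp
qed

text \<open>\<open>pdiv p q\<close> is the unique \<open>g\<close> with \<open>q = p g\<close>; it is only meaningful for \<open>p\<close>, \<open>q\<close> in one fibre.\<close>

definition pdiv where "pdiv p q = (THE g. g \<in> carrier (lgrp G) \<and> q = p \<star> g)"

lemma pdiv_act: "p \<in> TP \<Longrightarrow> g \<in> carrier (lgrp G) \<Longrightarrow> pdiv p (p \<star> g) = g"
  unfolding pdiv_def by (rule the_equality) (auto dest: act_free)

text \<open>Two points of one fibre are s \<theta>(p) and s \<theta>(q) for the same section value
  s, so they differ by inv \<theta>(p) times \<theta>(q).\<close>

lemma pdiv_local:
  assumes \<theta>: "\<And>p. p \<in> TP \<Longrightarrow> pr p \<in> U \<Longrightarrow> smooth_at (ptot P) (lmfd G) \<theta> p \<and> p = s (pr p) \<star> \<theta> p"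
    and s: "\<And>y. y \<in> U \<Longrightarrow> smooth_at M (ptot P) s y \<and> pr (s y) = y"
    and p: "p \<in> TP" "q \<in> TP" "pr p = pr q" "pr p \<in> U"
  shows "pdiv p q = linv (\<theta> p) \<cdot> \<theta> q" "pdiv p q \<in> carrier (lgrp G)" "p \<star> pdiv p q = q"
proof -
  have t: "\<theta> p \<in> carrier (lgrp G)" "\<theta> q \<in> carrier (lgrp G)"
    using smooth_at_points[OF smfd_P smfd_G conjunct1[OF \<theta>]] p by (simp_all add: points_G)
  have sp: "s (pr p) \<in> TP" using smooth_at_points[OF smfd_M smfd_P conjunct1[OF s[OF p(4)]]] by blast
  have eq: "p = s (pr p) \<star> \<theta> p" "q = s (pr p) \<star> \<theta> q" using \<theta>[OF p(1,4)] \<theta>[OF p(2)] p by auto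
  have "p \<star> (linv (\<theta> p) \<cdot> \<theta> q) = s (pr p) \<star> \<theta> p \<star> (linv (\<theta> p) \<cdot> \<theta> q)" using eq(1) by simp
  also have "\<dots> = s (pr p) \<star> (\<theta> p \<cdot> (linv (\<theta> p) \<cdot> \<theta> q))" using sp t by (simp add: act_mult)
  also have "\<theta> p \<cdot> (linv (\<theta> p) \<cdot> \<theta> q) = \<theta> q" using t by (simp add: m_assoc[symmetric])
  finally have q: "q = p \<star> (linv (\<theta> p) \<cdot> \<theta> q)" using eq(2) by simp
  show 1: "pdiv p q = linv (\<theta> p) \<cdot> \<theta> q" using pdiv_act[OF p(1), of "linv (\<theta> p) \<cdot> \<theta> q"] t q by simp
  show "pdiv p q \<in> carrier (lgrp G)" "p \<star> pdiv p q = q" unfolding 1 using t q by simp_all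
qed

lemma pdiv:
  assumes p: "p \<in> TP" "q \<in> TP" "pr p = pr q"
  shows "pdiv p q \<in> carrier (lgrp G)" "p \<star> pdiv p q = q"
proof -
  obtain U s \<theta> where U: "pr p \<in> U"
    and s: "\<And>y. y \<in> U \<Longrightarrow> smooth_at M (ptot P) s y \<and> pr (s y) = y"
    and \<theta>: "\<And>p. p \<in> TP \<Longrightarrow> pr p \<in> U \<Longrightarrow> smooth_at (ptot P) (lmfd G) \<theta> p \<and> p = s (pr p) \<star> \<theta> p"
    using trivialization[OF pr_points[OF p(1)]] by metis
  show "pdiv p q \<in> carrier (lgrp G)" "p \<star> pdiv p q = q"
    using pdiv_local[where s=s, OF \<theta> s p U] by blast+
qed

text \<open>\<open>pdiv\<close> lives on the fibre product of \<open>P\<close> with itself, which is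
  never made a manifold; smoothness is therefore stated for pairs of maps into \<open>P\<close> with
  equal projections.\<close>

lemma smooth_pdiv:
  assumes K: "smfd K" and f: "smooth_at K (ptot P) f x" and g: "smooth_at K (ptot P) g x"
    and V: "openin (mtop K) V" "x \<in> V" and eq: "\<And>y. y \<in> V \<Longrightarrow> pr (f y) = pr (g y)"
  shows "smooth_at K (lmfd G) (\<lambda>y. pdiv (f y) (g y)) x"
proof -
  have fx: "f x \<in> TP" and gx: "g x \<in> TP"
    using smooth_at_points[OF K smfd_P f] smooth_at_points[OF K smfd_P g] by auto
  obtain U s \<theta> where U: "openin (mtop M) U" "pr (f x) \<in> U"
    and s: "\<And>y. y \<in> U \<Longrightarrow> smooth_at M (ptot P) s y \<and> pr (s y) = y"
    and \<theta>: "\<And>p. p \<in> TP \<Longrightarrow> pr p \<in> U \<Longrightarrow> smooth_at (ptot P) (lmfd G) \<theta> p \<and> p = s (pr p) \<star> \<theta> p"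
    using trivialization[OF pr_points[OF fx]] by metis
  obtain V1 where V1: "openin (mtop K) V1" "x \<in> V1" "\<And>y. y \<in> V1 \<Longrightarrow> smooth_at K (ptot P) f y"
    using smooth_at_nbhd[OF K f] by metis
  obtain V2 where V2: "openin (mtop K) V2" "x \<in> V2" "\<And>y. y \<in> V2 \<Longrightarrow> smooth_at K (ptot P) g y"
    using smooth_at_nbhd[OF K g] by metis
  define W where "W = {y \<in> V1 \<inter> V2 \<inter> V. pr (f y) \<in> U}"
  have W: "openin (mtop K) W" unfolding W_def
    by (rule openin_smooth_vimage[OF K smfd_M smooth_pr[OF K V1(3)] _ U(1)]) (use V V1 V2 in auto)
  have xW: "x \<in> W" using V V1 V2 U by (simp add: W_def)
  have gU: "pr (g x) \<in> U" using eq[OF V(2)] U(2) by simp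
  have "smooth_at K (lmfd G) (\<lambda>y. linv (\<theta> (f y)) \<cdot> \<theta> (g y)) x"
    by (rule smooth_mult[OF K smooth_inv[OF K smooth_at_compose[OF K smfd_P smfd_G f conjunct1[OF \<theta>[OF fx U(2)]]]]
         smooth_at_compose[OF K smfd_P smfd_G g conjunct1[OF \<theta>[OF gx gU]]]])
  then show ?thesis
  proof (rule smooth_at_cong[OF K _ W xW])
    fix y assume y: "y \<in> W"
    have "f y \<in> TP" "g y \<in> TP"
      using smooth_at_points[OF K smfd_P V1(3)] smooth_at_points[OF K smfd_P V2(3)] y by (auto simp: W_def)
    then show "linv (\<theta> (f y)) \<cdot> \<theta> (g y) = pdiv (f y) (g y)"
      using pdiv_local(1)[where s=s and p="f y" and q="g y", OF \<theta> s] eq[of y] y by (simp add: W_def)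
  qed
qed

end

section \<open>Associated bundles\<close>

text \<open>The fibre is kept general because two instances occur: \<open>lie_alg G\<close> with
  \<open>Ad G\<close>, where the section \<open>a\<close> lives, and the module \<open>V\<close>,
  where \<open>h\<close> takes its values.\<close>

locale assoc_bundle = princ G M P
  for G :: "('g, 'l::real_inner) lie_group_data" and M :: "('a, 'e::real_inner) mfd"
    and P :: "('p, 'a, 'e, 'g, 'l) principal_bundle_data" +
  fixes N :: "('n, 'v::real_inner) mfd" and \<alpha> :: "'g \<Rightarrow> 'n \<Rightarrow> 'n"
  assumes smfd_N: "smfd N"
    and \<alpha>_one: "y \<in> points N \<Longrightarrow> \<alpha> \<one>\<^bsub>lgrp G\<^esub> y = y"
    and \<alpha>_mult: "g \<in> carrier (lgrp G) \<Longrightarrow> h \<in> carrier (lgrp G) \<Longrightarrow> y \<in> points N \<Longrightarrow> \<alpha> (g \<otimes>\<^bsub>lgrp G\<^esub> h) y = \<alpha> g (\<alpha> h y)"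
    and \<alpha>_smooth: "smooth_map (prod_mfd (lmfd G) N) N (\<lambda>(g, y). \<alpha> g y)"
begin

abbreviation cls where "cls \<equiv> assoc_class G P \<alpha>"
abbreviation bs where "bs \<equiv> backslash G P N \<alpha>"
abbreviation E where "E \<equiv> assoc_mfd G M P N \<alpha>"

lemma smooth_\<alpha>:
  assumes K: "smfd K" and f: "smooth_at K (lmfd G) f x" and g: "smooth_at K N g x"
  shows "smooth_at K N (\<lambda>x. \<alpha> (f x) (g x)) x"
proof -
  note Q = smfd_prod(1)[OF smfd_G smfd_N]
  have p: "smooth_at K (prod_mfd (lmfd G) N) (\<lambda>x. (f x, g x)) x"
    by (rule smooth_at_Pair[OF K smfd_G smfd_N f g])
  have "smooth_at (prod_mfd (lmfd G) N) N (\<lambda>(g, y). \<alpha> g y) (f x, g x)"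
    using \<alpha>_smooth smooth_at_points[OF K Q p] unfolding smooth_map_iff[OF Q smfd_N] by blast
  from smooth_at_compose[OF K Q smfd_N p this] show ?thesis by simp
qed

lemma \<alpha>_closed: "g \<in> carrier (lgrp G) \<Longrightarrow> y \<in> points N \<Longrightarrow> \<alpha> g y \<in> points N"
  using smooth_at_points[OF smfd_N smfd_N smooth_\<alpha>[OF smfd_N smooth_const_G[OF smfd_N] smooth_at_id[OF smfd_N]], of y g] by blast

text \<open>Substituting \<open>g \<cdot> h\<close> for the group element that runs through the
  orbit identifies the two classes.\<close>

lemma cls_act:
  assumes p: "p \<in> TP" and g: "g \<in> carrier (lgrp G)" and y: "y \<in> points N"
  shows "cls (p \<star> g) y = cls p (\<alpha> g y)"
proof -
  have *: "(p \<star> g \<star> h, \<alpha> (linv h) y) = (p \<star> (g \<cdot> h), \<alpha> (linv (g \<cdot> h)) (\<alpha> g y))" if h: "h \<in> carrier (lgrp G)" for h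
  proof -
    have "\<alpha> (linv (g \<cdot> h)) (\<alpha> g y) = \<alpha> (linv (g \<cdot> h) \<cdot> g) y" using g h y by (simp add: \<alpha>_mult)
    also have "linv (g \<cdot> h) \<cdot> g = linv h" using g h by (simp add: inv_mult_group m_assoc)
    finally show ?thesis using p g h by (simp add: act_mult)
  qed
  show ?thesis unfolding assoc_class_def
  proof (intro equalityI subsetI)
    fix w assume "w \<in> {(p \<star> g \<star> h, \<alpha> (linv h) y) |h. h \<in> carrier (lgrp G)}"
    then obtain h where h: "h \<in> carrier (lgrp G)" "w = (p \<star> g \<star> h, \<alpha> (linv h) y)" by blast
    have "g \<cdot> h \<in> carrier (lgrp G)" using g h by simp
    then show "w \<in> {(p \<star> h, \<alpha> (linv h) (\<alpha> g y)) |h. h \<in> carrier (lgrp G)}" using h(2) *[OF h(1)] by blast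
  next
    fix w assume "w \<in> {(p \<star> h, \<alpha> (linv h) (\<alpha> g y)) |h. h \<in> carrier (lgrp G)}"
    then obtain h where h: "h \<in> carrier (lgrp G)" "w = (p \<star> h, \<alpha> (linv h) (\<alpha> g y))" by blast
    have gh: "linv g \<cdot> h \<in> carrier (lgrp G)" and "g \<cdot> (linv g \<cdot> h) = h" using g h by (simp_all add: m_assoc[symmetric])
    then have "w = (p \<star> g \<star> (linv g \<cdot> h), \<alpha> (linv (linv g \<cdot> h)) y)" using *[OF gh] h(2) by simp
    then show "w \<in> {(p \<star> g \<star> h, \<alpha> (linv h) y) |h. h \<in> carrier (lgrp G)}" using gh by blast
  qed
qed

lemma cls_self: "p \<in> TP \<Longrightarrow> y \<in> points N \<Longrightarrow> (p, y) \<in> cls p y"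
  unfolding assoc_class_def using one_closed act_one \<alpha>_one inv_one by force

lemma cls_eqD:
  assumes "p \<in> TP" "y \<in> points N" "p' \<in> TP" "y' \<in> points N" "cls p y = cls p' y'"
  obtains g where "g \<in> carrier (lgrp G)" "p' = p \<star> g" "y' = \<alpha> (linv g) y"
  using cls_self[OF assms(3,4)] assms(5) unfolding assoc_class_def by blast

lemma cls_inj:
  assumes "p \<in> TP" "y \<in> points N" "y' \<in> points N" "cls p y = cls p y'"
  shows "y = y'"
proof (rule cls_eqD[OF assms(1,2,1,3,4)])
  fix g assume g: "g \<in> carrier (lgrp G)" "p = p \<star> g" "y' = \<alpha> (linv g) y"
  then have "g = \<e>" using act_free[OF assms(1) g(1) one_closed] act_one[OF assms(1)] by simp
  then show "y = y'" using g(3) \<alpha>_one[OF assms(2)] by simp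
qed

lemma cls_proj:
  assumes "p \<in> TP" "y \<in> points N" shows "assoc_proj P (cls p y) = pr p"
proof -
  have "(pr \<circ> fst) ` cls p y = {pr p}"
  proof (intro equalityI subsetI)
    fix x assume "x \<in> (pr \<circ> fst) ` cls p y"
    then show "x \<in> {pr p}" using pr_act[OF assms(1)] by (auto simp: assoc_class_def)
  next
    fix x assume "x \<in> {pr p}"
    then show "x \<in> (pr \<circ> fst) ` cls p y" using cls_self[OF assms] by force
  qed
  then show ?thesis by (simp add: assoc_proj_def)
qed

lemma bs_cls: "p \<in> TP \<Longrightarrow> y \<in> points N \<Longrightarrow> bs p (cls p y) = y"
  unfolding backslash_def by (rule the_equality) (auto dest: cls_inj)

text \<open>Change of frame within a fibre: q = p \<open>pdiv p q\<close>, and the group element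
  passes to the fibre component by \<open>cls_act\<close>.\<close>

lemma bs_cls_fibre:
  assumes "p \<in> TP" "q \<in> TP" "pr p = pr q" "y \<in> points N"
  shows "bs p (cls q y) = \<alpha> (pdiv p q) y" "cls q y = cls p (\<alpha> (pdiv p q) y)"
proof -
  note d = pdiv[OF assms(1-3)]
  show 1: "cls q y = cls p (\<alpha> (pdiv p q) y)" using cls_act[OF assms(1) d(1) assms(4)] d(2) by simp
  show "bs p (cls q y) = \<alpha> (pdiv p q) y" unfolding 1 using assms d by (intro bs_cls \<alpha>_closed)
qed

lemma points_E: "points E = {cls p y |p y. p \<in> TP \<and> y \<in> points N}"
  by (simp add: assoc_mfd_def generated_mfd_def)

lemma cls_points: "p \<in> TP \<Longrightarrow> y \<in> points N \<Longrightarrow> cls p y \<in> points E"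
  unfolding points_E by blast

lemma points_E_E:
  assumes "z \<in> points E"
  obtains p y where "p \<in> TP" "y \<in> points N" "z = cls p y"
  using assms unfolding points_E by blast

lemma proj_points: "z \<in> points E \<Longrightarrow> assoc_proj P z \<in> points M"
  by (erule points_E_E) (simp add: cls_proj pr_points)

lemma bs:
  assumes "z \<in> points E" "p \<in> TP" "assoc_proj P z = pr p"
  shows "bs p z \<in> points N" "cls p (bs p z) = z"
proof -
  obtain q y where q: "q \<in> TP" "y \<in> points N" "z = cls q y" by (rule points_E_E[OF assms(1)])
  have "pr p = pr q" using assms(3) q cls_proj by simp
  note b = bs_cls_fibre[OF assms(2) q(1) this q(2)] and d = pdiv[OF assms(2) q(1) this]
  show "bs p z \<in> points N" unfolding q(3) b(1) using d q by (intro \<alpha>_closed)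
  show "cls p (bs p z) = z" unfolding q(3) b(1) using b(2) by simp
qed

section \<open>Charts of the associated bundle over local sections\<close>

definition sec where
  "sec U s \<longleftrightarrow> openin (mtop M) U \<and> (\<forall>y\<in>U. smooth_at M (ptot P) s y \<and> pr (s y) = y)"

lemma secD: "sec U s \<Longrightarrow> y \<in> U \<Longrightarrow> smooth_at M (ptot P) s y" "sec U s \<Longrightarrow> y \<in> U \<Longrightarrow> pr (s y) = y"
  "sec U s \<Longrightarrow> y \<in> U \<Longrightarrow> s y \<in> TP" and sec_open: "sec U s \<Longrightarrow> openin (mtop M) U"
  using smooth_at_points[OF smfd_M smfd_P] unfolding sec_def by blast+

lemma sec_subset: "sec U s \<Longrightarrow> openin (mtop M) V \<Longrightarrow> V \<subseteq> U \<Longrightarrow> sec V s"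
  unfolding sec_def by blast

lemma sec_exists:
  assumes "x \<in> points M" obtains U s where "sec U s" "x \<in> U"
  using trivialization[OF assms] unfolding sec_def by metis

lemma sec_chart:
  assumes "c \<in> atlas M"
  shows "smooth_map (open_sub M (fst c)) (ptot P) s \<and> (\<forall>x\<in>fst c. pr (s x) = x) \<longleftrightarrow> sec (fst c) s"
proof -
  have o: "openin (mtop M) (fst c)" by (rule openin_chart_domain[OF smfd_M assms])
  show ?thesis unfolding sec_def smooth_map_iff[OF smfd_open_sub[OF smfd_M o] smfd_P]
    using o smooth_at_open_sub[OF smfd_M smfd_P o] by (auto simp: open_sub_def)
qed

text \<open>The charts in the definition of \<open>assoc_mfd\<close>.\<close>

definition ech where
  "ech s c d = ({cls (s x) y |x y. x \<in> fst c \<and> y \<in> fst d},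
     \<lambda>z. (snd c (assoc_proj P z), snd d (bs (s (assoc_proj P z)) z)))"

definition "EC = {ech s c d |s c d. c \<in> atlas M \<and> d \<in> atlas N \<and> sec (fst c) s}"

lemma E_eq: "E = generated_mfd (points E) EC"
proof -
  have "{({cls (s x) y |x y. x \<in> fst c \<and> y \<in> fst d},
     \<lambda>z. (snd c (assoc_proj P z), snd d (bs (s (assoc_proj P z)) z))) |s c d.
          c \<in> atlas M \<and> d \<in> atlas N \<and> smooth_map (open_sub M (fst c)) (ptot P) s \<and>
          (\<forall>x\<in>fst c. pr (s x) = x)} = EC"
    unfolding EC_def ech_def using sec_chart by blast
  then show ?thesis unfolding points_E by (simp only: assoc_mfd_def)
qed

context
  fixes s c d
  assumes c: "c \<in> atlas M" and d: "d \<in> atlas N" and s: "sec (fst c) s"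
begin

lemma ech_point:
  assumes "x \<in> fst c" "y \<in> fst d"
  shows "cls (s x) y \<in> fst (ech s c d)" "snd (ech s c d) (cls (s x) y) = (snd c x, snd d y)"
    "assoc_proj P (cls (s x) y) = x" "bs (s x) (cls (s x) y) = y" "cls (s x) y \<in> points E"
proof -
  have y: "y \<in> points N" using chart_subset[OF smfd_chart[OF smfd_N d] assms(2)] .
  have sx: "s x \<in> TP" "pr (s x) = x" using secD[OF s assms(1)] by auto
  show "cls (s x) y \<in> fst (ech s c d)" unfolding ech_def using assms by auto
  show 1: "assoc_proj P (cls (s x) y) = x" using cls_proj[OF sx(1) y] sx(2) by simp
  show 2: "bs (s x) (cls (s x) y) = y" by (rule bs_cls[OF sx(1) y])
  show "snd (ech s c d) (cls (s x) y) = (snd c x, snd d y)" unfolding ech_def by (simp add: 1 2)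
  show "cls (s x) y \<in> points E" by (rule cls_points[OF sx(1) y])
qed

lemma ech_domE:
  assumes "z \<in> fst (ech s c d)"
  obtains x y where "x \<in> fst c" "y \<in> fst d" "z = cls (s x) y"
  using assms unfolding ech_def by auto

lemma ech_dom_iff:
  assumes "z \<in> points E"
  shows "z \<in> fst (ech s c d) \<longleftrightarrow> assoc_proj P z \<in> fst c \<and> bs (s (assoc_proj P z)) z \<in> fst d"
proof
  assume "z \<in> fst (ech s c d)"
  then show "assoc_proj P z \<in> fst c \<and> bs (s (assoc_proj P z)) z \<in> fst d"
    by (rule ech_domE) (simp add: ech_point)
next
  assume a: "assoc_proj P z \<in> fst c \<and> bs (s (assoc_proj P z)) z \<in> fst d"
  then have "s (assoc_proj P z) \<in> TP" "assoc_proj P z = pr (s (assoc_proj P z))" using secD[OF s] by auto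
  from bs(2)[OF assms this] show "z \<in> fst (ech s c d)" using ech_point(1) a by metis
qed

lemma ech_chart: "is_chart (points E) (ech s c d)"
proof -
  have cM: "is_chart (points M) c" and dN: "is_chart (points N) d" using smfd_chart[OF smfd_M c] smfd_chart[OF smfd_N d] .
  have "inj_on (snd (ech s c d)) (fst (ech s c d))"
  proof (rule inj_onI)
    fix z z' assume z: "z \<in> fst (ech s c d)" "z' \<in> fst (ech s c d)" "snd (ech s c d) z = snd (ech s c d) z'"
    obtain x y where x: "x \<in> fst c" "y \<in> fst d" "z = cls (s x) y" by (rule ech_domE[OF z(1)])
    obtain x' y' where x': "x' \<in> fst c" "y' \<in> fst d" "z' = cls (s x') y'" by (rule ech_domE[OF z(2)])
    have "snd c x = snd c x'" "snd d y = snd d y'" using z(3) x x' by (simp_all add: ech_point)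
    then have "x = x'" "y = y'" using x x' cM dN unfolding is_chart_def inj_on_def by blast+
    then show "z = z'" using x x' by simp
  qed
  moreover have "snd (ech s c d) ` fst (ech s c d) = snd c ` fst c \<times> snd d ` fst d"
  proof (intro equalityI subsetI)
    fix w assume "w \<in> snd (ech s c d) ` fst (ech s c d)"
    then obtain z where z: "z \<in> fst (ech s c d)" "w = snd (ech s c d) z" by blast
    obtain x y where "x \<in> fst c" "y \<in> fst d" "z = cls (s x) y" by (rule ech_domE[OF z(1)])
    then show "w \<in> snd c ` fst c \<times> snd d ` fst d" using z(2) by (simp add: ech_point)
  next
    fix w assume "w \<in> snd c ` fst c \<times> snd d ` fst d"
    then obtain x y where xy: "x \<in> fst c" "y \<in> fst d" "w = (snd c x, snd d y)" by auto
    then show "w \<in> snd (ech s c d) ` fst (ech s c d)" using ech_point(1,2)[OF xy(1,2)] by (metis imageI)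
  qed
  moreover have "fst (ech s c d) \<subseteq> points E" using ech_domE ech_point(5) by blast
  ultimately show ?thesis using chart_open[OF cM] chart_open[OF dN] by (simp add: is_chart_def open_Times)
qed

end

text \<open>Between the frames s and s' the fibre component y over x changes to \<alpha> (pdiv (s'
  x) (s x)) y, which is \<open>T\<close> in the proof and is smooth by \<open>smooth_pdiv\<close>.
  The overlap corresponds to the open set \<open>D\<close> of pairs (x, y) at which both charts are
  defined.\<close>

lemma ech_transition:
  assumes c: "c \<in> atlas M" and d: "d \<in> atlas N" and s: "sec (fst c) s"
    and c': "c' \<in> atlas M" and d': "d' \<in> atlas N" and s': "sec (fst c') s'"
  shows "open (snd (ech s c d) ` (fst (ech s c d) \<inter> fst (ech s' c' d')))"
    and "smooth_on (snd (ech s c d) ` (fst (ech s c d) \<inter> fst (ech s' c' d')))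
      (\<lambda>w. snd (ech s' c' d') (chart_inv (ech s c d) w))"
proof -
  note MN = smfd_prod(1)[OF smfd_M smfd_N] and fdM = smfd_finite_dim[OF smfd_M] and fdN = smfd_finite_dim[OF smfd_N]
  let ?cd = "(fst c \<times> fst d, map_prod (snd c) (snd d))" and ?Q = "prod_mfd M N"
  define T where "T w = \<alpha> (pdiv (s' (fst w)) (s (fst w))) (snd w)" for w
  have cd: "?cd \<in> atlas ?Q" "(fst c' \<times> fst d, map_prod (snd c') (snd d)) \<in> atlas ?Q"
    using prod_chart_atlas[OF smfd_M smfd_N] c c' d by auto
  let ?U = "(fst c \<inter> fst c') \<times> fst d"
  have "openin (mtop ?Q) ((fst c \<times> fst d) \<inter> (fst c' \<times> fst d))"
    using openin_chart_domain[OF MN cd(1)] openin_chart_domain[OF MN cd(2)] by (simp add: openin_Int)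
  then have U: "openin (mtop ?Q) ?U" by (simp add: Times_Int_Times)
  have Up: "w \<in> points M \<times> points N" if "w \<in> ?U" for w
    using that chart_subset[OF smfd_chart[OF smfd_M c]] chart_subset[OF smfd_chart[OF smfd_N d]] by auto
  have sT: "smooth_at ?Q N T w" if w: "w \<in> ?U" for w
  proof -
    have w': "fst w \<in> fst c" "fst w \<in> fst c'" using w by auto
    note f = smooth_at_fst[OF smfd_M smfd_N Up[OF w]] and g = smooth_at_snd[OF smfd_M smfd_N Up[OF w]]
    have "smooth_at ?Q (lmfd G) (\<lambda>w. pdiv (s' (fst w)) (s (fst w))) w"
    proof (rule smooth_pdiv[OF MN _ _ U w])
      show "smooth_at ?Q (ptot P) (\<lambda>w. s' (fst w)) w" by (rule smooth_at_compose[OF MN smfd_M smfd_P f secD(1)[OF s' w'(2)]])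
      show "smooth_at ?Q (ptot P) (\<lambda>w. s (fst w)) w" by (rule smooth_at_compose[OF MN smfd_M smfd_P f secD(1)[OF s w'(1)]])
      show "pr (s' (fst v)) = pr (s (fst v))" if "v \<in> ?U" for v using that secD(2)[OF s] secD(2)[OF s'] by auto
    qed
    from smooth_\<alpha>[OF MN this g] show ?thesis by (simp add: T_def[abs_def])
  qed
  define D where "D = {w \<in> ?U. T w \<in> fst d'}"
  have D: "openin (mtop ?Q) D" unfolding D_def by (rule openin_smooth_vimage[OF MN smfd_N sT U openin_chart_domain[OF smfd_N d']])
  have Dcd: "D \<inter> fst ?cd = D" by (auto simp: D_def)
  have DU: "w \<in> ?U" if "w \<in> D" for w using that by (simp add: D_def)
  have tr: "bs (s' (fst w)) (cls (s (fst w)) (snd w)) = T w" if w: "w \<in> ?U" for w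
    unfolding T_def using w secD[OF s] secD[OF s'] Up[OF w] by (intro bs_cls_fibre) auto
  have int: "fst (ech s c d) \<inter> fst (ech s' c' d') = (\<lambda>w. cls (s (fst w)) (snd w)) ` D"
  proof (intro equalityI subsetI)
    fix z assume z: "z \<in> fst (ech s c d) \<inter> fst (ech s' c' d')"
    then have z1: "z \<in> fst (ech s c d)" and z2: "z \<in> fst (ech s' c' d')" by auto
    obtain x y where x: "x \<in> fst c" "y \<in> fst d" "z = cls (s x) y" by (rule ech_domE[OF c d s z1])
    note e = ech_point[OF c d s x(1,2)]
    have "z \<in> points E" using e x by simp
    from ech_dom_iff[OF c' d' s' this] z2 have "x \<in> fst c'" "bs (s' x) z \<in> fst d'" using e x by simp_all
    then have "(x, y) \<in> D" using tr[of "(x, y)"] x by (simp add: D_def)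
    then show "z \<in> (\<lambda>w. cls (s (fst w)) (snd w)) ` D" using x(3) by force
  next
    fix z assume "z \<in> (\<lambda>w. cls (s (fst w)) (snd w)) ` D"
    then obtain w where w: "w \<in> D" "z = cls (s (fst w)) (snd w)" by blast
    have wU: "fst w \<in> fst c" "fst w \<in> fst c'" "snd w \<in> fst d" "T w \<in> fst d'" using w by (auto simp: D_def)
    note e = ech_point[OF c d s wU(1,3)]
    have "z \<in> points E" using e w by simp
    from ech_dom_iff[OF c' d' s' this] have "z \<in> fst (ech s' c' d')" using tr[OF DU[OF w(1)]] wU e w(2) by simp
    then show "z \<in> fst (ech s c d) \<inter> fst (ech s' c' d')" using e w(2) by simp
  qed
  have im: "snd (ech s c d) ` (fst (ech s c d) \<inter> fst (ech s' c' d')) = snd ?cd ` D"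
    unfolding int image_image
  proof (rule image_cong[OF refl])
    fix w assume "w \<in> D"
    then have "fst w \<in> fst c" "snd w \<in> fst d" by (auto simp: D_def)
    from ech_point(2)[OF c d s this] show "snd (ech s c d) (cls (s (fst w)) (snd w)) = snd ?cd w"
      by (simp add: map_prod_def split_beta)
  qed
  have oD: "open (snd ?cd ` D)" using D cd(1) Dcd unfolding openin_mtop[OF MN] by metis
  show "open (snd (ech s c d) ` (fst (ech s c d) \<inter> fst (ech s' c' d')))" unfolding im by (rule oD)
  define h where "h w = (snd c' (fst w), snd d' (T w))" for w
  have sh: "smooth_at ?Q vec_mfd h w" if w: "w \<in> D" for w
  proof -
    have w': "fst w \<in> fst c'" "T w \<in> fst d'" using w by (auto simp: D_def)
    have "c' \<in> charts_at M (fst w)" "d' \<in> charts_at N (T w)" using c' d' w' by (simp_all add: charts_at_def)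
    note k = smooth_at_chart[OF smfd_M this(1)] smooth_at_chart[OF smfd_N this(2)]
    show ?thesis unfolding h_def[abs_def]
      by (rule smooth_at_vec_Pair[OF MN fdM fdN
           smooth_at_compose[OF MN smfd_M smfd_vec(1)[OF fdM] smooth_at_fst[OF smfd_M smfd_N Up[OF DU[OF w]]] k(1)]
           smooth_at_compose[OF MN smfd_N smfd_vec(1)[OF fdN] sT[OF DU[OF w]] k(2)]])
  qed
  note cdc = smfd_chart[OF MN cd(1)] and ec = ech_chart[OF c d s]
  have "smooth_on (snd ?cd ` D) (\<lambda>z. h (chart_inv ?cd z))"
  proof (rule smooth_on_local)
    fix z assume "z \<in> snd ?cd ` D"
    then obtain w where w: "w \<in> D" "z = snd ?cd w" by blast
    have "?cd \<in> charts_at ?Q w" using w cd(1) Dcd by (auto simp: charts_at_def D_def)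
    from sh[OF w(1)] smooth_at_to_vec[OF MN finite_dim_prod[OF fdM fdN] this, of h]
    show "\<exists>T. open T \<and> z \<in> T \<and> smooth_on T (\<lambda>z. h (chart_inv ?cd z))" unfolding w(2) by blast
  qed
  then show "smooth_on (snd (ech s c d) ` (fst (ech s c d) \<inter> fst (ech s' c' d')))
      (\<lambda>w. snd (ech s' c' d') (chart_inv (ech s c d) w))" unfolding im
  proof (rule smooth_on_cong[OF _ oD])
    fix z assume "z \<in> snd ?cd ` D"
    then obtain w where w: "w \<in> D" "z = snd ?cd w" by blast
    have wU: "fst w \<in> fst c" "fst w \<in> fst c'" "snd w \<in> fst d" "T w \<in> fst d'" using w by (auto simp: D_def)
    have "w \<in> fst ?cd" using wU by (simp add: mem_Times_iff)
    then have 1: "chart_inv ?cd z = w" unfolding w(2) by (rule chart_inv_left[OF cdc])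
    note e = ech_point[OF c d s wU(1,3)]
    have "z = snd (ech s c d) (cls (s (fst w)) (snd w))" using e(2) w(2) by (simp add: map_prod_def split_beta)
    then have 2: "chart_inv (ech s c d) z = cls (s (fst w)) (snd w)" using chart_inv_left[OF ec e(1)] by simp
    have "snd (ech s' c' d') (cls (s (fst w)) (snd w)) = h w"
      unfolding ech_def snd_conv e(3) h_def tr[OF DU[OF w(1)]] ..
    then show "h (chart_inv ?cd z) = snd (ech s' c' d') (chart_inv (ech s c d) z)" unfolding 1 2 by simp
  qed
qed

lemma EC_D:
  assumes "k \<in> EC" obtains s c d where "k = ech s c d" "c \<in> atlas M" "d \<in> atlas N" "sec (fst c) s"
  using assms unfolding EC_def by blast

text \<open>The section is prescribed and the base chart is shrunk to its domain, so that
  calculations can be made in a frame chosen beforehand.\<close>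

lemma ech_cover:
  assumes "z \<in> points E" "sec U s" "assoc_proj P z \<in> U"
  obtains c d where "c \<in> atlas M" "d \<in> atlas N" "sec (fst c) s" "fst c \<subseteq> U" "z \<in> fst (ech s c d)"
proof -
  let ?x = "assoc_proj P z"
  obtain c0 where c0: "c0 \<in> charts_at M ?x" by (rule smfd_ex_chart[OF smfd_M proj_points[OF assms(1)]])
  have sx: "s ?x \<in> TP" "pr (s ?x) = ?x" using secD[OF assms(2,3)] by auto
  obtain d where d: "d \<in> charts_at N (bs (s ?x) z)" using smfd_ex_chart[OF smfd_N] bs(1)[OF assms(1) sx(1)] sx(2) by metis
  let ?c = "(fst c0 \<inter> U, snd c0)"
  have U: "openin (mtop M) U" using assms(2) by (simp add: sec_def)
  have c: "?c \<in> atlas M" using restrict_chart[OF smfd_M _ U] c0 by (simp add: charts_at_def)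
  have sc: "sec (fst ?c) s" by (rule sec_subset[OF assms(2) openin_chart_domain[OF smfd_M c]]) simp
  have da: "d \<in> atlas N" using d by (simp add: charts_at_def)
  have "z \<in> fst (ech s ?c d)"
    using c0 d assms(3) ech_dom_iff[OF c da sc assms(1)] by (simp add: charts_at_def)
  then show ?thesis using that[OF c da sc] by simp
qed

lemma smfd_E: "smfd E" and ech_atlas: "c \<in> atlas M \<Longrightarrow> d \<in> atlas N \<Longrightarrow> sec (fst c) s \<Longrightarrow> ech s c d \<in> atlas E"
proof -
  have fd: "finite_dim TYPE('e \<times> 'v)" by (rule finite_dim_prod[OF smfd_finite_dim[OF smfd_M] smfd_finite_dim[OF smfd_N]])
  have ch: "is_chart (points E) k" if "k \<in> EC" for k
    using that by (rule EC_D) (simp add: ech_chart)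
  have cov: "(\<Union>k\<in>EC. fst k) = points E"
  proof (intro equalityI subsetI)
    fix z assume "z \<in> (\<Union>k\<in>EC. fst k)"
    then show "z \<in> points E" using chart_subset[OF ch] by blast
  next
    fix z assume z: "z \<in> points E"
    obtain U s where s: "sec U s" "assoc_proj P z \<in> U" by (rule sec_exists[OF proj_points[OF z]])
    obtain c d where "c \<in> atlas M" "d \<in> atlas N" "sec (fst c) s" "z \<in> fst (ech s c d)" using ech_cover[OF z s] by metis
    then show "z \<in> (\<Union>k\<in>EC. fst k)" unfolding EC_def by blast
  qed
  have co: "compatible k k'" if k: "k \<in> EC" "k' \<in> EC" for k k'
  proof -
    obtain s c d where 1: "k = ech s c d" "c \<in> atlas M" "d \<in> atlas N" "sec (fst c) s" by (rule EC_D[OF k(1)])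
    obtain s' c' d' where 2: "k' = ech s' c' d'" "c' \<in> atlas M" "d' \<in> atlas N" "sec (fst c') s'" by (rule EC_D[OF k(2)])
    show ?thesis unfolding compatible_def o_def 1(1) 2(1)
      using ech_transition[OF 1(2-4) 2(2-4)] ech_transition[OF 2(2-4) 1(2-4)] by (simp add: Int_commute)
  qed
  note * = generated_smfd[OF fd ch cov co]
  show "smfd E" by (subst E_eq) (rule *(1))
  show "ech s c d \<in> atlas E" if "c \<in> atlas M" "d \<in> atlas N" "sec (fst c) s"
  proof -
    have "ech s c d \<in> EC" unfolding EC_def mem_Collect_eq using that
      by (intro exI[of _ s] exI[of _ c] exI[of _ d]) simp
    then show ?thesis using *(2) by (subst E_eq) (rule subsetD)
  qed
qed

section \<open>Smooth maps into and out of the associated bundle\<close>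

lemma smooth_from_E:
  assumes z: "z \<in> points E" and U: "sec U s" "assoc_proj P z \<in> U"
  shows "smooth_at E M (assoc_proj P) z" "smooth_at E N (\<lambda>z. bs (s (assoc_proj P z)) z) z"
proof -
  note fdM = smfd_finite_dim[OF smfd_M] and fdN = smfd_finite_dim[OF smfd_N]
  obtain c d where cd: "c \<in> atlas M" "d \<in> atlas N" "sec (fst c) s" "z \<in> fst (ech s c d)" using ech_cover[OF z U] by metis
  let ?k = "ech s c d"
  have k: "?k \<in> atlas E" by (rule ech_atlas[OF cd(1-3)])
  have o: "openin (mtop E) (fst ?k)" by (rule openin_chart_domain[OF smfd_E k])
  have "?k \<in> charts_at E z" using k cd(4) by (simp add: charts_at_def)
  note s = smooth_at_chart[OF smfd_E this]
  have in': "assoc_proj P w \<in> fst c \<and> bs (s (assoc_proj P w)) w \<in> fst d" if "w \<in> fst ?k" for w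
    using that ech_dom_iff[OF cd(1-3), of w] chart_subset[OF smfd_chart[OF smfd_E k] that] by blast
  show "smooth_at E M (assoc_proj P) z"
    using smooth_at_vec_fst[OF smfd_E fdM fdN s] in'
    by (intro smooth_at_into_chart[OF smfd_E smfd_M cd(1) o cd(4)]) (simp_all add: ech_def)
  show "smooth_at E N (\<lambda>z. bs (s (assoc_proj P z)) z) z"
    using smooth_at_vec_snd[OF smfd_E fdM fdN s] in'
    by (intro smooth_at_into_chart[OF smfd_E smfd_N cd(2) o cd(4)]) (simp_all add: ech_def)
qed

lemma smooth_assoc_proj: "z \<in> points E \<Longrightarrow> smooth_at E M (assoc_proj P) z"
  using sec_exists[OF proj_points] smooth_from_E(1) by metis

text \<open>Converse to \<open>smooth_from_E\<close>: the base point and the component in a local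
  frame are the two halves of a chart.\<close>

lemma smooth_to_E:
  assumes K: "smfd K" and V: "openin (mtop K) V" "x \<in> V" and f: "\<And>k. k \<in> V \<Longrightarrow> f k \<in> points E"
    and U: "sec U s" "assoc_proj P (f x) \<in> U"
    and 1: "smooth_at K M (\<lambda>k. assoc_proj P (f k)) x" and 2: "smooth_at K N (\<lambda>k. bs (s (assoc_proj P (f k))) (f k)) x"
  shows "smooth_at K E f x"
proof -
  note fdM = smfd_finite_dim[OF smfd_M] and fdN = smfd_finite_dim[OF smfd_N]
  obtain c d where cd: "c \<in> atlas M" "d \<in> atlas N" "sec (fst c) s" "f x \<in> fst (ech s c d)"
    using ech_cover[OF f[OF V(2)] U] by metis
  let ?k = "ech s c d" and ?g = "\<lambda>k. bs (s (assoc_proj P (f k))) (f k)" and ?p = "\<lambda>k. assoc_proj P (f k)"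
  have k: "?k \<in> atlas E" by (rule ech_atlas[OF cd(1-3)])
  obtain V1 where V1: "openin (mtop K) V1" "x \<in> V1" "\<And>y. y \<in> V1 \<Longrightarrow> smooth_at K M ?p y"
    using smooth_at_nbhd[OF K 1] by metis
  obtain V2 where V2: "openin (mtop K) V2" "x \<in> V2" "\<And>y. y \<in> V2 \<Longrightarrow> smooth_at K N ?g y"
    using smooth_at_nbhd[OF K 2] by metis
  let ?W = "{k \<in> V1. ?p k \<in> fst c} \<inter> {k \<in> V2. ?g k \<in> fst d} \<inter> V"
  have W: "openin (mtop K) ?W"
    by (intro openin_Int V openin_smooth_vimage[OF K smfd_M V1(3,1)] openin_smooth_vimage[OF K smfd_N V2(3,1)]
        openin_chart_domain smfd_M smfd_N cd)
  have fx: "?p x \<in> fst c" "?g x \<in> fst d" using ech_dom_iff[OF cd(1-3) f[OF V(2)]] cd(4) by auto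
  show ?thesis
  proof (rule smooth_at_into_chart[OF K smfd_E k W])
    show "x \<in> ?W" using V V1 V2 fx by simp
    show "f y \<in> fst ?k" if "y \<in> ?W" for y using that ech_dom_iff[OF cd(1-3) f] by simp
    have "c \<in> charts_at M (?p x)" "d \<in> charts_at N (?g x)" using cd fx by (simp_all add: charts_at_def)
    note ch = smooth_at_chart[OF smfd_M this(1)] smooth_at_chart[OF smfd_N this(2)]
    have "smooth_at K vec_mfd (\<lambda>k. (snd c (?p k), snd d (?g k))) x"
      by (rule smooth_at_vec_Pair[OF K fdM fdN smooth_at_compose[OF K smfd_M smfd_vec(1)[OF fdM] 1 ch(1)]
            smooth_at_compose[OF K smfd_N smfd_vec(1)[OF fdN] 2 ch(2)]])
    then show "smooth_at K vec_mfd (\<lambda>k. snd ?k (f k)) x" by (simp add: ech_def)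
  qed
qed

text \<open>In a frame \<open>s\<close> the base point of [f, g] is pr f, and its fibre component is
  \<alpha> (pdiv s f) g; both are smooth.\<close>

lemma smooth_cls:
  assumes K: "smfd K" and f: "smooth_at K (ptot P) f x" and g: "smooth_at K N g x"
  shows "smooth_at K E (\<lambda>k. cls (f k) (g k)) x"
proof -
  obtain V1 where V1: "openin (mtop K) V1" "x \<in> V1" "\<And>y. y \<in> V1 \<Longrightarrow> smooth_at K (ptot P) f y"
    using smooth_at_nbhd[OF K f] by metis
  obtain V2 where V2: "openin (mtop K) V2" "x \<in> V2" "\<And>y. y \<in> V2 \<Longrightarrow> smooth_at K N g y"
    using smooth_at_nbhd[OF K g] by metis
  have fP: "f k \<in> TP" and gN: "g k \<in> points N" if "k \<in> V1 \<inter> V2" for k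
    using that smooth_at_points[OF K smfd_P V1(3)] smooth_at_points[OF K smfd_N V2(3)] by auto
  have x: "x \<in> V1 \<inter> V2" using V1 V2 by simp
  obtain U s where U: "sec U s" "pr (f x) \<in> U" by (rule sec_exists[OF pr_points[OF fP[OF x]]])
  define V where "V = {k \<in> V1 \<inter> V2. pr (f k) \<in> U}"
  have V: "openin (mtop K) V" unfolding V_def
    by (rule openin_smooth_vimage[OF K smfd_M smooth_pr[OF K V1(3)]]) (use V1 V2 U in \<open>auto simp: sec_def\<close>)
  have xV: "x \<in> V" using x U by (simp add: V_def)
  have pj: "assoc_proj P (cls (f k) (g k)) = pr (f k)" if "k \<in> V1 \<inter> V2" for k by (rule cls_proj[OF fP[OF that] gN[OF that]])
  have sf: "smooth_at K M (\<lambda>k. pr (f k)) x" by (rule smooth_pr[OF K f])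
  show ?thesis
  proof (rule smooth_to_E[OF K V xV _ U(1)])
    show "cls (f k) (g k) \<in> points E" if "k \<in> V" for k using that fP gN by (intro cls_points) (auto simp: V_def)
    show "assoc_proj P (cls (f x) (g x)) \<in> U" using pj[OF x] U by simp
    show "smooth_at K M (\<lambda>k. assoc_proj P (cls (f k) (g k))) x"
      by (rule smooth_at_cong[OF K sf V xV]) (simp add: pj V_def)
    have "smooth_at K (lmfd G) (\<lambda>k. pdiv (s (pr (f k))) (f k)) x"
      by (rule smooth_pdiv[OF K smooth_at_compose[OF K smfd_M smfd_P sf secD(1)[OF U]] f V xV])
        (simp add: V_def secD(2)[OF U(1)])
    then have "smooth_at K N (\<lambda>k. \<alpha> (pdiv (s (pr (f k))) (f k)) (g k)) x" by (rule smooth_\<alpha>[OF K _ g])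
    then show "smooth_at K N (\<lambda>k. bs (s (assoc_proj P (cls (f k) (g k)))) (cls (f k) (g k))) x"
    proof (rule smooth_at_cong[OF K _ V xV])
      fix k assume k: "k \<in> V"
      then have k': "k \<in> V1 \<inter> V2" "pr (f k) \<in> U" by (auto simp: V_def)
      show "\<alpha> (pdiv (s (pr (f k))) (f k)) (g k) = bs (s (assoc_proj P (cls (f k) (g k)))) (cls (f k) (g k))"
        unfolding pj[OF k'(1)] using fP[OF k'(1)] gN[OF k'(1)] secD[OF U(1) k'(2)] by (intro bs_cls_fibre(1)[symmetric]) auto
    qed
  qed
qed

text \<open>Points over different base points are separated in \<open>M\<close>, points of one fibre
  by their components in a local frame. Uniqueness of integral curves on the bundle depends on
  it.\<close>

lemma Hausdorff_E:
  assumes HN: "Hausdorff_space (mtop N)"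
  shows "Hausdorff_space (mtop E)"
  unfolding Hausdorff_space_def topspace_mtop[OF smfd_E]
proof (intro allI impI)
  fix z z' assume "z \<in> points E \<and> z' \<in> points E \<and> z \<noteq> z'"
  then have z: "z \<in> points E" "z' \<in> points E" "z \<noteq> z'" by auto
  show "\<exists>A B. openin (mtop E) A \<and> openin (mtop E) B \<and> z \<in> A \<and> z' \<in> B \<and> disjnt A B"
  proof (cases "assoc_proj P z = assoc_proj P z'")
    case False
    have "assoc_proj P z \<in> topspace (mtop M)" "assoc_proj P z' \<in> topspace (mtop M)"
      using proj_points z by (simp_all add: topspace_mtop[OF smfd_M])
    then obtain A B where AB: "openin (mtop M) A" "openin (mtop M) B" "assoc_proj P z \<in> A" "assoc_proj P z' \<in> B" "disjnt A B"
      using Hausdorff_M False unfolding Hausdorff_space_def by blast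
    have "openin (mtop E) {z \<in> points E. assoc_proj P z \<in> A}" "openin (mtop E) {z \<in> points E. assoc_proj P z \<in> B}"
      by (rule openin_smooth_vimage[OF smfd_E smfd_M smooth_assoc_proj openin_points[OF smfd_E] AB(1)],
          assumption, rule openin_smooth_vimage[OF smfd_E smfd_M smooth_assoc_proj openin_points[OF smfd_E] AB(2)])
    moreover have "disjnt {z \<in> points E. assoc_proj P z \<in> A} {z \<in> points E. assoc_proj P z \<in> B}"
      using AB(5) by (auto simp: disjnt_iff)
    ultimately show ?thesis using z AB by blast
  next
    case True
    obtain U s where U: "sec U s" "assoc_proj P z \<in> U" by (rule sec_exists[OF proj_points[OF z(1)]])
    let ?EU = "{z \<in> points E. assoc_proj P z \<in> U}" and ?b = "\<lambda>z. bs (s (assoc_proj P z)) z"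
    have EU: "openin (mtop E) ?EU"
      by (rule openin_smooth_vimage[OF smfd_E smfd_M smooth_assoc_proj openin_points[OF smfd_E] sec_open[OF U(1)]])
    have sx: "s (assoc_proj P z) \<in> TP" "pr (s (assoc_proj P z)) = assoc_proj P z" using secD[OF U] by auto
    have b: "?b z \<in> points N" "?b z' \<in> points N" using bs(1)[OF z(1) sx(1)] bs(1)[OF z(2) sx(1)] sx(2) True by simp_all
    have "?b z \<noteq> ?b z'" using bs(2)[OF z(1) sx(1)] bs(2)[OF z(2) sx(1)] sx(2) True z(3) by metis
    then obtain A B where AB: "openin (mtop N) A" "openin (mtop N) B" "?b z \<in> A" "?b z' \<in> B" "disjnt A B"
      using HN b unfolding Hausdorff_space_def topspace_mtop[OF smfd_N] by blast
    have sb: "smooth_at E N ?b w" if "w \<in> ?EU" for w using smooth_from_E(2)[OF _ U(1)] that by simp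
    have "openin (mtop E) {z \<in> ?EU. ?b z \<in> A}" by (rule openin_smooth_vimage[OF smfd_E smfd_N sb EU AB(1)])
    moreover have "openin (mtop E) {z \<in> ?EU. ?b z \<in> B}" by (rule openin_smooth_vimage[OF smfd_E smfd_N sb EU AB(2)])
    moreover have "disjnt {z \<in> ?EU. ?b z \<in> A} {z \<in> ?EU. ?b z \<in> B}" using AB(5) by (auto simp: disjnt_iff)
    moreover have "z \<in> {z \<in> ?EU. ?b z \<in> A}" "z' \<in> {z \<in> ?EU. ?b z \<in> B}" using z U AB True by simp_all
    ultimately show ?thesis by blast
  qed
qed

end

section \<open>The zero vector field and its canonical lift\<close>

text \<open>The zero field is treated as the generator of the constant flow, so that its lift can be
  evaluated by \<open>the_flow_field\<close>.\<close>

lemma zero_flow_field: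
  fixes N :: "('a, 'e::real_inner) mfd"
  assumes N: "smfd N"
  shows "smooth_flow N (\<lambda>x _. x)" "flow_field N (\<lambda>x _. x) = (\<lambda>_ _. 0)" "vector_field N (\<lambda>_ _. 0)"
proof -
  show F: "smooth_flow N (\<lambda>x _. x)"
    unfolding smooth_flow_def by (intro ballI conjI allI refl smooth_at_const smfd_vec(1) finite_dim_real N) simp_all
  show eq: "flow_field N (\<lambda>x _. x) = (\<lambda>_ _. 0)"
    using velocity_const[OF N] by (auto simp: flow_field_def)
  have "vector_field N (flow_field N (\<lambda>x _. x))"
  proof (rule flow_field_vector_field[OF N F])
    fix x assume x: "x \<in> points N"
    obtain c where c: "c \<in> charts_at N x" by (rule smfd_ex_chart[OF N x])
    have "smooth_at N vec_mfd (\<lambda>_. 0 :: 'e) x"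
      using x by (intro smooth_at_const N smfd_vec(1) smfd_finite_dim[OF N]) simp_all
    then have "smooth_at N vec_mfd (\<lambda>y. velocity N (\<lambda>_. y) 0 c) x"
      by (rule smooth_at_cong[OF N _ openin_points[OF N] x]) (simp add: velocity_const[OF N])
    then show "\<exists>c\<in>charts_at N x. smooth_at N vec_mfd (\<lambda>y. velocity N (\<lambda>_. y) 0 c) x" using c by blast
  qed
  then show "vector_field N (\<lambda>_ _. 0)" unfolding eq .
qed

lemma zero_flow:
  assumes N: "smfd N" and H: "Hausdorff_space (mtop N)"
  shows "flow_dom N (\<lambda>_ _. 0) t = points N" "x \<in> points N \<Longrightarrow> flow N (\<lambda>_ _. 0) t x = x"
  using flow_flow_field[OF N H zero_flow_field(1)[OF N], unfolded zero_flow_field(2)[OF N], OF zero_flow_field(3)[OF N]]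
  by simp_all

text \<open>An equality of records, so that \<open>FObj F\<close> at the open submanifold on which
  the zero flow is defined is literally \<open>FObj F M\<close>.\<close>

lemma open_sub_points:
  assumes "smfd N" shows "open_sub N (points N) = N"
proof -
  have "{c \<in> atlas N. fst c \<subseteq> points N} = atlas N"
    using smfd_chart[OF assms] unfolding is_chart_def by blast
  then show ?thesis by (simp add: open_sub_def)
qed

text \<open>The conditions on \<open>FMor\<close> in \<open>natural_bundle\<close> are stated for
  morphisms; this admits the identity to them.\<close>

lemma mor_id:
  assumes "manifold M" shows "mor M M id"
proof -
  note M = manifold_smfd[OF assms]
  have inv: "inv_into (points M) id x = x" if "x \<in> points M" for x
    using inv_into_f_f[of id "points M" x] that by simp
  have "smooth_map M M id"
    unfolding smooth_map_iff[OF M M] using smooth_at_id[OF M] by (simp add: id_def)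
  moreover have "smooth_map M M (inv_into (points M) id)"
    unfolding smooth_map_iff[OF M M]
  proof
    fix x assume x: "x \<in> points M"
    show "smooth_at M M (inv_into (points M) id) x"
      by (rule smooth_at_cong[OF M smooth_at_id[OF M x] openin_points[OF M] x]) (simp add: inv)
  qed
  ultimately have "diffeo M M id" by (simp add: diffeo_def)
  then have "local_diffeo M M id"
    unfolding local_diffeo_def using openin_points[OF M] open_sub_points[OF M]
    by (intro ballI exI[of _ "points M"]) simp
  then show ?thesis using assms by (simp add: mor_def)
qed

lemma natural_bundle_manifold:
  assumes "natural_bundle n F" "M \<in> Mf n"
  shows "manifold (FObj F M)"
  using assms unfolding natural_bundle_def fiber_bundle_def by blast

lemma canonical_lift_zero:
  assumes F: "natural_bundle n F" and Mn: "M \<in> Mf n"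
  shows "canonical_lift F M (\<lambda>_ _. 0) = (\<lambda>_ _. 0)"
proof -
  have mM: "manifold M" using Mn by (simp add: Mf_def)
  note M = manifold_smfd[OF mM] and HM = manifold_Hausdorff[OF mM]
  note mF = natural_bundle_manifold[OF F Mn]
  note FM = manifold_smfd[OF mF] and HF = manifold_Hausdorff[OF mF]
  have U: "open_sub M (flow_dom M (\<lambda>_ _. 0) t) = M" for t
    by (simp add: zero_flow[OF M HM] open_sub_points[OF M])
  have id: "FMor F M M id y = y" if "y \<in> points (FObj F M)" for y
    using F Mn that unfolding natural_bundle_def by blast
  \<comment> \<open>The flow of the zero field is the identity on \<open>points M\<close>, with no
    claim outside; the condition that \<open>FMor\<close> depends only on the values on the source
    bridges the gap.\<close>
  have fl: "FMor F M M (flow M (\<lambda>_ _. 0) t) y = y" if y: "y \<in> points (FObj F M)" for t y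
  proof -
    have "\<forall>g. (\<forall>x\<in>points M. g x = id x) \<longrightarrow> (\<forall>y\<in>points (FObj F M). FMor F M M g y = FMor F M M id y)"
      using F Mn mor_id[OF mM] unfolding natural_bundle_def by blast
    then show ?thesis using y id zero_flow(2)[OF M HM] by simp
  qed
  have "canonical_lift F M (\<lambda>_ _. 0) = flow_field (FObj F M) (\<lambda>x _. x)"
    unfolding canonical_lift_def Let_def U
  proof (rule the_flow_field[OF FM HF zero_flow_field(1)[OF FM]])
    show "vector_field (FObj F M) (flow_field (FObj F M) (\<lambda>x _. x))"
      by (simp add: zero_flow_field[OF FM])
    show "vector_field (FObj F M) (flow_field (FObj F M) (\<lambda>x _. x)) \<and>
      (\<forall>t. flow_dom (FObj F M) (flow_field (FObj F M) (\<lambda>x _. x)) t = FMor F M M id ` points (FObj F M)) \<and>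
      (\<forall>t. \<forall>y\<in>points (FObj F M). flow (FObj F M) (flow_field (FObj F M) (\<lambda>x _. x)) t (FMor F M M id y) =
         FMor F M M id (FMor F M M (flow M (\<lambda>_ _. 0) t) y))"
      by (simp add: zero_flow_field[OF FM] zero_flow[OF FM HF] id fl)
    fix Y
    assume "vector_field (FObj F M) Y \<and>
      (\<forall>t. flow_dom (FObj F M) Y t = FMor F M M id ` points (FObj F M)) \<and>
      (\<forall>t. \<forall>y\<in>points (FObj F M). flow (FObj F M) Y t (FMor F M M id y) =
         FMor F M M id (FMor F M M (flow M (\<lambda>_ _. 0) t) y))"
    then show "vector_field (FObj F M) Y \<and> (\<forall>t. flow_dom (FObj F M) Y t = points (FObj F M)) \<and>
      (\<forall>t. \<forall>x\<in>points (FObj F M). flow (FObj F M) Y t x = x)"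
      by (simp add: id fl)
  qed
  then show ?thesis by (simp add: zero_flow_field[OF FM])
qed

text \<open>The zero vector is the velocity of a constant curve, and the image of that curve is
  constant.\<close>

lemma tangent_map_zero:
  assumes M: "smfd M" and N: "smfd N" and f: "smooth_at M N f x"
  shows "tangent_map M N f x (\<lambda>_. 0) = (\<lambda>_. 0)"
proof -
  note V = smfd_vec(1)[OF finite_dim_real]
  have x: "x \<in> points M" "f x \<in> points N" using smooth_at_points[OF M N f] by auto
  have "smooth_at vec_mfd M (\<lambda>_. x) (0::real)" by (rule smooth_at_const[OF V M _ x(1)]) simp
  from tangent_map_velocity[OF M N this f] show ?thesis
    by (simp add: velocity_const[OF M x(1)] velocity_const[OF N x(2)])
qed

lemma Hausdorff_vec:
  assumes "finite_dim TYPE('v::real_inner)"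
  shows "Hausdorff_space (mtop (vec_mfd :: ('v, 'v) mfd))"
  unfolding Hausdorff_space_def topspace_mtop[OF smfd_vec(1)[OF assms]] openin_mtop_vec[OF assms] disjnt_def
  using hausdorff by blast

section \<open>Vertical fields from sections of the adjoint bundle\<close>

sublocale princ \<subseteq> A: assoc_bundle G M P "lie_alg G" "Ad G"
  by unfold_locales (simp_all add: smfd_lie_alg points_lie_alg Ad_one Ad_mult smooth_Ad)

locale princ_section = princ G M P
  for G :: "('g, 'l::real_inner) lie_group_data" and M :: "('a, 'e::real_inner) mfd"
    and P :: "('p, 'a, 'e, 'g, 'l) principal_bundle_data" +
  fixes a :: "'a \<Rightarrow> ('p \<times> ('g, 'l) tvec) set"
  assumes adj: "adjoint_section G M P a"
begin

text \<open>The equivariant function from \<open>P\<close> to the Lie algebra that corresponds to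
  the section \<open>a\<close>.\<close>

definition xi where "xi p = backslash G P (lie_alg G) (Ad G) p (a (pr p))"

definition Phi where "Phi p t = p \<star> oneps_of G (xi p) t"

abbreviation "X \<equiv> flow_field (ptot P) Phi"

lemma a_smooth: "x \<in> points M \<Longrightarrow> smooth_at M A.E a x"
  and a_proj: "x \<in> points M \<Longrightarrow> assoc_proj P (a x) = x"
  using adj unfolding adjoint_section_def smooth_map_iff[OF smfd_M A.smfd_E] by blast+

lemma a_points: "x \<in> points M \<Longrightarrow> a x \<in> points A.E"
  using smooth_at_points[OF smfd_M A.smfd_E a_smooth] by blast

lemma xi_TG: "p \<in> TP \<Longrightarrow> xi p \<in> TG"
  and cls_xi: "p \<in> TP \<Longrightarrow> A.cls p (xi p) = a (pr p)"
  using A.bs[of "a (pr p)" p] a_points[OF pr_points, of p] a_proj[OF pr_points, of p]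
  unfolding xi_def points_lie_alg by auto

text \<open>From [p g, Ad (inv g) \<xi>] = [p, \<xi>], both being the value of
  \<open>a\<close>.\<close>

lemma xi_act:
  assumes p: "p \<in> TP" and g: "g \<in> carrier (lgrp G)"
  shows "xi (p \<star> g) = Ad G (linv g) (xi p)"
proof -
  let ?y = "Ad G (linv g) (xi p)"
  have y: "?y \<in> points (lie_alg G)" using Ad_closed[OF inv_closed[OF g] xi_TG[OF p]] by (simp add: points_lie_alg)
  have "Ad G g ?y = Ad G (g \<cdot> linv g) (xi p)" using Ad_mult[OF g inv_closed[OF g] xi_TG[OF p]] by simp
  also have "\<dots> = xi p" using g by (simp add: Ad_one[OF xi_TG[OF p]])
  finally have "A.cls (p \<star> g) ?y = a (pr (p \<star> g))"
    using A.cls_act[OF p g y] cls_xi[OF p] pr_act[OF p g] by simp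
  then show ?thesis using A.bs_cls[OF act_closed[OF p g] y] by (simp add: xi_def[of "p \<star> g"])
qed

text \<open>In a local frame \<open>s\<close> the section becomes a smooth function \<eta> on the
  base, and \<open>xi q\<close> is Ad (pdiv q s) applied to it.\<close>

lemma xi_smooth:
  assumes p: "p \<in> TP" shows "smooth_at (ptot P) (lie_alg G) xi p"
proof -
  let ?x = "pr p"
  have x: "?x \<in> points M" by (rule pr_points[OF p])
  obtain U s where U: "A.sec U s" "?x \<in> U" by (rule A.sec_exists[OF x])
  define \<eta> where "\<eta> x = A.bs (s x) (a x)" for x
  note oU = A.sec_open[OF U(1)]
  have UM: "y \<in> points M" if "y \<in> U" for y using oU openin_mtop[OF smfd_M] that by blast
  have "assoc_proj P (a ?x) \<in> U" using a_proj[OF x] U(2) by simp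
  from smooth_at_compose[OF smfd_M A.smfd_E smfd_lie_alg a_smooth[OF x] A.smooth_from_E(2)[OF a_points[OF x] U(1) this]]
  have "smooth_at M (lie_alg G) (\<lambda>x. A.bs (s (assoc_proj P (a x))) (a x)) ?x" .
  then have s\<eta>: "smooth_at M (lie_alg G) \<eta> ?x"
    by (rule smooth_at_cong[OF smfd_M _ oU U(2)]) (simp add: \<eta>_def a_proj UM)
  note sid = smooth_at_id[OF smfd_P p]
  note spr = smooth_pr[OF smfd_P sid]
  define W where "W = {q \<in> TP. pr q \<in> U}"
  have W: "openin (mtop (ptot P)) W" unfolding W_def
    by (rule openin_smooth_vimage[OF smfd_P smfd_M smooth_pr[OF smfd_P smooth_at_id[OF smfd_P]] openin_points[OF smfd_P] oU])
  have pW: "p \<in> W" using p U(2) by (simp add: W_def)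
  have "smooth_at (ptot P) (lmfd G) (\<lambda>q. pdiv q (s (pr q))) p"
    by (rule smooth_pdiv[OF smfd_P sid smooth_at_compose[OF smfd_P smfd_M smfd_P spr A.secD(1)[OF U]] W pW])
      (simp add: W_def A.secD(2)[OF U(1)])
  from A.smooth_\<alpha>[OF smfd_P this smooth_at_compose[OF smfd_P smfd_M smfd_lie_alg spr s\<eta>]]
  show ?thesis
  proof (rule smooth_at_cong[OF smfd_P _ W pW])
    fix q assume q: "q \<in> W"
    then have q': "q \<in> TP" "pr q \<in> U" by (auto simp: W_def)
    note sq = A.secD(3)[OF U(1) q'(2)] A.secD(2)[OF U(1) q'(2)]
    have m: "pr q \<in> points M" by (rule pr_points[OF q'(1)])
    have b: "\<eta> (pr q) \<in> points (lie_alg G)" "A.cls (s (pr q)) (\<eta> (pr q)) = a (pr q)"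
      unfolding \<eta>_def using A.bs[OF a_points[OF m] sq(1)] sq(2) a_proj[OF m] by simp_all
    show "Ad G (pdiv q (s (pr q))) (\<eta> (pr q)) = xi q"
      using A.bs_cls_fibre(1)[OF q'(1) sq(1) _ b(1)] sq(2) b(2) by (simp add: xi_def)
  qed
qed

lemma oneps_xi: "p \<in> TP \<Longrightarrow> oneps G (oneps_of G (xi p))"
  by (rule oneps_of(1)[OF xi_TG])

lemma oneps_xi_carrier: "p \<in> TP \<Longrightarrow> oneps_of G (xi p) t \<in> carrier (lgrp G)"
  by (rule oneps_carrier[OF oneps_xi])

lemma Phi_points: "p \<in> TP \<Longrightarrow> Phi p t \<in> TP"
  and pr_Phi: "p \<in> TP \<Longrightarrow> pr (Phi p t) = pr p"
  by (simp_all add: Phi_def act_closed pr_act oneps_xi_carrier)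

text \<open>Since exp(t Ad (inv g) \<xi>) = inv g exp(t \<xi>) g, moving g past the exponential is
  exactly what \<open>xi_act\<close> requires. Invariance of \<open>X\<close> and the flow on the
  associated bundle rest on this.\<close>

lemma Phi_act:
  assumes p: "p \<in> TP" and g: "g \<in> carrier (lgrp G)"
  shows "Phi (p \<star> g) t = Phi p t \<star> g"
proof -
  have "Phi (p \<star> g) t = p \<star> g \<star> (linv g \<cdot> oneps_of G (xi p) t \<cdot> linv (linv g))"
    using oneps_of_Ad[OF inv_closed[OF g] xi_TG[OF p]] by (simp add: Phi_def xi_act[OF p g])
  also have "\<dots> = p \<star> (g \<cdot> (linv g \<cdot> oneps_of G (xi p) t \<cdot> g))"
    using p g oneps_xi_carrier[OF p] by (simp add: act_mult)
  also have "g \<cdot> (linv g \<cdot> oneps_of G (xi p) t \<cdot> g) = oneps_of G (xi p) t \<cdot> g"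
    using g oneps_xi_carrier[OF p] by (simp add: m_assoc[symmetric])
  finally show ?thesis using p g oneps_xi_carrier[OF p] by (simp add: Phi_def act_mult)
qed

lemma Phi_0: "p \<in> TP \<Longrightarrow> Phi p 0 = p"
  by (simp add: Phi_def oneps_0[OF oneps_xi] act_one)

text \<open>\<open>xi\<close> is constant along the orbit, because exp(s \<xi>) fixes \<xi> under
  the adjoint action; the rest is the group law of the one-parameter subgroup.\<close>

lemma Phi_add: 
  assumes p: "p \<in> TP" shows "Phi p (s + t) = Phi (Phi p s) t"
proof -
  have "xi (Phi p s) = xi p"
    unfolding Phi_def using xi_act[OF p oneps_xi_carrier[OF p]] Ad_oneps_self[OF xi_TG[OF p]] by simp
  then show ?thesis
    using p by (simp add: Phi_def oneps_add[OF oneps_xi] act_mult oneps_xi_carrier)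
qed

lemma Phi_smooth: "p \<in> TP \<Longrightarrow> smooth_at vec_mfd (ptot P) (Phi p) (t::real)"
  unfolding Phi_def[abs_def]
  by (intro smooth_act smooth_at_const smfd_vec(1) finite_dim_real smfd_P oneps_smooth oneps_xi) simp_all

lemma Phi_flow: "smooth_flow (ptot P) Phi"
  unfolding smooth_flow_def using Phi_0 Phi_add Phi_smooth by blast

lemma X_vector_field: "vector_field (ptot P) X"
proof (rule flow_field_vector_field[OF smfd_P Phi_flow])
  fix p assume p: "p \<in> TP"
  obtain c where c: "c \<in> charts_at (ptot P) p" by (rule smfd_ex_chart[OF smfd_P p])
  note PG = smfd_prod(1)[OF smfd_P smfd_G]
  have pe: "(p, \<e>) \<in> TP \<times> points (lmfd G)" using p by (simp add: points_G)
  have f: "smooth_at (prod_mfd (ptot P) (lmfd G)) (ptot P) (\<lambda>w. fst w \<star> snd w) (p, \<e>)"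
    by (rule smooth_act[OF PG smooth_at_fst[OF smfd_P smfd_G pe] smooth_at_snd[OF smfd_P smfd_G pe]])
  have "smooth_at (ptot P) vec_mfd (\<lambda>q. velocity (ptot P) (\<lambda>s. (\<lambda>w. fst w \<star> snd w) (q, oneps_of G (xi q) s)) 0 c) p"
    by (rule smooth_velocity_oneps[OF smfd_P smfd_P f openin_points[OF smfd_P] p xi_smooth])
      (use c p in \<open>simp_all add: act_one\<close>)
  then have "smooth_at (ptot P) vec_mfd (\<lambda>q. velocity (ptot P) (Phi q) 0 c) p" by (simp add: Phi_def[abs_def])
  then show "\<exists>c\<in>charts_at (ptot P) p. smooth_at (ptot P) vec_mfd (\<lambda>y. velocity (ptot P) (Phi y) 0 c) p" using c by blast
qed

lemma X_flow: "flow_dom (ptot P) X t = TP" "p \<in> TP \<Longrightarrow> flow (ptot P) X t p = Phi p t"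
  using flow_flow_field[OF smfd_P Hausdorff_P Phi_flow X_vector_field] by auto

lemma X_tangent_map:
  assumes p: "p \<in> TP" and N: "smfd N" and f: "smooth_at (ptot P) N f p"
  shows "tangent_map (ptot P) N f p (X p) = velocity N (\<lambda>s. f (Phi p s)) 0"
  using tangent_map_velocity[OF smfd_P N Phi_smooth[OF p], of f 0] f p by (simp add: Phi_0 flow_field_def)

lemma X_invariant: "G_invariant G P X"
  unfolding G_invariant_def
proof (intro ballI)
  fix g p assume g: "g \<in> carrier (lgrp G)" and p: "p \<in> TP"
  have "smooth_at (ptot P) (ptot P) (\<lambda>q. q \<star> g) p"
    by (rule smooth_act[OF smfd_P smooth_at_id[OF smfd_P p] smooth_const_G[OF smfd_P p g]])
  from X_tangent_map[OF p smfd_P this]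
  show "tangent_map (ptot P) (ptot P) (\<lambda>q. q \<star> g) p (X p) = X (p \<star> g)"
    using act_closed[OF p g] by (simp add: Phi_act[OF p g, abs_def, symmetric] flow_field_def)
qed

lemma X_vertical: "vertical M P X"
  unfolding vertical_def
proof
  fix p assume p: "p \<in> TP"
  from X_tangent_map[OF p smfd_M smooth_pr[OF smfd_P smooth_at_id[OF smfd_P p]]]
  show "tangent_map (ptot P) M pr p (X p) = (\<lambda>_. 0)"
    by (simp add: pr_Phi[OF p] velocity_const[OF smfd_M pr_points[OF p]])
qed

lemma section_field_eq: "section_field G M P a = X"
  unfolding section_field_def
\<comment> \<open>The flow alone determines the field; invariance and verticality are only verified
  for \<open>X\<close>.\<close>
proof (rule the_flow_field[OF smfd_P Hausdorff_P Phi_flow X_vector_field])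
  have exp: "p \<star> lie_exp G (\<lambda>c. t *\<^sub>R backslash G P (lie_alg G) (Ad G) p (a (pr p)) c) = Phi p t" if "p \<in> TP" for p t
    using lie_exp_scale[OF xi_TG[OF that], of t] by (simp add: Phi_def xi_def)
  show "vector_field (ptot P) X \<and> G_invariant G P X \<and> vertical M P X \<and>
      (\<forall>t. flow_dom (ptot P) X t = TP) \<and> (\<forall>t. \<forall>p\<in>TP. flow (ptot P) X t p =
         p \<star> lie_exp G (\<lambda>c. t *\<^sub>R backslash G P (lie_alg G) (Ad G) p (a (pr p)) c))"
    using X_vector_field X_invariant X_vertical X_flow exp by simp
  fix Y
  assume "vector_field (ptot P) Y \<and> G_invariant G P Y \<and> vertical M P Y \<and>
      (\<forall>t. flow_dom (ptot P) Y t = TP) \<and> (\<forall>t. \<forall>p\<in>TP. flow (ptot P) Y t p =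
         p \<star> lie_exp G (\<lambda>c. t *\<^sub>R backslash G P (lie_alg G) (Ad G) p (a (pr p)) c))"
  then show "vector_field (ptot P) Y \<and> (\<forall>t. flow_dom (ptot P) Y t = TP) \<and> (\<forall>t. \<forall>x\<in>TP. flow (ptot P) Y t x = Phi x t)"
    using exp by simp
qed

text \<open>Local sections show that the projection of \<open>P\<close> is onto, so a field on
  \<open>M\<close> below the vertical field \<open>X\<close> vanishes at every point.\<close>

lemma base_field_eq: "base_field M P X = (\<lambda>_ _. 0)"
  unfolding base_field_def
proof (rule the_equality)
  show "vector_field M (\<lambda>_ _. 0) \<and> (\<forall>p\<in>TP. tangent_map (ptot P) M pr p (X p) = (\<lambda>_. 0))"
    using zero_flow_field(3)[OF smfd_M] X_vertical by (simp add: vertical_def)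
  fix Y assume Y: "vector_field M Y \<and> (\<forall>p\<in>TP. tangent_map (ptot P) M pr p (X p) = Y (pr p))"
  show "Y = (\<lambda>_ _. 0)"
  proof
    fix x
    show "Y x = (\<lambda>_. 0)"
    proof (cases "x \<in> points M")
      case True
      obtain U s where U: "A.sec U s" "x \<in> U" by (rule A.sec_exists[OF True])
      have "s x \<in> TP" "pr (s x) = x" using A.secD[OF U] by auto
      then show ?thesis using Y X_vertical unfolding vertical_def by metis
    next
      case False
      then show ?thesis using Y by (simp add: vector_field_def)
    qed
  qed
qed

end

section \<open>The Darboux-Lie derivative\<close>

locale princ_module = princ_section G M P a
  for G :: "('g, 'l::real_inner) lie_group_data" and M :: "('a, 'e::real_inner) mfd"
    and P :: "('p, 'a, 'e, 'g, 'l) principal_bundle_data" and a +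
  fixes \<rho> :: "'g \<Rightarrow> 'v \<Rightarrow> 'v::real_inner"
  assumes lmod: "lie_module G \<rho>"
begin

lemma fd_V: "finite_dim TYPE('v)"
  using lmod by (simp add: lie_module_def)

lemma smfd_V: "smfd (vec_mfd :: ('v, 'v) mfd)"
  by (rule smfd_vec(1)[OF fd_V])

lemma \<rho>_linear: "g \<in> carrier (lgrp G) \<Longrightarrow> linear (\<rho> g)"
  using lmod by (simp add: lie_module_def)

end

sublocale princ_module \<subseteq> V: assoc_bundle G M P vec_mfd \<rho>
  using lmod smfd_V by unfold_locales (simp_all add: lie_module_def)

context princ_module
begin

section \<open>The infinitesimal action on the module\<close>

lemma \<rho>_deriv:
  assumes "g \<in> carrier (lgrp G)" "(\<gamma> has_vector_derivative w) F"
  shows "((\<lambda>t. \<rho> g (\<gamma> t)) has_vector_derivative \<rho> g w) F"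
  by (rule bounded_linear.has_vector_derivative[OF linear_bounded_finite_dim[OF fd_V \<rho>_linear[OF assms(1)]] assms(2)])

lemma \<rho>_inv: "g \<in> carrier (lgrp G) \<Longrightarrow> \<rho> (linv g) (\<rho> g v) = v" "g \<in> carrier (lgrp G) \<Longrightarrow> \<rho> g (\<rho> (linv g) v) = v"
  using V.\<alpha>_mult[of "linv g" g v] V.\<alpha>_mult[of g "linv g" v] V.\<alpha>_one[of v] by simp_all

lemma smooth_\<rho>_curve:
  assumes "smooth_at vec_mfd (lmfd G) \<gamma> (t::real)" shows "smooth_at vec_mfd vec_mfd (\<lambda>s. \<rho> (\<gamma> s) v) t"
  by (intro V.smooth_\<alpha> smfd_vec(1) finite_dim_real assms smooth_at_const smfd_V) simp_all

lemma vec_velocity_deriv: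
  fixes \<gamma> :: "real \<Rightarrow> 'v"
  assumes "smooth_at vec_mfd vec_mfd \<gamma> 0"
  shows "(\<gamma> has_vector_derivative vpr (velocity vec_mfd \<gamma> 0)) (at 0)"
proof -
  have "(\<gamma> has_vector_derivative velocity vec_mfd \<gamma> 0 (UNIV, id)) (at 0)"
    using velocity_chart[OF smfd_V assms vec_charts_at[OF fd_V]] by simp
  with vpr_eq[OF fd_V assms this] show ?thesis by simp
qed

text \<open>The velocity of \<rho> (\<gamma> t) v depends on \<gamma> only through its initial
  velocity, so the description can be evaluated on exp(s \<xi>).\<close>

lemma lie_alg_act_eq:
  assumes \<xi>: "\<xi> \<in> TG"
  shows "lie_alg_act G \<rho> \<xi> v = vpr (velocity vec_mfd (\<lambda>s. \<rho> (oneps_of G \<xi> s) v) 0)"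
  unfolding lie_alg_act_def
proof (rule the_equality)
  note o = oneps_of[OF \<xi>]
  show "\<exists>\<gamma>. smooth_curve_at_0 (lmfd G) \<gamma> \<and> \<gamma> 0 = \<e> \<and> velocity (lmfd G) \<gamma> 0 = \<xi> \<and>
     vpr (velocity vec_mfd (\<lambda>s. \<rho> (oneps_of G \<xi> s) v) 0) = vpr (velocity vec_mfd (\<lambda>t. \<rho> (\<gamma> t) v) 0)"
    using smooth_curve_at_0I[OF smfd_G oneps_smooth[OF o(1)]] oneps_0[OF o(1)] o(2) by blast
  fix w assume "\<exists>\<gamma>. smooth_curve_at_0 (lmfd G) \<gamma> \<and> \<gamma> 0 = \<e> \<and> velocity (lmfd G) \<gamma> 0 = \<xi> \<and>
     w = vpr (velocity vec_mfd (\<lambda>t. \<rho> (\<gamma> t) v) 0)"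
  then obtain \<gamma> where \<gamma>: "smooth_curve_at_0 (lmfd G) \<gamma>" "\<gamma> 0 = \<e>" "velocity (lmfd G) \<gamma> 0 = \<xi>"
    "w = vpr (velocity vec_mfd (\<lambda>t. \<rho> (\<gamma> t) v) 0)" by blast
  have e1: "\<e> \<in> points (lmfd G)" by (simp add: points_G)
  have "smooth_at (lmfd G) vec_mfd (\<lambda>g. \<rho> g v) (\<gamma> 0)"
    unfolding \<gamma>(2)
    by (rule V.smooth_\<alpha>[OF smfd_G smooth_at_id[OF smfd_G e1] smooth_at_const[OF smfd_G smfd_V e1]]) simp
  from velocity_map_cong[OF smfd_G smfd_V smooth_curve_at_0D[OF smfd_G \<gamma>(1)] oneps_smooth[OF o(1)] _ _ this, of 0]
  show "w = vpr (velocity vec_mfd (\<lambda>s. \<rho> (oneps_of G \<xi> s) v) 0)"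
    using \<gamma> o by (simp add: oneps_0)
qed

lemma lie_alg_act_deriv:
  assumes "\<xi> \<in> TG"
  shows "((\<lambda>s. \<rho> (oneps_of G \<xi> s) v) has_vector_derivative lie_alg_act G \<rho> \<xi> v) (at 0)"
  unfolding lie_alg_act_eq[OF assms]
  by (rule vec_velocity_deriv[OF smooth_\<rho>_curve[OF oneps_smooth[OF oneps_of(1)[OF assms]]]])

text \<open>Differentiate \<rho> (g exp(s \<xi>) inv g) (\<rho> g v) = \<rho> g (\<rho> (exp(s
  \<xi>)) v) at s = 0. It makes the class a \<sqdot> h independent of the frame.\<close>

lemma lie_alg_act_Ad:
  assumes \<xi>: "\<xi> \<in> TG" and g: "g \<in> carrier (lgrp G)"
  shows "lie_alg_act G \<rho> (Ad G g \<xi>) (\<rho> g v) = \<rho> g (lie_alg_act G \<rho> \<xi> v)"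
proof -
  have c: "oneps_of G \<xi> s \<in> carrier (lgrp G)" for s by (rule oneps_carrier[OF oneps_of(1)[OF \<xi>]])
  have "\<rho> (oneps_of G (Ad G g \<xi>) s) (\<rho> g v) = \<rho> g (\<rho> (oneps_of G \<xi> s) v)" for s
    using g c[of s] by (simp add: oneps_of_Ad[OF g \<xi>] V.\<alpha>_mult \<rho>_inv)
  then have "((\<lambda>s. \<rho> g (\<rho> (oneps_of G \<xi> s) v)) has_vector_derivative lie_alg_act G \<rho> (Ad G g \<xi>) (\<rho> g v)) (at 0)"
    using lie_alg_act_deriv[OF Ad_closed[OF g \<xi>], of "\<rho> g v"] by simp
  from vector_derivative_unique_at[OF this \<rho>_deriv[OF g lie_alg_act_deriv[OF \<xi>]]] show ?thesis .
qed

text \<open>Another representative of the class differs by some g, and the linear map \<rho> g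
  commutes with negation.\<close>

lemma assoc_neg_cls:
  assumes p: "p \<in> TP"
  shows "assoc_neg G P \<rho> (V.cls p w) = V.cls p (- w)"
  unfolding assoc_neg_def
proof (rule the_equality)
  show "\<exists>q\<in>TP. \<exists>v. V.cls p w = V.cls q v \<and> V.cls p (- w) = V.cls q (- v)" using p by blast
  fix z assume "\<exists>q\<in>TP. \<exists>v. V.cls p w = V.cls q v \<and> z = V.cls q (- v)"
  then obtain q v where q: "q \<in> TP" "V.cls p w = V.cls q v" "z = V.cls q (- v)" by blast
  obtain g where g: "g \<in> carrier (lgrp G)" "q = p \<star> g" "v = \<rho> (linv g) w"
    by (rule V.cls_eqD[OF p _ q(1) _ q(2)]) simp_all
  have "\<rho> g (- v) = - \<rho> g v" by (rule linear_neg[OF \<rho>_linear[OF g(1)]])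
  then show "z = V.cls p (- w)" using V.cls_act[OF p g(1), of "- v"] g q(3) by (simp add: \<rho>_inv)
qed

section \<open>The induced flow on the associated bundle\<close>

text \<open>By \<open>cls_Phi_cong\<close> below, the choice of \<open>p\<close> is irrelevant.\<close>

definition Psi where
  "Psi z t = (let p = (SOME p. p \<in> TP \<and> pr p = assoc_proj P z) in V.cls (Phi p t) (V.bs p z))"

text \<open>Representatives of one class differ by an element of \<open>G\<close>, and the flow on
  \<open>P\<close> commutes with the action of \<open>G\<close>.\<close>

lemma cls_Phi_cong:
  assumes p: "p \<in> TP" "q \<in> TP" and eq: "V.cls p v = V.cls q w"
  shows "V.cls (Phi p t) v = V.cls (Phi q t) w"
proof -
  obtain g where g: "g \<in> carrier (lgrp G)" "q = p \<star> g" "w = \<rho> (linv g) v"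
    by (rule V.cls_eqD[OF p(1) _ p(2) _ eq]) simp_all
  have "V.cls (Phi q t) w = V.cls (Phi p t) (\<rho> g w)"
    using V.cls_act[OF Phi_points[OF p(1)] g(1), of w t] by (simp add: g(2) Phi_act[OF p(1) g(1)])
  then show ?thesis using g by (simp add: \<rho>_inv)
qed

lemma Psi_cls:
  assumes p: "p \<in> TP" shows "Psi (V.cls p v) t = V.cls (Phi p t) v"
proof -
  let ?z = "V.cls p v"
  define q where "q = (SOME q. q \<in> TP \<and> pr q = assoc_proj P ?z)"
  have pz: "assoc_proj P ?z = pr p" by (rule V.cls_proj[OF p]) simp
  have "\<exists>q. q \<in> TP \<and> pr q = assoc_proj P ?z" using p pz by auto
  from someI_ex[OF this] have q: "q \<in> TP" "pr q = assoc_proj P ?z" unfolding q_def by auto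
  have "?z \<in> points V.E" by (rule V.cls_points[OF p]) simp
  from V.bs(2)[OF this q(1)] q(2) have "V.cls p v = V.cls q (V.bs q ?z)" by simp
  from cls_Phi_cong[OF p q(1) this] show ?thesis by (simp add: Psi_def q_def[symmetric])
qed

lemma Psi_flow: "smooth_flow V.E Psi"
  unfolding smooth_flow_def
proof (intro ballI)
  fix z assume "z \<in> points V.E"
  then obtain p v where p: "p \<in> TP" "z = V.cls p v" by (rule V.points_E_E)
  have "smooth_at vec_mfd V.E (\<lambda>t. V.cls (Phi p t) v) t" for t :: real
    by (intro V.smooth_cls smfd_vec(1) finite_dim_real Phi_smooth p(1) smooth_at_const smfd_V) simp_all
  moreover have "Psi z = (\<lambda>t. V.cls (Phi p t) v)" by (simp add: p(2) Psi_cls[OF p(1), abs_def] fun_eq_iff Psi_cls[OF p(1)])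
  ultimately have "smooth_at vec_mfd V.E (Psi z) t" for t :: real by simp
  moreover have "Psi z (s + t) = Psi (Psi z s) t" for s t
    using p(1) by (simp add: p(2) Psi_cls Phi_points Phi_add)
  moreover have "Psi z 0 = z" using p(1) by (simp add: p(2) Psi_cls Phi_0)
  ultimately show "Psi z 0 = z \<and> (\<forall>s t. Psi z (s + t) = Psi (Psi z s) t) \<and> (\<forall>t. smooth_at vec_mfd V.E (Psi z) t)" by blast
qed

text \<open>In a local frame \<open>s\<close>, the orbit of w is
  [s(x) exp(t \<xi>), s(x) \<setminus> w], with x the base point of w and \<xi> = xi (s(x)): a
  smooth map of w and a group element, evaluated along exp(t \<xi>). So
  \<open>smooth_velocity_oneps\<close> applies.\<close>

lemma Psi_vector_field: "vector_field V.E (flow_field V.E Psi)"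
proof (rule flow_field_vector_field[OF V.smfd_E Psi_flow])
  fix z assume z: "z \<in> points V.E"
  obtain c where c: "c \<in> charts_at V.E z" by (rule smfd_ex_chart[OF V.smfd_E z])
  obtain U s where U: "V.sec U s" "assoc_proj P z \<in> U" by (rule V.sec_exists[OF V.proj_points[OF z]])
  note EG = smfd_prod(1)[OF V.smfd_E smfd_G] and oU = V.sec_open[OF U(1)]
  define W where "W = {z \<in> points V.E. assoc_proj P z \<in> U}"
  have W: "openin (mtop V.E) W" unfolding W_def
    by (rule openin_smooth_vimage[OF V.smfd_E smfd_M V.smooth_assoc_proj openin_points[OF V.smfd_E] oU])
  have zW: "z \<in> W" using z U(2) by (simp add: W_def)
  have ze: "(z, \<e>) \<in> points V.E \<times> points (lmfd G)" using z by (simp add: points_G)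
  have ss: "smooth_at V.E (ptot P) (\<lambda>w. s (assoc_proj P w)) w" if "w \<in> W" for w
    using that by (intro smooth_at_compose[OF V.smfd_E smfd_M smfd_P V.smooth_assoc_proj V.secD(1)[OF U(1)]]) (auto simp: W_def)
  note sf = smooth_at_fst[OF V.smfd_E smfd_G ze] and sn = smooth_at_snd[OF V.smfd_E smfd_G ze]
  let ?f = "\<lambda>w. V.cls (s (assoc_proj P (fst w)) \<star> snd w) (V.bs (s (assoc_proj P (fst w))) (fst w))"
  have "smooth_at (prod_mfd V.E (lmfd G)) (ptot P) (\<lambda>w. s (assoc_proj P (fst w))) (z, \<e>)"
    using smooth_at_compose[where f=fst, OF EG V.smfd_E smfd_P sf, of "\<lambda>w. s (assoc_proj P w)"] ss[OF zW] by simp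
  note f1 = smooth_act[OF EG this sn]
  have f2: "smooth_at (prod_mfd V.E (lmfd G)) vec_mfd (\<lambda>w. V.bs (s (assoc_proj P (fst w))) (fst w)) (z, \<e>)"
    using smooth_at_compose[where f=fst, OF EG V.smfd_E smfd_V sf, of "\<lambda>w. V.bs (s (assoc_proj P w)) w"] 
      V.smooth_from_E(2)[OF z U] by simp
  have f: "smooth_at (prod_mfd V.E (lmfd G)) V.E ?f (z, \<e>)" by (rule V.smooth_cls[OF EG f1 f2])
  have sx: "s (assoc_proj P w) \<in> TP" "V.cls (s (assoc_proj P w)) (V.bs (s (assoc_proj P w)) w) = w" if "w \<in> W" for w
  proof -
    have w: "w \<in> points V.E" "assoc_proj P w \<in> U" using that by (auto simp: W_def)
    show sT: "s (assoc_proj P w) \<in> TP" by (rule V.secD(3)[OF U(1) w(2)])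
    show "V.cls (s (assoc_proj P w)) (V.bs (s (assoc_proj P w)) w) = w"
      by (rule V.bs(2)[OF w(1) sT]) (simp add: V.secD(2)[OF U(1) w(2)])
  qed
  have "smooth_at V.E vec_mfd (\<lambda>w. velocity V.E (\<lambda>t. ?f (w, oneps_of G (xi (s (assoc_proj P w))) t)) 0 c) z"
  proof (rule smooth_velocity_oneps[OF V.smfd_E V.smfd_E f W zW])
    show "smooth_at V.E (lie_alg G) (\<lambda>w. xi (s (assoc_proj P w))) w" if "w \<in> W" for w
      by (rule smooth_at_compose[OF V.smfd_E smfd_P smfd_lie_alg ss[OF that] xi_smooth[OF sx(1)[OF that]]])
    show "c \<in> charts_at V.E (?f (z, \<e>))" using c sx[OF zW] by (simp add: act_one)
  qed
  then have "smooth_at V.E vec_mfd (\<lambda>w. velocity V.E (Psi w) 0 c) z"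
  proof (rule smooth_at_cong[OF V.smfd_E _ W zW])
    fix w assume w: "w \<in> W"
    have "Psi w t = V.cls (Phi (s (assoc_proj P w)) t) (V.bs (s (assoc_proj P w)) w)" for t
      using Psi_cls[OF sx(1)[OF w], of "V.bs (s (assoc_proj P w)) w" t] sx(2)[OF w] by simp
    then have "Psi w = (\<lambda>t. ?f (w, oneps_of G (xi (s (assoc_proj P w))) t))" by (auto simp: Phi_def)
    then show "velocity V.E (\<lambda>t. ?f (w, oneps_of G (xi (s (assoc_proj P w))) t)) 0 c = velocity V.E (Psi w) 0 c" by simp
  qed
  then show "\<exists>c\<in>charts_at V.E z. smooth_at V.E vec_mfd (\<lambda>y. velocity V.E (Psi y) 0 c) z" using c by blast
qed

lemma assoc_field_eq: "assoc_field G M P \<rho> X = flow_field V.E Psi"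
  unfolding assoc_field_def X_flow(1)
proof (rule the_flow_field[OF V.smfd_E V.Hausdorff_E[OF Hausdorff_vec[OF fd_V]] Psi_flow Psi_vector_field])
  have E: "{V.cls p v |p v. p \<in> TP} = points V.E" by (simp add: V.points_E)
  note fl = flow_flow_field[OF V.smfd_E V.Hausdorff_E[OF Hausdorff_vec[OF fd_V]] Psi_flow Psi_vector_field]
  have cE: "V.cls p v \<in> points V.E" if "p \<in> TP" for p v by (rule V.cls_points[OF that]) simp
  show "vector_field V.E (flow_field V.E Psi) \<and>
      (\<forall>t. flow_dom V.E (flow_field V.E Psi) t = {V.cls p v |p v. p \<in> TP}) \<and>
      (\<forall>t. \<forall>p\<in>TP. \<forall>v. flow V.E (flow_field V.E Psi) t (V.cls p v) = V.cls (flow (ptot P) X t p) v)"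
    unfolding E using Psi_vector_field fl cE by (simp add: X_flow(2) Psi_cls)
  fix Y
  assume Y: "vector_field V.E Y \<and> (\<forall>t. flow_dom V.E Y t = {V.cls p v |p v. p \<in> TP}) \<and>
      (\<forall>t. \<forall>p\<in>TP. \<forall>v. flow V.E Y t (V.cls p v) = V.cls (flow (ptot P) X t p) v)"
  have "flow V.E Y t z = Psi z t" if z: "z \<in> points V.E" for t z
  proof -
    obtain p v where p: "p \<in> TP" "z = V.cls p v" by (rule V.points_E_E[OF z])
    then show ?thesis using Y by (simp add: X_flow(2) Psi_cls)
  qed
  then show "vector_field V.E Y \<and> (\<forall>t. flow_dom V.E Y t = points V.E) \<and> (\<forall>t. \<forall>x\<in>points V.E. flow V.E Y t x = Psi x t)"
    using Y unfolding E by blast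
qed

text \<open>Consequently the velocity of \<open>[p, \<gamma>]\<close> determines that of \<open>\<gamma>\<close>.\<close>

lemma cls_left_inverse:
  assumes p: "p \<in> TP"
  obtains f where "\<And>v. f (V.cls p v) = v" "\<And>v. smooth_at V.E vec_mfd f (V.cls p v)"
proof -
  obtain U s where U: "V.sec U s" "pr p \<in> U" by (rule V.sec_exists[OF pr_points[OF p]])
  note sp = V.secD(3)[OF U] V.secD(2)[OF U]
  let ?k = "pdiv (s (pr p)) p"
  note k = pdiv[OF sp(1) p sp(2)]
  \<comment> \<open>On the fibre through \<open>p\<close> this is p \<setminus> z, because p is the
    section value times \<open>?k\<close>; over neighbouring points, keeping \<open>?k\<close> fixed
    merely extends it smoothly.\<close>
  define f where "f z = \<rho> (linv ?k) (V.bs (s (assoc_proj P z)) z)" for z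
  have pj: "assoc_proj P (V.cls p v) = pr p" for v by (rule V.cls_proj[OF p]) simp
  have E: "V.cls p v \<in> points V.E" for v by (rule V.cls_points[OF p]) simp
  have "f (V.cls p v) = v" for v
    unfolding f_def pj using V.bs_cls_fibre(1)[OF sp(1) p sp(2), of v] k by (simp add: \<rho>_inv)
  moreover have "smooth_at V.E vec_mfd f (V.cls p v)" for v
    unfolding f_def[abs_def]
    by (rule V.smooth_\<alpha>[OF V.smfd_E smooth_const_G[OF V.smfd_E E inv_closed[OF k(1)]] V.smooth_from_E(2)[OF E U(1)]])
      (simp add: pj U(2))
  ultimately show ?thesis using that by blast
qed

text \<open>The lifted field contributes zero, so \<eta> is minus the velocity of
  [p, exp(s \<xi>) v], that is, the velocity of the same curve run backwards.\<close>

lemma darboux_lie_eq: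
  assumes p: "p \<in> TP" and FM: "smfd (FObj F M)" and lift: "canonical_lift F M (\<lambda>_ _. 0) = (\<lambda>_ _. 0)"
    and h: "smooth_at (FObj F M) V.E h y" "h y = V.cls p v"
  shows "darboux_lie F G M P \<rho> X h y = V.cls p (- lie_alg_act G \<rho> (xi p) v)"
proof -
  let ?w = "lie_alg_act G \<rho> (xi p) v"
  note R = smfd_vec(1)[OF finite_dim_real] and o = oneps_xi[OF p]
  define \<beta> where "\<beta> s = \<rho> (oneps_of G (xi p) s) v" for s
  \<comment> \<open>The time reversal of \<beta>, spelled as an affine substitution to match
    \<open>velocity_affine\<close>.\<close>
  define \<delta> where "\<delta> s = \<beta> (0 + (- 1) * s)" for s
  have s\<beta>: "smooth_at vec_mfd vec_mfd \<beta> t" for t unfolding \<beta>_def[abs_def] by (rule smooth_\<rho>_curve[OF oneps_smooth[OF o]])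
  have s\<delta>: "smooth_at vec_mfd vec_mfd \<delta> t" for t unfolding \<delta>_def[abs_def] by (rule smooth_at_affine_curve[OF smfd_V s\<beta>])
  have \<beta>0: "\<beta> 0 = v" "\<delta> 0 = v" using V.\<alpha>_one[of v] by (simp_all add: \<delta>_def \<beta>_def oneps_0[OF o])
  have d\<beta>: "(\<beta> has_vector_derivative ?w) (at 0)"
    unfolding \<beta>_def[abs_def] by (rule lie_alg_act_deriv[OF xi_TG[OF p]])
  have "((\<lambda>s. 0 + (- 1) * s) has_vector_derivative (- 1)) (at (0::real))"
    by (auto intro!: derivative_eq_intros)
  from vector_diff_chain_at[OF this, of \<beta> ?w] d\<beta>
  have d\<delta>: "(\<delta> has_vector_derivative - ?w) (at 0)" by (simp add: \<delta>_def[abs_def] o_def)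
  have vpr\<delta>: "vpr (velocity vec_mfd \<delta> 0) = - ?w" by (rule vpr_eq[OF fd_V s\<delta> d\<delta>])
  have sE: "smooth_at vec_mfd V.E (\<lambda>t. V.cls q (\<gamma> t)) t" if "q \<in> TP" "smooth_at vec_mfd vec_mfd \<gamma> t" for q \<gamma> and t :: real
    by (intro V.smooth_cls R smooth_at_const smfd_P that) simp
  let ?\<eta> = "\<lambda>c. tangent_map (FObj F M) V.E h y (canonical_lift F M (base_field M P X) y) c - assoc_field G M P \<rho> X (h y) c"
  have "Psi (h y) = (\<lambda>s. V.cls p (\<beta> s))"
    using V.cls_act[OF p oneps_xi_carrier[OF p]] by (auto simp: h(2) Psi_cls[OF p] Phi_def \<beta>_def)
  moreover have "h y \<in> points V.E" using smooth_at_points[OF FM V.smfd_E h(1)] by blast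
  ultimately have "assoc_field G M P \<rho> X (h y) = velocity V.E (\<lambda>s. V.cls p (\<beta> s)) 0"
    by (simp add: assoc_field_eq flow_field_def)
  moreover have "velocity V.E (\<lambda>s. V.cls p (\<delta> s)) 0 = (\<lambda>c. (- 1) *\<^sub>R velocity V.E (\<lambda>s. V.cls p (\<beta> s)) (0 + (- 1) * 0) c)"
    unfolding \<delta>_def by (rule velocity_affine[OF V.smfd_E sE[OF p s\<beta>]])
  ultimately have \<eta>: "?\<eta> = velocity V.E (\<lambda>s. V.cls p (\<delta> s)) 0"
    by (simp add: base_field_eq lift tangent_map_zero[OF FM V.smfd_E h(1)])
  show ?thesis unfolding darboux_lie_def Let_def
  proof (rule the_equality)
    show "\<exists>q\<in>TP. \<exists>\<gamma>. smooth_curve_at_0 vec_mfd \<gamma> \<and> V.cls q (\<gamma> 0) = h y \<and>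
        ?\<eta> = velocity V.E (\<lambda>t. V.cls q (\<gamma> t)) 0 \<and> V.cls p (- ?w) = V.cls q (vpr (velocity vec_mfd \<gamma> 0))"
      using p smooth_curve_at_0I[OF smfd_V s\<delta>] \<eta> vpr\<delta> \<beta>0 h(2) by (intro bexI[of _ p] exI[of _ \<delta>]) simp_all
    fix z assume "\<exists>q\<in>TP. \<exists>\<gamma>. smooth_curve_at_0 vec_mfd \<gamma> \<and> V.cls q (\<gamma> 0) = h y \<and>
        ?\<eta> = velocity V.E (\<lambda>t. V.cls q (\<gamma> t)) 0 \<and> z = V.cls q (vpr (velocity vec_mfd \<gamma> 0))"
    then obtain q \<gamma> where q: "q \<in> TP" "V.cls q (\<gamma> 0) = h y" "?\<eta> = velocity V.E (\<lambda>t. V.cls q (\<gamma> t)) 0"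
      "z = V.cls q (vpr (velocity vec_mfd \<gamma> 0))" and "smooth_curve_at_0 vec_mfd \<gamma>" by blast
    then have s\<gamma>: "smooth_at vec_mfd vec_mfd \<gamma> 0" by (intro smooth_curve_at_0D[OF smfd_V])
    have "V.cls p v = V.cls q (\<gamma> 0)" using q(2) h(2) by simp
    \<comment> \<open>Any other frame q is p g. Rewritten in the frame p, the competing curve is
      \<rho> g \<gamma>; the left inverse \<open>f\<close> recovers its velocity in
      \<open>V\<close>, and linearity of \<rho> g takes g out of \<open>vpr\<close>.\<close>
    then obtain g where g: "g \<in> carrier (lgrp G)" "q = p \<star> g" "\<gamma> 0 = \<rho> (linv g) v"
      by (rule V.cls_eqD[OF p _ q(1), rotated 2]) simp_all
    have cq: "V.cls q u = V.cls p (\<rho> g u)" for u unfolding g(2) by (rule V.cls_act[OF p g(1)]) simp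
    let ?\<gamma> = "\<lambda>t. \<rho> g (\<gamma> t)"
    have s\<gamma>': "smooth_at vec_mfd vec_mfd ?\<gamma> 0" by (intro V.smooth_\<alpha> R smooth_const_G s\<gamma> g(1)) simp
    obtain f where f: "\<And>v. f (V.cls p v) = v" "\<And>v. smooth_at V.E vec_mfd f (V.cls p v)" using cls_left_inverse[OF p] by metis
    have "velocity vec_mfd (\<lambda>t. f (V.cls p (?\<gamma> t))) 0 = velocity vec_mfd (\<lambda>t. f (V.cls p (\<delta> t))) 0"
    proof (rule velocity_map_cong[where f=f, OF V.smfd_E smfd_V sE[OF p s\<gamma>'] sE[OF p s\<delta>] _ _ f(2)])
      show "V.cls p (?\<gamma> 0) = V.cls p (\<delta> 0)" using g by (simp add: \<beta>0 \<rho>_inv)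
      show "velocity V.E (\<lambda>t. V.cls p (?\<gamma> t)) 0 = velocity V.E (\<lambda>t. V.cls p (\<delta> t)) 0"
        using q(3) unfolding \<eta> cq by simp
    qed
    then have "vpr (velocity vec_mfd ?\<gamma> 0) = - ?w" using vpr\<delta> by (simp add: f(1))
    moreover have "vpr (velocity vec_mfd ?\<gamma> 0) = \<rho> g (vpr (velocity vec_mfd \<gamma> 0))"
      by (rule vpr_eq[OF fd_V s\<gamma>' \<rho>_deriv[OF g(1) vec_velocity_deriv[OF s\<gamma>]]])
    ultimately show "z = V.cls p (- ?w)" unfolding q(4) cq by simp
  qed
qed

text \<open>In the frame q = p g both the Lie algebra element and the vector are transformed by inv
  g, and by \<open>lie_alg_act_Ad\<close> so is the result, which leaves the class
  unchanged.\<close>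

lemma section_dot_eq:
  assumes p: "p \<in> TP" "pr p = FProj F M y" and h: "h y = V.cls p v"
  shows "section_dot F G M P \<rho> a h y = V.cls p (lie_alg_act G \<rho> (xi p) v)"
  unfolding section_dot_def Let_def
proof (rule the_equality)
  have bs: "V.bs p (h y) = v" unfolding h by (rule V.bs_cls[OF p(1)]) simp
  show "\<exists>q\<in>pfiber P (FProj F M y). V.cls p (lie_alg_act G \<rho> (xi p) v) = V.cls q
      (lie_alg_act G \<rho> (backslash G P (lie_alg G) (Ad G) q (a (FProj F M y))) (V.bs q (h y)))"
    using p bs by (intro bexI[of _ p]) (simp_all add: pfiber_def xi_def)
  fix z assume "\<exists>q\<in>pfiber P (FProj F M y). z = V.cls q
      (lie_alg_act G \<rho> (backslash G P (lie_alg G) (Ad G) q (a (FProj F M y))) (V.bs q (h y)))"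
  then obtain q where q: "q \<in> TP" "pr q = FProj F M y" "z = V.cls q (lie_alg_act G \<rho> (xi q) (V.bs q (h y)))"
    by (auto simp: pfiber_def xi_def)
  let ?g = "pdiv p q"
  have g: "?g \<in> carrier (lgrp G)" "p \<star> ?g = q" using pdiv[OF p(1) q(1)] p(2) q(2) by simp_all
  have "V.cls q (\<rho> (linv ?g) v) = h y"
    using V.cls_act[OF p(1) g(1), of "\<rho> (linv ?g) v"] g h by (simp add: \<rho>_inv)
  then have "V.bs q (h y) = \<rho> (linv ?g) v" using V.bs_cls[OF q(1), of "\<rho> (linv ?g) v"] by simp
  moreover have "xi q = Ad G (linv ?g) (xi p)" using xi_act[OF p(1) g(1)] g(2) by simp
  ultimately have "z = V.cls (p \<star> ?g) (\<rho> (linv ?g) (lie_alg_act G \<rho> (xi p) v))"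
    using q(3) lie_alg_act_Ad[OF xi_TG[OF p(1)] inv_closed[OF g(1)]] g(2) by simp
  then show "z = V.cls p (lie_alg_act G \<rho> (xi p) v)"
    using V.cls_act[OF p(1) g(1), of "\<rho> (linv ?g) (lie_alg_act G \<rho> (xi p) v)"] g(1) by (simp add: \<rho>_inv)
qed

end

theorem proposition6p1:
  fixes F :: "('a, 'e::real_inner, 'b, 's::real_inner) natural_bundle_data"
    and M :: "('a, 'e) mfd"
    and G :: "('g, 'l::real_inner) lie_group_data"
    and P :: "('p, 'a, 'e, 'g, 'l) principal_bundle_data"
    and \<rho> :: "'g \<Rightarrow> 'v \<Rightarrow> 'v::real_inner"
    and a :: "'a \<Rightarrow> ('p \<times> ('g, 'l) tvec) set"
    and h :: "'b \<Rightarrow> ('p \<times> 'v) set"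
    and n :: nat
  assumes "natural_bundle n F"
    and "M \<in> Mf n"
    and "lie_group G"
    and "principal_bundle G M P"
    and "lie_module G \<rho>"
    and "adjoint_section G M P a"
    and "bundle_map_to_assoc F G M P \<rho> h"
  shows "\<forall>y\<in>points (FObj F M).
    darboux_lie F G M P \<rho> (section_field G M P a) h y =
    assoc_neg G P \<rho> (section_dot F G M P \<rho> a h y)"
proof
  interpret princ_module G M P a \<rho>
    using assms(3-6) by unfold_locales
  fix y assume y: "y \<in> points (FObj F M)"
  note FM = manifold_smfd[OF natural_bundle_manifold[OF assms(1,2)]]
  have h: "smooth_at (FObj F M) V.E h y" "assoc_proj P (h y) = FProj F M y"
    using assms(7) y unfolding bundle_map_to_assoc_def smooth_map_iff[OF FM V.smfd_E] by blast+
  have "h y \<in> points V.E" using smooth_at_points[OF FM V.smfd_E h(1)] by blast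
  \<comment> \<open>A single frame \<open>p\<close> over the base point of \<open>y\<close>
    evaluates both sides.\<close>
  then obtain p v where p: "p \<in> TP" "h y = V.cls p v" by (rule V.points_E_E)
  have "pr p = FProj F M y" using V.cls_proj[OF p(1), of v] h(2) p(2) by simp
  from section_dot_eq[where h=h and v=v, OF p(1) this p(2)] darboux_lie_eq[OF p(1) FM canonical_lift_zero[OF assms(1,2)] h(1) p(2)]
  show "darboux_lie F G M P \<rho> (section_field G M P a) h y = assoc_neg G P \<rho> (section_dot F G M P \<rho> a h y)"
    by (simp add: section_field_eq assoc_neg_cls[OF p(1)])
qed

end
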